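(* There are no complete weighted parabolic $L$-stable self-shrinkers in $\mathbb R^{n+1}$.
   Context: Hypersurfaces are smooth, connected, orientable, immersed, without boundary. For an oriented hypersurface $\Sigma\subset\mathbb R^{n+1}$ with unit normal $N$, $A$ is the second fundamental form and $H$ the mean curvature (the trace of the second fundamental form, with the sign $H=\mathrm{div}_\Sigma N$); $x$ is the position vector and $\langle\cdot,\cdot\rangle$ the Euclidean metric. $\Sigma$ is a self-shrinker if $H=\frac12\langle x,N\rangle$. Let $\phi_{-1}(x)=-\frac{|x|^2}{4}$; self-shrinkers are exactly the weighted minimal hypersurfaces of $(\mathbb R^{n+1},\langle\cdot,\cdot\rangle,\phi_{-1})$, i.e. critical points of the weighted area $\int_\Sigma e^{\phi_{-1}}dv_\Sigma$ for compactly supported variations. A self-shrinker $\Sigma$ is $L$-stable if it is stable as a weighted minimal hypersurface, i.e. the second variation of the weighted area is nonnegative for all compactly supported variations; equivalently $$\int_\Sigma\left(|A|^2+\tfrac12\right)u^2e^{\phi_{-1}}\,dv_\Sigma\le\int_\Sigma|\nabla u|^2e^{\phi_{-1}}\,dv_\Sigma$$ for all compactly supported piecewise smooth functions $u$ on $\Sigma$. A complete self-shrinker $\Sigma$ with induced metric $g$ is weighted parabolic if every function $u\ge 0$ on $\Sigma$ with $\Delta u+g(\nabla\phi_{-1},\nabla u)\le 0$ is constant, where $\Delta,\nabla$ are those of $g$ and $\phi_{-1}$ is restricted to $\Sigma$. *)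

theory Defs
  imports "HOL-Analysis.Analysis"
begin

subsection \<open>Functions of class C^k on open subsets of Euclidean space\<close>

text \<open>In finite dimension, continuity of all directional derivatives \<open>x \<mapsto> Df(x) v\<close> is continuity
  of \<open>Df\<close>, so this is the usual class C^k.\<close>

primrec C_k_on :: "nat \<Rightarrow> 'a::euclidean_space set \<Rightarrow> ('a \<Rightarrow> 'b::real_normed_vector) \<Rightarrow> bool" where
  "C_k_on 0 W f \<longleftrightarrow> continuous_on W f"
| "C_k_on (Suc k) W f \<longleftrightarrow>
     (\<forall>x\<in>W. f differentiable (at x)) \<and> (\<forall>v. C_k_on k W (\<lambda>x. frechet_derivative f (at x) v))"

definition smooth_on :: "'a::euclidean_space set \<Rightarrow> ('a \<Rightarrow> 'b::real_normed_vector) \<Rightarrow> bool" where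
  "smooth_on W f \<longleftrightarrow> (\<forall>k. C_k_on k W f)"

definition partial :: "(real^'n \<Rightarrow> 'b::real_normed_vector) \<Rightarrow> 'n \<Rightarrow> real^'n \<Rightarrow> 'b" where
  "partial f i x = frechet_derivative f (at x) (axis i 1)"


subsection \<open>Immersed oriented hypersurfaces\<close>

text \<open>A pair \<open>(W, \<psi>)\<close> is a local parametrization, i.e. the inverse of a coordinate map:
  \<open>\<psi>\<close> maps the open set \<open>W\<close> of R^n homeomorphically onto the coordinate neighbourhood \<open>\<psi> ` W\<close>.\<close>

type_synonym ('m, 'n) chart = "(real^'n) set \<times> (real^'n \<Rightarrow> 'm)"

definition smooth_atlas :: "('m::topological_space, 'n::finite) chart set \<Rightarrow> bool" where
  "smooth_atlas \<A> \<longleftrightarrow>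
     (\<Union>(W, \<psi>)\<in>\<A>. \<psi> ` W) = UNIV \<and>
     (\<forall>(W, \<psi>)\<in>\<A>. open W \<and> open (\<psi> ` W) \<and> (\<exists>\<kappa>. homeomorphism W (\<psi> ` W) \<psi> \<kappa>)) \<and>
     (\<forall>(W, \<psi>)\<in>\<A>. \<forall>(V, \<theta>)\<in>\<A>. smooth_on {x\<in>W. \<psi> x \<in> \<theta> ` V} (the_inv_into V \<theta> \<circ> \<psi>))"

text \<open>The underlying manifold is the whole type \<open>'m\<close> with its topology.  The immersion
  \<open>pos\<close> is the position vector \<open>x\<close>, and \<open>unit_normal\<close> is \<open>N\<close>.\<close>

record ('m, 'n, 'k) hypersurface =
  charts :: "('m, 'n) chart set"
  pos :: "'m \<Rightarrow> real^'k"
  unit_normal :: "'m \<Rightarrow> real^'k"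

definition C_k_fun :: "nat \<Rightarrow> ('m, 'n::finite, 'k::finite) hypersurface \<Rightarrow> ('m \<Rightarrow> 'b::real_normed_vector) \<Rightarrow> bool"
  where "C_k_fun k S f \<longleftrightarrow> (\<forall>(W, \<psi>)\<in>charts S. C_k_on k W (f \<circ> \<psi>))"

definition smooth_fun :: "('m, 'n::finite, 'k::finite) hypersurface \<Rightarrow> ('m \<Rightarrow> 'b::real_normed_vector) \<Rightarrow> bool"
  where "smooth_fun S f \<longleftrightarrow> (\<forall>k. C_k_fun k S f)"

text \<open>For a hypersurface immersed in Euclidean space, orientability is the existence of a smooth
  unit normal along the immersion.\<close>

definition immersed_hypersurface ::
    "('m::{t2_space, second_countable_topology}, 'n::finite, 'k::finite) hypersurface \<Rightarrow> bool" where
  "immersed_hypersurface S \<longleftrightarrow>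
     CARD('k) = CARD('n) + 1 \<and>
     connected (UNIV :: 'm set) \<and>
     smooth_atlas (charts S) \<and>
     smooth_fun S (pos S) \<and>
     (\<forall>(W, \<psi>)\<in>charts S. \<forall>x\<in>W. inj (frechet_derivative (pos S \<circ> \<psi>) (at x))) \<and>
     smooth_fun S (unit_normal S) \<and>
     (\<forall>p. norm (unit_normal S p) = 1) \<and>
     (\<forall>(W, \<psi>)\<in>charts S. \<forall>x\<in>W. \<forall>v.
        unit_normal S (\<psi> x) \<bullet> frechet_derivative (pos S \<circ> \<psi>) (at x) v = 0)"


subsection \<open>Geometry in local coordinates\<close>

context
  fixes S :: "('m, 'n::finite, 'k::finite) hypersurface" and \<psi> :: "real^'n \<Rightarrow> 'm"
begin

definition metric_mat :: "real^'n \<Rightarrow> real^'n^'n" where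
  "metric_mat x = (\<chi> i j. partial (pos S \<circ> \<psi>) i x \<bullet> partial (pos S \<circ> \<psi>) j x)"

definition metric_inv :: "real^'n \<Rightarrow> real^'n^'n" where
  "metric_inv x = matrix_inv (metric_mat x)"

definition vol_density :: "real^'n \<Rightarrow> real" where
  "vol_density x = sqrt (det (metric_mat x))"

text \<open>The sign \<open>A(v, w) = \<langle>D\<^sub>v N, w\<rangle>\<close> is the one for which the trace of \<open>A\<close> is \<open>div N\<close>.\<close>

definition second_form :: "real^'n \<Rightarrow> real^'n^'n" where
  "second_form x = (\<chi> i j. partial (unit_normal S \<circ> \<psi>) i x \<bullet> partial (pos S \<circ> \<psi>) j x)"

definition loc_mean_curv :: "real^'n \<Rightarrow> real" where
  "loc_mean_curv x = (\<Sum>i\<in>UNIV. \<Sum>j\<in>UNIV. metric_inv x $ i $ j * second_form x $ i $ j)"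

definition loc_norm_A_sq :: "real^'n \<Rightarrow> real" where
  "loc_norm_A_sq x =
     (\<Sum>i\<in>UNIV. \<Sum>j\<in>UNIV. \<Sum>k\<in>UNIV. \<Sum>l\<in>UNIV.
        metric_inv x $ i $ k * metric_inv x $ j $ l * second_form x $ i $ j * second_form x $ k $ l)"

definition loc_grad_inner :: "('m \<Rightarrow> real) \<Rightarrow> ('m \<Rightarrow> real) \<Rightarrow> real^'n \<Rightarrow> real" where
  "loc_grad_inner u v x =
     (\<Sum>i\<in>UNIV. \<Sum>j\<in>UNIV. metric_inv x $ i $ j * partial (u \<circ> \<psi>) i x * partial (v \<circ> \<psi>) j x)"

definition loc_laplacian :: "('m \<Rightarrow> real) \<Rightarrow> real^'n \<Rightarrow> real" where
  "loc_laplacian u x =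
     (1 / vol_density x) *
     (\<Sum>i\<in>UNIV. partial (\<lambda>y. vol_density y * (\<Sum>j\<in>UNIV. metric_inv y $ i $ j * partial (u \<circ> \<psi>) j y)) i x)"

end

text \<open>Each of these scalars takes the same value in every chart around a point, so it may be
  evaluated in an arbitrarily chosen one.\<close>

definition chart_at :: "('m, 'n::finite, 'k::finite) hypersurface \<Rightarrow> 'm \<Rightarrow> ('m, 'n) chart" where
  "chart_at S p = (SOME c. c \<in> charts S \<and> p \<in> snd c ` fst c)"

definition coord_at :: "('m, 'n::finite, 'k::finite) hypersurface \<Rightarrow> 'm \<Rightarrow> real^'n" where
  "coord_at S p = the_inv_into (fst (chart_at S p)) (snd (chart_at S p)) p"

definition mean_curv :: "('m, 'n::finite, 'k::finite) hypersurface \<Rightarrow> 'm \<Rightarrow> real" where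
  "mean_curv S p = loc_mean_curv S (snd (chart_at S p)) (coord_at S p)"

definition norm_A_sq :: "('m, 'n::finite, 'k::finite) hypersurface \<Rightarrow> 'm \<Rightarrow> real" where
  "norm_A_sq S p = loc_norm_A_sq S (snd (chart_at S p)) (coord_at S p)"

definition grad_inner ::
    "('m, 'n::finite, 'k::finite) hypersurface \<Rightarrow> ('m \<Rightarrow> real) \<Rightarrow> ('m \<Rightarrow> real) \<Rightarrow> 'm \<Rightarrow> real" where
  "grad_inner S u v p = loc_grad_inner S (snd (chart_at S p)) u v (coord_at S p)"

definition laplacian :: "('m, 'n::finite, 'k::finite) hypersurface \<Rightarrow> ('m \<Rightarrow> real) \<Rightarrow> 'm \<Rightarrow> real" where
  "laplacian S u p = loc_laplacian S (snd (chart_at S p)) u (coord_at S p)"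

text \<open>The Riemannian measure \<open>dv\<close>: the unique Borel measure which is \<open>sqrt (det g) dx\<close> in every
  chart.\<close>

definition volume_measure :: "('m::topological_space, 'n::finite, 'k::finite) hypersurface \<Rightarrow> 'm measure" where
  "volume_measure S = (THE \<mu>. sets \<mu> = sets borel \<and>
     (\<forall>(W, \<psi>)\<in>charts S. \<forall>B\<in>sets borel. B \<subseteq> \<psi> ` W \<longrightarrow>
        emeasure \<mu> B = (\<integral>\<^sup>+x\<in>{x\<in>W. \<psi> x \<in> B}. ennreal (vol_density S \<psi> x) \<partial>lborel)))"


subsection \<open>Completeness of the induced metric\<close>

text \<open>Since \<open>pos\<close> is an immersion, a continuous curve \<open>c\<close> in the manifold is piecewise C^1 iff
  \<open>pos \<circ> c\<close> is, and its length for the induced metric is the Euclidean length of \<open>pos \<circ> c\<close>.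
  The predicate \<open>valid_path\<close> lets the derivative blow up at finitely many parameters;
  measuring length in the extended nonnegative reals gives a curve of infinite length the
  value infinity, so that it does not affect the infimum.\<close>

definition curve_length :: "('m, 'n::finite, 'k::finite) hypersurface \<Rightarrow> (real \<Rightarrow> 'm) \<Rightarrow> ennreal" where
  "curve_length S c = (\<integral>\<^sup>+t\<in>{0..1}. ennreal (norm (vector_derivative (pos S \<circ> c) (at t))) \<partial>lborel)"

definition induced_dist ::
    "('m::topological_space, 'n::finite, 'k::finite) hypersurface \<Rightarrow> 'm \<Rightarrow> 'm \<Rightarrow> real" where
  "induced_dist S p q = enn2real (INF c\<in>{c. path c \<and> valid_path (pos S \<circ> c) \<and>
     pathstart c = p \<and> pathfinish c = q}. curve_length S c)"

definition complete_hypersurface ::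
    "('m::topological_space, 'n::finite, 'k::finite) hypersurface \<Rightarrow> bool" where
  "complete_hypersurface S \<longleftrightarrow> Metric_space.mcomplete (UNIV :: 'm set) (induced_dist S)"


subsection \<open>Self-shrinkers, stability and parabolicity\<close>

definition self_shrinker :: "('m, 'n::finite, 'k::finite) hypersurface \<Rightarrow> bool" where
  "self_shrinker S \<longleftrightarrow> (\<forall>p. mean_curv S p = 1/2 * (pos S p \<bullet> unit_normal S p))"

definition weight :: "('m, 'n::finite, 'k::finite) hypersurface \<Rightarrow> 'm \<Rightarrow> real" where
  "weight S p = - (norm (pos S p))\<^sup>2 / 4"

text \<open>For functions with compact support, to which this is applied, finitely many pieces amount to
  locally finitely many.  A function satisfying the predicate is locally Lipschitz, hence
  differentiable off a null set.\<close>

definition piecewise_smooth ::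
    "('m::topological_space, 'n::finite, 'k::finite) hypersurface \<Rightarrow> ('m \<Rightarrow> real) \<Rightarrow> bool" where
  "piecewise_smooth S u \<longleftrightarrow> continuous_on UNIV u \<and>
     (\<exists>P :: ('m set \<times> ('m \<Rightarrow> real)) set. finite P \<and> (\<Union>(C, w)\<in>P. C) = UNIV \<and>
        (\<forall>(C, w)\<in>P. closed C \<and> smooth_fun S w \<and> (\<forall>p\<in>C. u p = w p)))"

text \<open>Both integrands are nonnegative, so the integrals are taken in the extended nonnegative reals.\<close>

definition L_stable :: "('m::topological_space, 'n::finite, 'k::finite) hypersurface \<Rightarrow> bool" where
  "L_stable S \<longleftrightarrow>
     (\<forall>u. piecewise_smooth S u \<and> compact (closure {p. u p \<noteq> 0}) \<longrightarrow>
        (\<integral>\<^sup>+p. ennreal ((norm_A_sq S p + 1/2) * (u p)\<^sup>2 * exp (weight S p)) \<partial>volume_measure S)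
        \<le> (\<integral>\<^sup>+p. ennreal (grad_inner S u u p * exp (weight S p)) \<partial>volume_measure S))"

definition weighted_parabolic :: "('m, 'n::finite, 'k::finite) hypersurface \<Rightarrow> bool" where
  "weighted_parabolic S \<longleftrightarrow>
     (\<forall>u :: 'm \<Rightarrow> real. C_k_fun 2 S u \<and> (\<forall>p. u p \<ge> 0) \<and>
        (\<forall>p. laplacian S u p + grad_inner S (weight S) u p \<le> 0) \<longrightarrow> u constant_on UNIV)"

end

theory Submission
  imports Defs "HOL-Real_Asymp.Real_Asymp"
begin

text \<open>Write \<open>\<phi>\<close> for the weight and \<open>L u = \<Delta> u + g(\<nabla>\<phi>, \<nabla>u)\<close>.  Since \<open>|A|\<^sup>2 \<ge> 0\<close>, stability gives the
  Poincare inequality \<open>\<integral> u\<^sup>2 e\<^sup>\<phi> \<le> 2 \<integral> |\<nabla>u|\<^sup>2 e\<^sup>\<phi>\<close> for compactly supported smooth \<open>u\<close>.  Hence for a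
  nonnegative bump function \<open>f\<close> the functional \<open>J v = 1/2 \<integral> |\<nabla>v|\<^sup>2 e\<^sup>\<phi> - \<integral> f v e\<^sup>\<phi>\<close> is bounded below, and it has a
  nonnegative minimising sequence of smooth functions of compact support, which is Cauchy in \<open>L\<^sup>2\<close>.  Its limit is a
  nonnegative weak solution of \<open>L u = - f\<close>, which is of class C^2 by interior elliptic regularity.
  Such a function is superharmonic and not constant, contrary to weighted parabolicity.

  Elliptic regularity is needed only for a limit that is a distribution of order 0 with a smooth
  right-hand side, and is obtained from Fourier series: on a small ball the operator is a small perturbation of one
  with constant coefficients, so the equation gains one power of decay for the Fourier coefficients of every
  localization of the distribution, and this can be iterated.\<close>

section \<open>Calculus of C^k functions and test functions\<close>

text \<open>The constant 1/2 in the stability inequality acts as a spectral gap: it turns control of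
  the energy into control of the weighted L^2 norm. No Sobolev space is formed. The minimising
  sequence is only tested, chart by chart, against smooth functions of compact support, so its limit
  is a linear functional bounded by sup norms on compact sets, and regularity has to produce a C^2
  density for that functional. The densities found near different points are glued by their
  uniqueness. In coordinates the weight and the volume density are both absorbed into the
  coefficients: with \<rho> the density of the weighted area, \<rho> L is the symmetric
  divergence-form operator with coefficients \<rho> g^{ij}, so that every integration by parts takes
  place against Lebesgue measure. The Riemannian measure is given by a definite description. Its
  existence and uniqueness, which rest on the change of variables between charts, must be
  established before the stability inequality can be read as a statement about integrals in
  coordinates.\<close>

text \<open>No differentiability is required: \<open>frechet_derivative\<close> is chosen from the
  set of derivatives at \<open>x\<close>, and f and g have the same such set.\<close>

lemma frechet_derivative_cong_open:
  assumes "open W" "x \<in> W" "\<And>y. y \<in> W \<Longrightarrow> f y = g y"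
  shows "frechet_derivative f (at x) = frechet_derivative g (at x)"
proof -
  have "(f has_derivative D) (at x) \<longleftrightarrow> (g has_derivative D) (at x)" for D
    using assms by (metis has_derivative_transform_within_open)
  thus ?thesis by (simp add: frechet_derivative_def)
qed

lemma C_k_on_SucD: "C_k_on (Suc k) W f \<Longrightarrow> C_k_on k W f"
proof (induction k arbitrary: f)
  case 0
  thus ?case by (auto intro!: differentiable_imp_continuous_on simp: differentiable_on_def
        intro: differentiable_at_imp_differentiable_on differentiable_at_withinI)
qed auto

lemma C_k_on_le: "C_k_on k W f \<Longrightarrow> j \<le> k \<Longrightarrow> C_k_on j W f"
  by (induction k) (auto simp: le_Suc_eq dest: C_k_on_SucD simp del: C_k_on.simps)

lemma C_k_on_subset: "C_k_on k W f \<Longrightarrow> V \<subseteq> W \<Longrightarrow> C_k_on k V f"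
  by (induction k arbitrary: f) (auto intro: continuous_on_subset)

lemma C_k_on_continuous: "C_k_on k W f \<Longrightarrow> continuous_on W f"
  using C_k_on_le[of k W f 0] by simp

lemma C_k_on_differentiable: "C_k_on (Suc k) W f \<Longrightarrow> x \<in> W \<Longrightarrow> f differentiable (at x)"
  by simp

lemma C_k_on_has_derivative:
  "C_k_on (Suc k) W f \<Longrightarrow> x \<in> W \<Longrightarrow> (f has_derivative frechet_derivative f (at x)) (at x)"
  using frechet_derivative_works C_k_on_differentiable by blast

lemma C_k_on_cong:
  assumes "open W" "C_k_on k W f" "\<And>y. y \<in> W \<Longrightarrow> f y = g y"
  shows "C_k_on k W g"
  using assms(2,3)
proof (induction k arbitrary: f g)
  case 0
  thus ?case by (simp cong: continuous_on_cong)
next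
  case (Suc k)
  have "frechet_derivative f (at x) = frechet_derivative g (at x)" if "x \<in> W" for x
    using frechet_derivative_cong_open[OF assms(1) that] Suc.prems(2) by blast
  moreover have "g differentiable (at x)" if "x \<in> W" for x
    using Suc.prems that assms(1) unfolding differentiable_def
    by (metis C_k_on_differentiable differentiable_def has_derivative_transform_within_open)
  moreover have "C_k_on k W (\<lambda>x. frechet_derivative g (at x) v)" for v
    by (rule Suc.IH[of "\<lambda>x. frechet_derivative f (at x) v"]) (use Suc.prems calculation in auto)
  ultimately show ?case by simp
qed

text \<open>Lets a derivative be supplied by a formula in place of the chosen
  \<open>frechet_derivative\<close>, which agrees with it on \<open>W\<close>.\<close>

lemma C_k_on_SucI:
  assumes "open W" "\<And>x. x \<in> W \<Longrightarrow> (f has_derivative f' x) (at x)" "\<And>v. C_k_on k W (\<lambda>x. f' x v)"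
  shows "C_k_on (Suc k) W f"
proof -
  have "frechet_derivative f (at x) = f' x" if "x \<in> W" for x
    using assms(2)[OF that] frechet_derivative_at by force
  thus ?thesis using assms by (auto simp: differentiable_def intro: C_k_on_cong[OF _ assms(3)])
qed

text \<open>The derivatives in \<open>C_k_on\<close> are taken at points of the whole space rather
  than within \<open>W\<close>, so the property is local. This is what allows smoothness to be
  proved by cases on different open pieces.\<close>

lemma C_k_on_local:
  assumes "\<And>x. x \<in> W \<Longrightarrow> \<exists>U. open U \<and> x \<in> U \<and> C_k_on k U f"
  shows "C_k_on k W f"
  using assms
proof (induction k arbitrary: f)
  case 0
  thus ?case by (metis C_k_on.simps(1) continuous_at_imp_continuous_on continuous_on_eq_continuous_at)
next
  case (Suc k)
  have "C_k_on k W (\<lambda>x. frechet_derivative f (at x) v)" for v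
    by (rule Suc.IH) (use Suc.prems in fastforce)
  thus ?case using Suc.prems by auto
qed

lemma C_k_on_const [intro]: "open W \<Longrightarrow> C_k_on k W (\<lambda>x. c)"
  by (induction k arbitrary: c) (auto intro: continuous_intros)

lemma C_k_on_bounded_linear: "open W \<Longrightarrow> bounded_linear L \<Longrightarrow> C_k_on k W L"
proof (induction k)
  case (Suc k)
  show ?case by (rule C_k_on_SucI[where f'="\<lambda>x. L"]) (use Suc in \<open>auto intro: bounded_linear_imp_has_derivative\<close>)
qed (simp add: linear_continuous_on)

lemma C_k_on_compose_linear: 
  assumes "open W" "C_k_on k W f" "bounded_linear L"
  shows "C_k_on k W (\<lambda>x. L (f x))"
  using assms(2)
proof (induction k arbitrary: f)
  case 0
  thus ?case using assms(3) by (simp add: linear_continuous_on_compose bounded_linear.continuous_on)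
next
  case (Suc k)
  show ?case
    by (rule C_k_on_SucI[where f'="\<lambda>x v. L (frechet_derivative f (at x) v)"])
      (use assms Suc in \<open>auto intro!: bounded_linear.has_derivative[OF assms(3)] C_k_on_has_derivative[OF Suc.prems]\<close>)
qed

lemma C_k_on_add:
  assumes "open W" "C_k_on k W f" "C_k_on k W g"
  shows "C_k_on k W (\<lambda>x. f x + g x)"
  using assms(2,3)
proof (induction k arbitrary: f g)
  case 0
  thus ?case by (auto intro: continuous_intros)
next
  case (Suc k)
  show ?case
    by (rule C_k_on_SucI[where f'="\<lambda>x v. frechet_derivative f (at x) v + frechet_derivative g (at x) v"])
      (use assms Suc in \<open>auto intro!: has_derivative_add C_k_on_has_derivative Suc.IH simp del: C_k_on.simps, auto\<close>)
qed

lemma C_k_on_bilinear: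
  assumes "open W" "bounded_bilinear prd" "C_k_on k W f" "C_k_on k W g"
  shows "C_k_on k W (\<lambda>x. prd (f x) (g x))"
  using assms(3,4)
proof (induction k arbitrary: f g)
  case 0
  thus ?case using bounded_bilinear.continuous_on[OF assms(2)] by auto
next
  case (Suc k)
  have *: "C_k_on k W (\<lambda>x. frechet_derivative f (at x) v)" "C_k_on k W (\<lambda>x. frechet_derivative g (at x) v)" for v
    using Suc.prems by auto
  show ?case
  proof (rule C_k_on_SucI[where f'="\<lambda>x v. prd (f x) (frechet_derivative g (at x) v) + prd (frechet_derivative f (at x) v) (g x)"])
    show "((\<lambda>x. prd (f x) (g x)) has_derivative
           (\<lambda>v. prd (f x) (frechet_derivative g (at x) v) + prd (frechet_derivative f (at x) v) (g x))) (at x)" 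
      if "x \<in> W" for x
      using bounded_bilinear.FDERIV[OF assms(2) C_k_on_has_derivative[OF Suc.prems(1) that] C_k_on_has_derivative[OF Suc.prems(2) that]] .
    show "C_k_on k W (\<lambda>x. prd (f x) (frechet_derivative g (at x) v) + prd (frechet_derivative f (at x) v) (g x))" for v
      by (intro C_k_on_add assms(1) Suc.IH * C_k_on_SucD[OF Suc.prems(1)] C_k_on_SucD[OF Suc.prems(2)])
  qed (fact assms(1))
qed

lemmas C_k_on_mult = C_k_on_bilinear[OF _ bounded_bilinear_mult]
lemmas C_k_on_scaleR = C_k_on_bilinear[OF _ bounded_bilinear_scaleR]
lemmas C_k_on_inner = C_k_on_bilinear[OF _ bounded_bilinear_inner]

lemma C_k_on_uminus: "open W \<Longrightarrow> C_k_on k W f \<Longrightarrow> C_k_on k W (\<lambda>x. - f x)"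
  by (erule (1) C_k_on_compose_linear) (auto intro: bounded_linear_minus bounded_linear_ident)

lemma C_k_on_diff: "open W \<Longrightarrow> C_k_on k W f \<Longrightarrow> C_k_on k W g \<Longrightarrow> C_k_on k W (\<lambda>x. f x - g x)"
  using C_k_on_add[of W k f "\<lambda>x. - g x"] C_k_on_uminus[of W k g] by simp

lemma C_k_on_sum: "open W \<Longrightarrow> (\<And>i. i \<in> I \<Longrightarrow> C_k_on k W (f i)) \<Longrightarrow> C_k_on k W (\<lambda>x. \<Sum>i\<in>I. f i x)"
  by (induction I rule: infinite_finite_induct) (auto intro: C_k_on_add)

lemma C_k_on_prod:
  fixes f :: "'i \<Rightarrow> 'a::euclidean_space \<Rightarrow> 'b::{real_normed_algebra,comm_ring_1}"
  shows "open W \<Longrightarrow> (\<And>i. i \<in> I \<Longrightarrow> C_k_on k W (f i)) \<Longrightarrow> C_k_on k W (\<lambda>x. \<Prod>i\<in>I. f i x)"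
  by (induction I rule: infinite_finite_induct) (auto intro: C_k_on_mult)

text \<open>The chain rule is expanded in the basis of the middle space, which turns the derivative
  into a finite sum of products. The outer function varies in the induction because its directional
  derivatives take its place.\<close>

lemma C_k_on_compose:
  fixes f :: "'b::euclidean_space \<Rightarrow> 'c::real_normed_vector" and g :: "'a::euclidean_space \<Rightarrow> 'b"
  assumes "open W" "C_k_on k W g" "C_k_on k V f" "g ` W \<subseteq> V"
  shows "C_k_on k W (\<lambda>x. f (g x))"
  using assms(2,3)
proof (induction k arbitrary: f)
  case 0
  thus ?case using assms(4) by (auto intro: continuous_on_compose2)
next
  case (Suc k)
  let ?D = "\<lambda>x v. \<Sum>b\<in>Basis. (frechet_derivative g (at x) v \<bullet> b) *\<^sub>R frechet_derivative f (at (g x)) b"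
  have g: "C_k_on k W (\<lambda>x. frechet_derivative g (at x) v)" for v
    using Suc.prems by auto
  have f: "C_k_on k V (\<lambda>x. frechet_derivative f (at x) v)" for v
    using Suc.prems by auto
  show ?case
  proof (rule C_k_on_SucI[where f' = ?D])
    fix x assume x: "x \<in> W"
    let ?g = "frechet_derivative g (at x)" and ?f = "frechet_derivative f (at (g x))"
    have df: "(f has_derivative ?f) (at (g x))"
      using C_k_on_has_derivative[OF Suc.prems(2)] x assms(4) by blast
    have "((\<lambda>x. f (g x)) has_derivative (\<lambda>v. ?f (?g v))) (at x)"
      using has_derivative_compose[OF C_k_on_has_derivative[OF Suc.prems(1) x] df] .
    moreover have "?f (?g v) = ?D x v" for v
    proof -
      have "?f (?g v) = ?f (\<Sum>b\<in>Basis. (?g v \<bullet> b) *\<^sub>R b)" by (simp add: euclidean_representation)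
      also have "\<dots> = ?D x v"
        using has_derivative_linear[OF df] by (simp add: linear_sum linear_scale)
      finally show ?thesis .
    qed
    ultimately show "((\<lambda>x. f (g x)) has_derivative ?D x) (at x)" by (simp only:)
  next
    show "C_k_on k W (\<lambda>x. ?D x v)" for v
      by (intro C_k_on_sum C_k_on_scaleR C_k_on_inner assms(1) g C_k_on_const Suc.IH f C_k_on_SucD[OF Suc.prems(1)])
  qed (fact assms(1))
qed

lemma C_k_on_real_DERIV:
  fixes F :: "nat \<Rightarrow> real \<Rightarrow> real"
  assumes "open W" "\<And>j x. x \<in> W \<Longrightarrow> (F j has_field_derivative c j * F (Suc j) x + d j * F (Suc (Suc j)) x) (at x)"
  shows "C_k_on k W (F j)"
proof (induction k arbitrary: j)
  case 0
  have "isCont (F j) x" if "x \<in> W" for x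
    using assms(2)[OF that] DERIV_isCont by blast
  thus ?case by (simp add: continuous_at_imp_continuous_on)
next
  case (Suc k)
  have "C_k_on k W (\<lambda>x. (c j * F (Suc j) x + d j * F (Suc (Suc j)) x) * v)" for v
    by (rule C_k_on_mult[OF assms(1) C_k_on_add[OF assms(1) C_k_on_mult[OF assms(1)] C_k_on_mult[OF assms(1)]]])
      (rule C_k_on_const[OF assms(1)] Suc.IH)+
  thus ?case
    by (intro C_k_on_SucI[where f'="\<lambda>x. (*) (c j * F (Suc j) x + d j * F (Suc (Suc j)) x)"])
      (use assms(1) assms(2)[of _ j] in \<open>simp_all add: has_field_derivative_def\<close>)
qed

lemma C_k_on_powr: "C_k_on k {0<..} (\<lambda>x::real. x powr a)"
proof -
  have "C_k_on k {0<..} ((\<lambda>j x::real. x powr (a - real j)) 0)"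
    by (rule C_k_on_real_DERIV[where c="\<lambda>j. a - real j" and d="\<lambda>_. 0"])
      (auto intro!: derivative_eq_intros simp: powr_diff powr_minus field_simps powr_add)
  thus ?thesis by simp
qed

lemma C_k_on_sqrt: 
  assumes "open W" "C_k_on k W f" "\<And>x. x \<in> W \<Longrightarrow> f x > 0"
  shows "C_k_on k W (\<lambda>x. sqrt (f x))"
proof -
  have "C_k_on k W (\<lambda>x. f x powr (1/2))"
    using C_k_on_compose[OF assms(1,2) C_k_on_powr] assms(3) by (auto simp: image_subset_iff)
  thus ?thesis by (rule C_k_on_cong[OF assms(1)]) (use assms(3) in \<open>simp add: powr_half_sqrt less_imp_le\<close>)
qed

lemma C_k_on_inverse:
  fixes f :: "_ \<Rightarrow> real"
  assumes "open W" "C_k_on k W f" "\<And>x. x \<in> W \<Longrightarrow> f x > 0"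
  shows "C_k_on k W (\<lambda>x. inverse (f x))"
proof -
  have "C_k_on k W (\<lambda>x. f x powr (-1))"
    by (rule C_k_on_compose[OF assms(1,2) C_k_on_powr]) (use assms(3) in auto)
  thus ?thesis by (rule C_k_on_cong[OF assms(1)]) (use assms(3) in \<open>force simp: powr_minus\<close>)
qed

lemma C_k_on_exp: "C_k_on k UNIV (exp :: real \<Rightarrow> real)"
  using C_k_on_real_DERIV[of UNIV "\<lambda>j. exp" "\<lambda>_. 1" "\<lambda>_. 0" k 0] by (auto intro!: derivative_eq_intros)

section \<open>A smooth function flat at the origin\<close>

text \<open>The case \<open>m = 0\<close> is the classical function exp(-1/x) extended by 0; the
  other powers are present only to close the family under differentiation.\<close>

definition flat_exp :: "nat \<Rightarrow> real \<Rightarrow> real" where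
  "flat_exp m x = (if x \<le> 0 then 0 else exp (- inverse x) * inverse x ^ m)"

text \<open>Only the point 0 is delicate: the right difference quotient there is exp(-1/y) y^(-m-1),
  where the exponential beats the power, and the left one vanishes.\<close>

lemma flat_exp_deriv: "(flat_exp m has_real_derivative (- real m) * flat_exp (Suc m) x + 1 * flat_exp (Suc (Suc m)) x) (at x)"
proof -
  consider "x < 0" | "x > 0" | "x = 0" by linarith
  thus ?thesis
  proof cases
    case 1
    have "((\<lambda>_. 0) has_real_derivative 0) (at x)" by simp
    hence "(flat_exp m has_real_derivative 0) (at x)"
      by (rule DERIV_cong_ev[THEN iffD1, rotated 3])
        (use 1 in \<open>auto simp: flat_exp_def intro!: eventually_nhds_in_open[of "{..<0}", THEN eventually_mono]\<close>)
    thus ?thesis using 1 by (simp add: flat_exp_def)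
  next
    case 2
    have "((\<lambda>x. exp (- inverse x) * inverse x ^ m) has_real_derivative
        (- real m) * flat_exp (Suc m) x + 1 * flat_exp (Suc (Suc m)) x) (at x)"
      using 2 by (auto intro!: derivative_eq_intros simp: flat_exp_def field_simps power2_eq_square)
         (cases m; simp add: field_simps)+
    thus ?thesis
      by (rule DERIV_cong_ev[THEN iffD1, rotated 3])
        (use 2 in \<open>auto simp: flat_exp_def intro!: eventually_nhds_in_open[of "{0<..}", THEN eventually_mono]\<close>)
  next
    case 3
    have "((\<lambda>y. flat_exp m y / y) \<longlongrightarrow> 0) (at_right 0)"
    proof -
      have "((\<lambda>y::real. exp (- inverse y) * inverse y ^ m / y) \<longlongrightarrow> 0) (at_right 0)"
        by real_asymp
      thus ?thesis
        by (rule Lim_transform_eventually) (auto simp: flat_exp_def eventually_at_filter)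
    qed
    moreover have "((\<lambda>y. flat_exp m y / y) \<longlongrightarrow> 0) (at_left 0)"
      by (rule Lim_transform_eventually[of "\<lambda>_. 0"]) (auto simp: flat_exp_def eventually_at_filter)
    ultimately have "((\<lambda>y. flat_exp m y / y) \<longlongrightarrow> 0) (at 0)"
      by (simp add: filterlim_split_at)
    thus ?thesis using 3 by (simp add: has_field_derivative_iff flat_exp_def)
  qed
qed

lemma C_k_on_flat_exp: "C_k_on k UNIV (flat_exp m)"
  by (rule C_k_on_real_DERIV[of UNIV flat_exp "\<lambda>m. - real m" "\<lambda>_. 1"]) (use flat_exp_deriv in auto)

lemma flat_exp_pos: "0 < x \<Longrightarrow> flat_exp m x > 0" and flat_exp_nonpos: "x \<le> 0 \<Longrightarrow> flat_exp m x = 0"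
  and flat_exp_nonneg: "flat_exp m x \<ge> 0"
  by (auto simp: flat_exp_def)

lemma frechet_derivative_zero_ext:
  assumes "compact K" "\<And>x. x \<notin> K \<Longrightarrow> f x = 0" "x \<notin> K"
  shows "frechet_derivative f (at x) v = 0"
proof -
  have "frechet_derivative f (at x) = frechet_derivative (\<lambda>_. 0) (at x)"
    by (rule frechet_derivative_cong_open[of "- K"]) (use assms compact_imp_closed in auto)
  thus ?thesis by (simp add: frechet_derivative_const)
qed

section \<open>Supports and test functions\<close>

definition supported_in :: "'a::topological_space set \<Rightarrow> ('a \<Rightarrow> 'b::zero) \<Rightarrow> bool" where
  "supported_in W f \<longleftrightarrow> (\<exists>K. compact K \<and> K \<subseteq> W \<and> (\<forall>x. x \<notin> K \<longrightarrow> f x = 0))"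

text \<open>Smoothness is imposed on the whole space and the compact support is placed inside
  \<open>W\<close>, so that a test function of a smaller set is, without any extension, a test
  function of a larger one.\<close>

definition test_fun :: "'a::euclidean_space set \<Rightarrow> ('a \<Rightarrow> 'b::real_normed_vector) \<Rightarrow> bool" where
  "test_fun W f \<longleftrightarrow> smooth_on UNIV f \<and> supported_in W f"

lemma test_fun_smooth: "test_fun W f \<Longrightarrow> C_k_on k UNIV f"
  by (simp add: test_fun_def smooth_on_def)

lemma test_fun_smooth_on: "test_fun W f \<Longrightarrow> smooth_on V f"
  by (auto simp add: test_fun_def smooth_on_def intro: C_k_on_subset)

lemma test_fun_continuous: "test_fun W f \<Longrightarrow> continuous_on V f"
  using C_k_on_continuous[OF test_fun_smooth] continuous_on_subset by blast

lemma test_fun_has_derivative: 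
  "test_fun W f \<Longrightarrow> (f has_derivative frechet_derivative f (at x)) (at x)"
  using C_k_on_has_derivative[OF test_fun_smooth] by blast

lemma test_fun_mono: "test_fun V f \<Longrightarrow> V \<subseteq> W \<Longrightarrow> test_fun W f"
  unfolding test_fun_def supported_in_def by blast

text \<open>The open sets \<open>W\<close> and \<open>- K\<close> cover the space, and on the second
  one g vanishes identically.\<close>

lemma C_k_on_zero_ext:
  assumes "open W" "C_k_on k W g" "closed K" "K \<subseteq> W" "\<And>x. x \<notin> K \<Longrightarrow> g x = 0"
  shows "C_k_on k UNIV g"
proof (rule C_k_on_local)
  fix x
  show "\<exists>U. open U \<and> x \<in> U \<and> C_k_on k U g"
  proof (cases "x \<in> W")
    case False
    have "C_k_on k (- K) (\<lambda>x. 0 :: 'b)" using assms(3) by (intro C_k_on_const) auto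
    hence "C_k_on k (- K) g" by (rule C_k_on_cong[rotated]) (use assms in auto)
    thus ?thesis using False assms(3,4) by blast
  qed (use assms in blast)
qed

text \<open>The first factor may behave badly near the boundary of \<open>W\<close>; the product is
  zero off the support of the second one.\<close>

lemma test_fun_bilinear:
  assumes "open W" "bounded_bilinear prd" "smooth_on W g" "test_fun W f"
  shows "test_fun W (\<lambda>x. prd (g x) (f x))"
proof -
  obtain K where K: "compact K" "K \<subseteq> W" "\<And>x. x \<notin> K \<Longrightarrow> f x = 0"
    using assms(4) by (auto simp: test_fun_def supported_in_def)
  have z: "prd (g x) (f x) = 0" if "x \<notin> K" for x
    using K(3)[OF that] bounded_bilinear.zero_right[OF assms(2)] by simp
  have "C_k_on k UNIV (\<lambda>x. prd (g x) (f x))" for k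
    by (rule C_k_on_zero_ext[OF assms(1) C_k_on_bilinear[OF assms(1,2)] compact_imp_closed[OF K(1)] K(2) z])
      (use assms(3) test_fun_smooth[OF assms(4)] in \<open>auto simp: smooth_on_def intro: C_k_on_subset\<close>)
  thus ?thesis using K(1,2) z by (auto simp: test_fun_def smooth_on_def supported_in_def)
qed

lemmas test_fun_mult = test_fun_bilinear[OF _ bounded_bilinear_mult]
lemmas test_fun_scaleR = test_fun_bilinear[OF _ bounded_bilinear_scaleR]

lemma test_fun_deriv:
  assumes "test_fun W f"
  shows "test_fun W (\<lambda>x. frechet_derivative f (at x) v)"
proof -
  obtain K where K: "compact K" "K \<subseteq> W" "\<And>x. x \<notin> K \<Longrightarrow> f x = 0"
    using assms by (auto simp: test_fun_def supported_in_def)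
  have "C_k_on k UNIV (\<lambda>x. frechet_derivative f (at x) v)" for k
    using test_fun_smooth[OF assms, of "Suc k"] by simp
  thus ?thesis using K frechet_derivative_zero_ext[OF K(1,3)]
    by (auto simp: test_fun_def smooth_on_def supported_in_def)
qed

lemma supported_in_add:
  fixes f g :: "_ \<Rightarrow> 'b::monoid_add"
  assumes "supported_in W f" "supported_in W g" shows "supported_in W (\<lambda>x. f x + g x)"
proof -
  obtain K L where "compact K" "K \<subseteq> W" "\<forall>x. x \<notin> K \<longrightarrow> f x = 0" "compact L" "L \<subseteq> W" "\<forall>x. x \<notin> L \<longrightarrow> g x = 0"
    using assms unfolding supported_in_def by blast
  thus ?thesis unfolding supported_in_def by (intro exI[of _ "K \<union> L"]) (auto intro: compact_Un)
qed

lemma test_fun_add: "test_fun W f \<Longrightarrow> test_fun W g \<Longrightarrow> test_fun W (\<lambda>x. f x + g x)"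
  by (auto simp: test_fun_def smooth_on_def intro: C_k_on_add supported_in_add)

lemma test_fun_zero: "test_fun W (\<lambda>x. 0)"
  by (auto simp: test_fun_def smooth_on_def supported_in_def)

lemma test_fun_sum: "(\<And>i. i \<in> I \<Longrightarrow> test_fun W (f i)) \<Longrightarrow> test_fun W (\<lambda>x. \<Sum>i\<in>I. f i x)"
  by (induction I rule: infinite_finite_induct) (auto intro: test_fun_add test_fun_zero)

lemma smooth_on_const: "open W \<Longrightarrow> smooth_on W (\<lambda>x. c)"
  by (auto simp: smooth_on_def)

lemma smooth_on_subset: "smooth_on W f \<Longrightarrow> V \<subseteq> W \<Longrightarrow> smooth_on V f"
  by (auto simp: smooth_on_def intro: C_k_on_subset)

lemma smooth_on_continuous: "smooth_on W f \<Longrightarrow> continuous_on W f"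
  by (auto simp: smooth_on_def intro: C_k_on_continuous)

lemma smooth_on_deriv: "smooth_on W f \<Longrightarrow> smooth_on W (\<lambda>x. frechet_derivative f (at x) v)"
  unfolding smooth_on_def by (metis C_k_on.simps(2))

lemma smooth_on_has_derivative:
  "smooth_on W f \<Longrightarrow> x \<in> W \<Longrightarrow> (f has_derivative frechet_derivative f (at x)) (at x)"
  unfolding smooth_on_def using C_k_on_has_derivative by blast

lemma smooth_on_bilinear:
  "open W \<Longrightarrow> bounded_bilinear prd \<Longrightarrow> smooth_on W f \<Longrightarrow> smooth_on W g \<Longrightarrow> smooth_on W (\<lambda>x. prd (f x) (g x))"
  by (simp add: smooth_on_def C_k_on_bilinear)

lemmas smooth_on_mult = smooth_on_bilinear[OF _ bounded_bilinear_mult]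
lemmas smooth_on_scaleR = smooth_on_bilinear[OF _ bounded_bilinear_scaleR]
lemmas smooth_on_inner = smooth_on_bilinear[OF _ bounded_bilinear_inner]

lemma smooth_on_add: "open W \<Longrightarrow> smooth_on W f \<Longrightarrow> smooth_on W g \<Longrightarrow> smooth_on W (\<lambda>x. f x + g x)"
  by (simp add: smooth_on_def C_k_on_add)

lemma smooth_on_diff: "open W \<Longrightarrow> smooth_on W f \<Longrightarrow> smooth_on W g \<Longrightarrow> smooth_on W (\<lambda>x. f x - g x)"
  by (simp add: smooth_on_def C_k_on_diff)

lemma smooth_on_compose_linear: "open W \<Longrightarrow> smooth_on W f \<Longrightarrow> bounded_linear L \<Longrightarrow> smooth_on W (\<lambda>x. L (f x))"
  by (simp add: smooth_on_def C_k_on_compose_linear)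

lemma smooth_on_compose:
  fixes f :: "'b::euclidean_space \<Rightarrow> 'c::real_normed_vector" and g :: "'a::euclidean_space \<Rightarrow> 'b"
  shows "open W \<Longrightarrow> smooth_on W g \<Longrightarrow> smooth_on V f \<Longrightarrow> g ` W \<subseteq> V \<Longrightarrow> smooth_on W (\<lambda>x. f (g x))"
  unfolding smooth_on_def by (auto intro: C_k_on_compose)

lemma smooth_on_cong: "open W \<Longrightarrow> smooth_on W f \<Longrightarrow> (\<And>y. y \<in> W \<Longrightarrow> f y = g y) \<Longrightarrow> smooth_on W g"
  unfolding smooth_on_def using C_k_on_cong by blast

lemma smooth_on_linear: "open W \<Longrightarrow> bounded_linear L \<Longrightarrow> smooth_on W L"
  by (simp add: smooth_on_def C_k_on_bounded_linear)

lemma smooth_on_sq_dist: "open W \<Longrightarrow> smooth_on W (\<lambda>x::'a::euclidean_space. (x - p) \<bullet> (x - p))"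
  by (intro smooth_on_inner smooth_on_diff smooth_on_const smooth_on_linear[OF _ bounded_linear_ident])

section \<open>Bump and cutoff functions\<close>

lemma bump_exists:
  fixes p :: "'a::euclidean_space"
  assumes "open W" "p \<in> W"
  obtains h :: "'a \<Rightarrow> real" where "test_fun W h" "\<And>x. h x \<ge> 0" "h p > 0"
proof -
  obtain r where r: "r > 0" "cball p r \<subseteq> W" using assms open_contains_cball by blast
  \<comment> \<open>The squared distance is smooth also at the centre p, unlike the distance
    itself.\<close>
  let ?h = "\<lambda>x. flat_exp 0 (r\<^sup>2 - (x - p) \<bullet> (x - p))"
  have z: "?h x = 0" if "x \<notin> cball p r" for x
  proof -
    have "r < norm (x - p)" using that by (simp add: dist_norm norm_minus_commute)
    hence "r\<^sup>2 \<le> (norm (x - p))\<^sup>2" using r(1) by (intro power_mono) auto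
    thus ?thesis by (intro flat_exp_nonpos) (simp add: power2_norm_eq_inner)
  qed
  have "smooth_on UNIV ?h"
    by (rule smooth_on_compose[where V=UNIV and f="flat_exp 0", OF _ smooth_on_diff[OF _ smooth_on_const smooth_on_sq_dist]])
      (auto simp: smooth_on_def C_k_on_flat_exp)
  hence "test_fun W ?h" using z r by (auto simp: test_fun_def supported_in_def intro!: exI[of _ "cball p r"])
  thus ?thesis using that[of ?h] r(1) by (simp add: flat_exp_nonneg flat_exp_pos)
qed

text \<open>The cutoff is u / (u + w) with u positive exactly inside radius b and w positive exactly
  outside radius a. Since a < b the denominator never vanishes.\<close>

lemma cutoff_exists:
  fixes p :: "'a::euclidean_space"
  assumes "0 < a" "a < b"
  obtains h :: "'a \<Rightarrow> real" where "test_fun UNIV h" "\<And>x. x \<in> cball p a \<Longrightarrow> h x = 1" "\<And>x. x \<notin> ball p b \<Longrightarrow> h x = 0"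
proof -
  let ?s = "\<lambda>x. (x - p) \<bullet> (x - p)"
  let ?u = "\<lambda>x. flat_exp 0 (b\<^sup>2 - ?s x)" and ?w = "\<lambda>x. flat_exp 0 (?s x - a\<^sup>2)"
  let ?h = "\<lambda>x. ?u x * inverse (?u x + ?w x)"
  have ab: "a\<^sup>2 < b\<^sup>2" using assms by (intro power_strict_mono) auto
  have pos: "?u x + ?w x > 0" for x
    using ab flat_exp_pos[of "b\<^sup>2 - ?s x" 0] flat_exp_pos[of "?s x - a\<^sup>2" 0]
      flat_exp_nonneg[of 0 "b\<^sup>2 - ?s x"] flat_exp_nonneg[of 0 "?s x - a\<^sup>2"] 
    by (cases "?s x < b\<^sup>2") (auto intro: add_pos_nonneg add_nonneg_pos)
  have z: "?h x = 0" if "x \<notin> ball p b" for x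
  proof -
    have "b \<le> norm (x - p)" using that by (simp add: dist_norm norm_minus_commute)
    hence "b\<^sup>2 \<le> (norm (x - p))\<^sup>2" using assms by (intro power_mono) auto
    hence "?u x = 0" by (intro flat_exp_nonpos) (simp add: power2_norm_eq_inner)
    thus ?thesis by simp
  qed
  have o: "?h x = 1" if "x \<in> cball p a" for x
  proof -
    have "norm (x - p) \<le> a" using that by (simp add: dist_norm norm_minus_commute)
    hence "(norm (x - p))\<^sup>2 \<le> a\<^sup>2" by (intro power_mono) auto
    hence "?w x = 0" by (intro flat_exp_nonpos) (simp add: power2_norm_eq_inner)
    thus ?thesis using pos[of x] by simp
  qed
  have sm: "C_k_on k UNIV ?u" "C_k_on k UNIV ?w" for k
    by (rule C_k_on_compose[OF _ _ C_k_on_flat_exp];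
        use smooth_on_sq_dist[of UNIV p] in \<open>auto intro!: C_k_on_diff C_k_on_const simp: smooth_on_def\<close>)+
  have "smooth_on UNIV ?h" unfolding smooth_on_def
    by (intro allI C_k_on_mult C_k_on_inverse C_k_on_add sm pos) auto
  moreover have "supported_in UNIV ?h" unfolding supported_in_def
    by (intro exI[of _ "cball p b"] conjI compact_cball allI impI z) auto
  ultimately have "test_fun UNIV ?h" by (simp add: test_fun_def)
  thus ?thesis using that z o by blast
qed

section \<open>Integration by parts and the fundamental lemma\<close>

lemma integrable_supported:
  fixes f :: "'a::euclidean_space \<Rightarrow> 'b::{banach, second_countable_topology}"
  assumes "continuous_on W f" "supported_in W f"
  shows "integrable lborel f"
proof -
  obtain K where K: "compact K" "K \<subseteq> W" "\<And>x. x \<notin> K \<Longrightarrow> f x = 0"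
    using assms by (auto simp: supported_in_def)
  have "integrable lborel (\<lambda>x. indicator K x *\<^sub>R f x)"
    by (rule borel_integrable_compact) (use K assms continuous_on_subset in auto)
  also have "(\<lambda>x. indicator K x *\<^sub>R f x) = f"
    using K(3) by (auto simp: indicator_def fun_eq_iff)
  finally show ?thesis .
qed

lemma integral_translation:
  fixes f :: "'a::euclidean_space \<Rightarrow> 'b::{banach, second_countable_topology}"
  assumes "f \<in> borel_measurable borel"
  shows "(\<integral>x. f (c + x) \<partial>lborel) = (\<integral>x. f x \<partial>lborel)"
proof -
  have "(\<integral>x. f x \<partial>lborel) = (\<integral>x. f x \<partial>distr lborel borel ((+) c))" by (simp add: lborel_distr_plus)
  also have "\<dots> = (\<integral>x. f (c + x) \<partial>lborel)" by (rule integral_distr) (use assms in auto)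
  finally show ?thesis ..
qed

lemma bounded_supported:
  fixes f :: "'a::topological_space \<Rightarrow> 'b::real_normed_vector"
  assumes "continuous_on W f" "supported_in W f"
  obtains B where "B > 0" "\<And>x. norm (f x) \<le> B"
proof -
  obtain K where K: "compact K" "K \<subseteq> W" "\<And>x. x \<notin> K \<Longrightarrow> f x = 0"
    using assms by (auto simp: supported_in_def)
  have "bounded (f ` K)"
    using K assms by (intro compact_imp_bounded compact_continuous_image) (auto intro: continuous_on_subset)
  then obtain B where "B > 0" "\<forall>x\<in>K. norm (f x) \<le> B" by (auto simp: bounded_pos)
  thus ?thesis using K(3) that[of B] by (metis less_imp_le norm_zero)
qed

text \<open>Difference quotients have integral 0 by translation invariance, and they converge to the
  derivative dominatedly: the mean value inequality bounds them, and their supports stay in one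
  ball. No splitting into coordinates is involved.\<close>

lemma integral_deriv_zero:
  fixes f :: "'a::euclidean_space \<Rightarrow> 'b::{banach, second_countable_topology}"
  assumes C1: "C_k_on 1 UNIV f" and supp: "supported_in UNIV f"
  shows "(\<integral>x. frechet_derivative f (at x) v \<partial>lborel) = 0"
proof -
  let ?D = "\<lambda>x. frechet_derivative f (at x) v"
  have der: "(f has_derivative frechet_derivative f (at x)) (at x)" for x
    using C_k_on_has_derivative[of 0 UNIV f x] C1 by simp
  have cf: "continuous_on UNIV f" using C1 C_k_on_continuous by blast
  have cD: "continuous_on UNIV ?D" using C1 by simp
  obtain K where K: "compact K" "\<And>x. x \<notin> K \<Longrightarrow> f x = 0"
    using supp by (auto simp: supported_in_def)
  have D0: "x \<notin> K \<Longrightarrow> ?D x = 0" for x by (rule frechet_derivative_zero_ext[OF K(1)]) (auto simp: K(2))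
  have "supported_in UNIV ?D" using K(1) D0 by (auto simp: supported_in_def)
  then obtain B where B: "B > 0" "\<And>x. norm (?D x) \<le> B" using bounded_supported[OF cD] by blast
  obtain R where R: "R > 0" "\<And>x. x \<in> K \<Longrightarrow> norm x \<le> R"
    using compact_imp_bounded[OF K(1)] by (auto simp: bounded_pos)
  \<comment> \<open>Steps in (0, 1]; the bound 1 keeps the support of every quotient within radius
    \<open>R + norm v\<close>.\<close>
  define t where "t n = inverse (real (Suc n))" for n
  have t: "t n > 0" "t n \<le> 1" for n by (auto simp: t_def field_simps)
  have t0: "t \<longlonglongrightarrow> 0" unfolding t_def by (rule LIMSEQ_inverse_real_of_nat)
  define q where "q n x = (1 / t n) *\<^sub>R (f (t n *\<^sub>R v + x) - f x)" for n x
  have int_q: "(\<integral>x. q n x \<partial>lborel) = 0" for n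
  proof -
    have fm: "f \<in> borel_measurable borel" using cf by (rule borel_measurable_continuous_onI)
    have i1: "integrable lborel f" by (rule integrable_supported[OF cf supp])
    have "integrable (distr lborel borel ((+) (t n *\<^sub>R v))) f" using i1 by (simp add: lborel_distr_plus)
    hence i2: "integrable lborel (\<lambda>x. f (t n *\<^sub>R v + x))" by (subst (asm) integrable_distr_eq) (use fm in auto)
    show ?thesis unfolding q_def using i1 i2 by (simp add: integral_translation[OF fm])
  qed
  have lip: "norm (f (s *\<^sub>R v + x) - f x) \<le> B * s" if "s \<ge> 0" for s x
  proof -
    let ?g = "\<lambda>r::real. f (r *\<^sub>R v + x)"
    have "norm (?g s - ?g 0) \<le> B * norm (s - 0)"
    proof (rule differentiable_bound[OF convex_UNIV])
      fix r :: real
      have lin: "linear (frechet_derivative f (at (r *\<^sub>R v + x)))" using der has_derivative_linear by blast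
      have "(?g has_derivative (\<lambda>h. frechet_derivative f (at (r *\<^sub>R v + x)) (h *\<^sub>R v))) (at r)"
        by (rule has_derivative_compose[OF _ der]) (auto intro!: derivative_eq_intros)
      thus "(?g has_derivative (\<lambda>h. h *\<^sub>R ?D (r *\<^sub>R v + x))) (at r within UNIV)"
        using linear_scale[OF lin] by simp
      show "onorm (\<lambda>h. h *\<^sub>R ?D (r *\<^sub>R v + x)) \<le> B"
        by (rule onorm_le) (simp, metis B(2) abs_ge_zero mult.commute mult_left_mono)
    qed auto
    thus ?thesis using that by simp
  qed
  have "(\<lambda>n. \<integral>x. q n x \<partial>lborel) \<longlonglongrightarrow> (\<integral>x. ?D x \<partial>lborel)"
  proof (rule integral_dominated_convergence[where w="\<lambda>x. indicator (cball 0 (R + norm v)) x *\<^sub>R B"])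
    show "?D \<in> borel_measurable lborel" using cD by (simp add: borel_measurable_continuous_onI)
    show "q n \<in> borel_measurable lborel" for n unfolding q_def
      by (simp, rule borel_measurable_continuous_onI) (intro continuous_intros continuous_on_compose2[OF cf]; simp)
    show "integrable lborel (\<lambda>x::'a. indicator (cball 0 (R + norm v)) x *\<^sub>R B)"
      by (rule borel_integrable_compact) auto
    show "AE x in lborel. (\<lambda>n. q n x) \<longlonglongrightarrow> ?D x"
    proof (rule AE_I2)
      fix x
      have lin: "linear (frechet_derivative f (at x))" using der has_derivative_linear by blast
      have "((\<lambda>r. f (r *\<^sub>R v + x)) has_derivative (\<lambda>h. frechet_derivative f (at (0 *\<^sub>R v + x)) (h *\<^sub>R v))) (at 0)"
        by (rule has_derivative_compose[OF _ der]) (auto intro!: derivative_eq_intros)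
      hence "((\<lambda>r. f (r *\<^sub>R v + x)) has_vector_derivative ?D x) (at 0)"
        by (simp add: has_vector_derivative_def linear_scale[OF lin])
      hence "((\<lambda>h. norm (f (h *\<^sub>R v + x) - f x - h *\<^sub>R ?D x) / norm h) \<longlongrightarrow> 0) (at 0)"
        by (simp add: has_vector_derivative_def has_derivative_at)
      moreover have "norm (f (h *\<^sub>R v + x) - f x - h *\<^sub>R ?D x) / norm h = norm ((1/h) *\<^sub>R (f (h *\<^sub>R v + x) - f x) - ?D x)"
        if "h \<noteq> 0" for h :: real
      proof -
        have "(1/h) *\<^sub>R (f (h *\<^sub>R v + x) - f x) - ?D x = (1/h) *\<^sub>R (f (h *\<^sub>R v + x) - f x - h *\<^sub>R ?D x)"
          using that by (simp add: scaleR_diff_right)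
        thus ?thesis by simp
      qed
      hence "\<forall>\<^sub>F h in at 0. norm (f (h *\<^sub>R v + x) - f x - h *\<^sub>R ?D x) / norm h = norm ((1/h) *\<^sub>R (f (h *\<^sub>R v + x) - f x) - ?D x)"
        by (simp add: eventually_at_filter)
      ultimately have "((\<lambda>h. norm ((1/h) *\<^sub>R (f (h *\<^sub>R v + x) - f x) - ?D x)) \<longlongrightarrow> 0) (at 0)"
        by (rule Lim_transform_eventually)
      hence "((\<lambda>h. (1/h) *\<^sub>R (f (h *\<^sub>R v + x) - f x)) \<longlongrightarrow> ?D x) (at 0)"
        by (simp add: Lim_null[of _ "?D x"] tendsto_norm_zero_iff)
      moreover have "filterlim t (at 0) sequentially"
        using t0 t(1) by (simp add: filterlim_at less_imp_neq[symmetric])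
      ultimately show "(\<lambda>n. q n x) \<longlonglongrightarrow> ?D x"
        unfolding q_def by (rule filterlim_compose)
    qed
    show "AE x in lborel. norm (q n x) \<le> indicator (cball 0 (R + norm v)) x *\<^sub>R B" for n
    proof (rule AE_I2)
      fix x
      have b: "norm (q n x) \<le> B"
        using lip[of "t n" x] t[of n] unfolding q_def norm_scaleR by (simp add: field_simps)
      have "q n x = 0" if "norm x > R + norm v"
      proof -
        have "norm (t n *\<^sub>R v) \<le> norm v" using t[of n] by (simp add: mult_left_le_one_le)
        hence "norm (t n *\<^sub>R v + x) > R" using that norm_diff_ineq[of x "t n *\<^sub>R v"] by (simp add: add.commute)
        moreover have "norm x > R" using that by (smt (verit) norm_ge_zero)
        ultimately show ?thesis using R(2) K(2) unfolding q_def by (metis diff_zero linorder_not_le scaleR_zero_right)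
      qed
      thus "norm (q n x) \<le> indicator (cball 0 (R + norm v)) x *\<^sub>R B"
        using b B(1) by (auto simp: indicator_def)
    qed
  qed
  thus ?thesis using int_q by (simp add: LIMSEQ_const_iff)
qed

lemma supported_in_bilinear:
  assumes "bounded_bilinear prd" "supported_in W g"
  shows "supported_in W (\<lambda>x. prd (f x) (g x))"
  using assms(2) bounded_bilinear.zero_right[OF assms(1)] unfolding supported_in_def by metis

lemma supported_in_deriv: "supported_in W f \<Longrightarrow> supported_in W (\<lambda>x. frechet_derivative f (at x) v)"
  unfolding supported_in_def by (metis frechet_derivative_zero_ext)

text \<open>The general bilinear product covers real and complex factors alike. The function f is
  controlled on \<open>W\<close> only; the product with g, extended by zero, is C^1 everywhere, and
  its derivative integrates to 0.\<close>

lemma integral_by_parts: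
  fixes f :: "'a::euclidean_space \<Rightarrow> 'c::real_normed_vector" and g :: "'a \<Rightarrow> 'd::real_normed_vector"
    and prd :: "'c \<Rightarrow> 'd \<Rightarrow> 'b::{banach, second_countable_topology}"
  assumes bil: "bounded_bilinear prd"
    and W: "open W" and f: "C_k_on 1 W f" and g: "C_k_on 1 W g" and supp: "supported_in W g"
  shows "(\<integral>x. prd (frechet_derivative f (at x) v) (g x) \<partial>lborel) = - (\<integral>x. prd (f x) (frechet_derivative g (at x) v) \<partial>lborel)"
proof -
  interpret bounded_bilinear prd by (rule bil)
  let ?p = "\<lambda>x. prd (f x) (g x)"
  obtain K where K: "compact K" "K \<subseteq> W" "\<And>x. x \<notin> K \<Longrightarrow> g x = 0"
    using supp by (auto simp: supported_in_def)
  have C1: "C_k_on 1 UNIV ?p"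
    by (rule C_k_on_zero_ext[OF W C_k_on_bilinear[OF W bil f g] compact_imp_closed[OF K(1)] K(2)]) 
      (use K(3) zero_right in simp)
  have s1: "supported_in W (\<lambda>x. prd (frechet_derivative f (at x) v) (g x))"
    and s2: "supported_in W (\<lambda>x. prd (f x) (frechet_derivative g (at x) v))"
    by (rule supported_in_bilinear[OF bil supp], rule supported_in_bilinear[OF bil supported_in_deriv[OF supp]])
  have fc: "continuous_on W f" "continuous_on W g" "continuous_on W (\<lambda>x. frechet_derivative f (at x) v)"
    "continuous_on W (\<lambda>x. frechet_derivative g (at x) v)"
    using C_k_on_continuous[OF f] C_k_on_continuous[OF g] f g by auto
  have i1: "integrable lborel (\<lambda>x. prd (frechet_derivative f (at x) v) (g x))"
    by (rule integrable_supported[OF _ s1]) (rule continuous_on fc)+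
  have i2: "integrable lborel (\<lambda>x. prd (f x) (frechet_derivative g (at x) v))"
    by (rule integrable_supported[OF _ s2]) (rule continuous_on fc)+
  have "frechet_derivative ?p (at x) v = prd (f x) (frechet_derivative g (at x) v) + prd (frechet_derivative f (at x) v) (g x)" for x
  proof (cases "x \<in> W")
    case True
    have "(?p has_derivative (\<lambda>v. prd (f x) (frechet_derivative g (at x) v) + prd (frechet_derivative f (at x) v) (g x))) (at x)"
      using C_k_on_has_derivative[of 0 W f x] C_k_on_has_derivative[of 0 W g x] True f g by (intro FDERIV) auto
    thus ?thesis by (rule fun_cong[OF frechet_derivative_at, symmetric])
  next
    case False
    hence x: "x \<notin> K" using K by blast
    hence "frechet_derivative ?p (at x) v = 0" "frechet_derivative g (at x) v = 0"
      using frechet_derivative_zero_ext[OF K(1), of ?p x v] frechet_derivative_zero_ext[OF K(1), of g x v] x K(3) by (auto simp: zero_right)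
    thus ?thesis using K(3) x by (simp add: zero_right)
  qed
  moreover have "supported_in UNIV ?p" using K by (auto simp: supported_in_def zero_right)
  ultimately have "(\<integral>x. prd (f x) (frechet_derivative g (at x) v) + prd (frechet_derivative f (at x) v) (g x) \<partial>lborel) = 0"
    using integral_deriv_zero[OF C1, of v] by simp
  thus ?thesis using i1 i2 by (simp add: add_eq_0_iff)
qed

text \<open>The version with an inequality carries the sign of the approximating functions over to
  the limit; applied to g and -g it gives the usual one. If g were negative at x, a bump supported
  where g < 0 would make the integral strictly negative.\<close>

lemma fundamental_lemma:
  fixes g :: "'a::euclidean_space \<Rightarrow> real"
  assumes W: "open W" and g: "continuous_on W g"
    and z: "\<And>h::'a \<Rightarrow> real. test_fun W h \<Longrightarrow> (\<And>x. h x \<ge> 0) \<Longrightarrow> (\<integral>x. g x * h x \<partial>lborel) \<ge> 0"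
    and x: "x \<in> W"
  shows "g x \<ge> 0"
proof (rule ccontr)
  assume "\<not> g x \<ge> 0"
  hence neg: "g x < 0" by simp
  define V where "V = {y\<in>W. g y < 0}"
  have V: "open V" unfolding V_def
    using continuous_open_preimage[OF g W, of "{..<0}"] by (simp add: vimage_def Int_def)
  obtain h :: "'a \<Rightarrow> real" where h: "test_fun V h" "\<And>y. h y \<ge> 0" "h x > 0"
    using bump_exists[OF V, of x] x neg by (auto simp: V_def)
  have hW: "test_fun W h" by (rule test_fun_mono[OF h(1)]) (auto simp: V_def)
  have h0: "h y = 0" if "y \<notin> V" for y using h(1) that unfolding test_fun_def supported_in_def by blast
  have le: "g y * h y \<le> 0" for y
    using h(2)[of y] h0[of y] by (cases "y \<in> V") (auto simp: V_def mult_nonpos_nonneg)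
  have hsup: "supported_in W (\<lambda>x. g x * h x)" using hW by (intro supported_in_bilinear[OF bounded_bilinear_mult]) (simp add: test_fun_def)
  have int: "integrable lborel (\<lambda>x. g x * h x)"
    by (rule integrable_supported[OF _ hsup]) (intro continuous_intros g test_fun_continuous[OF h(1)])
  have "(\<integral>x. - (g x * h x) \<partial>lborel) = 0"
  proof (rule antisym)
    show "(\<integral>x. - (g x * h x) \<partial>lborel) \<le> 0" using z[OF hW h(2)] by simp
    show "(\<integral>x. - (g x * h x) \<partial>lborel) \<ge> 0" using le by (intro integral_nonneg_AE) simp
  qed
  hence ae: "AE y in lborel. - (g y * h y) = 0"
    using integral_nonneg_eq_0_iff_AE[of lborel "\<lambda>x. - (g x * h x)"] int le by simp
  let ?Z = "{y\<in>V. h y > 0}"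
  have Z: "open ?Z" 
    using continuous_open_preimage[OF test_fun_continuous[OF h(1)] V, of "{0<..}"] by (simp add: vimage_def Int_def)
  have "?Z \<in> null_sets lborel"
  proof -
    have "AE y in lborel. y \<notin> ?Z" using ae by (auto elim!: eventually_mono simp: V_def)
    thus ?thesis using borel_open[OF Z] by (simp add: AE_iff_null_sets)
  qed
  hence "negligible ?Z" using negligible_iff_null_sets null_sets_completionI by blast
  moreover have "x \<in> ?Z" using h(3) x neg by (simp add: V_def)
  ultimately show False using open_not_negligible[OF Z] by blast
qed

section \<open>Multiple Fourier series\<close>

definition lat :: "int^'n \<Rightarrow> real^'n" where "lat k = (\<chi> i. real_of_int (k $ i))"

lemma lat_nth [simp]: "lat k $ i = real_of_int (k $ i)" by (simp add: lat_def)
lemma lat_add [simp]: "lat (k + l) = lat k + lat l" by (simp add: vec_eq_iff)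
lemma lat_diff [simp]: "lat (k - l) = lat k - lat l" by (simp add: vec_eq_iff)
lemma lat_uminus [simp]: "lat (- k) = - lat k" by (simp add: vec_eq_iff)
lemma lat_zero [simp]: "lat 0 = 0" by (simp add: vec_eq_iff)
lemma lat_eq_0_iff [simp]: "lat k = 0 \<longleftrightarrow> k = 0" by (simp add: vec_eq_iff)

definition ek :: "int^'n \<Rightarrow> real^'n \<Rightarrow> complex" where "ek k x = cis (lat k \<bullet> x)"

lemma ek_zero [simp]: "ek 0 x = 1" by (simp add: ek_def)
lemma ek_add: "ek (k + l) x = ek k x * ek l x" by (simp add: ek_def inner_add_left cis_mult)
lemma norm_ek [simp]: "norm (ek k x) = 1" by (simp add: ek_def)

lemma ek_has_derivative: "(ek k has_derivative (\<lambda>v. \<i> * of_real (lat k \<bullet> v) * ek k x)) (at x)"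
proof -
  have c: "(cis has_derivative (\<lambda>h. of_real h * (\<i> * cis t))) (at t)" for t
  proof -
    have "(cis has_vector_derivative (\<i> * cis t)) (at t)"
      unfolding has_vector_derivative_complex_iff by (auto intro!: derivative_eq_intros)
    thus ?thesis by (simp add: has_vector_derivative_def scaleR_conv_of_real)
  qed
  have "((\<lambda>x. lat k \<bullet> x) has_derivative (\<lambda>v. lat k \<bullet> v)) (at x)" by (auto intro!: derivative_eq_intros)
  from has_derivative_compose[OF this c] show ?thesis unfolding ek_def[abs_def] by (simp add: mult_ac)
qed

lemma frechet_derivative_ek: "frechet_derivative (ek k) (at x) v = \<i> * of_real (lat k \<bullet> v) * ek k x"
  using frechet_derivative_at[OF ek_has_derivative, of k x] by metis

lemma C_k_on_ek: "open W \<Longrightarrow> C_k_on j W (ek k)"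
proof (induction j)
  case 0
  have "isCont (ek k) x" for x using has_derivative_continuous[OF ek_has_derivative] .
  thus ?case by (simp add: continuous_at_imp_continuous_on)
next
  case (Suc j)
  show ?case by (rule C_k_on_SucI[OF Suc.prems ek_has_derivative])
    (rule C_k_on_mult[OF Suc.prems C_k_on_const[OF Suc.prems] Suc.IH[OF Suc.prems]])
qed

lemma smooth_on_ek: "open W \<Longrightarrow> smooth_on W (ek k)" by (simp add: smooth_on_def C_k_on_ek)

lemma continuous_on_ek: "continuous_on W (ek k)"
  using C_k_on_continuous[OF C_k_on_ek[of UNIV]] continuous_on_subset by blast

section \<open>Polynomial weights on the lattice\<close>

definition wt :: "int^'n \<Rightarrow> real" where "wt k = 1 + norm (lat k)"

lemma wt_ge_1: "wt k \<ge> 1" by (simp add: wt_def)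
lemma wt_pos: "wt k > 0" using wt_ge_1[of k] by linarith
text \<open>Peetre's inequality. It distributes the weight at k over the two factors of a
  convolution sum over m.\<close>

lemma wt_diff_le: "wt k \<le> wt m * wt (k - m)"
proof -
  have "norm (lat k) \<le> norm (lat m) + norm (lat k - lat m)"
    using norm_triangle_ineq[of "lat m" "lat k - lat m"] by simp
  thus ?thesis unfolding wt_def lat_diff by (simp add: algebra_simps) 
      (smt (verit) mult_nonneg_nonneg norm_ge_zero)
qed
lemma lat_component_le_wt: "1 + \<bar>real_of_int (k $ i)\<bar> \<le> wt k"
  using component_le_norm_cart[of "lat k" i] by (simp add: wt_def)

text \<open>Partial derivatives give decay in one coordinate at a time; this bound assembles it into
  decay in the full weight. The auxiliary m is the largest coordinate in absolute value, but at
  least 1.\<close>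

lemma wt_power_le: "wt (k::int^'n) ^ N \<le> (1 + real CARD('n)) ^ N * (1 + (\<Sum>i\<in>UNIV. \<bar>real_of_int (k $ i)\<bar> ^ N))"
proof -
  define m where "m = Max (insert 1 (range (\<lambda>i. \<bar>real_of_int (k $ i)\<bar>)))"
  have m: "1 \<le> m" "\<And>i. \<bar>real_of_int (k $ i)\<bar> \<le> m" unfolding m_def by (intro Max_ge; simp)+
  have "norm (lat k) \<le> (\<Sum>i\<in>UNIV. \<bar>real_of_int (k $ i)\<bar>)" using norm_le_l1_cart[of "lat k"] by simp
  also have "\<dots> \<le> real CARD('n) * m" using sum_bounded_above[of UNIV "\<lambda>i. \<bar>real_of_int (k $ i)\<bar>" m] m by simp
  finally have "wt k \<le> (1 + real CARD('n)) * m" using m(1) by (simp add: wt_def algebra_simps)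
  hence "wt k ^ N \<le> ((1 + real CARD('n)) * m) ^ N" using wt_pos[of k] by (intro power_mono) auto
  moreover have "m ^ N \<le> 1 + (\<Sum>i\<in>UNIV. \<bar>real_of_int (k $ i)\<bar> ^ N)"
  proof -
    have "m \<in> insert 1 (range (\<lambda>i. \<bar>real_of_int (k $ i)\<bar>))" unfolding m_def by (intro Max_in) auto
    thus ?thesis
    proof
      assume "m = 1" thus ?thesis by (simp add: sum_nonneg)
    next
      assume "m \<in> range (\<lambda>i. \<bar>real_of_int (k $ i)\<bar>)"
      then obtain i where "m = \<bar>real_of_int (k $ i)\<bar>" by blast
      hence "m ^ N \<le> (\<Sum>i\<in>UNIV. \<bar>real_of_int (k $ i)\<bar> ^ N)"
        by (simp add: member_le_sum[of i UNIV "\<lambda>i. \<bar>real_of_int (k $ i)\<bar> ^ N"])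
      thus ?thesis by simp
    qed
  qed
  ultimately show ?thesis by (simp add: power_mult_distrib) (smt (verit) mult_left_mono zero_le_power of_nat_0_le_iff)
qed

text \<open>Every factor \<open>1 + |k $ i|\<close> is at most the weight, so the summand is
  dominated by a product of one-dimensional terms 1/(1+|j|)^2; hence the exponent twice the
  dimension. Over a finite box the sum of these products factors.\<close>

lemma summable_wt: "(\<lambda>k::int^'n. 1 / wt k ^ (2 * CARD('n))) summable_on UNIV"
proof (rule nonneg_bdd_above_summable_on)
  let ?a = "\<lambda>j::int. 1 / (1 + \<bar>real_of_int j\<bar>)\<^sup>2"
  have "?a summable_on UNIV"
  proof -
    have s: "summable (\<lambda>n. 1 / (1 + real n)\<^sup>2)"
      using inverse_power_summable[of 2, where 'a=real] summable_Suc_iff[of "\<lambda>n. inverse ((real n)\<^sup>2)"]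
      by (simp add: inverse_eq_divide)
    hence "(\<lambda>n. 1 / (1 + real n)\<^sup>2) summable_on UNIV"
      by (subst summable_on_UNIV_nonneg_real_iff) auto
    hence 1: "?a summable_on (range int)"
      by (subst summable_on_reindex) (auto simp: o_def)
    have "(\<lambda>n. 1 / (1 + real n)\<^sup>2) summable_on UNIV"
      using s by (subst summable_on_UNIV_nonneg_real_iff) auto
    hence 2: "?a summable_on (range (\<lambda>n. - int n))"
      by (subst summable_on_reindex) (auto simp: o_def inj_on_def)
    have "j \<in> range int \<union> range (\<lambda>n. - int n)" for j by (cases j rule: int_cases2) auto
    hence "range int \<union> range (\<lambda>n. - int n) = UNIV" by blast
    thus ?thesis using summable_on_union[OF 1 2] by simp
  qed
  then obtain A where A: "\<And>J. finite J \<Longrightarrow> sum ?a J \<le> A"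
    using finite_sum_le_infsum[of ?a UNIV] by (metis UNIV_I subset_UNIV zero_le_divide_1_iff zero_le_power2)
  have A0: "A \<ge> 0" using A[of "{}"] by simp
  show "bdd_above (sum (\<lambda>k::int^'n. 1 / wt k ^ (2 * CARD('n))) ` {F. F \<subseteq> UNIV \<and> finite F})"
  proof (rule bdd_aboveI2)
    fix F :: "(int^'n) set" assume "F \<in> {F. F \<subseteq> UNIV \<and> finite F}"
    hence F: "finite F" by simp
    \<comment> \<open>All coordinates that occur in F, so that F lies in the box with sides
      J.\<close>
    define J where "J = (\<Union>i. (\<lambda>k. k $ i) ` F)"
    have J: "finite J" using F by (auto simp: J_def)
    have "sum (\<lambda>k. 1 / wt k ^ (2 * CARD('n))) F \<le> (\<Sum>k\<in>F. \<Prod>i\<in>UNIV. ?a (k $ i))"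
    proof (rule sum_mono)
      fix k assume "k \<in> F"
      have "(\<Prod>i\<in>(UNIV::'n set). (1 + \<bar>real_of_int (k $ i)\<bar>)\<^sup>2) \<le> (\<Prod>i\<in>(UNIV::'n set). (wt k)\<^sup>2)"
        by (intro prod_mono conjI power_mono lat_component_le_wt) auto
      also have "\<dots> = wt k ^ (2 * CARD('n))" by (simp add: power_mult)
      finally have "1 / wt k ^ (2 * CARD('n)) \<le> 1 / (\<Prod>i\<in>(UNIV::'n set). (1 + \<bar>real_of_int (k $ i)\<bar>)\<^sup>2)"
        by (intro divide_left_mono mult_pos_pos prod_pos) (auto simp: wt_pos add_pos_nonneg)
      thus "1 / wt k ^ (2 * CARD('n)) \<le> (\<Prod>i\<in>UNIV. ?a (k $ i))" by (simp add: prod_dividef)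
    qed
    also have "\<dots> = (\<Sum>g\<in>vec_nth ` F. \<Prod>i\<in>UNIV. ?a (g i))"
      by (subst sum.reindex) (auto simp: inj_on_def vec_nth_inject)
    also have "\<dots> \<le> (\<Sum>g\<in>PiE (UNIV::'n set) (\<lambda>_. J). \<Prod>i\<in>UNIV. ?a (g i))"
    proof (rule sum_mono2)
      show "finite (PiE (UNIV::'n set) (\<lambda>_. J))" using J by (intro finite_PiE) auto
      show "vec_nth ` F \<subseteq> PiE UNIV (\<lambda>_. J)" by (auto simp: J_def)
    qed (auto intro!: prod_nonneg)
    also have "\<dots> = (\<Prod>i\<in>(UNIV::'n set). \<Sum>j\<in>J. ?a j)" using J by (subst prod_sum_PiE) auto
    also have "\<dots> \<le> (\<Prod>i\<in>(UNIV::'n set). A)" using A[OF J] by (intro prod_mono conjI sum_nonneg) auto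
    finally show "sum (\<lambda>k. 1 / wt k ^ (2 * CARD('n))) F \<le> A ^ CARD('n)" by simp
  qed
qed (simp add: wt_pos less_imp_le)

lemma summable_decay:
  fixes c :: "int^'n \<Rightarrow> 'a::banach"
  assumes "\<And>k. norm (c k) * wt k ^ (2 * CARD('n)) \<le> C"
  shows "(\<lambda>k. norm (c k)) summable_on UNIV"
proof (rule summable_on_comparison_test)
  show "(\<lambda>k::int^'n. C * (1 / wt k ^ (2 * CARD('n)))) summable_on UNIV"
    by (intro summable_on_cmult_right summable_wt)
  show "norm (c k) \<le> C * (1 / wt k ^ (2 * CARD('n)))" for k
    using assms[of k] wt_pos[of k] by (simp add: field_simps)
qed auto

section \<open>Orthogonality of the exponentials on the cube\<close>

text \<open>Lebesgue measure is the image of a product measure indexed by \<open>Basis\<close>; what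
  has to be done is to relabel the basis vectors by the coordinates i.\<close>

lemma integral_prod_coords:
  fixes f :: "'n::finite \<Rightarrow> real \<Rightarrow> complex"
  assumes "\<And>i. integrable lborel (f i)"
  shows "(\<integral>x. (\<Prod>i\<in>UNIV. f i (x $ i)) \<partial>(lborel :: (real^'n) measure)) = (\<Prod>i\<in>UNIV. \<integral>t. f i t \<partial>lborel)"
proof -
  interpret product_sigma_finite "\<lambda>_::real^'n. lborel :: real measure" by standard
  have B: "Basis = range (\<lambda>i. axis i (1::real))" by (simp add: Basis_vec_def UNION_singleton_eq_range)
  have inj: "inj (\<lambda>i::'n. axis i (1::real))" by (simp add: inj_on_def axis_eq_axis)
  have r: "(\<Prod>b\<in>Basis. F b) = (\<Prod>i\<in>UNIV. F (axis i 1))" for F :: "real^'n \<Rightarrow> complex"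
    by (simp only: B prod.reindex[OF inj] o_def)
  define f' where "f' b = f (axis_index b)" for b :: "real^'n"
  have ai: "axis_index (axis i (1::real)) = i" for i :: 'n by (simp add: axis_index_axis)
  have fm: "f i \<in> borel_measurable borel" for i using assms[of i] by simp
  have comp: "(\<Sum>b\<in>Basis. g b *\<^sub>R b) $ i = g (axis i 1)" for g :: "real^'n \<Rightarrow> real" and i
    by (simp add: cart_eq_inner_axis inner_sum_left inner_Basis if_distrib cong: if_cong)
  have "(\<integral>x. (\<Prod>i\<in>UNIV. f i (x $ i)) \<partial>(lborel :: (real^'n) measure)) =
     (\<integral>g. (\<Prod>i\<in>UNIV. f i ((\<Sum>b\<in>Basis. g b *\<^sub>R b) $ i)) \<partial>(\<Pi>\<^sub>M b\<in>(Basis::(real^'n) set). lborel))"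
  proof (subst lborel_eq, rule integral_distr)
    show "(\<lambda>f. \<Sum>b\<in>Basis. f b *\<^sub>R b) \<in> (\<Pi>\<^sub>M b\<in>(Basis::(real^'n) set). lborel) \<rightarrow>\<^sub>M borel" by measurable
    have "(\<lambda>x::real^'n. f i (x $ i)) \<in> borel_measurable borel" for i
      by (rule measurable_compose[OF _ fm]) (simp add: borel_measurable_continuous_onI continuous_on_component)
    thus "(\<lambda>x::real^'n. \<Prod>i\<in>UNIV. f i (x $ i)) \<in> borel_measurable borel" by (intro borel_measurable_prod) auto
  qed
  also have "\<dots> = (\<integral>g. (\<Prod>b\<in>Basis. f' b (g b)) \<partial>(\<Pi>\<^sub>M b\<in>(Basis::(real^'n) set). lborel))"
    by (simp only: comp r f'_def ai)
  also have "\<dots> = (\<Prod>b\<in>Basis. \<integral>t. f' b t \<partial>lborel)"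
    by (rule product_integral_prod) (auto simp: f'_def assms)
  also have "\<dots> = (\<Prod>i\<in>UNIV. \<integral>t. f i t \<partial>lborel)"
    by (simp only: r f'_def ai)
  finally show ?thesis .
qed

definition cube :: "(real^'n) set" where "cube = cbox (\<chi> i. - pi) (\<chi> i. pi)"
definition ocube :: "(real^'n) set" where "ocube = box (\<chi> i. - pi) (\<chi> i. pi)"

lemma mem_cube: "x \<in> cube \<longleftrightarrow> (\<forall>i. - pi \<le> x $ i \<and> x $ i \<le> pi)"
  and mem_ocube: "x \<in> ocube \<longleftrightarrow> (\<forall>i. - pi < x $ i \<and> x $ i < pi)"
  by (simp_all add: cube_def ocube_def mem_box_cart)

lemma compact_cube [simp]: "compact cube" and open_ocube [simp]: "open ocube" and ocube_subset: "ocube \<subseteq> cube"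
  by (auto simp: cube_def ocube_def box_subset_cbox open_box)

lemma integral_cis: 
  "(\<integral>t. indicator {- pi..pi} t *\<^sub>R cis (real_of_int m * t) \<partial>lborel) = (if m = 0 then 2 * pi else 0)"
  and integrable_cis: "integrable lborel (\<lambda>t. indicator {- pi..pi} t *\<^sub>R cis (real_of_int m * t))"
proof -
  show "integrable lborel (\<lambda>t. indicator {- pi..pi} t *\<^sub>R cis (real_of_int m * t))"
    by (rule borel_integrable_compact) (auto intro!: continuous_intros)
  show "(\<integral>t. indicator {- pi..pi} t *\<^sub>R cis (real_of_int m * t) \<partial>lborel) = (if m = 0 then 2 * pi else 0)"
  proof (cases "m = 0")
    case True thus ?thesis by (simp add: scaleR_conv_of_real)
  next
    case False
    let ?F = "\<lambda>t. cis (real_of_int m * t) / (\<i> * of_int m)"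
    have "(?F has_vector_derivative cis (real_of_int m * t)) (at t within {- pi..pi})" for t
      using False unfolding has_vector_derivative_complex_iff
      by (auto intro!: derivative_eq_intros simp: Re_divide Im_divide power2_eq_square)
    hence "has_bochner_integral lborel (\<lambda>t. indicator {- pi..pi} t *\<^sub>R cis (real_of_int m * t)) (?F pi - ?F (- pi))"
      by (intro has_bochner_integral_FTC_Icc) (auto intro!: continuous_intros)
    moreover have "cis (real_of_int m * pi) = cis (real_of_int m * (- pi))"
    proof -
      have "cis (real_of_int m * pi) = cis (real_of_int m * (- pi)) * cis (2 * pi * of_int m)"
        by (simp add: cis_mult algebra_simps)
      thus ?thesis by simp
    qed
    ultimately show ?thesis using False by (simp add: has_bochner_integral_integral_eq)
  qed
qed

lemma integral_ek_cube:
  "(\<integral>x. indicator cube x *\<^sub>R ek k x \<partial>lborel) = (if k = 0 then (2 * pi) ^ CARD('n) else 0)" for k :: "int^'n"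
proof -
  have "indicator cube x *\<^sub>R ek k x = (\<Prod>i\<in>UNIV. indicator {- pi..pi} (x $ i) *\<^sub>R cis (real_of_int (k $ i) * x $ i))" for x
  proof -
    have "ek k x = (\<Prod>i\<in>UNIV. cis (real_of_int (k $ i) * x $ i))"
      by (simp add: ek_def inner_vec_def cis_conv_exp sum_distrib_left exp_sum)
    thus ?thesis
      by (cases "x \<in> cube") (auto simp: indicator_def mem_cube intro!: prod.cong)
  qed
  hence "(\<integral>x. indicator cube x *\<^sub>R ek k x \<partial>lborel) = (\<Prod>i\<in>UNIV. complex_of_real (if k $ i = 0 then 2 * pi else 0))"
    using integral_prod_coords[where f="\<lambda>i t. indicator {- pi..pi} t *\<^sub>R cis (real_of_int (k $ i) * t)", OF integrable_cis]
    unfolding integral_cis by simp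
  also have "\<dots> = (if k = 0 then (2 * pi) ^ CARD('n) else 0)"
    by (auto simp: vec_eq_iff)
  finally show ?thesis by simp
qed

section \<open>Fourier coefficients of test functions\<close>

text \<open>The integral extends over the whole space. For a function supported in the cube this is
  the usual periodic Fourier coefficient, and derivatives can be moved without boundary
  terms.\<close>

definition fcoef :: "(real^'n \<Rightarrow> complex) \<Rightarrow> int^'n \<Rightarrow> complex" where
  "fcoef f k = (\<integral>x. ek (- k) x * f x \<partial>lborel) / (2 * pi) ^ CARD('n)"

lemma fcoef_deriv:
  assumes "test_fun W f" "open W"
  shows "fcoef (\<lambda>x. frechet_derivative f (at x) v) k = \<i> * of_real (lat k \<bullet> v) * fcoef f k"
proof -
  have "(\<integral>x. frechet_derivative (ek (- k)) (at x) v * f x \<partial>lborel) = - (\<integral>x. ek (- k) x * frechet_derivative f (at x) v \<partial>lborel)"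
    by (rule integral_by_parts[OF bounded_bilinear_mult assms(2)])
      (use assms in \<open>auto intro!: C_k_on_ek C_k_on_subset[OF test_fun_smooth] simp del: C_k_on.simps simp: test_fun_def\<close>)
  hence "(\<integral>x. ek (- k) x * frechet_derivative f (at x) v \<partial>lborel) = \<i> * of_real (lat k \<bullet> v) * (\<integral>x. ek (- k) x * f x \<partial>lborel)"
    by (simp add: frechet_derivative_ek mult.assoc)
  thus ?thesis by (simp add: fcoef_def)
qed

lemma norm_fcoef_le:
  fixes f :: "real^'n \<Rightarrow> complex"
  assumes "continuous_on UNIV f" "compact K" "\<And>x. x \<notin> K \<Longrightarrow> f x = 0" "\<And>x. norm (f x) \<le> B"
  shows "norm (fcoef f k) \<le> measure lborel K * B"
proof -
  have B: "B \<ge> 0" using assms(4)[of 0] norm_ge_zero order_trans by blast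
  have int: "integrable lborel (\<lambda>x. ek (- k) x * f x)"
    by (rule integrable_supported[of UNIV])
      (use assms in \<open>auto intro!: continuous_on_mult continuous_on_ek simp: supported_in_def\<close>)
  have "norm (\<integral>x. ek (- k) x * f x \<partial>lborel) \<le> (\<integral>x. norm (ek (- k) x * f x) \<partial>lborel)"
    by (rule integral_norm_bound)
  also have "\<dots> \<le> (\<integral>x. indicator K x *\<^sub>R B \<partial>lborel)"
  proof (rule integral_mono)
    show "integrable lborel (\<lambda>x. indicat_real K x *\<^sub>R B)" by (rule borel_integrable_compact) (use assms in auto)
    show "norm (ek (- k) x * f x) \<le> indicator K x *\<^sub>R B" for x
      using assms(3,4)[of x] by (auto simp: norm_mult indicator_def)
  qed (use int in auto)
  also have "\<dots> = measure lborel K * B" using assms(2) by (simp add: compact_imp_closed mult.commute)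
  finally have 1: "norm (\<integral>x. ek (- k) x * f x \<partial>lborel) \<le> measure lborel K * B" .
  have "1 \<le> (2 * pi) ^ CARD('n)" using pi_gt3 by (intro one_le_power) simp
  hence "norm (\<integral>x. ek (- k) x * f x \<partial>lborel) / (2 * pi) ^ CARD('n) \<le> norm (\<integral>x. ek (- k) x * f x \<partial>lborel) / 1"
    by (intro divide_left_mono) auto
  hence "norm (fcoef f k) \<le> norm (\<integral>x. ek (- k) x * f x \<partial>lborel)"
    by (simp add: fcoef_def norm_divide norm_power norm_mult)
  with 1 show ?thesis by linarith
qed

text \<open>Each partial derivative in direction i multiplies the coefficient by
  \<open>k $ i\<close> up to a unit, and is again a test function.\<close>

lemma fcoef_component_decay:
  fixes f :: "real^'n \<Rightarrow> complex"
  assumes "test_fun W f" "open W"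
  shows "\<exists>C. \<forall>k. norm (fcoef f k) * \<bar>real_of_int (k $ i)\<bar> ^ N \<le> C"
  using assms(1)
proof (induction N arbitrary: f)
  case 0
  obtain K where K: "compact K" "\<And>x. x \<notin> K \<Longrightarrow> f x = 0"
    using 0 by (auto simp: test_fun_def supported_in_def)
  have c: "continuous_on UNIV f" using test_fun_continuous[OF 0] .
  obtain B where "\<And>x. norm (f x) \<le> B"
    using bounded_supported[OF c, of thesis] K by (auto simp: supported_in_def)
  from norm_fcoef_le[OF c K this] show ?case by auto
next
  case (Suc N)
  obtain C where C: "\<And>k. norm (fcoef (\<lambda>x. frechet_derivative f (at x) (axis i 1)) k) * \<bar>real_of_int (k $ i)\<bar> ^ N \<le> C"
    using Suc.IH[OF test_fun_deriv[OF Suc.prems]] by blast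
  have "norm (fcoef f k) * \<bar>real_of_int (k $ i)\<bar> ^ Suc N \<le> C" for k
    using C[of k] by (simp add: fcoef_deriv[OF Suc.prems assms(2)] inner_axis norm_mult mult_ac)
  thus ?case by blast
qed

lemma fcoef_decay:
  fixes f :: "real^'n \<Rightarrow> complex"
  assumes "test_fun W f" "open W"
  shows "\<exists>C. \<forall>k. norm (fcoef f k) * wt k ^ N \<le> C"
proof -
  have "\<forall>i. \<exists>C. \<forall>k. norm (fcoef f k) * \<bar>real_of_int (k $ i)\<bar> ^ N \<le> C"
    using fcoef_component_decay[OF assms] by blast
  then obtain C where C: "\<And>i k. norm (fcoef f k) * \<bar>real_of_int (k $ i)\<bar> ^ N \<le> C i" by metis
  obtain C0 where C0: "\<And>k. norm (fcoef f k) \<le> C0" using fcoef_component_decay[OF assms, where N=0] by auto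
  let ?c = "(1 + real CARD('n)) ^ N"
  have "norm (fcoef f k) * wt k ^ N \<le> ?c * (C0 + (\<Sum>i\<in>UNIV. C i))" for k
  proof -
    have "norm (fcoef f k) * wt k ^ N \<le> norm (fcoef f k) * (?c * (1 + (\<Sum>i\<in>UNIV. \<bar>real_of_int (k $ i)\<bar> ^ N)))"
      by (rule mult_left_mono[OF wt_power_le]) simp
    also have "\<dots> = ?c * (norm (fcoef f k) + (\<Sum>i\<in>UNIV. norm (fcoef f k) * \<bar>real_of_int (k $ i)\<bar> ^ N))"
      by (simp add: algebra_simps sum_distrib_left)
    also have "\<dots> \<le> ?c * (C0 + (\<Sum>i\<in>UNIV. C i))"
      by (intro mult_left_mono add_mono C0 sum_mono C) auto
    finally show ?thesis .
  qed
  thus ?thesis by blast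
qed

lemma fcoef_summable:
  fixes f :: "real^'n \<Rightarrow> complex"
  assumes "test_fun W f" "open W"
  shows "(\<lambda>k. norm (fcoef f k)) summable_on UNIV"
  using fcoef_decay[OF assms] summable_decay by blast

section \<open>Absolutely convergent trigonometric series\<close>

definition trig :: "(int^'n \<Rightarrow> complex) \<Rightarrow> real^'n \<Rightarrow> complex" where
  "trig c x = (\<Sum>\<^sub>\<infinity>k. c k * ek k x)"

lemma trig_uniform_limit:
  assumes "(\<lambda>k. norm (c k)) summable_on UNIV"
  shows "uniform_limit Y (\<lambda>S x. \<Sum>k\<in>S. c k * ek k x) (trig c) (finite_subsets_at_top UNIV)"
  unfolding trig_def[abs_def]
  by (rule Weierstrass_m_test_general[OF _ assms]) (simp add: norm_mult)

lemma trig_has_sum: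
  assumes "(\<lambda>k. norm (c k)) summable_on UNIV"
  shows "((\<lambda>k. c k * ek k x) has_sum trig c x) UNIV"
  unfolding trig_def
  by (rule has_sum_infsum, rule abs_summable_summable) (use assms in \<open>simp add: norm_mult\<close>)

lemma continuous_on_trig:
  assumes "(\<lambda>k. norm (c k)) summable_on UNIV"
  shows "continuous_on Y (trig c)"
  by (rule uniform_limit_theorem[OF _ trig_uniform_limit[OF assms]])
    (auto intro!: always_eventually continuous_intros continuous_on_ek)

text \<open>Uniform convergence of the partial sums allows termwise integration against any
  integrable f; the \<open>M + 1\<close> in the proof avoids dividing by a vanishing L^1
  norm.\<close>

lemma trig_integral:
  fixes c :: "int^'n \<Rightarrow> complex" and f :: "real^'n \<Rightarrow> complex"
  assumes c: "(\<lambda>k. norm (c k)) summable_on UNIV" and f: "integrable lborel f"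
  shows "((\<lambda>k. c k * (\<integral>x. ek k x * f x \<partial>lborel)) has_sum (\<integral>x. trig c x * f x \<partial>lborel)) UNIV"
proof -
  have fm: "f \<in> borel_measurable borel" using f by simp
  have bdd: "integrable lborel (\<lambda>x. h x * f x)"
    if "continuous_on UNIV h" "\<And>x. norm (h x) \<le> B" for h :: "real^'n \<Rightarrow> complex" and B
  proof (rule Bochner_Integration.integrable_bound[OF integrable_norm[where f="\<lambda>x. of_real B * f x"]])
    show "integrable lborel (\<lambda>x. of_real B * f x)" using f by simp
    show "(\<lambda>x. h x * f x) \<in> borel_measurable lborel"
      using borel_measurable_continuous_onI[OF that(1)] fm by simp
    have "norm (h x * f x) \<le> norm (norm (of_real B * f x))" for x
      using that(2)[of x] by (simp add: norm_mult mult_right_mono)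
    thus "AE x in lborel. norm (h x * f x) \<le> norm (norm (of_real B * f x))" by simp
  qed
  have ie: "integrable lborel (\<lambda>x. ek k x * f x)" for k by (rule bdd[of _ 1]) (auto intro: continuous_on_ek)
  have tb: "norm (trig c x) \<le> (\<Sum>\<^sub>\<infinity>k. norm (c k))" for x
  proof -
    have "norm (\<Sum>\<^sub>\<infinity>k. c k * ek k x) \<le> (\<Sum>\<^sub>\<infinity>k. norm (c k * ek k x))"
      by (rule norm_infsum_bound) (use c in \<open>simp add: norm_mult\<close>)
    thus ?thesis by (simp add: trig_def norm_mult)
  qed
  have it: "integrable lborel (\<lambda>x. trig c x * f x)" by (rule bdd[OF continuous_on_trig[OF c] tb])
  let ?F = "finite_subsets_at_top (UNIV :: (int^'n) set)"
  define M where "M = (\<integral>x. norm (f x) \<partial>lborel)"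
  have M: "M \<ge> 0" by (simp add: M_def)
  show ?thesis unfolding has_sum_def
  proof (rule tendstoI)
    fix e :: real assume e: "e > 0"
    have "\<forall>\<^sub>F S in ?F. \<forall>x\<in>UNIV. dist (\<Sum>k\<in>S. c k * ek k x) (trig c x) < e / (M + 1)"
      using trig_uniform_limit[OF c, of UNIV] e M unfolding uniform_limit_iff
      by (meson add_nonneg_pos divide_pos_pos zero_less_one)
    thus "\<forall>\<^sub>F S in ?F. dist (\<Sum>k\<in>S. c k * (\<integral>x. ek k x * f x \<partial>lborel)) (\<integral>x. trig c x * f x \<partial>lborel) < e"
    proof (rule eventually_mono)
      fix S assume S: "\<forall>x\<in>UNIV. dist (\<Sum>k\<in>S. c k * ek k x) (trig c x) < e / (M + 1)"
      have iS: "integrable lborel (\<lambda>x. \<Sum>k\<in>S. c k * (ek k x * f x))"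
        using ie by (intro Bochner_Integration.integrable_sum integrable_mult_right) auto
      have "(\<Sum>k\<in>S. c k * (\<integral>x. ek k x * f x \<partial>lborel)) - (\<integral>x. trig c x * f x \<partial>lborel)
          = (\<integral>x. (\<Sum>k\<in>S. c k * (ek k x * f x)) - trig c x * f x \<partial>lborel)"
        using it iS ie by simp
      also have "norm \<dots> \<le> (\<integral>x. norm ((\<Sum>k\<in>S. c k * (ek k x * f x)) - trig c x * f x) \<partial>lborel)"
        by (rule integral_norm_bound)
      also have "\<dots> \<le> (\<integral>x. e / (M + 1) * norm (f x) \<partial>lborel)"
      proof (rule integral_mono)
        fix x
        have "(\<Sum>k\<in>S. c k * (ek k x * f x)) - trig c x * f x = ((\<Sum>k\<in>S. c k * ek k x) - trig c x) * f x"
          by (simp add: sum_distrib_right left_diff_distrib mult.assoc)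
        thus "norm ((\<Sum>k\<in>S. c k * (ek k x * f x)) - trig c x * f x) \<le> e / (M + 1) * norm (f x)"
          using S[rule_format, of x] less_imp_le by (simp only: norm_mult dist_norm) (intro mult_right_mono; simp)
      qed (use it iS f in auto)
      also have "\<dots> = e * (M / (M + 1))" by (simp add: M_def)
      also have "\<dots> < e" using e M by (simp add: field_simps)
      finally show "dist (\<Sum>k\<in>S. c k * (\<integral>x. ek k x * f x \<partial>lborel)) (\<integral>x. trig c x * f x \<partial>lborel) < e"
        by (simp add: dist_norm)
    qed
  qed
qed

text \<open>The powers of the trigonometric polynomial \<open>\<Prod>\<^sub>i (1 + cos (x\<^sub>i - y\<^sub>i)) / 2\<close> concentrate at \<open>y\<close>, so a
  nonzero value of \<open>g\<close> at \<open>y\<close> contradicts orthogonality to all of them.\<close>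

lemma cube_orthogonal_zero:
  fixes g :: "real^'n \<Rightarrow> complex"
  assumes g: "continuous_on cube g" and orth: "\<And>l. (\<integral>x. indicator cube x *\<^sub>R (ek l x * g x) \<partial>lborel) = 0"
    and y: "y \<in> ocube"
  shows "g y = 0"
proof (rule ccontr)
  assume gy: "g y \<noteq> 0"
  define I where "I h = (\<integral>x. indicator cube x *\<^sub>R h x \<partial>lborel)" for h :: "real^'n \<Rightarrow> complex"
  define A where "A h \<longleftrightarrow> continuous_on cube h \<and> (\<forall>l. I (\<lambda>x. ek l x * h x) = 0)" for h
  \<comment> \<open>A factor with values in [0, 1] that equals 1 where the i-th coordinates agree
    modulo 2 pi.\<close>
  define q1 where "q1 i x = (1 + cos (x $ i - y $ i)) / 2" for i :: 'n and x
  define q where "q x = (\<Prod>i\<in>UNIV. q1 i x)" for x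
  have int: "integrable lborel (\<lambda>x. indicator cube x *\<^sub>R h x)" if "continuous_on cube h" for h :: "real^'n \<Rightarrow> complex"
    by (rule borel_integrable_compact[OF compact_cube that])
  have lin: "(\<integral>x. a * u x + b * v x + c * w x \<partial>lborel) = a * (\<integral>x. u x \<partial>lborel) + b * (\<integral>x. v x \<partial>lborel) + c * (\<integral>x. w x \<partial>lborel)"
    if "integrable lborel u" "integrable lborel v" "integrable lborel w" for a b c and u v w :: "real^'n \<Rightarrow> complex"
    using that by simp
  have cq1: "continuous_on X (q1 i)" for X i unfolding q1_def by (intro continuous_intros) auto
  have cq: "continuous_on X q" for X unfolding q_def by (intro continuous_intros cq1)
  \<comment> \<open>By Euler's formula the factor has only the frequencies 0 and plus or minus the
    i-th unit vector, so multiplication by it merely shifts l and preserves orthogonality to all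
    exponentials.\<close>
  have Aq1: "A (\<lambda>x. of_real (q1 i x) * h x)" if "A h" for h i
  proof -
    have ch: "continuous_on cube h" using that by (simp add: A_def)
    have I0: "I (\<lambda>x. ek l x * h x) = 0" for l using that by (simp add: A_def)
    let ?a = "axis i (1::int)"
    have la: "lat ?a = axis i 1" by (simp add: vec_eq_iff axis_def)
    have e: "complex_of_real (q1 i x) = 1/2 + cis (- (y $ i)) / 4 * ek ?a x + cis (y $ i) / 4 * ek (- ?a) x" for x
      by (simp add: q1_def ek_def la inner_axis' cis_mult complex_eq_iff cos_diff sin_diff field_simps)
    have "I (\<lambda>x. ek l x * (of_real (q1 i x) * h x)) = 0" for l
    proof -
      have "(\<lambda>x. indicator cube x *\<^sub>R (ek l x * (of_real (q1 i x) * h x))) = 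
        (\<lambda>x. 1/2 * (indicator cube x *\<^sub>R (ek l x * h x)) + cis (- (y $ i)) / 4 * (indicator cube x *\<^sub>R (ek (l + ?a) x * h x))
           + cis (y $ i) / 4 * (indicator cube x *\<^sub>R (ek (l + - ?a) x * h x)))"
        unfolding e ek_add by (simp add: fun_eq_iff algebra_simps)
      moreover have "integrable lborel (\<lambda>x. indicator cube x *\<^sub>R (ek m x * h x))" for m
        by (intro int continuous_on_mult continuous_on_ek ch)
      ultimately have "I (\<lambda>x. ek l x * (of_real (q1 i x) * h x)) = 
        1/2 * I (\<lambda>x. ek l x * h x) + cis (- (y $ i)) / 4 * I (\<lambda>x. ek (l + ?a) x * h x) + cis (y $ i) / 4 * I (\<lambda>x. ek (l + - ?a) x * h x)"
        unfolding I_def by (simp only: lin)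
      thus ?thesis by (simp only: I0) simp
    qed
    thus ?thesis unfolding A_def by (auto intro!: continuous_intros ch cq1)
  qed
  have Aprod: "A (\<lambda>x. of_real (\<Prod>i\<in>J. q1 i x) * h x)" if "finite J" "A h" for J h
    using that
  proof (induction J)
    case (insert j J)
    have "(\<lambda>x. of_real (\<Prod>i\<in>insert j J. q1 i x) * h x) = (\<lambda>x. of_real (q1 j x) * (of_real (\<Prod>i\<in>J. q1 i x) * h x))"
      using insert by (simp add: mult.assoc)
    thus ?case using Aq1[OF insert.IH[OF insert.prems], of j] by simp
  qed simp
  have Ag: "A g" using g orth by (simp add: A_def I_def)
  have AN: "A (\<lambda>x. of_real (q x ^ N) * g x)" for N
  proof (induction N)
    case (Suc N)
    have "(\<lambda>x. of_real (q x ^ Suc N) * g x) = (\<lambda>x. of_real (q x) * (of_real (q x ^ N) * g x))" by (simp add: mult.assoc)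
    thus ?case using Aprod[OF _ Suc, of UNIV] by (simp add: q_def)
  qed (simp add: Ag)
  \<comment> \<open>The conjugate of \<open>g y\<close> makes the value at y equal to |g y|^2 > 0
    and reduces everything to real integrals.\<close>
  define h where "h x = Re (cnj (g y) * g x)" for x
  have ch: "continuous_on cube h" unfolding h_def by (intro continuous_intros g)
  have hy: "h y > 0" using gy by (auto simp: h_def complex_eq_iff sum_squares_gt_zero_iff)
  have z: "(\<integral>x. indicator cube x * (q x ^ N * h x) \<partial>lborel) = 0" for N
  proof -
    have i: "integrable lborel (\<lambda>x. indicator cube x *\<^sub>R (of_real (q x ^ N) * g x))"
      by (intro int continuous_intros g cq)
    have "0 = Re (cnj (g y) * I (\<lambda>x. of_real (q x ^ N) * g x))"
      using AN[of N] unfolding A_def by (auto dest!: spec[of _ 0])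
    also have "\<dots> = (\<integral>x. Re (cnj (g y) * (indicator cube x *\<^sub>R (of_real (q x ^ N) * g x))) \<partial>lborel)"
      unfolding I_def by (subst integral_Re[OF integrable_mult_right[OF i]]) (simp only: integral_mult_right_zero)
    also have "\<dots> = (\<integral>x. indicator cube x * (q x ^ N * h x) \<partial>lborel)"
      by (rule Bochner_Integration.integral_cong) (auto simp: h_def indicator_def algebra_simps)
    finally show ?thesis by simp
  qed
  define c where "c = h y / 2"
  have c: "c > 0" "h y > c" using hy by (auto simp: c_def)
  define U where "U = {x\<in>ocube. h x > c}"
  have oU: "open U" unfolding U_def
    using continuous_open_preimage[OF continuous_on_subset[OF ch ocube_subset] open_ocube, of "{c<..}"]
    by (simp add: vimage_def Int_def)
  have yU: "y \<in> U" using y c by (simp add: U_def)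
  have q10: "0 \<le> q1 j x" "q1 j x \<le> 1" for j x
    using cos_ge_minus_one[of "x $ j - y $ j"] cos_le_one[of "x $ j - y $ j"] unfolding q1_def by (simp_all only: field_simps)
  have q01: "0 \<le> q x" "q x \<le> 1" for x
    unfolding q_def using q10 by (auto intro!: prod_nonneg prod_le_1)
  \<comment> \<open>Here y must lie in the open cube: then |x_i - y_i| < 2 pi, and the cosine is 1
    only for x_i = y_i. For y on a face the opposite face would also carry a maximum.\<close>
  have qlt: "q x < 1" if "x \<in> cube" "x \<noteq> y" for x
  proof -
    obtain i where i: "x $ i \<noteq> y $ i" using \<open>x \<noteq> y\<close> by (auto simp: vec_eq_iff)
    have b: "\<bar>x $ i - y $ i\<bar> < 2 * pi" using that(1) y unfolding mem_cube mem_ocube by (smt (verit))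
    have "cos (x $ i - y $ i) \<noteq> 1"
    proof
      assume "cos (x $ i - y $ i) = 1"
      then obtain n :: int where n: "x $ i - y $ i = of_int n * 2 * pi" using cos_one_2pi_int by auto
      have "\<bar>of_int n :: real\<bar> < 1" using b unfolding n by (simp add: abs_mult)
      hence "n = 0" by linarith
      thus False using n i by simp
    qed
    hence "cos (x $ i - y $ i) < 1" using cos_le_one[of "x $ i - y $ i"] by linarith
    hence lt: "q1 i x < 1" by (simp add: q1_def)
    have "q x = q1 i x * (\<Prod>j\<in>UNIV - {i}. q1 j x)" unfolding q_def by (simp add: prod.remove)
    also have "\<dots> \<le> q1 i x" using q10 by (intro mult_right_le_one_le prod_nonneg prod_le_1) auto
    finally show ?thesis using lt by simp
  qed
  have qy: "q y = 1" by (simp add: q_def q1_def)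
  obtain r1 where r1: "0 \<le> r1" "r1 < 1" "\<And>x. x \<in> cube - U \<Longrightarrow> q x \<le> r1"
  proof (cases "cube - U = {}")
    case True thus ?thesis using that[of 0] by auto
  next
    case False
    have "compact (cube - U)" using oU by (intro compact_diff) auto
    then obtain x0 where "x0 \<in> cube - U" "\<And>x. x \<in> cube - U \<Longrightarrow> q x \<le> q x0"
      using continuous_attains_sup[OF _ False cq] by blast
    thus ?thesis using that[of "q x0"] q01 qlt[of x0] yU by blast
  qed
  \<comment> \<open>Strictly between the maximum r1 of q off U and the value 1 of q at y; the N-th
    powers are to be compared through (r1/r2)^N.\<close>
  define r2 where "r2 = (1 + r1) / 2"
  have r2: "r1 < r2" "r2 < 1" "0 < r2" using r1 by (auto simp: r2_def)
  define V where "V = {x\<in>U. q x > r2}"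
  have oV: "open V" unfolding V_def
    using continuous_open_preimage[OF cq oU, of "{r2<..}"] by (simp add: vimage_def Int_def)
  have yV: "y \<in> V" using yU qy r2 by (simp add: V_def)
  have Vc: "V \<subseteq> cube" using ocube_subset by (auto simp: V_def U_def)
  have fin: "emeasure lborel V < \<infinity>"
    using emeasure_mono[OF Vc] emeasure_bounded_finite[OF compact_imp_bounded[OF compact_cube]] le_less_trans by (metis (no_types) borel_closed compact_cube compact_imp_closed sets_lborel)
  have mV: "measure lborel V > 0"
  proof -
    have "V \<notin> null_sets lborel"
      using open_not_negligible[OF oV] yV negligible_iff_null_sets null_sets_completionI by blast
    hence "emeasure lborel V \<noteq> 0" using oV by (auto simp: null_sets_def)
    thus ?thesis using fin by (simp add: measure_def enn2real_positive_iff zero_less_iff_neq_zero)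
  qed
  obtain M where M: "M > 0" "\<And>x. x \<in> cube \<Longrightarrow> \<bar>h x\<bar> \<le> M"
    using compact_imp_bounded[OF compact_continuous_image[OF ch compact_cube]] by (auto simp: bounded_pos)
  \<comment> \<open>On V the integrand is at least c r2^N, on the rest of U it is nonnegative, and
    off U it is at least -M r1^N. Since the total is 0, the first contribution is bounded by the
    last.\<close>
  have key: "c * r2 ^ N * measure lborel V \<le> M * r1 ^ N * measure lborel (cube :: (real^'n) set)" for N
  proof -
    let ?L = "\<lambda>x. indicator V x * (c * r2 ^ N) - indicator cube x * (M * r1 ^ N)"
    have iV: "integrable lborel (indicat_real V)" using fin oV by (simp add: integrable_real_indicator)
    have iC: "integrable lborel (indicat_real (cube :: (real^'n) set))"
      using borel_integrable_compact[OF compact_cube, of "\<lambda>_. 1::real"] by simp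
    have "(\<integral>x. ?L x \<partial>lborel) \<le> (\<integral>x. indicator cube x * (q x ^ N * h x) \<partial>lborel)"
    proof (rule integral_mono)
      show "integrable lborel (\<lambda>x. indicator cube x * (q x ^ N * h x))"
        using borel_integrable_compact[OF compact_cube continuous_on_mult[OF continuous_on_power[OF cq] ch]] by simp
      show "integrable lborel ?L" using iV iC by simp
      fix x
      consider "x \<in> V" | "x \<in> U - V" | "x \<in> cube - U" | "x \<notin> cube" using ocube_subset by (auto simp: U_def)
      thus "?L x \<le> indicator cube x * (q x ^ N * h x)"
      proof cases
        case 1
        have "c * r2 ^ N \<le> q x ^ N * h x"
          using 1 c r2 unfolding V_def U_def by (subst mult.commute) (intro mult_mono power_mono; auto)
        moreover have "M * r1 ^ N \<ge> 0" using M r1 by simp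
        ultimately show ?thesis using 1 Vc by (auto simp: indicator_def)
      next
        case 2
        have "0 \<le> q x ^ N * h x" using 2 c q01[of x] unfolding U_def by (intro mult_nonneg_nonneg) auto
        moreover have "M * r1 ^ N \<ge> 0" using M r1 by simp
        ultimately show ?thesis using 2 by (auto simp: indicator_def)
      next
        case 3
        have "\<bar>q x ^ N * h x\<bar> \<le> r1 ^ N * M" 
          unfolding abs_mult using 3 r1(1,3) M q01 by (intro mult_mono) (auto intro: power_mono)
        thus ?thesis using 3 by (auto simp: indicator_def V_def mult.commute)
      next
        case 4
        thus ?thesis using Vc by (auto simp: indicator_def)
      qed
    qed
    also have "\<dots> = 0" by (rule z)
    finally show ?thesis using iV iC by (simp add: mult.commute)
  qed
  have "(\<lambda>N. (r1 / r2) ^ N * (M * measure lborel (cube :: (real^'n) set))) \<longlonglongrightarrow> 0 * (M * measure lborel (cube :: (real^'n) set))"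
    by (intro tendsto_mult tendsto_const LIMSEQ_power_zero) (use r1 r2 in auto)
  moreover have "c * measure lborel V \<le> (r1 / r2) ^ N * (M * measure lborel (cube :: (real^'n) set))" for N
    using key[of N] r2 by (simp add: power_divide field_simps)
  ultimately have "c * measure lborel V \<le> 0 * (M * measure lborel (cube :: (real^'n) set))"
    using LIMSEQ_le_const by blast
  thus False using c mV by (simp add: mult_le_0_iff)
qed

section \<open>Fourier inversion\<close>

lemma integral_cube_supported:
  assumes "supported_in ocube f"
  shows "(\<integral>x. indicator cube x *\<^sub>R f x \<partial>lborel) = (\<integral>x. f x \<partial>lborel)"
  using assms ocube_subset unfolding supported_in_def
  by (intro Bochner_Integration.integral_cong) (auto simp: indicator_def)

text \<open>Orthogonality of the exponentials shows that the series and f have the same integrals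
  over the cube against every \<open>ek l\<close>, so their difference vanishes on the open
  cube.\<close>

lemma fourier_inversion:
  fixes f :: "real^'n \<Rightarrow> complex"
  assumes f: "test_fun ocube f" and x: "x \<in> ocube"
  shows "trig (fcoef f) x = f x"
proof -
  have sum: "(\<lambda>k. norm (fcoef f k)) summable_on UNIV" by (rule fcoef_summable[OF f]) simp
  have int: "integrable lborel (\<lambda>x. indicator cube x *\<^sub>R h x)" if "continuous_on cube h" for h :: "real^'n \<Rightarrow> complex"
    by (rule borel_integrable_compact[OF compact_cube that])
  have "trig (fcoef f) x - f x = 0"
  proof (rule cube_orthogonal_zero[OF _ _ x])
    show "continuous_on cube (\<lambda>x. trig (fcoef f) x - f x)"
      by (intro continuous_intros continuous_on_trig[OF sum] test_fun_continuous[OF f])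
    fix l
    have fs: "supported_in ocube (\<lambda>x. ek l x * f x)"
      using f by (intro supported_in_bilinear[OF bounded_bilinear_mult]) (simp add: test_fun_def)
    have i1: "integrable lborel (\<lambda>x. indicator cube x *\<^sub>R (ek l x * trig (fcoef f) x))"
      by (intro int continuous_intros continuous_on_ek continuous_on_trig[OF sum])
    have i2: "integrable lborel (\<lambda>x. indicator cube x *\<^sub>R (ek l x * f x))"
      by (intro int continuous_intros continuous_on_ek test_fun_continuous[OF f])
    have "integrable lborel (\<lambda>x. indicator cube x *\<^sub>R ek l x)" by (intro int continuous_on_ek)
    from trig_integral[OF sum this]
    have "((\<lambda>k. fcoef f k * (\<integral>x. indicator cube x *\<^sub>R ek (k + l) x \<partial>lborel)) has_sum 
      (\<integral>x. indicator cube x *\<^sub>R (ek l x * trig (fcoef f) x) \<partial>lborel)) UNIV"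
      by (simp add: ek_add mult_ac)
    moreover have "fcoef f k * (\<integral>x. indicator cube x *\<^sub>R ek (k + l) x \<partial>lborel) 
      = (if k = - l then fcoef f (- l) * (2 * pi) ^ CARD('n) else 0)" for k
      by (simp add: integral_ek_cube add_eq_0_iff2)
    ultimately have "((\<lambda>k. if k = - l then fcoef f (- l) * (2 * pi) ^ CARD('n) else 0) has_sum 
      (\<integral>x. indicator cube x *\<^sub>R (ek l x * trig (fcoef f) x) \<partial>lborel)) UNIV" by simp
    moreover have "((\<lambda>k. if k = - l then fcoef f (- l) * (2 * pi) ^ CARD('n) else 0) has_sum (fcoef f (- l) * (2 * pi) ^ CARD('n))) UNIV"
      by (rule has_sum_finite_neutralI[of "{- l}"]) auto
    ultimately have "(\<integral>x. indicator cube x *\<^sub>R (ek l x * trig (fcoef f) x) \<partial>lborel) = fcoef f (- l) * (2 * pi) ^ CARD('n)"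
      using has_sum_unique by blast
    also have "\<dots> = (\<integral>x. indicator cube x *\<^sub>R (ek l x * f x) \<partial>lborel)"
      by (simp add: integral_cube_supported[OF fs] fcoef_def)
    finally show "(\<integral>x. indicator cube x *\<^sub>R (ek l x * (trig (fcoef f) x - f x)) \<partial>lborel) = 0"
      using i1 i2 by (simp add: right_diff_distrib scaleR_diff_right)
  qed
  thus ?thesis by simp
qed

section \<open>Termwise differentiation\<close>

lemma infinite_lattice: "infinite (UNIV :: (int^'n) set)"
proof
  assume "finite (UNIV :: (int^'n) set)"
  hence "finite (range (\<lambda>m::int. (\<chi> i. m) :: int^'n))" by (rule finite_subset[rotated]) simp
  hence "finite (UNIV :: int set)" by (rule finite_imageD) (simp add: inj_on_def vec_eq_iff)
  thus False by simp
qed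

text \<open>Expresses the remainder after a finite partial sum as an unconditional sum over the full
  index set, which can then be compared with the corresponding remainder of a majorant.\<close>

lemma has_sum_drop_finite:
  fixes f :: "'a \<Rightarrow> 'b::real_normed_vector"
  assumes "(f has_sum a) UNIV" "finite S"
  shows "((\<lambda>k. f k - (if k \<in> S then f k else 0)) has_sum (a - sum f S)) UNIV"
proof -
  have "((\<lambda>k. if k \<in> S then f k else 0) has_sum sum f S) UNIV"
    using assms(2) by (intro has_sum_finite_neutralI[of S]) auto
  hence "((\<lambda>k. - (if k \<in> S then f k else 0)) has_sum (- sum f S)) UNIV"
    by (subst has_sum_uminus) simp
  from has_sum_add[OF assms(1) this] show ?thesis by simp
qed

text \<open>Differentiation of series is available for sequences, so the lattice is enumerated by a
  bijection e. One factor \<open>wt\<close> pays for the derivative, and the remainders are bounded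
  uniformly in x by those of the sum of M.\<close>

lemma trig_has_derivative:
  fixes c :: "int^'n \<Rightarrow> complex"
  assumes c: "(\<lambda>k. norm (c k) * wt k) summable_on UNIV"
  shows "(trig c has_derivative (\<lambda>v. trig (\<lambda>k. c k * (\<i> * of_real (lat k \<bullet> v))) x)) (at x)"
proof -
  define M where "M k = norm (c k) * wt k" for k
  define e where "e = from_nat_into (UNIV :: (int^'n) set)"
  have bij: "bij_betw e UNIV UNIV" unfolding e_def by (rule bij_betw_from_nat_into[OF _ infinite_lattice]) simp
  hence inj: "inj_on e S" for S using bij_betw_imp_inj_on inj_on_subset by blast
  have c0: "(\<lambda>k. norm (c k)) summable_on UNIV"
    by (rule summable_on_comparison_test[OF c]) (use wt_ge_1 in \<open>auto simp: mult_le_cancel_left1\<close>)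
  have cv: "norm (c k * (\<i> * of_real (lat k \<bullet> v))) \<le> norm v * M k" for k v
  proof -
    have "\<bar>lat k \<bullet> v\<bar> \<le> norm (lat k) * norm v" by (rule Cauchy_Schwarz_ineq2)
    also have "\<dots> \<le> wt k * norm v" by (intro mult_right_mono) (auto simp: wt_def)
    finally have "norm (c k) * \<bar>lat k \<bullet> v\<bar> \<le> norm (c k) * (wt k * norm v)" by (rule mult_left_mono) simp
    thus ?thesis by (simp add: norm_mult M_def mult_ac)
  qed
  have cs: "(\<lambda>k. norm (c k * (\<i> * of_real (lat k \<bullet> v)))) summable_on UNIV" for v
    by (rule summable_on_comparison_test[OF summable_on_cmult_right[OF c[folded M_def], of "norm v"] cv]) auto
  define T where "T = (\<Sum>\<^sub>\<infinity>k. M k)"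
  have MT: "(M has_sum T) UNIV" unfolding T_def M_def by (rule has_sum_infsum[OF c])
  let ?g' = "\<lambda>x v. trig (\<lambda>k. c k * (\<i> * of_real (lat k \<bullet> v))) x"
  have "\<exists>g. \<forall>x\<in>UNIV. (\<lambda>n. c (e n) * ek (e n) x) sums g x \<and> (g has_derivative ?g' x) (at x within UNIV)"
  proof (rule has_derivative_series[where f'="\<lambda>n x v. c (e n) * (\<i> * of_real (lat (e n) \<bullet> v) * ek (e n) x)"])
    show "((\<lambda>x. c (e n) * ek (e n) x) has_derivative (\<lambda>v. c (e n) * (\<i> * of_real (lat (e n) \<bullet> v) * ek (e n) x))) (at x within UNIV)" for n x
      by (rule has_derivative_at_withinI[OF bounded_linear.has_derivative[OF bounded_linear_mult_right ek_has_derivative]])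
    show "(\<lambda>n. c (e n) * ek (e n) 0) sums trig c 0"
      by (rule has_sum_imp_sums)
        (use trig_has_sum[OF c0, of 0] has_sum_reindex_bij_betw[OF bij, of "\<lambda>k. c k * ek k 0" "trig c 0"] in simp)
    fix \<epsilon> :: real assume \<epsilon>: "\<epsilon> > 0"
    have "(\<lambda>n. M (e n)) sums T"
      by (rule has_sum_imp_sums) (use MT has_sum_reindex_bij_betw[OF bij, of M T] in simp)
    hence "\<forall>\<^sub>F n in sequentially. dist (\<Sum>i<n. M (e i)) T < \<epsilon>"
      using \<epsilon> unfolding sums_def by (rule tendstoD)
    thus "\<forall>\<^sub>F n in sequentially. \<forall>x\<in>UNIV. \<forall>h. norm ((\<Sum>i<n. c (e i) * (\<i> * of_real (lat (e i) \<bullet> h) * ek (e i) x)) - ?g' x h) \<le> \<epsilon> * norm h"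
    proof (rule eventually_mono, intro ballI allI)
      fix n x h assume n: "dist (\<Sum>i<n. M (e i)) T < \<epsilon>"
      let ?S = "e ` {..<n}"
      let ?F = "\<lambda>k. c k * (\<i> * of_real (lat k \<bullet> h)) * ek k x"
      have 1: "((\<lambda>k. ?F k - (if k \<in> ?S then ?F k else 0)) has_sum (?g' x h - (\<Sum>k\<in>?S. ?F k))) UNIV"
        by (intro has_sum_drop_finite trig_has_sum[OF cs]) auto
      have 2: "((\<lambda>k. norm h * (M k - (if k \<in> ?S then M k else 0))) has_sum (norm h * (T - (\<Sum>k\<in>?S. M k)))) UNIV"
        by (intro has_sum_cmult_right has_sum_drop_finite MT) auto
      have "norm (?g' x h - (\<Sum>k\<in>?S. ?F k)) \<le> norm h * (T - (\<Sum>k\<in>?S. M k))"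
        by (rule norm_infsum_le[OF 1 2]) (use cv in \<open>auto simp: norm_mult\<close>)
      also have "(\<Sum>k\<in>?S. M k) = (\<Sum>i<n. M (e i))" by (simp add: sum.reindex[OF inj])
      also have "norm h * (T - (\<Sum>i<n. M (e i))) \<le> norm h * \<epsilon>"
        using n by (intro mult_left_mono) (auto simp: dist_real_def)
      also have "(\<Sum>k\<in>?S. ?F k) = (\<Sum>i<n. c (e i) * (\<i> * of_real (lat (e i) \<bullet> h) * ek (e i) x))"
        by (simp add: sum.reindex[OF inj] mult_ac)
      finally show "norm ((\<Sum>i<n. c (e i) * (\<i> * of_real (lat (e i) \<bullet> h) * ek (e i) x)) - ?g' x h) \<le> \<epsilon> * norm h"
        by (simp add: norm_minus_commute mult.commute)
    qed
  qed auto
  then obtain g where g: "\<And>x. (\<lambda>n. c (e n) * ek (e n) x) sums g x" "\<And>x. (g has_derivative ?g' x) (at x)" by auto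
  have "(\<lambda>n. c (e n) * ek (e n) x) sums trig c x" for x
    by (rule has_sum_imp_sums)
      (use trig_has_sum[OF c0, of x] has_sum_reindex_bij_betw[OF bij, of "\<lambda>k. c k * ek k x" "trig c x"] in simp)
  hence "trig c = g" using g(1) sums_unique2 by blast
  thus ?thesis using g(2) by simp
qed

lemma C_k_on_trig:
  assumes "(\<lambda>k. norm (c k) * wt k ^ j) summable_on UNIV"
  shows "C_k_on j UNIV (trig c)"
  using assms
proof (induction j arbitrary: c)
  case 0
  thus ?case by (auto intro: continuous_on_trig)
next
  case (Suc j)
  have w: "wt k \<le> wt k ^ Suc j" for k using self_le_power[OF wt_ge_1] by blast
  have "(\<lambda>k. norm (c k) * wt k) summable_on UNIV"
    by (rule summable_on_comparison_test[OF Suc.prems]) (use w wt_pos[THEN less_imp_le] in \<open>auto intro!: mult_left_mono mult_nonneg_nonneg simp del: power_Suc\<close>)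
  note d = trig_has_derivative[OF this]
  show ?case
  proof (rule C_k_on_SucI[OF _ d])
    fix v
    show "C_k_on j UNIV (trig (\<lambda>k. c k * (\<i> * of_real (lat k \<bullet> v))))"
    proof (rule Suc.IH, rule summable_on_comparison_test[OF summable_on_cmult_right[OF Suc.prems, of "norm v"]])
      fix k
      have "\<bar>lat k \<bullet> v\<bar> \<le> norm (lat k) * norm v" by (rule Cauchy_Schwarz_ineq2)
      also have "\<dots> \<le> wt k * norm v" by (intro mult_right_mono) (auto simp: wt_def)
      finally have "norm (c k) * \<bar>lat k \<bullet> v\<bar> * wt k ^ j \<le> norm (c k) * (wt k * norm v) * wt k ^ j"
        using wt_pos[of k] by (intro mult_right_mono mult_left_mono) auto
      thus "norm (c k * (\<i> * of_real (lat k \<bullet> v))) * wt k ^ j \<le> norm v * (norm (c k) * wt k ^ Suc j)"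
        by (simp add: norm_mult mult_ac)
    qed (use wt_pos[THEN less_imp_le] in \<open>auto intro!: mult_nonneg_nonneg zero_le_power\<close>)
  qed simp
qed

section \<open>Coefficients of functions depending on a small parameter\<close>

lemma smooth_on_Pair: "smooth_on UNIV (\<lambda>y. (r, y))" for r :: "'b::euclidean_space"
proof -
  have "smooth_on UNIV (\<lambda>y. (r, 0) + (0, y))"
    by (intro smooth_on_add smooth_on_const smooth_on_linear) (auto intro!: bounded_linear_Pair bounded_linear_zero bounded_linear_ident)
  thus ?thesis by simp
qed

context
  fixes G :: "real \<times> (real^'n) \<Rightarrow> complex" and K :: "(real^'n) set"
  assumes K: "compact K"
begin

lemma slice_derivative:
  assumes "smooth_on UNIV G"
  shows "((\<lambda>y. G (r, y)) has_derivative (\<lambda>v. frechet_derivative G (at (r, y)) (0, v))) (at y)"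
proof -
  have "((\<lambda>y. (r, y)) has_derivative (\<lambda>v. (0, v))) (at y)" by (auto intro!: derivative_eq_intros)
  from has_derivative_compose[OF this smooth_on_has_derivative[OF assms]] show ?thesis by simp
qed

lemma slice_test_fun:
  assumes "smooth_on UNIV G" "\<And>r y. y \<notin> K \<Longrightarrow> G (r, y) = 0"
  shows "test_fun UNIV (\<lambda>y. G (r, y))"
  using smooth_on_compose[OF _ smooth_on_Pair assms(1), of r] assms(2) K
  by (auto simp: test_fun_def supported_in_def)

end

text \<open>In the application \<open>G (r, y)\<close> is \<open>a (p + r y) - a p\<close>, cut off in \<open>y\<close>: in the rescaled variable the
  oscillation of a coefficient is small together with all its derivatives.\<close>

lemma slice_uniformly_small:
  fixes G :: "real \<times> (real^'n) \<Rightarrow> complex"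
  assumes G: "continuous_on UNIV G" "\<And>r y. y \<notin> K \<Longrightarrow> G (r, y) = 0" "\<And>y. G (0, y) = 0" and K: "compact K"
    and \<epsilon>: "\<epsilon> > 0"
  shows "\<exists>\<delta>>0. \<forall>r y. \<bar>r\<bar> < \<delta> \<longrightarrow> norm (G (r, y)) \<le> \<epsilon>"
proof -
  have "compact ({-1..1::real} \<times> K)" using K by (intro compact_Times) auto
  hence "uniformly_continuous_on ({-1..1} \<times> K) G"
    using G(1) compact_uniformly_continuous continuous_on_subset by blast
  then obtain d where d: "d > 0" "\<And>z w. z \<in> {-1..1} \<times> K \<Longrightarrow> w \<in> {-1..1} \<times> K \<Longrightarrow> dist w z < d \<Longrightarrow> dist (G w) (G z) < \<epsilon>"
    unfolding uniformly_continuous_on_def using \<epsilon> by metis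
  have "norm (G (r, y)) \<le> \<epsilon>" if "\<bar>r\<bar> < min d 1" for r y
  proof (cases "y \<in> K")
    case True
    have "dist (G (r, y)) (G (0, y)) < \<epsilon>"
      by (rule d(2)) (use that True in \<open>auto simp: dist_Pair_Pair\<close>)
    thus ?thesis using G(3) by (simp add: dist_norm)
  qed (use G \<epsilon> in simp)
  thus ?thesis using d(1) by (intro exI[of _ "min d 1"]) auto
qed

text \<open>The hypotheses on G are inherited by its derivatives in y: they stay smooth jointly in
  (r, y), vanish for y off K, and vanish for r = 0. So the induction on N can differentiate once and
  return to the same situation, with a bound uniform in k.\<close>

lemma slice_coefficient_small:
  fixes G :: "real \<times> (real^'n) \<Rightarrow> complex"
  assumes K: "compact K" and \<epsilon>: "\<epsilon> > 0"
    and G: "smooth_on UNIV G" "\<And>r y. y \<notin> K \<Longrightarrow> G (r, y) = 0" "\<And>y. G (0, y) = 0" 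
  shows "\<exists>\<delta>>0. \<forall>r k. \<bar>r\<bar> < \<delta> \<longrightarrow> norm (fcoef (\<lambda>y. G (r, y)) k) * \<bar>real_of_int (k $ i)\<bar> ^ N \<le> \<epsilon>"
  using G
proof (induction N arbitrary: G)
  case 0
  define m where "m = measure lborel K"
  have m: "m \<ge> 0" by (simp add: m_def)
  then obtain \<delta> where \<delta>: "\<delta> > 0" "\<And>r y. \<bar>r\<bar> < \<delta> \<Longrightarrow> norm (G (r, y)) \<le> \<epsilon> / (m + 1)"
    using slice_uniformly_small[OF smooth_on_continuous[OF 0(1)] 0(2,3) K, of "\<epsilon> / (m + 1)"] \<epsilon> by (auto simp: add_nonneg_pos)
  have "norm (fcoef (\<lambda>y. G (r, y)) k) \<le> \<epsilon>" if "\<bar>r\<bar> < \<delta>" for r k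
  proof -
    have "norm (fcoef (\<lambda>y. G (r, y)) k) \<le> m * (\<epsilon> / (m + 1))" unfolding m_def
      by (rule norm_fcoef_le[OF test_fun_continuous[OF slice_test_fun[OF K 0(1,2)]] K 0(2)])
        (use \<delta>(2)[OF that] in \<open>auto simp: m_def\<close>)
    also have "\<dots> \<le> \<epsilon>" using m \<epsilon> by (simp add: field_simps)
    finally show ?thesis .
  qed
  thus ?case using \<delta>(1) by auto
next
  case (Suc N)
  let ?D = "\<lambda>z. frechet_derivative G (at z) (0, axis i 1)"
  have D: "frechet_derivative (\<lambda>y. G (r, y)) (at y) v = frechet_derivative G (at (r, y)) (0, v)" for r y v
    by (rule fun_cong[OF frechet_derivative_at[OF slice_derivative[OF K Suc.prems(1)]], symmetric])
  have s: "smooth_on UNIV ?D" by (rule smooth_on_deriv[OF Suc.prems(1)])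
  have z: "?D (r, y) = 0" if "y \<notin> K" for r y
    unfolding D[symmetric] by (rule frechet_derivative_zero_ext[OF K _ that]) (rule Suc.prems(2))
  have o: "?D (0, y) = 0" for y
    unfolding D[symmetric] by (simp add: Suc.prems(3) frechet_derivative_const)
  obtain \<delta> where \<delta>: "\<delta> > 0" "\<And>r k. \<bar>r\<bar> < \<delta> \<Longrightarrow> norm (fcoef (\<lambda>y. ?D (r, y)) k) * \<bar>real_of_int (k $ i)\<bar> ^ N \<le> \<epsilon>"
    using Suc.IH[OF s z o] by blast
  have "norm (fcoef (\<lambda>y. G (r, y)) k) * \<bar>real_of_int (k $ i)\<bar> ^ Suc N \<le> \<epsilon>" if "\<bar>r\<bar> < \<delta>" for r k
  proof -
    have "fcoef (\<lambda>y. ?D (r, y)) k = \<i> * of_real (lat k \<bullet> axis i 1) * fcoef (\<lambda>y. G (r, y)) k"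
      unfolding D[symmetric] by (rule fcoef_deriv[OF slice_test_fun[OF K Suc.prems(1,2)] open_UNIV])
    thus ?thesis using \<delta>(2)[OF that, of k] by (simp add: inner_axis norm_mult mult_ac)
  qed
  thus ?case using \<delta>(1) by blast
qed

lemma slice_coefficients_small:
  fixes G :: "real \<times> (real^'n) \<Rightarrow> complex"
  assumes K: "compact K" and \<epsilon>: "\<epsilon> > 0"
    and G: "smooth_on UNIV G" "\<And>r y. y \<notin> K \<Longrightarrow> G (r, y) = 0" "\<And>y. G (0, y) = 0" 
  shows "\<exists>\<delta>>0. \<forall>r k. \<bar>r\<bar> < \<delta> \<longrightarrow> norm (fcoef (\<lambda>y. G (r, y)) k) * wt k ^ N \<le> \<epsilon>"
proof -
  let ?c = "(1 + real CARD('n)) ^ N"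
  \<comment> \<open>One share for the uncontrolled power and one for each coordinate; the factor in
    front comes from \<open>wt_power_le\<close>.\<close>
  define \<eta> where "\<eta> = \<epsilon> / (?c * (1 + real CARD('n)))"
  have \<eta>: "\<eta> > 0" using \<epsilon> by (simp add: \<eta>_def add_pos_nonneg)
  obtain \<delta>0 where \<delta>0: "\<delta>0 > 0" "\<And>r k. \<bar>r\<bar> < \<delta>0 \<Longrightarrow> norm (fcoef (\<lambda>y. G (r, y)) k) \<le> \<eta>"
    using slice_coefficient_small[OF K \<eta> G, where N=0] by auto
  have "\<forall>i. \<exists>\<delta>>0. \<forall>r k. \<bar>r\<bar> < \<delta> \<longrightarrow> norm (fcoef (\<lambda>y. G (r, y)) k) * \<bar>real_of_int (k $ i)\<bar> ^ N \<le> \<eta>"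
    using slice_coefficient_small[OF K \<eta> G] by blast
  then obtain d where d: "\<And>i. d i > 0" "\<And>i r k. \<bar>r\<bar> < d i \<Longrightarrow> norm (fcoef (\<lambda>y. G (r, y)) k) * \<bar>real_of_int (k $ i)\<bar> ^ N \<le> \<eta>"
    by metis
  define \<delta> where "\<delta> = Min (insert \<delta>0 (range d))"
  have \<delta>: "\<delta> > 0" unfolding \<delta>_def using d(1) \<delta>0(1) by (subst Min_gr_iff) auto
  have le: "\<delta> \<le> \<delta>0" "\<delta> \<le> d i" for i unfolding \<delta>_def by (intro Min_le; simp)+
  have "norm (fcoef (\<lambda>y. G (r, y)) k) * wt k ^ N \<le> \<epsilon>" if r: "\<bar>r\<bar> < \<delta>" for r k
  proof -
    let ?f = "norm (fcoef (\<lambda>y. G (r, y)) k)"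
    have "?f * wt k ^ N \<le> ?f * (?c * (1 + (\<Sum>i\<in>UNIV. \<bar>real_of_int (k $ i)\<bar> ^ N)))"
      by (rule mult_left_mono[OF wt_power_le]) simp
    also have "\<dots> = ?c * (?f + (\<Sum>i\<in>UNIV. ?f * \<bar>real_of_int (k $ i)\<bar> ^ N))"
      by (simp add: algebra_simps sum_distrib_left)
    also have "\<dots> \<le> ?c * (\<eta> + (\<Sum>i\<in>(UNIV::'n set). \<eta>))"
      using less_le_trans[OF r le(1)] less_le_trans[OF r le(2)] by (intro mult_left_mono add_mono sum_mono \<delta>0(2) d(2)) auto
    also have "\<dots> = ?c * (1 + real CARD('n)) * \<eta>" by (simp add: algebra_simps)
    also have "\<dots> = \<epsilon>" unfolding \<eta>_def
      by (subst times_divide_eq_right, rule nonzero_mult_div_cancel_left) (simp add: add_nonneg_eq_0_iff)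
    finally show ?thesis .
  qed
  thus ?thesis using \<delta> by blast
qed

section \<open>Interior elliptic regularity\<close>

text \<open>The values lie in an arbitrary normed space, so that the same operator acts on complex
  test functions in the regularity theory and on real functions elsewhere.\<close>

definition div_op :: "('n \<Rightarrow> 'n \<Rightarrow> real^'n \<Rightarrow> real) \<Rightarrow> (real^'n \<Rightarrow> 'b::real_normed_vector) \<Rightarrow> real^'n \<Rightarrow> 'b" where
  "div_op a f x = (\<Sum>i\<in>UNIV. partial (\<lambda>y. \<Sum>j\<in>UNIV. a i j y *\<^sub>R partial f j y) i x)"

lemma test_fun_partial: "test_fun W f \<Longrightarrow> test_fun W (partial f i)"
  using test_fun_deriv[of W f "axis i 1"] by (simp add: partial_def[abs_def])

lemma smooth_on_partial: "smooth_on W f \<Longrightarrow> smooth_on W (partial f i)"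
  using smooth_on_deriv[of W f "axis i 1"] by (simp add: partial_def[abs_def])

lemma test_fun_flux:
  assumes "open W" "\<And>i j. smooth_on W (a i j)" "test_fun W f"
  shows "test_fun W (\<lambda>x. \<Sum>j\<in>UNIV. a i j x *\<^sub>R partial f j x)"
  by (intro test_fun_sum test_fun_scaleR assms test_fun_partial)

lemma test_fun_div_op:
  assumes "open W" "\<And>i j. smooth_on W (a i j)" "test_fun W f"
  shows "test_fun W (div_op a f)"
  unfolding div_op_def[abs_def] by (intro test_fun_sum test_fun_partial test_fun_flux assms)

lemma partial_add:
  "test_fun W f \<Longrightarrow> test_fun W g \<Longrightarrow> partial (\<lambda>x. f x + g x) i x = partial f i x + partial g i x"
  unfolding partial_def by (rule fun_cong[OF frechet_derivative_at[OF has_derivative_add], symmetric])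
    (rule test_fun_has_derivative; assumption)+

lemma partial_cmult:
  fixes c :: "'b::real_normed_algebra"
  shows "test_fun W f \<Longrightarrow> partial (\<lambda>x. c * f x) i x = c * partial f i x"
  unfolding partial_def by (rule fun_cong[OF frechet_derivative_at[OF bounded_linear.has_derivative[OF bounded_linear_mult_right]], symmetric])
    (rule test_fun_has_derivative)

lemma partial_sum:
  "(\<And>j. j \<in> J \<Longrightarrow> test_fun W (f j)) \<Longrightarrow> partial (\<lambda>x. \<Sum>j\<in>J. f j x) i x = (\<Sum>j\<in>J. partial (f j) i x)"
  unfolding partial_def by (rule fun_cong[OF frechet_derivative_at[OF has_derivative_sum], symmetric])
    (rule test_fun_has_derivative)

section \<open>Distributions of order zero\<close>

text \<open>The continuity condition involves the sup norm only. This makes the Fourier coefficients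
  of each localization bounded, which starts the regularity argument, and lets uniformly convergent
  series pass through the functional. Quantifying over all bounds \<open>B\<close> avoids speaking
  of suprema.\<close>

locale distribution =
  fixes W :: "(real^'n) set" and \<Lambda> :: "(real^'n \<Rightarrow> complex) \<Rightarrow> complex"
  assumes open_domain: "open W"
    and add: "\<And>f g. test_fun W f \<Longrightarrow> test_fun W g \<Longrightarrow> \<Lambda> (\<lambda>x. f x + g x) = \<Lambda> f + \<Lambda> g"
    and scale: "\<And>f c. test_fun W f \<Longrightarrow> \<Lambda> (\<lambda>x. c * f x) = c * \<Lambda> f"
    and order_0: "\<And>K. compact K \<Longrightarrow> K \<subseteq> W \<Longrightarrow> \<exists>C. \<forall>f B. test_fun W f \<longrightarrow> (\<forall>x. x \<notin> K \<longrightarrow> f x = 0) \<longrightarrow> 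
      (\<forall>x. norm (f x) \<le> B) \<longrightarrow> norm (\<Lambda> f) \<le> C * B"
begin

lemma test_fun_cmult: "test_fun W f \<Longrightarrow> test_fun W (\<lambda>x. c * f x :: complex)"
  by (rule test_fun_mult[OF open_domain smooth_on_const[OF open_domain]])

lemma zero: "\<Lambda> (\<lambda>x. 0) = 0"
  using scale[OF test_fun_zero, of 0] by simp

lemma sum: "(\<And>i. i \<in> I \<Longrightarrow> test_fun W (f i)) \<Longrightarrow> \<Lambda> (\<lambda>x. \<Sum>i\<in>I. f i x) = (\<Sum>i\<in>I. \<Lambda> (f i))"
proof (induction I rule: infinite_finite_induct)
  case (insert i I)
  have "\<Lambda> (\<lambda>x. f i x + (\<Sum>i\<in>I. f i x)) = \<Lambda> (f i) + \<Lambda> (\<lambda>x. \<Sum>i\<in>I. f i x)"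
    by (rule add) (auto intro: test_fun_sum insert.prems)
  thus ?case using insert by simp
qed (simp_all add: zero)

lemma minus: "test_fun W f \<Longrightarrow> test_fun W g \<Longrightarrow> \<Lambda> (\<lambda>x. f x - g x) = \<Lambda> f - \<Lambda> g"
  using add[of f "\<lambda>x. - 1 * g x"] scale[of g "- 1"] test_fun_cmult[of g "- 1"] by simp

lemma minus_minus_cmult:
  assumes "test_fun W f" "test_fun W g" "test_fun W k"
  shows "\<Lambda> (\<lambda>x. f x - b * g x - c * k x) = \<Lambda> f - b * \<Lambda> g - c * \<Lambda> k"
proof -
  have t: "test_fun W (\<lambda>x. f x - b * g x)"
    using test_fun_add[OF assms(1) test_fun_cmult[OF assms(2), of "- b"]] by simp
  have "\<Lambda> (\<lambda>x. f x - b * g x - c * k x) = \<Lambda> (\<lambda>x. f x - b * g x) - \<Lambda> (\<lambda>x. c * k x)"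
    by (rule minus[OF t test_fun_cmult[OF assms(3)]])
  also have "\<Lambda> (\<lambda>x. f x - b * g x) = \<Lambda> f - \<Lambda> (\<lambda>x. b * g x)"
    by (rule minus[OF assms(1) test_fun_cmult[OF assms(2)]])
  finally show ?thesis by (simp only: scale assms)
qed

end

lemma integral_affine:
  fixes f :: "'a::euclidean_space \<Rightarrow> 'b::{banach, second_countable_topology}"
  assumes "f \<in> borel_measurable borel" "r > 0"
  shows "(\<integral>x. f x \<partial>lborel) = r ^ DIM('a) *\<^sub>R (\<integral>y. f (p + r *\<^sub>R y) \<partial>lborel)"
proof -
  have "(\<integral>x. f x \<partial>lborel) = (\<integral>x. f x \<partial>density (distr lborel borel (\<lambda>x. p + r *\<^sub>R x)) (\<lambda>_. \<bar>r\<bar> ^ DIM('a)))"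
    using lborel_affine[of r p] assms(2) by simp
  also have "\<dots> = (\<integral>x. r ^ DIM('a) *\<^sub>R f x \<partial>distr lborel borel (\<lambda>x. p + r *\<^sub>R x))"
    using assms by (subst integral_density) auto
  also have "\<dots> = (\<integral>y. r ^ DIM('a) *\<^sub>R f (p + r *\<^sub>R y) \<partial>lborel)"
    using assms by (subst integral_distr) auto
  finally show ?thesis by simp
qed

lemma test_fun_affine:
  fixes f :: "'a::euclidean_space \<Rightarrow> 'b::real_normed_vector"
  assumes "test_fun (ball p r) f" "r > 0"
  shows "test_fun (ball 0 1) (\<lambda>y. f (p + r *\<^sub>R y))"
proof -
  obtain K where K: "compact K" "K \<subseteq> ball p r" "\<And>x. x \<notin> K \<Longrightarrow> f x = 0"
    using assms(1) by (auto simp: test_fun_def supported_in_def)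
  let ?L = "(\<lambda>x. (1 / r) *\<^sub>R (x - p)) ` K"
  have "smooth_on UNIV (\<lambda>y. p + r *\<^sub>R y)"
    by (intro smooth_on_add smooth_on_const smooth_on_linear[OF _ bounded_linear_scaleR_right]) auto
  hence "smooth_on UNIV (\<lambda>y. f (p + r *\<^sub>R y))"
    by (rule smooth_on_compose[OF open_UNIV _ test_fun_smooth_on[OF assms(1)]]) auto
  moreover have "compact ?L" using K(1) by (intro compact_continuous_image continuous_intros)
  moreover have "?L \<subseteq> ball 0 1" using K(2) assms(2) by (auto simp: dist_norm norm_minus_commute divide_less_eq subset_iff)
  moreover have "f (p + r *\<^sub>R y) = 0" if "y \<notin> ?L" for y
  proof (rule K(3), rule notI)
    assume "p + r *\<^sub>R y \<in> K"
    hence "(1 / r) *\<^sub>R (p + r *\<^sub>R y - p) \<in> ?L" by blast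
    thus False using that assms(2) by simp
  qed
  ultimately show ?thesis unfolding test_fun_def supported_in_def by blast
qed

lemma ball_subset_ocube: "ball 0 1 \<subseteq> (ocube :: (real^'n) set)" "cball 0 2 \<subseteq> (ocube :: (real^'n) set)"
proof -
  show 2: "cball 0 2 \<subseteq> (ocube :: (real^'n) set)"
  proof
    fix x :: "real^'n" assume "x \<in> cball 0 2"
    hence "\<bar>x $ i\<bar> \<le> 2" for i using component_le_norm_cart[of x i] by simp
    thus "x \<in> ocube" unfolding mem_ocube using pi_gt3 by (smt (verit))
  qed
  show "ball 0 1 \<subseteq> (ocube :: (real^'n) set)" using 2 by (rule order_trans[rotated]) auto
qed

text \<open>The coefficients are \<open>\<alpha>\<close>, their value at the centre, plus Fourier series in the rescaled variable
  \<open>(x - p) / r\<close> which are small compared with the ellipticity constant of \<open>\<alpha>\<close>.\<close>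

locale frozen_coefficients = distribution "ball p r" \<Lambda> for p :: "real^'n" and r \<Lambda> +
  fixes a :: "'n \<Rightarrow> 'n \<Rightarrow> real^'n \<Rightarrow> real" and h :: "real^'n \<Rightarrow> real"
    and \<alpha> :: "'n \<Rightarrow> 'n \<Rightarrow> real" and c :: "'n \<Rightarrow> 'n \<Rightarrow> int^'n \<Rightarrow> complex" and lam :: real and S :: nat
  assumes r: "r > 0" and smooth_a: "\<And>i j. smooth_on (ball p r) (a i j)" and smooth_h: "smooth_on (ball p r) h"
    and weak: "\<And>f :: real^'n \<Rightarrow> complex. test_fun (ball p r) f \<Longrightarrow> \<Lambda> (div_op a f) = - (\<integral>x. h x *\<^sub>R f x \<partial>lborel)"
    and a_eq: "\<And>i j x. x \<in> ball p r \<Longrightarrow> of_real (a i j x) = of_real (\<alpha> i j) + trig (c i j) ((1 / r) *\<^sub>R (x - p))"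
    and lam: "lam > 0" and elliptic: "\<And>\<xi>. lam * (norm \<xi>)\<^sup>2 \<le> (\<Sum>i\<in>UNIV. \<Sum>j\<in>UNIV. \<alpha> i j * \<xi> $ i * \<xi> $ j)"
    and c_summable: "\<And>i j. (\<lambda>m. norm (c i j m) * wt m ^ S) summable_on UNIV"
    and c_small: "(\<Sum>i\<in>UNIV. \<Sum>j\<in>UNIV. \<Sum>\<^sub>\<infinity>m. norm (c i j m) * wt m ^ S) \<le> lam / 2"
begin

section \<open>Fourier coefficients of localizations\<close>

definition E :: "int^'n \<Rightarrow> real^'n \<Rightarrow> complex" where "E k x = ek k ((1 / r) *\<^sub>R (x - p))"

lemma E_add: "E (k + l) x = E k x * E l x" by (simp add: E_def ek_add)
lemma norm_E [simp]: "norm (E k x) = 1" by (simp add: E_def)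

lemma smooth_E: "smooth_on UNIV (E k)"
proof -
  have "smooth_on UNIV (\<lambda>x. (1 / r) *\<^sub>R (x - p))"
    by (intro smooth_on_scaleR smooth_on_diff smooth_on_const smooth_on_linear[OF _ bounded_linear_ident]) auto
  thus ?thesis unfolding E_def[abs_def] by (rule smooth_on_compose[OF open_UNIV _ smooth_on_ek[OF open_UNIV]]) auto
qed

lemma test_fun_E: "test_fun (ball p r) f \<Longrightarrow> test_fun (ball p r) (\<lambda>x. E k x * f x)"
  by (rule test_fun_mult[OF open_domain smooth_on_subset[OF smooth_E]]) auto

lemma E_has_derivative: "(E k has_derivative (\<lambda>v. \<i> * of_real (lat k \<bullet> v / r) * E k x)) (at x)"
proof -
  have "((\<lambda>x. (1 / r) *\<^sub>R (x - p)) has_derivative (\<lambda>v. (1 / r) *\<^sub>R v)) (at x)"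
    by (auto intro!: derivative_eq_intros)
  from has_derivative_compose[OF this ek_has_derivative] show ?thesis unfolding E_def[abs_def] by simp
qed

lemma partial_E_mult:
  assumes "test_fun (ball p r) f"
  shows "partial (\<lambda>x. E (- k) x * f x) i x = E (- k) x * (partial f i x - \<i> * of_real (of_int (k $ i) / r) * f x)"
proof -
  have "((\<lambda>x. E (- k) x * f x) has_derivative 
    (\<lambda>v. E (- k) x * frechet_derivative f (at x) v + \<i> * of_real (lat (- k) \<bullet> v / r) * E (- k) x * f x)) (at x)"
    by (rule has_derivative_mult[OF E_has_derivative test_fun_has_derivative[OF assms]])
  from fun_cong[OF frechet_derivative_at[OF this], of "axis i 1"] show ?thesis
    by (simp add: partial_def inner_axis algebra_simps)
qed

text \<open>Up to a normalising constant, the Fourier coefficient in the rescaled variable of the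
  distribution multiplied by f. All localizations f are treated at once, because the equation for
  one of them involves others, built from its derivatives and the coefficients.\<close>

definition U :: "(real^'n \<Rightarrow> complex) \<Rightarrow> int^'n \<Rightarrow> complex" where "U f k = \<Lambda> (\<lambda>x. E (- k) x * f x)"

lemma U_bounded:
  assumes "test_fun (ball p r) f" shows "\<exists>C. \<forall>k. norm (U f k) \<le> C"
proof -
  obtain K where K: "compact K" "K \<subseteq> ball p r" "\<And>x. x \<notin> K \<Longrightarrow> f x = 0"
    using assms by (auto simp: test_fun_def supported_in_def)
  obtain C where C: "\<And>f B. test_fun (ball p r) f \<Longrightarrow> (\<And>x. x \<notin> K \<Longrightarrow> f x = 0) \<Longrightarrow> 
      (\<And>x. norm (f x) \<le> B) \<Longrightarrow> norm (\<Lambda> f) \<le> C * B"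
    using order_0[OF K(1,2)] by metis
  obtain B where B: "\<And>x. norm (f x) \<le> B"
    using bounded_supported[OF test_fun_continuous[OF assms, of UNIV]] assms unfolding test_fun_def supported_in_def by (metis subset_UNIV)
  have "norm (U f k) \<le> C * B" for k unfolding U_def
    by (rule C[OF test_fun_E[OF assms]]) (use K(3) B in \<open>auto simp: norm_mult\<close>)
  thus ?thesis by blast
qed

text \<open>On a fixed compact support the functional is continuous for uniform convergence, so
  multiplication by an absolutely convergent trigonometric series can be carried out term by
  term.\<close>

lemma series:
  assumes f: "test_fun (ball p r) f" and d: "(\<lambda>m. norm (d m)) summable_on UNIV"
    and g: "test_fun (ball p r) g" "\<And>x. g x = trig d ((1 / r) *\<^sub>R (x - p)) * f x"
  shows "((\<lambda>m. d m * U f (- m)) has_sum \<Lambda> g) UNIV"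
proof -
  obtain K where K: "compact K" "K \<subseteq> ball p r" "\<And>x. x \<notin> K \<Longrightarrow> f x = 0"
    using f by (auto simp: test_fun_def supported_in_def)
  obtain C' where C': "\<And>f B. test_fun (ball p r) f \<Longrightarrow> (\<And>x. x \<notin> K \<Longrightarrow> f x = 0) \<Longrightarrow> 
      (\<And>x. norm (f x) \<le> B) \<Longrightarrow> norm (\<Lambda> f) \<le> C' * B"
    using order_0[OF K(1,2)] by metis
  \<comment> \<open>The order-0 constant need not be nonnegative as given; the absolute value makes
    it usable in the estimates.\<close>
  define C where "C = \<bar>C'\<bar>"
  have C: "norm (\<Lambda> f) \<le> C * B" if "test_fun (ball p r) f" "\<And>x. x \<notin> K \<Longrightarrow> f x = 0" "\<And>x. norm (f x) \<le> B" for f B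
  proof -
    have "0 \<le> B" using that(3)[of 0] norm_ge_zero order_trans by blast
    hence "C' * B \<le> C * B" unfolding C_def by (intro mult_right_mono) auto
    thus ?thesis using C'[OF that] by linarith
  qed
  obtain B where B: "B > 0" "\<And>x. norm (f x) \<le> B"
    using bounded_supported[OF test_fun_continuous[OF f, of UNIV]] f unfolding test_fun_def supported_in_def by (metis subset_UNIV)
  have C0: "C \<ge> 0" by (simp add: C_def)
  show ?thesis unfolding has_sum_def
  proof (rule tendstoI)
    fix e :: real assume e: "e > 0"
    let ?e = "e / ((C + 1) * B)"
    have pos: "?e > 0" using e C0 B by simp
    have "\<forall>\<^sub>F T in finite_subsets_at_top UNIV. \<forall>x\<in>UNIV. dist (\<Sum>k\<in>T. d k * ek k x) (trig d x) < ?e"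
      using trig_uniform_limit[OF d, of UNIV] pos unfolding uniform_limit_iff by meson
    thus "\<forall>\<^sub>F T in finite_subsets_at_top UNIV. dist (\<Sum>m\<in>T. d m * U f (- m)) (\<Lambda> g) < e"
    proof (rule eventually_mono)
      fix T assume T: "\<forall>x\<in>UNIV. dist (\<Sum>k\<in>T. d k * ek k x) (trig d x) < ?e"
      let ?s = "\<lambda>x. \<Sum>m\<in>T. d m * (E m x * f x)"
      have ts: "test_fun (ball p r) ?s" by (intro test_fun_sum test_fun_cmult test_fun_E f)
      have td: "test_fun (ball p r) (\<lambda>x. ?s x - g x)"
        using test_fun_add[OF ts test_fun_cmult[OF g(1), of "- 1"]] by simp
      have "(\<Sum>m\<in>T. d m * U f (- m)) = \<Lambda> ?s"
        by (subst sum) (auto simp: U_def scale test_fun_E f test_fun_cmult)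
      hence "dist (\<Sum>m\<in>T. d m * U f (- m)) (\<Lambda> g) = norm (\<Lambda> (\<lambda>x. ?s x - g x))"
        by (simp add: minus[OF ts g(1)] dist_norm)
      also have "\<dots> \<le> C * (?e * B)"
      proof (rule C[OF td])
        show "?s x - g x = 0" if "x \<notin> K" for x using K(3)[OF that] by (simp add: g(2))
        fix x
        let ?y = "(1 / r) *\<^sub>R (x - p)"
        have "?s x - g x = ((\<Sum>k\<in>T. d k * ek k ?y) - trig d ?y) * f x"
          by (simp add: g(2) E_def sum_distrib_right left_diff_distrib mult.assoc)
        also have "norm \<dots> \<le> ?e * B"
          unfolding norm_mult using T B pos by (intro mult_mono) (auto simp: dist_norm less_imp_le)
        finally show "norm (?s x - g x) \<le> ?e * B" .
      qed
      also have "?e * B = e / (C + 1)" using B(1) by simp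
      also have "C * (e / (C + 1)) = e * (C / (C + 1))" by simp
      also have "\<dots> < e" using e C0 by (simp add: field_simps)
      finally show "dist (\<Sum>m\<in>T. d m * U f (- m)) (\<Lambda> g) < e" .
    qed
  qed
qed

text \<open>Rescaling the ball to the unit ball turns this into the decay of ordinary Fourier
  coefficients.\<close>

lemma integral_E_decay:
  assumes "test_fun (ball p r) f"
  shows "\<exists>C. \<forall>k. norm (\<integral>x. E (- k) x * f x \<partial>lborel) * wt k ^ N \<le> C"
proof -
  let ?g = "\<lambda>y. f (p + r *\<^sub>R y)"
  obtain C where C: "\<And>k. norm (fcoef ?g k) * wt k ^ N \<le> C"
    using fcoef_decay[OF test_fun_affine[OF assms r], of N] by auto
  have "(\<integral>x. E (- k) x * f x \<partial>lborel) = (2 * pi * r) ^ CARD('n) * fcoef ?g k" for k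
  proof -
    have "(\<lambda>x. E (- k) x * f x) \<in> borel_measurable borel"
      using test_fun_continuous[OF test_fun_E[OF assms]] by (rule borel_measurable_continuous_onI)
    from integral_affine[OF this r, of p]
    have "(\<integral>x. E (- k) x * f x \<partial>lborel) = of_real (r ^ CARD('n)) * (\<integral>y. ek (- k) y * ?g y \<partial>lborel)"
      using r by (simp add: E_def scaleR_conv_of_real[where 'a=complex])
    also have "(\<integral>y. ek (- k) y * ?g y \<partial>lborel) = (2 * pi) ^ CARD('n) * fcoef ?g k" by (simp add: fcoef_def)
    finally show ?thesis by (simp add: power_mult_distrib mult_ac)
  qed
  hence "norm (\<integral>x. E (- k) x * f x \<partial>lborel) * wt k ^ N \<le> (2 * pi * r) ^ CARD('n) * C" for k
    using C[of k] r by (simp add: norm_mult norm_power mult.assoc mult_left_mono)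
  thus ?thesis by blast
qed

text \<open>Conjugating the operator with an exponential: the part quadratic in k is the principal
  symbol, the linear part carries one derivative of f or of a coefficient. The products under the
  derivative are left unexpanded, so that every term is an exponential times a test
  function.\<close>

lemma div_op_E_mult:
  fixes f :: "real^'n \<Rightarrow> complex"
  assumes f: "test_fun (ball p r) f"
  shows "div_op a (\<lambda>x. E (- k) x * f x) x = E (- k) x * div_op a f x
     - \<i> / r * (\<Sum>i\<in>UNIV. \<Sum>j\<in>UNIV. of_int (k $ j) * (E (- k) x * partial (\<lambda>y. a i j y *\<^sub>R f y) i x)
         + of_int (k $ i) * (E (- k) x * (a i j x *\<^sub>R partial f j x)))
     - 1 / r\<^sup>2 * (\<Sum>i\<in>UNIV. \<Sum>j\<in>UNIV. of_int (k $ i * k $ j) * (E (- k) x * (a i j x *\<^sub>R f x)))"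
proof -
  define F where "F i y = (\<Sum>j\<in>UNIV. a i j y *\<^sub>R partial f j y) + (\<Sum>j\<in>UNIV. (- \<i> / r * of_int (k $ j)) * (a i j y *\<^sub>R f y))" for i y
  have tH: "test_fun (ball p r) (\<lambda>y. a i j y *\<^sub>R f y)" for i j
    by (rule test_fun_scaleR[OF open_domain smooth_a f])
  have tG: "test_fun (ball p r) (\<lambda>y. \<Sum>j\<in>UNIV. a i j y *\<^sub>R partial f j y)" for i
    by (rule test_fun_flux[OF open_domain smooth_a f])
  have tS: "test_fun (ball p r) (\<lambda>y. \<Sum>j\<in>UNIV. (- \<i> / r * of_int (k $ j)) * (a i j y *\<^sub>R f y))" for i
    by (intro test_fun_sum test_fun_cmult tH)
  have tF: "test_fun (ball p r) (F i)" for i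
    unfolding F_def[abs_def] by (rule test_fun_add[OF tG tS])
  have "(\<lambda>y. \<Sum>j\<in>UNIV. a i j y *\<^sub>R partial (\<lambda>x. E (- k) x * f x) j y) = (\<lambda>y. E (- k) y * F i y)" for i
    by (rule ext, simp only: partial_E_mult[OF f] F_def sum.distrib[symmetric] sum_distrib_left)
      (simp add: scaleR_conv_of_real algebra_simps)
  hence "div_op a (\<lambda>x. E (- k) x * f x) x = (\<Sum>i\<in>UNIV. E (- k) x * (partial (F i) i x - \<i> * of_real (of_int (k $ i) / r) * F i x))"
    unfolding div_op_def by (simp add: partial_E_mult[OF tF])
  moreover have "partial (F i) i x = partial (\<lambda>y. \<Sum>j\<in>UNIV. a i j y *\<^sub>R partial f j y) i x 
     + (\<Sum>j\<in>UNIV. (- \<i> / r * of_int (k $ j)) * partial (\<lambda>y. a i j y *\<^sub>R f y) i x)" for i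
    unfolding F_def[abs_def] partial_add[OF tG tS]
    by (subst partial_sum[OF test_fun_cmult[OF tH]]) (simp only: partial_cmult[OF tH])
  ultimately have "div_op a (\<lambda>x. E (- k) x * f x) x = (\<Sum>i\<in>UNIV. E (- k) x * (partial (\<lambda>y. \<Sum>j\<in>UNIV. a i j y *\<^sub>R partial f j y) i x 
     + (\<Sum>j\<in>UNIV. (- \<i> / r * of_int (k $ j)) * partial (\<lambda>y. a i j y *\<^sub>R f y) i x) - \<i> * of_real (of_int (k $ i) / r) * F i x))"
    by (simp only:)
  also have "\<dots> = E (- k) x * div_op a f x + (\<Sum>i\<in>UNIV. E (- k) x * (\<Sum>j\<in>UNIV. (- \<i> / r * of_int (k $ j)) * partial (\<lambda>y. a i j y *\<^sub>R f y) i x))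
      - (\<Sum>i\<in>UNIV. E (- k) x * (\<i> * of_real (of_int (k $ i) / r) * F i x))"
    by (simp only: div_op_def ring_distribs sum.distrib sum_subtractf sum_distrib_left)
  finally have 1: "div_op a (\<lambda>x. E (- k) x * f x) x = \<dots>" .
  have 2: "(\<Sum>i\<in>UNIV. E (- k) x * (\<i> * of_real (of_int (k $ i) / r) * F i x)) = 
     (\<Sum>i\<in>UNIV. \<Sum>j\<in>UNIV. \<i> / r * (of_int (k $ i) * (E (- k) x * (a i j x *\<^sub>R partial f j x))))
     + (\<Sum>i\<in>UNIV. \<Sum>j\<in>UNIV. 1 / r\<^sup>2 * (of_int (k $ i * k $ j) * (E (- k) x * (a i j x *\<^sub>R f x))))"
    unfolding F_def sum.distrib[symmetric] 
    by (intro sum.cong refl) (simp add: sum_distrib_left sum.distrib[symmetric] scaleR_conv_of_real algebra_simps power2_eq_square)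
  have 3: "(\<Sum>i\<in>UNIV. E (- k) x * (\<Sum>j\<in>UNIV. (- \<i> / r * of_int (k $ j)) * partial (\<lambda>y. a i j y *\<^sub>R f y) i x)) =
     (\<Sum>i\<in>UNIV. \<Sum>j\<in>UNIV. - (\<i> / r * (of_int (k $ j) * (E (- k) x * partial (\<lambda>y. a i j y *\<^sub>R f y) i x))))"
    by (intro sum.cong refl) (simp add: sum_distrib_left algebra_simps)
  show ?thesis unfolding 1 2 3
    by (simp only: sum_negf sum_distrib_left[symmetric] sum.distrib distrib_left) (simp add: algebra_simps)
qed

text \<open>The weak equation tested with the localized exponential and solved for the principal
  symbol: the left side is quadratic in k, the right side at most linear. This difference is the
  source of the gain of one power of decay.\<close>

lemma key_identity:
  fixes f :: "real^'n \<Rightarrow> complex"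
  assumes f: "test_fun (ball p r) f"
  shows "(\<Sum>i\<in>UNIV. \<Sum>j\<in>UNIV. of_int (k $ i * k $ j) * U (\<lambda>x. a i j x *\<^sub>R f x) k) =
     r\<^sup>2 * (U (div_op a f) k + (\<integral>x. E (- k) x * (h x *\<^sub>R f x) \<partial>lborel))
     - \<i> * r * (\<Sum>i\<in>UNIV. \<Sum>j\<in>UNIV. of_int (k $ j) * U (partial (\<lambda>y. a i j y *\<^sub>R f y) i) k
         + of_int (k $ i) * U (\<lambda>x. a i j x *\<^sub>R partial f j x) k)"
proof -
  have tH: "test_fun (ball p r) (\<lambda>y. a i j y *\<^sub>R f y)" for i j
    by (rule test_fun_scaleR[OF open_domain smooth_a f])
  have tG: "test_fun (ball p r) (\<lambda>y. a i j y *\<^sub>R partial f j y)" for i j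
    by (rule test_fun_scaleR[OF open_domain smooth_a test_fun_partial[OF f]])
  let ?A = "\<lambda>x. E (- k) x * div_op a f x"
  let ?B = "\<lambda>x. \<Sum>i\<in>UNIV. \<Sum>j\<in>UNIV. of_int (k $ j) * (E (- k) x * partial (\<lambda>y. a i j y *\<^sub>R f y) i x)
         + of_int (k $ i) * (E (- k) x * (a i j x *\<^sub>R partial f j x))"
  let ?C = "\<lambda>x. \<Sum>i\<in>UNIV. \<Sum>j\<in>UNIV. of_int (k $ i * k $ j) * (E (- k) x * (a i j x *\<^sub>R f x))"
  have tA: "test_fun (ball p r) ?A" by (intro test_fun_E test_fun_div_op open_domain smooth_a f)
  have tB1: "test_fun (ball p r) (\<lambda>x. of_int (k $ j) * (E (- k) x * partial (\<lambda>y. a i j y *\<^sub>R f y) i x))"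
    and tB2: "test_fun (ball p r) (\<lambda>x. of_int (k $ i) * (E (- k) x * (a i j x *\<^sub>R partial f j x)))" for i j
    by (intro test_fun_cmult test_fun_E test_fun_partial tH tG)+
  have tC1: "test_fun (ball p r) (\<lambda>x. of_int (k $ i * k $ j) * (E (- k) x * (a i j x *\<^sub>R f x)))" for i j
    by (intro test_fun_cmult test_fun_E tH)
  have tB: "test_fun (ball p r) ?B" by (intro test_fun_sum test_fun_add tB1 tB2)
  have tC: "test_fun (ball p r) ?C" by (intro test_fun_sum tC1)
  have LA: "\<Lambda> ?A = U (div_op a f) k" by (simp add: U_def)
  have LB: "\<Lambda> ?B = (\<Sum>i\<in>UNIV. \<Sum>j\<in>UNIV. of_int (k $ j) * U (partial (\<lambda>y. a i j y *\<^sub>R f y) i) k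
         + of_int (k $ i) * U (\<lambda>x. a i j x *\<^sub>R partial f j x) k)"
    by (subst sum, (intro test_fun_sum test_fun_add tB1 tB2)[1], intro sum.cong refl,
        subst sum, (intro test_fun_add tB1 tB2)[1], intro sum.cong refl, subst add[OF tB1 tB2])
      (simp only: U_def scale[OF test_fun_E[OF test_fun_partial[OF tH]]] scale[OF test_fun_E[OF tG]])
  have LC: "\<Lambda> ?C = (\<Sum>i\<in>UNIV. \<Sum>j\<in>UNIV. of_int (k $ i * k $ j) * U (\<lambda>x. a i j x *\<^sub>R f x) k)"
    by (subst sum, (intro test_fun_sum tC1)[1], intro sum.cong refl,
        subst sum, (intro tC1)[1], intro sum.cong refl) (simp only: U_def scale[OF test_fun_E[OF tH]])
  have "\<Lambda> (div_op a (\<lambda>x. E (- k) x * f x)) = \<Lambda> (\<lambda>x. (?A x - \<i> / r * ?B x) - 1 / r\<^sup>2 * ?C x)"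
    by (rule arg_cong[of _ _ \<Lambda>], rule ext, rule div_op_E_mult[OF f])
  also have "\<dots> = \<Lambda> ?A - \<i> / r * \<Lambda> ?B - 1 / r\<^sup>2 * \<Lambda> ?C"
    by (rule minus_minus_cmult[OF tA tB tC])
  finally have e: "- (\<integral>x. E (- k) x * (h x *\<^sub>R f x) \<partial>lborel) = \<Lambda> ?A - \<i> / r * \<Lambda> ?B - 1 / r\<^sup>2 * \<Lambda> ?C"
    unfolding weak[OF test_fun_E[OF f]] by simp
  have "\<Lambda> ?C = r\<^sup>2 * (\<Lambda> ?A + (\<integral>x. E (- k) x * (h x *\<^sub>R f x) \<partial>lborel)) - \<i> * r * \<Lambda> ?B"
  proof -
    have "1 / r\<^sup>2 * \<Lambda> ?C = \<Lambda> ?A - \<i> / r * \<Lambda> ?B + (\<integral>x. E (- k) x * (h x *\<^sub>R f x) \<partial>lborel)"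
      using e by (simp add: algebra_simps)
    hence "r\<^sup>2 * (1 / r\<^sup>2 * \<Lambda> ?C) = r\<^sup>2 * (\<Lambda> ?A - \<i> / r * \<Lambda> ?B + (\<integral>x. E (- k) x * (h x *\<^sub>R f x) \<partial>lborel))" by simp
    thus ?thesis using r by (simp add: algebra_simps power2_eq_square)
  qed
  thus ?thesis unfolding LA LB LC .
qed

text \<open>Multiplication by the deviation of a coefficient from its value at the centre acts on
  Fourier coefficients as convolution with \<open>c i j\<close>.\<close>

lemma coefficient_series:
  fixes f :: "real^'n \<Rightarrow> complex"
  assumes f: "test_fun (ball p r) f" and c: "(\<lambda>m. norm (c i j m)) summable_on UNIV"
  shows "((\<lambda>m. c i j m * U f (k - m)) has_sum (U (\<lambda>x. a i j x *\<^sub>R f x) k - \<alpha> i j * U f k)) UNIV"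
proof -
  let ?f = "\<lambda>x. E (- k) x * f x"
  let ?g = "\<lambda>x. E (- k) x * (a i j x *\<^sub>R f x) - \<alpha> i j * ?f x"
  have tf: "test_fun (ball p r) ?f" by (rule test_fun_E[OF f])
  have ta: "test_fun (ball p r) (\<lambda>x. E (- k) x * (a i j x *\<^sub>R f x))"
    by (rule test_fun_E[OF test_fun_scaleR[OF open_domain smooth_a f]])
  have tg: "test_fun (ball p r) ?g"
    using test_fun_add[OF ta test_fun_cmult[OF tf, of "- of_real (\<alpha> i j)"]] by simp
  have f0: "f x = 0" if "x \<notin> ball p r" for x using f that unfolding test_fun_def supported_in_def by blast
  have "?g x = trig (c i j) ((1 / r) *\<^sub>R (x - p)) * ?f x" for x
    using a_eq[of x i j] f0[of x] by (cases "x \<in> ball p r") (simp_all add: scaleR_conv_of_real algebra_simps)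
  from series[OF tf c tg this]
  have "((\<lambda>m. c i j m * U ?f (- m)) has_sum \<Lambda> ?g) UNIV" .
  moreover have "U ?f (- m) = U f (k - m)" for m
    unfolding U_def using E_add[of m "- k"] by (simp add: mult.assoc[symmetric])
  moreover have "\<Lambda> ?g = U (\<lambda>x. a i j x *\<^sub>R f x) k - \<alpha> i j * U f k"
    unfolding U_def by (subst minus[OF ta test_fun_cmult[OF tf]]) (simp only: scale[OF tf])
  ultimately show ?thesis by simp
qed

lemma lat_component_le: "\<bar>of_int (k $ i)\<bar> \<le> norm (lat k)"
  using component_le_norm_cart[of "lat k" i] by simp

section \<open>Gain of decay\<close>

text \<open>Every term on the right of \<open>key_identity\<close> is a coefficient of some
  localization, which decays of order s by hypothesis, or a coefficient of a smooth function, times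
  at most one factor k.\<close>

lemma bootstrap_rhs:
  fixes f :: "real^'n \<Rightarrow> complex"
  assumes IH: "\<And>f. test_fun (ball p r) f \<Longrightarrow> \<exists>C. \<forall>k. norm (U f k) * wt k ^ s \<le> C"
    and f: "test_fun (ball p r) f"
  shows "\<exists>C\<ge>0. \<forall>k. norm (\<Sum>i\<in>UNIV. \<Sum>j\<in>UNIV. of_int (k $ i * k $ j) * U (\<lambda>x. a i j x *\<^sub>R f x) k) * wt k ^ s \<le> C * wt k"
proof -
  have IH': "\<exists>C\<ge>0. \<forall>k. norm (U f k) * wt k ^ s \<le> C" if t: "test_fun (ball p r) f" for f
  proof -
    obtain C where C: "\<And>k. norm (U f k) * wt k ^ s \<le> C" using IH[OF t] by blast
    moreover have "0 \<le> norm (U f 0) * wt 0 ^ s" by (intro mult_nonneg_nonneg zero_le_power less_imp_le[OF wt_pos] norm_ge_zero)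
    ultimately show ?thesis using order_trans by blast
  qed
  have tH: "test_fun (ball p r) (\<lambda>y. a i j y *\<^sub>R f y)" for i j
    by (rule test_fun_scaleR[OF open_domain smooth_a f])
  have tG: "test_fun (ball p r) (\<lambda>y. a i j y *\<^sub>R partial f j y)" for i j
    by (rule test_fun_scaleR[OF open_domain smooth_a test_fun_partial[OF f]])
  obtain D1 where D1: "D1 \<ge> 0" "\<And>k. norm (U (div_op a f) k) * wt k ^ s \<le> D1"
    using IH'[OF test_fun_div_op[where a=a, OF open_domain smooth_a f]] by blast
  obtain D2' where D2': "\<And>k. norm (\<integral>x. E (- k) x * (h x *\<^sub>R f x) \<partial>lborel) * wt k ^ s \<le> D2'"
    using integral_E_decay[OF test_fun_scaleR[OF open_domain smooth_h f], of s] by blast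
  define D2 where "D2 = \<bar>D2'\<bar>"
  have D2: "D2 \<ge> 0" "norm (\<integral>x. E (- k) x * (h x *\<^sub>R f x) \<partial>lborel) * wt k ^ s \<le> D2" for k
    using D2'[of k] by (auto simp: D2_def)
  have "\<forall>i j. \<exists>C\<ge>0. \<forall>k. norm (U (partial (\<lambda>y. a i j y *\<^sub>R f y) i) k) * wt k ^ s \<le> C"
    using IH'[OF test_fun_partial[OF tH]] by blast
  then obtain D3 where D3: "\<And>i j. D3 i j \<ge> 0" "\<And>i j k. norm (U (partial (\<lambda>y. a i j y *\<^sub>R f y) i) k) * wt k ^ s \<le> D3 i j"
    by metis
  have "\<forall>i j. \<exists>C\<ge>0. \<forall>k. norm (U (\<lambda>x. a i j x *\<^sub>R partial f j x) k) * wt k ^ s \<le> C"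
    using IH'[OF tG] by blast
  then obtain D4 where D4: "\<And>i j. D4 i j \<ge> 0" "\<And>i j k. norm (U (\<lambda>x. a i j x *\<^sub>R partial f j x) k) * wt k ^ s \<le> D4 i j"
    by metis
  define C where "C = r\<^sup>2 * (D1 + D2) + r * (\<Sum>i\<in>UNIV. \<Sum>j\<in>UNIV. D3 i j + D4 i j)"
  have "C \<ge> 0" unfolding C_def using D1(1) D2(1) D3(1) D4(1) r by (intro add_nonneg_nonneg mult_nonneg_nonneg sum_nonneg) auto
  moreover have "norm (\<Sum>i\<in>UNIV. \<Sum>j\<in>UNIV. of_int (k $ i * k $ j) * U (\<lambda>x. a i j x *\<^sub>R f x) k) * wt k ^ s \<le> C * wt k" for k
  proof -
    let ?w = "wt k ^ s"
    have w: "?w \<ge> 0" using wt_pos[of k] by auto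
    have kw: "\<bar>of_int (k $ i)\<bar> \<le> wt k" for i using lat_component_le_wt[of k i] by linarith
    let ?T = "\<lambda>i j. of_int (k $ j) * U (partial (\<lambda>y. a i j y *\<^sub>R f y) i) k + of_int (k $ i) * U (\<lambda>x. a i j x *\<^sub>R partial f j x) k"
    have T: "norm (?T i j) * ?w \<le> wt k * (D3 i j + D4 i j)" for i j
    proof -
      have "norm (?T i j) * ?w \<le> (\<bar>of_int (k $ j)\<bar> * norm (U (partial (\<lambda>y. a i j y *\<^sub>R f y) i) k) 
           + \<bar>of_int (k $ i)\<bar> * norm (U (\<lambda>x. a i j x *\<^sub>R partial f j x) k)) * ?w"
        using w by (intro mult_right_mono order_trans[OF norm_triangle_ineq]) (simp_all add: norm_mult)
      also have "\<dots> = \<bar>of_int (k $ j)\<bar> * (norm (U (partial (\<lambda>y. a i j y *\<^sub>R f y) i) k) * ?w)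
           + \<bar>of_int (k $ i)\<bar> * (norm (U (\<lambda>x. a i j x *\<^sub>R partial f j x) k) * ?w)" by (simp add: algebra_simps)
      also have "\<dots> \<le> wt k * D3 i j + wt k * D4 i j"
        using w by (intro add_mono mult_mono kw D3 D4) (auto simp: wt_pos[THEN less_imp_le])
      finally show ?thesis by (simp add: algebra_simps)
    qed
    let ?A = "U (div_op a f) k + (\<integral>x. E (- k) x * (h x *\<^sub>R f x) \<partial>lborel)"
    have "norm ?A * ?w \<le> (norm (U (div_op a f) k) + norm (\<integral>x. E (- k) x * (h x *\<^sub>R f x) \<partial>lborel)) * ?w"
      using w by (intro mult_right_mono norm_triangle_ineq) auto
    also have "\<dots> \<le> (D1 + D2) * 1" using D1(2)[of k] D2(2)[of k] by (simp add: algebra_simps)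
    also have "\<dots> \<le> (D1 + D2) * wt k" using wt_ge_1 D1(1) D2(1) by (intro mult_left_mono) auto
    finally have A: "norm ?A * ?w \<le> (D1 + D2) * wt k" .
    have "norm (\<Sum>i\<in>UNIV. \<Sum>j\<in>UNIV. ?T i j) * ?w \<le> (\<Sum>i\<in>UNIV. \<Sum>j\<in>UNIV. norm (?T i j)) * ?w"
      using w by (intro mult_right_mono order_trans[OF norm_sum] sum_mono norm_sum) auto
    also have "\<dots> = (\<Sum>i\<in>UNIV. \<Sum>j\<in>UNIV. norm (?T i j) * ?w)" by (simp add: sum_distrib_right)
    also have "\<dots> \<le> (\<Sum>i\<in>UNIV. \<Sum>j\<in>UNIV. wt k * (D3 i j + D4 i j))" by (intro sum_mono T)
    finally have B: "norm (\<Sum>i\<in>UNIV. \<Sum>j\<in>UNIV. ?T i j) * ?w \<le> wt k * (\<Sum>i\<in>UNIV. \<Sum>j\<in>UNIV. D3 i j + D4 i j)"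
      by (simp add: sum_distrib_left)
    have "norm (r\<^sup>2 * ?A - \<i> * r * (\<Sum>i\<in>UNIV. \<Sum>j\<in>UNIV. ?T i j)) * ?w
        \<le> (r\<^sup>2 * norm ?A + r * norm (\<Sum>i\<in>UNIV. \<Sum>j\<in>UNIV. ?T i j)) * ?w"
      using w r by (intro mult_right_mono order_trans[OF norm_triangle_ineq4]) (simp_all add: norm_mult norm_power)
    also have "\<dots> = r\<^sup>2 * (norm ?A * ?w) + r * (norm (\<Sum>i\<in>UNIV. \<Sum>j\<in>UNIV. ?T i j) * ?w)" by (simp add: algebra_simps)
    also have "\<dots> \<le> r\<^sup>2 * ((D1 + D2) * wt k) + r * (wt k * (\<Sum>i\<in>UNIV. \<Sum>j\<in>UNIV. D3 i j + D4 i j))"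
      using A B r by (intro add_mono mult_left_mono) auto
    also have "\<dots> = C * wt k" by (simp add: C_def algebra_simps)
    finally show ?thesis unfolding key_identity[OF f] .
  qed
  ultimately show ?thesis by blast
qed

text \<open>The weight \<open>wt\<close> is truncated at \<open>T\<close> to make the supremum \<open>M\<close> finite a priori.  The perturbation then
  contributes at most half of the principal term and is absorbed, and the bound is uniform in \<open>T\<close>.\<close>

lemma bootstrap_step:
  fixes f :: "real^'n \<Rightarrow> complex"
  assumes IH: "\<And>f. test_fun (ball p r) f \<Longrightarrow> \<exists>C. \<forall>k. norm (U f k) * wt k ^ s \<le> C"
    and s: "Suc s \<le> S" and f: "test_fun (ball p r) f"
  shows "\<exists>C. \<forall>k. norm (U f k) * wt k ^ Suc s \<le> C"
proof -
  obtain C1 where C1: "C1 \<ge> 0" "\<And>k. norm (\<Sum>i\<in>UNIV. \<Sum>j\<in>UNIV. of_int (k $ i * k $ j) * U (\<lambda>x. a i j x *\<^sub>R f x) k) * wt k ^ s \<le> C1 * wt k"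
    using bootstrap_rhs[OF IH f] by blast
  obtain C0 where C0: "\<And>k. norm (U f k) * wt k ^ s \<le> C0" using IH[OF f] by blast
  \<comment> \<open>\<open>C0\<close> serves the frequency 0, where the symbol vanishes and the
    truncated weight is 1. For the others |k| is at least 1, hence \<open>wt k\<close> is at most
    2|k|, and squaring this gives the factor 4.\<close>
  define Z where "Z = max C0 (4 * C1 / lam)"
  have w1: "1 \<le> wt m ^ S" for m :: "int^'n" using wt_ge_1 by (rule one_le_power)
  have w0: "0 < wt m ^ l" for m :: "int^'n" and l by (rule zero_less_power[OF wt_pos])
  have cs: "(\<lambda>m. norm (c i j m)) summable_on UNIV" for i j
    by (rule summable_on_comparison_test[OF c_summable[of i j]]) (use w1 in \<open>auto simp: mult_le_cancel_left1\<close>)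
  have main: "wt k ^ s * min (wt k) T * norm (U f k) \<le> 2 * Z" if T: "T \<ge> 1" for T k
  proof -
    define \<omega> where "\<omega> k = wt k ^ s * min (wt k) T" for k :: "int^'n"
    have \<omega>0: "\<omega> k > 0" for k using T w0 wt_pos[of k] by (auto simp: \<omega>_def intro!: mult_pos_pos)
    define M where "M = (SUP k. \<omega> k * norm (U f k))"
    have bdd: "bdd_above (range (\<lambda>k. \<omega> k * norm (U f k)))"
    proof (rule bdd_aboveI2)
      fix k
      have "\<omega> k * norm (U f k) = min (wt k) T * (norm (U f k) * wt k ^ s)" by (simp add: \<omega>_def)
      also have "\<dots> \<le> T * (norm (U f k) * wt k ^ s)" using w0[of k s] by (intro mult_right_mono) auto
      also have "\<dots> \<le> T * C0" using T C0 by (intro mult_left_mono) auto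
      finally show "\<omega> k * norm (U f k) \<le> T * C0" .
    qed
    have M: "\<omega> k * norm (U f k) \<le> M" for k unfolding M_def by (rule cSUP_upper[OF _ bdd]) simp
    have M0: "M \<ge> 0" using M[of 0] \<omega>0[of 0] by (meson mult_nonneg_nonneg norm_ge_zero less_imp_le order_trans)
    \<comment> \<open>Peetre's inequality survives the truncation because \<open>wt m\<close> is at
      least 1. Moving the weight across the convolution costs s+1 powers of \<open>wt m\<close>,
      which the summability of order S covers.\<close>
    have shift: "\<omega> k \<le> wt m ^ S * \<omega> (k - m)" for k m
    proof -
      have "min (wt k) T \<le> wt m * min (wt (k - m)) T"
      proof (cases "wt (k - m) \<le> T")
        case True thus ?thesis using wt_diff_le[of k m] by (simp add: min_def)
      next
        case False
        have "T \<le> wt m * T" using wt_ge_1[of m] T by (simp add: mult_le_cancel_right1)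
        thus ?thesis using False by (auto simp: min_def)
      qed
      hence "\<omega> k \<le> (wt m * wt (k - m)) ^ s * (wt m * min (wt (k - m)) T)"
        unfolding \<omega>_def using wt_pos[THEN less_imp_le] T wt_diff_le[of k m] by (intro mult_mono power_mono) (auto simp: min_def)
      also have "\<dots> = wt m ^ Suc s * \<omega> (k - m)" by (simp add: \<omega>_def power_mult_distrib mult_ac)
      also have "\<dots> \<le> wt m ^ S * \<omega> (k - m)"
        using \<omega>0[of "k - m"] s wt_ge_1[of m] by (intro mult_right_mono power_increasing) auto
      finally show ?thesis .
    qed
    define e where "e i j = (\<Sum>\<^sub>\<infinity>m. norm (c i j m) * wt m ^ S)" for i j
    have conv: "\<omega> k * norm (U (\<lambda>x. a i j x *\<^sub>R f x) k - \<alpha> i j * U f k) \<le> e i j * M" for i j k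
    proof -
      have 1: "((\<lambda>m. of_real (\<omega> k) * (c i j m * U f (k - m))) has_sum (of_real (\<omega> k) * (U (\<lambda>x. a i j x *\<^sub>R f x) k - \<alpha> i j * U f k))) UNIV"
        by (rule has_sum_cmult_right[OF coefficient_series[OF f cs]])
      have 2: "((\<lambda>m. norm (c i j m) * wt m ^ S * M) has_sum (e i j * M)) UNIV"
        unfolding e_def by (rule has_sum_cmult_left[OF has_sum_infsum[OF c_summable]])
      have "norm (of_real (\<omega> k) * (U (\<lambda>x. a i j x *\<^sub>R f x) k - \<alpha> i j * U f k)) \<le> e i j * M"
      proof (rule norm_infsum_le[OF 1 2])
        fix m
        have "norm (of_real (\<omega> k) * (c i j m * U f (k - m))) = norm (c i j m) * (\<omega> k * norm (U f (k - m)))"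
          using \<omega>0[of k] by (simp add: norm_mult)
        also have "\<dots> \<le> norm (c i j m) * (wt m ^ S * \<omega> (k - m) * norm (U f (k - m)))"
          by (intro mult_left_mono mult_right_mono shift) auto
        also have "\<dots> \<le> norm (c i j m) * (wt m ^ S * M)"
          using M[of "k - m"] w0[of m S] by (intro mult_left_mono) (auto simp: mult.assoc)
        finally show "norm (of_real (\<omega> k) * (c i j m * U f (k - m))) \<le> norm (c i j m) * wt m ^ S * M" by (simp add: mult.assoc)
      qed
      thus ?thesis using \<omega>0[of k] by (simp add: norm_mult)
    qed
    have bound: "\<omega> k * norm (U f k) \<le> Z + M / 2" for k
    proof (cases "k = 0")
      case True
      have "\<omega> k * norm (U f k) \<le> C0" using C0[of k] T True by (simp add: \<omega>_def wt_def)
      thus ?thesis using M0 by (simp add: Z_def)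
    next
      case False
      let ?n = "norm (lat k)"
      obtain i where "k $ i \<noteq> 0" using False by (auto simp: vec_eq_iff)
      hence "1 \<le> \<bar>real_of_int (k $ i)\<bar>" by linarith
      hence n1: "1 \<le> ?n" using lat_component_le[of k i] by linarith
      let ?q = "\<Sum>i\<in>UNIV. \<Sum>j\<in>UNIV. \<alpha> i j * of_int (k $ i) * of_int (k $ j)"
      let ?R = "\<Sum>i\<in>UNIV. \<Sum>j\<in>UNIV. of_int (k $ i * k $ j) * U (\<lambda>x. a i j x *\<^sub>R f x) k"
      let ?V = "\<lambda>i j. U (\<lambda>x. a i j x *\<^sub>R f x) k - \<alpha> i j * U f k"
      have q: "lam * ?n\<^sup>2 \<le> ?q" using elliptic[of "lat k"] by simp
      \<comment> \<open>The coefficients are replaced by their values at the centre;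
        \<open>?V\<close> collects the error, which is a convolution with small total mass.\<close>
      have "of_real ?q * U f k = ?R - (\<Sum>i\<in>UNIV. \<Sum>j\<in>UNIV. of_int (k $ i * k $ j) * ?V i j)"
        by (simp add: sum_subtractf[symmetric] sum_distrib_left algebra_simps)
      hence "norm (of_real ?q * U f k) \<le> norm ?R + norm (\<Sum>i\<in>UNIV. \<Sum>j\<in>UNIV. of_int (k $ i * k $ j) * ?V i j)"
        by (simp only: norm_triangle_ineq4)
      also have "\<dots> \<le> norm ?R + (\<Sum>i\<in>UNIV. \<Sum>j\<in>UNIV. norm (of_int (k $ i * k $ j) * ?V i j))"
        by (intro add_left_mono order_trans[OF norm_sum] sum_mono norm_sum)
      also have "\<dots> \<le> norm ?R + (\<Sum>i\<in>UNIV. \<Sum>j\<in>UNIV. ?n\<^sup>2 * norm (?V i j))"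
      proof (intro add_left_mono sum_mono)
        fix i j
        have "\<bar>real_of_int (k $ i)\<bar> * \<bar>real_of_int (k $ j)\<bar> \<le> ?n * ?n" by (intro mult_mono lat_component_le) auto
        hence "\<bar>real_of_int (k $ i)\<bar> * \<bar>real_of_int (k $ j)\<bar> * norm (?V i j) \<le> ?n\<^sup>2 * norm (?V i j)"
          by (intro mult_right_mono) (auto simp: power2_eq_square)
        thus "norm (of_int (k $ i * k $ j) * ?V i j) \<le> ?n\<^sup>2 * norm (?V i j)" by (simp add: norm_mult)
      qed
      finally have "lam * ?n\<^sup>2 * norm (U f k) \<le> norm ?R + ?n\<^sup>2 * (\<Sum>i\<in>UNIV. \<Sum>j\<in>UNIV. norm (?V i j))"
        using mult_right_mono[OF order_trans[OF q abs_ge_self], of "norm (U f k)"]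
        by (simp add: norm_mult sum_distrib_left del: of_real_sum of_real_mult)
      hence "\<omega> k * (lam * ?n\<^sup>2 * norm (U f k)) \<le> \<omega> k * (norm ?R + ?n\<^sup>2 * (\<Sum>i\<in>UNIV. \<Sum>j\<in>UNIV. norm (?V i j)))"
        using \<omega>0[of k] by (intro mult_left_mono) auto
      also have "\<dots> = \<omega> k * norm ?R + ?n\<^sup>2 * (\<Sum>i\<in>UNIV. \<Sum>j\<in>UNIV. \<omega> k * norm (?V i j))"
        by (simp add: algebra_simps sum_distrib_left)
      also have "\<dots> \<le> C1 * (4 * ?n\<^sup>2) + ?n\<^sup>2 * (lam / 2 * M)"
      proof (intro add_mono mult_left_mono)
        have "\<omega> k * norm ?R = min (wt k) T * (norm ?R * wt k ^ s)" by (simp add: \<omega>_def)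
        also have "\<dots> \<le> wt k * (C1 * wt k)" using wt_pos[of k] w0[of k s]
          by (intro mult_mono[OF _ C1(2)] mult_nonneg_nonneg) auto
        also have "\<dots> = C1 * (wt k)\<^sup>2" by (simp add: power2_eq_square)
        also have "\<dots> \<le> C1 * (2 * ?n)\<^sup>2"
          using n1 C1(1) wt_pos[of k] by (intro mult_left_mono power_mono) (auto simp: wt_def)
        finally show "\<omega> k * norm ?R \<le> C1 * (4 * ?n\<^sup>2)" by (simp add: power_mult_distrib)
        have "(\<Sum>i\<in>UNIV. \<Sum>j\<in>UNIV. \<omega> k * norm (?V i j)) \<le> (\<Sum>i\<in>UNIV. \<Sum>j\<in>UNIV. e i j * M)"
          by (intro sum_mono conv)
        also have "\<dots> = (\<Sum>i\<in>UNIV. \<Sum>j\<in>UNIV. e i j) * M" by (simp add: sum_distrib_right)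
        also have "\<dots> \<le> lam / 2 * M" using c_small M0 unfolding e_def by (intro mult_right_mono) auto
        finally show "(\<Sum>i\<in>UNIV. \<Sum>j\<in>UNIV. \<omega> k * norm (?V i j)) \<le> lam / 2 * M" .
      qed simp
      finally have "lam * ?n\<^sup>2 * (\<omega> k * norm (U f k)) \<le> lam * ?n\<^sup>2 * (4 * C1 / lam + M / 2)"
        using lam by (simp add: algebra_simps)
      moreover have "lam * ?n\<^sup>2 > 0" using lam n1 by (intro mult_pos_pos) auto
      ultimately have "\<omega> k * norm (U f k) \<le> 4 * C1 / lam + M / 2" by (simp only: mult_le_cancel_left_pos)
      thus ?thesis by (simp add: Z_def)
    qed
    \<comment> \<open>The supremum is finite by truncation, so half of it may be subtracted, leaving
      M at most 2 Z with no dependence on T.\<close>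
    have "M \<le> Z + M / 2" unfolding M_def by (rule cSUP_least) (use bound in \<open>auto simp: M_def\<close>)
    thus ?thesis using M[of k] unfolding \<omega>_def by linarith
  qed
  \<comment> \<open>For each k the truncation level is taken to be \<open>wt k\<close> itself, where
    it has no effect.\<close>
  have "norm (U f k) * wt k ^ Suc s \<le> 2 * Z" for k
    using main[of "wt k" k] wt_ge_1[of k] by (simp add: mult_ac)
  thus ?thesis by blast
qed

lemma U_decay:
  assumes "s \<le> S" "test_fun (ball p r) f"
  shows "\<exists>C. \<forall>k. norm (U f k) * wt k ^ s \<le> C"
  using assms
proof (induction s arbitrary: f)
  case 0
  thus ?case using U_bounded by simp
next
  case (Suc s)
  show ?case by (rule bootstrap_step[OF _ Suc.prems]) (use Suc in auto)
qed

end

section \<open>From decay to a density\<close>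

context frozen_coefficients
begin

text \<open>Of the required decay, 2n powers make the series absolutely summable and 2 more pay for
  two derivatives. The density is the Fourier series of the localized distribution, and the identity
  is Parseval's relation, obtained by expanding the test function g.\<close>

lemma local_density:
  assumes S: "2 * CARD('n) + 2 \<le> S" and f: "test_fun (ball p r) f"
  shows "\<exists>v. C_k_on 2 UNIV v \<and> (\<forall>g. test_fun (ball p r) g \<longrightarrow> \<Lambda> (\<lambda>x. g x * f x) = (\<integral>x. v x * g x \<partial>lborel))"
proof -
  obtain C where C: "\<And>k. norm (U f k) * wt k ^ (2 * CARD('n) + 2) \<le> C" using U_decay[OF S f] by blast
  have "(\<lambda>k. norm (of_real (wt k ^ 2) * U f k)) summable_on UNIV"
  proof (rule summable_decay)
    show "norm (of_real (wt k ^ 2) * U f k) * wt k ^ (2 * CARD('n)) \<le> C" for k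
      using C[of k] wt_pos[of k] by (simp add: norm_mult power_add power2_eq_square mult_ac del: of_real_power)
  qed
  hence sum2: "(\<lambda>k. norm (U f k) * wt k ^ 2) summable_on UNIV"
    by (rule summable_on_cong[THEN iffD1, rotated]) (use wt_pos[THEN less_imp_le] in \<open>simp add: norm_mult mult.commute del: of_real_power\<close>)
  have sum0: "(\<lambda>k. norm (U f k)) summable_on UNIV"
    by (rule summable_on_comparison_test[OF sum2]) (use one_le_power[OF wt_ge_1, where n=2] in \<open>auto simp: mult_le_cancel_left1\<close>)
  \<comment> \<open>The factor r^n comes from the affine change of variables and (2 pi)^n from the
    normalisation of \<open>fcoef\<close>.\<close>
  define v where "v x = 1 / (2 * pi * r) ^ CARD('n) * trig (U f) ((1 / r) *\<^sub>R (x - p))" for x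
  have aff: "C_k_on 2 UNIV (\<lambda>x. (1 / r) *\<^sub>R (x - p))"
    by (intro C_k_on_scaleR C_k_on_diff C_k_on_const C_k_on_bounded_linear[OF _ bounded_linear_ident]) auto
  have v: "C_k_on 2 UNIV v" unfolding v_def
    by (intro C_k_on_mult C_k_on_const open_UNIV C_k_on_compose[OF open_UNIV aff C_k_on_trig[OF sum2]]) auto
  have "\<Lambda> (\<lambda>x. g x * f x) = (\<integral>x. v x * g x \<partial>lborel)" if g: "test_fun (ball p r) g" for g
  proof -
    let ?g = "\<lambda>y. g (p + r *\<^sub>R y)"
    have tg: "test_fun (ball 0 1) ?g" by (rule test_fun_affine[OF g r])
    have tg': "test_fun ocube ?g" by (rule test_fun_mono[OF tg ball_subset_ocube(1)])
    have f0: "f x = 0" if "x \<notin> ball p r" for x using f that unfolding test_fun_def supported_in_def by blast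
    have eq: "g x * f x = trig (fcoef ?g) ((1 / r) *\<^sub>R (x - p)) * f x" for x
    proof (cases "x \<in> ball p r")
      case True
      have "norm (x - p) / r < 1" using True r by (simp add: dist_norm norm_minus_commute divide_less_eq)
      hence "(1 / r) *\<^sub>R (x - p) \<in> ball 0 1" using r by simp
      hence "trig (fcoef ?g) ((1 / r) *\<^sub>R (x - p)) = ?g ((1 / r) *\<^sub>R (x - p))"
        using fourier_inversion[OF tg'] ball_subset_ocube(1) by blast
      thus ?thesis using r by simp
    qed (simp add: f0)
    have tgf: "test_fun (ball p r) (\<lambda>x. g x * f x)"
      by (rule test_fun_mult[OF open_domain test_fun_smooth_on[OF g] f])
    have 1: "((\<lambda>m. fcoef ?g m * U f (- m)) has_sum \<Lambda> (\<lambda>x. g x * f x)) UNIV"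
      by (rule series[OF f fcoef_summable[OF tg open_ball] tgf eq])
    have meas: "(\<lambda>x. v x * g x) \<in> borel_measurable borel"
      by (intro borel_measurable_continuous_onI continuous_intros C_k_on_continuous[OF v] test_fun_continuous[OF g])
    have int: "integrable lborel ?g"
      by (rule integrable_supported[OF test_fun_continuous[OF tg, of UNIV]]) (use tg in \<open>auto simp: test_fun_def supported_in_def\<close>)
    have "(\<integral>x. v x * g x \<partial>lborel) = of_real (r ^ CARD('n)) * (\<integral>y. 1 / (2 * pi * r) ^ CARD('n) * (trig (U f) y * ?g y) \<partial>lborel)"
      unfolding integral_affine[OF meas r, of p] using r by (simp add: v_def scaleR_conv_of_real[where 'a=complex] mult.assoc)
    also have "\<dots> = 1 / (2 * pi) ^ CARD('n) * (\<integral>y. trig (U f) y * ?g y \<partial>lborel)"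
      using r by (simp add: power_mult_distrib)
    finally have 2: "(\<integral>x. v x * g x \<partial>lborel) = \<dots>" .
    have "((\<lambda>k. 1 / (2 * pi) ^ CARD('n) * (U f k * (\<integral>y. ek k y * ?g y \<partial>lborel))) has_sum (\<integral>x. v x * g x \<partial>lborel)) UNIV"
      unfolding 2 by (rule has_sum_cmult_right[OF trig_integral[OF sum0 int]])
    moreover have "1 / (2 * pi) ^ CARD('n) * (U f k * (\<integral>y. ek k y * ?g y \<partial>lborel)) = fcoef ?g (- k) * U f k" for k
      by (simp add: fcoef_def)
    ultimately have "((\<lambda>k. fcoef ?g (- k) * U f k) has_sum (\<integral>x. v x * g x \<partial>lborel)) UNIV" by simp
    \<comment> \<open>Expanding g and expanding v produce the same sum up to the reflection of the
      lattice.\<close>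
    moreover have "bij_betw uminus UNIV (UNIV :: (int^'n) set)" by (simp add: bij_uminus)
    ultimately have "((\<lambda>m. fcoef ?g m * U f (- m)) has_sum (\<integral>x. v x * g x \<partial>lborel)) UNIV"
      using has_sum_reindex_bij_betw[of uminus UNIV UNIV "\<lambda>k. fcoef ?g (- k) * U f k"] by simp
    thus ?thesis using 1 has_sum_unique by blast
  qed
  thus ?thesis using v by blast
qed

end

section \<open>Freezing the coefficients at a point\<close>

lemma distribution_mono:
  assumes "distribution W \<Lambda>" "open V" "V \<subseteq> W"
  shows "distribution V \<Lambda>"
proof -
  interpret distribution W \<Lambda> by (rule assms(1))
  note m = test_fun_mono[OF _ assms(3)]
  show ?thesis
  proof
    show "\<Lambda> (\<lambda>x. f x + g x) = \<Lambda> f + \<Lambda> g" if "test_fun V f" "test_fun V g" for f g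
      by (rule add[OF m m]) (fact that)+
    show "\<Lambda> (\<lambda>x. c * f x) = c * \<Lambda> f" if "test_fun V f" for f c
      by (rule scale[OF m[OF that]])
    show "\<exists>C. \<forall>f B. test_fun V f \<longrightarrow> (\<forall>x. x \<notin> K \<longrightarrow> f x = 0) \<longrightarrow> (\<forall>x. norm (f x) \<le> B) \<longrightarrow> norm (\<Lambda> f) \<le> C * B"
      if "compact K" "K \<subseteq> V" for K
      using order_0[OF that(1), OF order_trans[OF that(2) assms(3)]] m by meson
  qed (fact assms(2))
qed

lemma quadratic_form_lower_bound:
  fixes A :: "'n::finite \<Rightarrow> 'n \<Rightarrow> real"
  assumes "\<And>\<xi>::real^'n. \<xi> \<noteq> 0 \<Longrightarrow> (\<Sum>i\<in>UNIV. \<Sum>j\<in>UNIV. A i j * \<xi> $ i * \<xi> $ j) > 0"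
  shows "\<exists>lam>0. \<forall>\<xi>::real^'n. lam * (norm \<xi>)\<^sup>2 \<le> (\<Sum>i\<in>UNIV. \<Sum>j\<in>UNIV. A i j * \<xi> $ i * \<xi> $ j)"
proof -
  let ?q = "\<lambda>\<xi>::real^'n. \<Sum>i\<in>UNIV. \<Sum>j\<in>UNIV. A i j * \<xi> $ i * \<xi> $ j"
  have cp: "compact (sphere (0::real^'n) 1)" and ne: "sphere (0::real^'n) 1 \<noteq> {}" by auto
  have "continuous_on (sphere (0::real^'n) 1) ?q" by (intro continuous_intros)
  from continuous_attains_inf[OF cp ne this] obtain x where x: "x \<in> sphere 0 1" "\<And>y. y \<in> sphere 0 1 \<Longrightarrow> ?q x \<le> ?q y"
    by blast
  have "?q x * (norm \<xi>)\<^sup>2 \<le> ?q \<xi>" for \<xi>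
  proof (cases "\<xi> = 0")
    case False
    let ?s = "norm \<xi>"
    have "(1 / ?s) *\<^sub>R \<xi> \<in> sphere 0 1" using False by simp
    hence "?q x \<le> ?q ((1 / ?s) *\<^sub>R \<xi>)" by (rule x(2))
    also have "\<dots> = (1 / ?s)\<^sup>2 * ?q \<xi>" by (simp add: sum_distrib_left power2_eq_square mult_ac)
    finally show ?thesis using False by (simp add: power_divide field_simps)
  qed simp
  moreover have "?q x > 0" using x(1) by (intro assms) auto
  ultimately show ?thesis by blast
qed

text \<open>The radius r is chosen so small that, after rescaling the ball to unit size, the
  variation of the coefficients has weighted Fourier norm at most half the ellipticity constant at
  p. The density then comes from a localization that equals 1 on the half ball.\<close>

theorem elliptic_regularity:
  fixes a :: "'n::finite \<Rightarrow> 'n \<Rightarrow> real^'n \<Rightarrow> real" and h :: "real^'n \<Rightarrow> real"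
  assumes dist: "distribution W \<Lambda>" and a: "\<And>i j. smooth_on W (a i j)" and h: "smooth_on W h"
    and pos: "\<And>x \<xi>. x \<in> W \<Longrightarrow> \<xi> \<noteq> 0 \<Longrightarrow> (\<Sum>i\<in>UNIV. \<Sum>j\<in>UNIV. a i j x * \<xi> $ i * \<xi> $ j) > 0"
    and weak: "\<And>f :: real^'n \<Rightarrow> complex. test_fun W f \<Longrightarrow> \<Lambda> (div_op a f) = - (\<integral>x. h x *\<^sub>R f x \<partial>lborel)"
    and p: "p \<in> W"
  shows "\<exists>\<rho>>0. ball p \<rho> \<subseteq> W \<and> (\<exists>v. C_k_on 2 UNIV v \<and> (\<forall>f. test_fun (ball p \<rho>) f \<longrightarrow> \<Lambda> f = (\<integral>x. v x * f x \<partial>lborel)))"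
proof -
  interpret distribution W \<Lambda> by (rule dist)
  obtain lam where lam: "lam > 0" "\<And>\<xi>::real^'n. lam * (norm \<xi>)\<^sup>2 \<le> (\<Sum>i\<in>UNIV. \<Sum>j\<in>UNIV. a i j p * \<xi> $ i * \<xi> $ j)"
    using quadratic_form_lower_bound[of "\<lambda>i j. a i j p", OF pos[OF p]] by blast
  obtain R where R: "R > 0" "cball p R \<subseteq> W" using open_domain p open_contains_cball by blast
  \<comment> \<open>Makes the coefficients globally smooth without changing them near p, so that
    they can be evaluated at p + s y for all s and y.\<close>
  obtain cut :: "real^'n \<Rightarrow> real" where cut: "test_fun UNIV cut" "\<And>x. x \<in> cball p (R / 2) \<Longrightarrow> cut x = 1" "\<And>x. x \<notin> ball p R \<Longrightarrow> cut x = 0"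
    using cutoff_exists[of "R / 2" R p] R(1) by auto
  \<comment> \<open>Equal to 1 on the rescaled ball, and supported within radius 2 < pi, hence
    inside the open cube where Fourier inversion holds.\<close>
  obtain \<zeta> :: "real^'n \<Rightarrow> real" where \<zeta>: "test_fun UNIV \<zeta>" "\<And>x. x \<in> cball 0 1 \<Longrightarrow> \<zeta> x = 1" "\<And>x. x \<notin> ball 0 2 \<Longrightarrow> \<zeta> x = 0"
    using cutoff_exists[of 1 2 "0 :: real^'n"] by auto
  have cutW: "test_fun W cut" 
    using cut(1,3) R(2) unfolding test_fun_def supported_in_def by (meson ball_subset_cball compact_cball subsetD)
  define b where "b i j x = a i j x * cut x" for i j x
  have b: "test_fun W (b i j)" for i j unfolding b_def[abs_def] by (rule test_fun_mult[OF open_domain a cutW])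
  have ba: "b i j x = a i j x" if "x \<in> cball p (R / 2)" for i j x using cut(2)[OF that] by (simp add: b_def)
  \<comment> \<open>The oscillation about p as a function of the scale and the rescaled variable
    jointly; at scale 0 it vanishes identically, which is why its coefficients become small.\<close>
  define G :: "'n \<Rightarrow> 'n \<Rightarrow> real \<times> (real^'n) \<Rightarrow> complex" where
    "G i j z = of_real (\<zeta> (snd z) * (b i j (p + fst z *\<^sub>R snd z) - b i j p))" for i j z
  have sm: "smooth_on UNIV (\<lambda>z::real \<times> (real^'n). p + fst z *\<^sub>R snd z)"
    by (intro smooth_on_add smooth_on_scaleR smooth_on_const smooth_on_linear bounded_linear_fst bounded_linear_snd open_UNIV)
  have G: "smooth_on UNIV (G i j)" for i j
    unfolding G_def[abs_def]
    by (intro smooth_on_compose_linear[OF _ _ bounded_linear_of_real] smooth_on_mult smooth_on_diff smooth_on_const open_UNIV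
      smooth_on_compose[OF open_UNIV smooth_on_linear[OF open_UNIV bounded_linear_snd] test_fun_smooth_on[OF \<zeta>(1)]]
      smooth_on_compose[OF open_UNIV sm test_fun_smooth_on[OF b]]) auto
  have G0: "G i j (s, y) = 0" if "y \<notin> cball 0 2" for i j s y using that \<zeta>(3)[of y] by (simp add: G_def)
  have G1: "G i j (0, y) = 0" for i j y by (simp add: G_def)
  define S where "S = 2 * CARD('n) + 2"
  define Z where "Z = (\<Sum>\<^sub>\<infinity>k::int^'n. 1 / wt k ^ (2 * CARD('n)))"
  have Z: "Z \<ge> 0" unfolding Z_def using wt_pos by (intro infsum_nonneg) (simp add: less_imp_le)
  \<comment> \<open>There are n^2 coefficients and each has weighted norm at most \<epsilon> Z, so
    the total is at most lam/2; \<open>Z + 1\<close> guarantees a positive denominator.\<close>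
  define \<epsilon> where "\<epsilon> = lam / 2 / ((real CARD('n))\<^sup>2 * (Z + 1))"
  have \<epsilon>: "\<epsilon> > 0" using lam(1) Z unfolding \<epsilon>_def by (intro divide_pos_pos mult_pos_pos) auto
  \<comment> \<open>The extra 2n powers are spent on summing over the lattice, leaving the weight
    \<open>wt ^ S\<close> in the sum.\<close>
  have "\<forall>i j. \<exists>\<delta>>0. \<forall>s k. \<bar>s\<bar> < \<delta> \<longrightarrow> norm (fcoef (\<lambda>y. G i j (s, y)) k) * wt k ^ (S + 2 * CARD('n)) \<le> \<epsilon>"
    using slice_coefficients_small[OF compact_cball \<epsilon> G G0 G1] by blast
  then obtain d where d: "\<And>i j. d i j > 0" 
    "\<And>i j s k. \<bar>s\<bar> < d i j \<Longrightarrow> norm (fcoef (\<lambda>y. G i j (s, y)) k) * wt k ^ (S + 2 * CARD('n)) \<le> \<epsilon>"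
    by metis
  \<comment> \<open>At most R/2, so that the cut-off coefficients agree with the original ones on
    the ball, and below all thresholds \<open>d i j\<close>.\<close>
  define r where "r = Min (insert (R / 2) (range (\<lambda>(i, j). d i j / 2)))"
  have r0: "r > 0" unfolding r_def using d(1) R(1) by (subst Min_gr_iff) auto
  have rR: "r \<le> R / 2" unfolding r_def by (rule Min_le) auto
  have rd: "\<bar>r\<bar> < d i j" for i j
  proof -
    have "r \<le> d i j / 2" unfolding r_def by (rule Min_le) (auto intro!: image_eqI[of _ _ "(i, j)"])
    thus ?thesis using d(1)[of i j] r0 by linarith
  qed
  have rW: "ball p r \<subseteq> W" using R rR by (auto intro!: subsetD[OF R(2)])
  define c where "c i j = fcoef (\<lambda>y. G i j (r, y))" for i j
  have cb: "norm (c i j m) * wt m ^ S \<le> \<epsilon> * (1 / wt m ^ (2 * CARD('n)))" for i j m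
    using d(2)[OF rd, of i j m] wt_pos[of m] by (simp add: c_def power_add field_simps)
  have es: "(\<lambda>m::int^'n. \<epsilon> * (1 / wt m ^ (2 * CARD('n)))) summable_on UNIV"
    by (rule summable_on_cmult_right[OF summable_wt])
  have cs: "(\<lambda>m. norm (c i j m) * wt m ^ S) summable_on UNIV" for i j
    by (rule summable_on_comparison_test[OF es cb]) (intro mult_nonneg_nonneg zero_le_power less_imp_le[OF wt_pos] norm_ge_zero)
  have "frozen_coefficients p r \<Lambda> a h (\<lambda>i j. a i j p) c lam S"
  proof (intro frozen_coefficients.intro frozen_coefficients_axioms.intro)
    show "distribution (ball p r) \<Lambda>" by (rule distribution_mono[OF dist open_ball rW])
    show "r > 0" by (rule r0)
    show "smooth_on (ball p r) (a i j)" for i j by (rule smooth_on_subset[OF a rW])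
    show "smooth_on (ball p r) h" by (rule smooth_on_subset[OF h rW])
    show "\<Lambda> (div_op a f) = - (\<integral>x. h x *\<^sub>R f x \<partial>lborel)" if "test_fun (ball p r) f" for f :: "real^'n \<Rightarrow> complex"
      by (rule weak[OF test_fun_mono[OF that rW]])
    show "complex_of_real (a i j x) = of_real (a i j p) + trig (c i j) ((1 / r) *\<^sub>R (x - p))" if x: "x \<in> ball p r" for i j x
    proof -
      let ?y = "(1 / r) *\<^sub>R (x - p)"
      have "norm (x - p) / r < 1" using x r0 by (simp add: dist_norm norm_minus_commute divide_less_eq)
      hence y: "?y \<in> ball 0 1" using r0 by simp
      have t: "test_fun ocube (\<lambda>y. G i j (r, y))"
        unfolding test_fun_def supported_in_def
        by (intro conjI test_fun_smooth_on[OF slice_test_fun[OF compact_cball G G0]] exI[of _ "cball 0 2"]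
            compact_cball ball_subset_ocube(2) allI impI G0)
      have "trig (c i j) ?y = G i j (r, ?y)" unfolding c_def
        by (rule fourier_inversion[OF t]) (use y ball_subset_ocube(1) in blast)
      also have "\<dots> = of_real (a i j x - a i j p)"
        using y r0 x rR R(1) \<zeta>(2)[of ?y] by (simp add: G_def ba)
      finally show ?thesis by simp
    qed
    show "lam > 0" by (rule lam(1))
    show "lam * (norm \<xi>)\<^sup>2 \<le> (\<Sum>i\<in>UNIV. \<Sum>j\<in>UNIV. a i j p * \<xi> $ i * \<xi> $ j)" for \<xi> by (rule lam(2))
    show "(\<lambda>m. norm (c i j m) * wt m ^ S) summable_on UNIV" for i j by (rule cs)
    have "(\<Sum>\<^sub>\<infinity>m. norm (c i j m) * wt m ^ S) \<le> \<epsilon> * Z" for i j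
      unfolding Z_def infsum_cmult_right'[symmetric] by (rule infsum_mono[OF cs es cb])
    hence "(\<Sum>i\<in>UNIV. \<Sum>j\<in>UNIV. \<Sum>\<^sub>\<infinity>m. norm (c i j m) * wt m ^ S) \<le> (\<Sum>i\<in>(UNIV::'n set). \<Sum>j\<in>(UNIV::'n set). \<epsilon> * Z)"
      by (intro sum_mono)
    also have "\<dots> = (real CARD('n))\<^sup>2 * Z * \<epsilon>" by (simp add: power2_eq_square)
    also have "\<dots> \<le> (real CARD('n))\<^sup>2 * (Z + 1) * \<epsilon>" using \<epsilon> by (intro mult_right_mono mult_left_mono) auto
    also have "\<dots> = lam / 2" unfolding \<epsilon>_def times_divide_eq_right[of _ "lam / 2"] by (rule nonzero_mult_div_cancel_left) (use Z in \<open>simp add: add_nonneg_eq_0_iff\<close>)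
    finally show "(\<Sum>i\<in>UNIV. \<Sum>j\<in>UNIV. \<Sum>\<^sub>\<infinity>m. norm (c i j m) * wt m ^ S) \<le> lam / 2" .
  qed
  then interpret frozen_coefficients p r \<Lambda> a h "\<lambda>i j. a i j p" c lam S .
  \<comment> \<open>Multiplication by this cutoff does not change test functions of the half ball,
    so the density of the localization represents the functional itself there.\<close>
  obtain \<eta> :: "real^'n \<Rightarrow> real" where \<eta>: "test_fun UNIV \<eta>" "\<And>x. x \<in> cball p (r / 2) \<Longrightarrow> \<eta> x = 1" "\<And>x. x \<notin> ball p (3 * r / 4) \<Longrightarrow> \<eta> x = 0"
    using cutoff_exists[of "r / 2" "3 * r / 4" p] r0 by auto
  have \<eta>': "test_fun (ball p r) (\<lambda>x. complex_of_real (\<eta> x))"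
    unfolding test_fun_def supported_in_def
  proof (intro conjI exI[of _ "cball p (3 * r / 4)"] allI impI)
    show "smooth_on UNIV (\<lambda>x. complex_of_real (\<eta> x))"
      by (rule smooth_on_compose_linear[OF open_UNIV test_fun_smooth_on[OF \<eta>(1)] bounded_linear_of_real])
    show "complex_of_real (\<eta> x) = 0" if "x \<notin> cball p (3 * r / 4)" for x using \<eta>(3)[of x] that by simp
  qed (use r0 in auto)
  obtain v where v: "C_k_on 2 UNIV v" "\<And>g. test_fun (ball p r) g \<Longrightarrow> \<Lambda> (\<lambda>x. g x * of_real (\<eta> x)) = (\<integral>x. v x * g x \<partial>lborel)"
    using local_density[OF _ \<eta>'] by (auto simp: S_def)
  have "\<Lambda> f = (\<integral>x. v x * f x \<partial>lborel)" if f: "test_fun (ball p (r / 2)) f" for f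
  proof -
    have f0: "f x = 0" if "x \<notin> ball p (r / 2)" for x using f that unfolding test_fun_def supported_in_def by blast
    have fe: "f x * of_real (\<eta> x) = f x" for x using f0[of x] \<eta>(2)[of x] by (cases "x \<in> ball p (r / 2)") auto
    have "test_fun (ball p r) f" by (rule test_fun_mono[OF f]) (use r0 in auto)
    from v(2)[OF this] show ?thesis by (simp only: fe)
  qed
  moreover have "ball p (r / 2) \<subseteq> W" using rW r0 by (auto intro!: subsetD[OF rW])
  ultimately show ?thesis using v(1) r0 by (intro exI[of _ "r / 2"]) auto
qed

section \<open>Change of variables\<close>

text \<open>The change of variables theorem of the library requires a well-ordered index type, so an
  arbitrary finite index type is replaced by an initial segment of the natural numbers.\<close>

typedef ('n::finite) rank = "{..<CARD('n)}"
  by (rule exI[of _ 0]) simp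

instantiation rank :: (finite) linorder
begin
definition "x \<le> y \<longleftrightarrow> Rep_rank x \<le> Rep_rank y"
definition "x < y \<longleftrightarrow> Rep_rank x < Rep_rank y"
instance
proof
  fix x y z :: "'a rank"
  show "x < y \<longleftrightarrow> x \<le> y \<and> \<not> y \<le> x" unfolding less_eq_rank_def less_rank_def by linarith
  show "x \<le> x" unfolding less_eq_rank_def by simp
  show "x \<le> y \<Longrightarrow> y \<le> z \<Longrightarrow> x \<le> z" unfolding less_eq_rank_def by simp
  show "x \<le> y \<Longrightarrow> y \<le> x \<Longrightarrow> x = y" unfolding less_eq_rank_def by (simp add: Rep_rank_inject[symmetric])
  show "x \<le> y \<or> y \<le> x" unfolding less_eq_rank_def by linarith
qed
end

instance rank :: (finite) wellorder
proof
  fix P :: "'a rank \<Rightarrow> bool" and a assume step: "\<And>x. (\<And>y. y < x \<Longrightarrow> P y) \<Longrightarrow> P x"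
  show "P a"
  proof (induction a rule: measure_induct_rule[of Rep_rank])
    case (less x)
    show ?case by (rule step) (rule less, simp add: less_rank_def)
  qed
qed

lemma card_rank: "card (UNIV :: 'n rank set) = CARD('n::finite)" and finite_rank: "finite (UNIV :: 'n rank set)"
proof -
  have "x \<in> Abs_rank ` {..<CARD('n)}" for x :: "'n rank"
    by (rule Abs_rank_cases[of x]) auto
  hence U: "(UNIV :: 'n rank set) = Abs_rank ` {..<CARD('n)}" by blast
  have inj: "inj_on (Abs_rank :: nat \<Rightarrow> 'n rank) {..<CARD('n)}"
    by (rule inj_onI) (simp add: Abs_rank_inject)
  show "card (UNIV :: 'n rank set) = CARD('n)" by (subst U, subst card_image[OF inj]) simp
  show "finite (UNIV :: 'n rank set)" by (subst U) simp
qed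

instance rank :: (finite) finite
  by standard (rule finite_rank)

text \<open>Conjugation with e matches the permutations of the two index types and preserves the
  sign.\<close>

lemma det_reindex:
  fixes A :: "real^'n^'n" and e :: "'m::finite \<Rightarrow> 'n::finite"
  assumes e: "bij e"
  shows "det (\<chi> i j. A $ e i $ e j) = det A"
proof -
  have inv: "bij (inv e)" "e \<circ> inv e = id" "inv e \<circ> e = id"
    using e bij_imp_bij_inv[OF e] bij_is_surj[OF e] bij_is_inj[OF e] by (auto simp: fun_eq_iff surj_f_inv_f)
  have sg: "sign (e \<circ> q \<circ> inv e) = sign q" if "q permutes UNIV" for q
  proof -
    have "map_permutation UNIV e q = e \<circ> q \<circ> inv e"
      using bij_is_surj[OF e] by (auto simp: map_permutation_def restrict_id_def fun_eq_iff)
    thus ?thesis using sign_map_permutation[of e UNIV q] that bij_is_inj[OF e] by simp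
  qed
  show ?thesis unfolding det_def
  proof (rule sum.reindex_bij_witness[of _ "\<lambda>p. inv e \<circ> p \<circ> e" "\<lambda>q. e \<circ> q \<circ> inv e"])
    fix q :: "'m \<Rightarrow> 'm" assume q: "q \<in> {q. q permutes UNIV}"
    show "inv e \<circ> (e \<circ> q \<circ> inv e) \<circ> e = q" using inv by (simp add: fun_eq_iff)
    show "e \<circ> q \<circ> inv e \<in> {p. p permutes UNIV}"
      using q inv e by (auto intro!: bij_imp_permutes bij_comp permutes_bij)
    have "(\<Prod>i\<in>UNIV. A $ i $ (e \<circ> q \<circ> inv e) i) = (\<Prod>i\<in>UNIV. A $ e i $ (e \<circ> q \<circ> inv e) (e i))"
      by (rule prod.reindex_bij_betw[symmetric]) (use e in simp)
    also have "\<dots> = (\<Prod>i\<in>UNIV. A $ e i $ e (q i))" using inv by (simp add: fun_eq_iff)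
    finally show "of_int (sign (e \<circ> q \<circ> inv e)) * (\<Prod>i\<in>UNIV. A $ i $ (e \<circ> q \<circ> inv e) i)
        = of_int (sign q) * (\<Prod>i\<in>UNIV. (\<chi> i j. A $ e i $ e j) $ i $ q i)"
      using sg q by simp
  next
    fix p :: "'n \<Rightarrow> 'n" assume p: "p \<in> {p. p permutes UNIV}"
    show "e \<circ> (inv e \<circ> p \<circ> e) \<circ> inv e = p" using inv by (simp add: fun_eq_iff)
    show "inv e \<circ> p \<circ> e \<in> {q. q permutes UNIV}"
      using p inv e by (auto intro!: bij_imp_permutes bij_comp permutes_bij)
  qed
qed

text \<open>Relabelling the coordinates maps boxes to boxes with the same side lengths, and Lebesgue
  measure is determined by boxes.\<close>

lemma lborel_reindex:
  fixes e :: "'m::finite \<Rightarrow> 'n::finite"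
  assumes e: "bij e"
  shows "distr lborel borel (\<lambda>x::real^'n. \<chi> i. x $ e i) = (lborel :: (real^'m) measure)"
proof (rule lborel_eqI[symmetric])
  let ?L = "\<lambda>x::real^'n. (\<chi> i. x $ e i) :: real^'m"
  let ?M = "\<lambda>y::real^'m. (\<chi> j. y $ inv e j) :: real^'n"
  have inv: "e (inv e j) = j" "inv e (e i) = i" for i j
    using e by (simp_all add: bij_is_surj bij_is_inj surj_f_inv_f)
  fix l u :: "real^'m" assume le: "\<And>b. b \<in> Basis \<Longrightarrow> l \<bullet> b \<le> u \<bullet> b"
  have le': "l $ i \<le> u $ i" for i using le[of "axis i 1"] by (simp add: inner_axis)
  have meas: "?L \<in> borel_measurable borel"
    by (intro borel_measurable_continuous_onI continuous_intros)
  have "?L -` box l u = box (?M l) (?M u)"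
  proof -
    have "(\<forall>i. l $ i < x $ e i \<and> x $ e i < u $ i) \<longleftrightarrow> (\<forall>j. l $ inv e j < x $ j \<and> x $ j < u $ inv e j)" for x :: "real^'n"
      using inv by (intro iffI allI) (erule allE[of _ "inv e _"], simp, erule allE[of _ "e _"], simp)
    thus ?thesis unfolding set_eq_iff mem_box_cart vimage_def by simp
  qed
  hence "emeasure (distr lborel borel ?L) (box l u) = emeasure lborel (box (?M l) (?M u))"
    using meas by (simp add: emeasure_distr)
  also have "\<dots> = (\<Prod>b\<in>Basis. (?M u - ?M l) \<bullet> b)"
    by (rule emeasure_lborel_box) (auto simp: Basis_vec_def inner_axis le')
  also have "(\<Prod>b\<in>Basis. (?M u - ?M l) \<bullet> b) = (\<Prod>j\<in>UNIV. u $ inv e j - l $ inv e j)"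
    by (simp add: Basis_vec_def UNION_singleton_eq_range prod.reindex axis_eq_axis inj_on_def inner_axis)
  also have "\<dots> = (\<Prod>i\<in>UNIV. u $ i - l $ i)"
    by (rule prod.reindex_bij_betw) (use bij_imp_bij_inv[OF e] in simp)
  also have "\<dots> = (\<Prod>b\<in>Basis. (u - l) \<bullet> b)"
    by (simp add: Basis_vec_def UNION_singleton_eq_range prod.reindex axis_eq_axis inj_on_def inner_axis)
  finally show "emeasure (distr lborel borel ?L) (box l u) = (\<Prod>b\<in>Basis. (u - l) \<bullet> b)" .
qed simp

section \<open>Change of variables for nonnegative integrands\<close>

text \<open>Real functions are viewed as functions into \<open>real^1\<close> to apply the theorem
  on absolutely integrable vector functions. Integrability of the two integrands is equivalent, so
  when it fails both extended integrals are infinite.\<close>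

lemma nn_change_of_variables_wellorder:
  fixes g :: "real^'m::{finite,wellorder} \<Rightarrow> real^'m::_" and f :: "real^'m::_ \<Rightarrow> real"
  assumes T: "T \<in> sets borel"
    and der: "\<And>x. x \<in> T \<Longrightarrow> (g has_derivative g' x) (at x)" and inj: "inj_on g T"
    and f0: "\<And>y. f y \<ge> 0"
    and mf: "(\<lambda>y. indicator (g ` T) y * f y) \<in> borel_measurable borel"
    and mg: "(\<lambda>x. indicator T x * (\<bar>det (matrix (g' x))\<bar> * f (g x))) \<in> borel_measurable borel"
  shows "(\<integral>\<^sup>+x. ennreal (indicator T x * (\<bar>det (matrix (g' x))\<bar> * f (g x))) \<partial>lborel) =
    (\<integral>\<^sup>+y. ennreal (indicator (g ` T) y * f y) \<partial>lborel)"
proof -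
  let ?A = "\<lambda>x. \<bar>det (matrix (g' x))\<bar> * f (g x)"
  have iff: "?A absolutely_integrable_on T \<and> integral T ?A = b \<longleftrightarrow> f absolutely_integrable_on g ` T \<and> integral (g ` T) f = b" for b
    using has_absolute_integral_change_of_variables[of T g g' "\<lambda>y. vec (f y) :: real^1" "vec b"] T der inj
    unfolding absolutely_integrable_on_1_iff integral_on_1_eq by (simp add: has_derivative_at_withinI)
  have lb: "set_integrable lebesgue X k \<longleftrightarrow> integrable lborel (\<lambda>x. indicator X x * k x)"
    if "(\<lambda>x. indicator X x * k x) \<in> borel_measurable borel" for X and k :: "real^'m::_ \<Rightarrow> real"
    using that unfolding set_integrable_def by (simp add: integrable_completion)
  have eq: "integral X k = (\<integral>x. indicator X x * k x \<partial>lborel)"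
    if "(\<lambda>x. indicator X x * k x) \<in> borel_measurable borel" "k absolutely_integrable_on X" for X and k :: "real^'m::_ \<Rightarrow> real"
    using set_lebesgue_integral_eq_integral(2)[OF that(2)] that(1)
    unfolding set_lebesgue_integral_def by (simp add: integral_completion)
  show ?thesis
  proof (cases "f absolutely_integrable_on g ` T")
    case True
    hence A: "?A absolutely_integrable_on T" "integral T ?A = integral (g ` T) f" using iff by blast+
    have "(\<integral>\<^sup>+x. ennreal (indicator T x * ?A x) \<partial>lborel) = ennreal (\<integral>x. indicator T x * ?A x \<partial>lborel)"
      using A(1) f0 unfolding lb[OF mg] by (intro nn_integral_eq_integral) auto
    also have "(\<integral>x. indicator T x * ?A x \<partial>lborel) = (\<integral>y. indicator (g ` T) y * f y \<partial>lborel)"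
      using A eq[OF mg A(1)] eq[OF mf True] by simp
    also have "ennreal \<dots> = (\<integral>\<^sup>+y. ennreal (indicator (g ` T) y * f y) \<partial>lborel)"
      using True f0 unfolding lb[OF mf] by (intro nn_integral_eq_integral[symmetric]) auto
    finally show ?thesis .
  next
    case False
    hence "\<not> ?A absolutely_integrable_on T" using iff by blast
    hence "\<not> integrable lborel (\<lambda>x. indicator T x * ?A x)" "\<not> integrable lborel (\<lambda>y. indicator (g ` T) y * f y)"
      using False lb[OF mg] lb[OF mf] by blast+
    moreover have "(\<integral>\<^sup>+x. ennreal (k x) \<partial>lborel) = \<infinity>"
      if "k \<in> borel_measurable borel" "\<And>x. k x \<ge> 0" "\<not> integrable lborel k" for k :: "real^'m::_ \<Rightarrow> real"
    proof (rule ccontr)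
      assume "(\<integral>\<^sup>+x. ennreal (k x) \<partial>lborel) \<noteq> \<infinity>"
      hence "(\<integral>\<^sup>+x. ennreal (k x) \<partial>lborel) < \<infinity>" by (simp add: less_top)
      thus False using integrableI_nonneg[of k lborel] that by simp
    qed
    ultimately have "(\<integral>\<^sup>+x. ennreal (indicator T x * ?A x) \<partial>lborel) = \<infinity>" "(\<integral>\<^sup>+y. ennreal (indicator (g ` T) y * f y) \<partial>lborel) = \<infinity>"
      using mg mf f0 by simp_all
    thus ?thesis by simp
  qed
qed

text \<open>The map is conjugated by the relabelling L and its inverse M, which preserve Lebesgue
  measure and leave the Jacobian determinant unchanged.\<close>

lemma nn_change_of_variables:
  fixes g :: "real^'n::finite \<Rightarrow> real^'n" and f :: "real^'n \<Rightarrow> real"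
  assumes T: "T \<in> sets borel"
    and der: "\<And>x. x \<in> T \<Longrightarrow> (g has_derivative g' x) (at x)" and inj: "inj_on g T"
    and f0: "\<And>y. f y \<ge> 0"
    and mf: "(\<lambda>y. indicator (g ` T) y * f y) \<in> borel_measurable borel"
    and mg: "(\<lambda>x. indicator T x * (\<bar>det (matrix (g' x))\<bar> * f (g x))) \<in> borel_measurable borel"
  shows "(\<integral>\<^sup>+x. ennreal (indicator T x * (\<bar>det (matrix (g' x))\<bar> * f (g x))) \<partial>lborel) =
    (\<integral>\<^sup>+y. ennreal (indicator (g ` T) y * f y) \<partial>lborel)"
proof -
  obtain e :: "'n rank \<Rightarrow> 'n" where e: "bij e"
    using finite_same_card_bij[of "UNIV :: 'n rank set" "UNIV :: 'n set"] card_rank[where 'n='n] by auto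
  define L where "L x = (\<chi> i. x $ e i)" for x :: "real^'n"
  define M where "M y = (\<chi> j. y $ inv e j)" for y :: "real^('n rank)"
  have inv: "e (inv e j) = j" "inv e (e i) = i" for i j
    using e by (simp_all add: bij_is_surj bij_is_inj surj_f_inv_f)
  have LM [simp]: "L (M y) = y" "M (L x) = x" for x y by (simp_all add: L_def M_def inv vec_eq_iff)
  have blL: "bounded_linear L" and blM: "bounded_linear M"
    unfolding L_def[abs_def] M_def[abs_def] 
    by (rule linear_conv_bounded_linear[THEN iffD1], rule linearI; simp add: vec_eq_iff)+
  have mL: "L \<in> borel_measurable borel" and mM: "M \<in> borel_measurable borel"
    using blL blM by (auto intro!: borel_measurable_continuous_onI linear_continuous_on)
  have injL: "inj_on L X" for X by (rule inj_on_inverseI[of _ M]) simp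
  have memL: "y \<in> L ` X \<longleftrightarrow> M y \<in> X" for X y
    by (auto intro!: image_eqI[of _ _ "M y"])
  hence imL: "indicator (L ` X) y = (indicator X (M y) :: real)" for X y
    by (simp add: indicator_def)
  have M_axis: "M (axis j 1) = axis (e j) 1" for j
    using inv by (auto simp: M_def axis_def vec_eq_iff)
  define G where "G y = L (g (M y))" for y
  define G' where "G' y v = L (g' (M y) (M v))" for y v
  have det: "det (matrix (G' (L x))) = det (matrix (g' x))" if "x \<in> T" for x
  proof -
    have "matrix (G' (L x)) = (\<chi> i j. matrix (g' x) $ e i $ e j)"
      by (simp add: vec_eq_iff matrix_def G'_def M_axis) (simp add: L_def)
    thus ?thesis using det_reindex[OF e] by simp
  qed
  have GT: "G ` L ` T = L ` g ` T" by (auto simp: G_def image_image)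
  have distr: "(\<integral>\<^sup>+y. k y \<partial>(lborel :: (real^('n rank)) measure)) = (\<integral>\<^sup>+x. k (L x) \<partial>lborel)" if "k \<in> borel_measurable borel" for k
  proof -
    have "(lborel :: (real^('n rank)) measure) = distr lborel borel L"
      unfolding L_def[abs_def] by (rule lborel_reindex[OF e, symmetric])
    thus ?thesis using nn_integral_distr[of L lborel borel k] mL that by simp
  qed
  have k1: "(\<lambda>y. indicator (G ` L ` T) y * f (M y)) \<in> borel_measurable borel"
    unfolding GT imL by (rule measurable_compose[OF mM mf])
  have "(\<lambda>y. indicator T (M y) * (\<bar>det (matrix (g' (M y)))\<bar> * f (g (M y)))) \<in> borel_measurable borel"
    by (rule measurable_compose[OF mM mg])
  also have "(\<lambda>y. indicator T (M y) * (\<bar>det (matrix (g' (M y)))\<bar> * f (g (M y)))) = 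
     (\<lambda>y. indicator (L ` T) y * (\<bar>det (matrix (G' y))\<bar> * f (M (G y))))"
  proof
    fix y show "indicator T (M y) * (\<bar>det (matrix (g' (M y)))\<bar> * f (g (M y))) = indicator (L ` T) y * (\<bar>det (matrix (G' y))\<bar> * f (M (G y)))"
      using det[of "M y"] by (cases "M y \<in> T") (simp_all add: indicator_def memL G_def)
  qed
  finally have k2: "(\<lambda>y. indicator (L ` T) y * (\<bar>det (matrix (G' y))\<bar> * f (M (G y)))) \<in> borel_measurable borel" .
  have LT: "L ` T \<in> sets borel"
  proof -
    have "L ` T = M -` T \<inter> space borel" using memL by auto
    thus ?thesis using measurable_sets[OF mM T] by simp
  qed
  have "(\<integral>\<^sup>+y. ennreal (indicator (L ` T) y * (\<bar>det (matrix (G' y))\<bar> * f (M (G y)))) \<partial>lborel) =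
     (\<integral>\<^sup>+y. ennreal (indicator (G ` L ` T) y * f (M y)) \<partial>lborel)"
  proof (rule nn_change_of_variables_wellorder[OF LT _ _ f0 k1 k2])
    fix y assume "y \<in> L ` T"
    hence "M y \<in> T" by auto
    have "((\<lambda>y. g (M y)) has_derivative (\<lambda>v. g' (M y) (M v))) (at y)"
      by (rule has_derivative_compose[OF bounded_linear_imp_has_derivative[OF blM] der[OF \<open>M y \<in> T\<close>]])
    thus "(G has_derivative G' y) (at y)"
      unfolding G_def[abs_def] G'_def[abs_def] by (rule bounded_linear.has_derivative[OF blL])
  next
    show "inj_on G (L ` T)" using inj by (auto simp: inj_on_def G_def dest!: arg_cong[of "L _" "L _" M])
  qed
  also have "(\<integral>\<^sup>+y. ennreal (indicator (G ` L ` T) y * f (M y)) \<partial>lborel) = (\<integral>\<^sup>+y. ennreal (indicator (g ` T) y * f y) \<partial>lborel)"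
    unfolding GT using k1 by (subst distr) (simp_all add: GT imL)
  also have "(\<integral>\<^sup>+y. ennreal (indicator (L ` T) y * (\<bar>det (matrix (G' y))\<bar> * f (M (G y)))) \<partial>lborel) 
     = (\<integral>\<^sup>+x. ennreal (indicator T x * (\<bar>det (matrix (g' x))\<bar> * f (g x))) \<partial>lborel)"
  proof (subst distr)
    show "(\<integral>\<^sup>+x. ennreal (indicator (L ` T) (L x) * (\<bar>det (matrix (G' (L x)))\<bar> * f (M (G (L x))))) \<partial>lborel) = 
      (\<integral>\<^sup>+x. ennreal (indicator T x * (\<bar>det (matrix (g' x))\<bar> * f (g x))) \<partial>lborel)"
    proof (rule nn_integral_cong)
      fix x :: "real^'n"
      show "ennreal (indicator (L ` T) (L x) * (\<bar>det (matrix (G' (L x)))\<bar> * f (M (G (L x))))) = 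
        ennreal (indicator T x * (\<bar>det (matrix (g' x))\<bar> * f (g x)))"
        using det[of x] by (cases "x \<in> T") (simp_all add: indicator_def memL G_def)
    qed
  qed (use k2 in simp)
  finally show ?thesis .
qed

section \<open>Local geometry of an immersed hypersurface\<close>

lemma axis_inner_matrix: "axis i 1 \<bullet> (A *v axis j 1) = (A :: real^'n^'n) $ i $ j"
  by (simp add: inner_axis' matrix_vector_mult_basis column_def)

lemma matrix_inv_invertible:
  fixes A :: "real^'n^'n"
  assumes "det A \<noteq> 0"
  shows "A ** matrix_inv A = mat 1" "matrix_inv A ** A = mat 1"
proof -
  have "\<exists>B. A ** B = mat 1 \<and> B ** A = mat 1"
    using assms unfolding invertible_det_nz[symmetric] invertible_def by blast
  from someI_ex[OF this] show "A ** matrix_inv A = mat 1" "matrix_inv A ** A = mat 1"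
    unfolding matrix_inv_def by auto
qed

text \<open>Exhibits the entries of the inverse as quotients of determinants, from which their
  smoothness can be read off.\<close>

lemma matrix_inv_cramer:
  fixes A :: "real^'n^'n"
  assumes "det A \<noteq> 0"
  shows "matrix_inv A $ i $ j = det (\<chi> k l. if l = i then axis j 1 $ k else A $ k $ l) / det A"
proof -
  have "A *v (matrix_inv A *v axis j 1) = axis j 1"
    by (simp add: matrix_vector_mul_assoc matrix_inv_invertible(1)[OF assms])
  hence "matrix_inv A *v axis j 1 = (\<chi> i. det (\<chi> k l. if l = i then axis j 1 $ k else A $ k $ l) / det A)"
    by (simp only: cramer[OF assms])
  hence "(matrix_inv A *v axis j 1) $ i = det (\<chi> k l. if l = i then axis j 1 $ k else A $ k $ l) / det A"
    by (simp only: vec_lambda_beta)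
  moreover have "(matrix_inv A *v axis j 1) $ i = matrix_inv A $ i $ j"
    by (simp add: matrix_vector_mult_def axis_def if_distrib cong: if_cong)
  ultimately show ?thesis by (simp only:)
qed

text \<open>On the segment from the identity to A all matrices are positive definite, hence
  invertible, so the determinant cannot pass through 0. Symmetry of A does not enter.\<close>

lemma positive_definite_det:
  fixes A :: "real^'n^'n"
  assumes pos: "\<And>v. v \<noteq> 0 \<Longrightarrow> v \<bullet> (A *v v) > 0"
  shows "det A > 0"
proof (rule ccontr)
  assume "\<not> det A > 0"
  define B where "B t = (1 - t) *\<^sub>R mat 1 + t *\<^sub>R A" for t :: real
  have "continuous_on {0..1} (\<lambda>t. det (B t))"
    unfolding det_def B_def by (simp, intro continuous_intros)
  moreover have "B 0 = mat 1" "B 1 = A" by (simp_all add: B_def vec_eq_iff)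
  ultimately obtain t where t: "0 \<le> t" "t \<le> 1" "det (B t) = 0"
    using IVT2'[of "\<lambda>t. det (B t)" 1 0 0] \<open>\<not> det A > 0\<close> by auto
  hence "\<not> inj ((*v) (B t))"
    using invertible_det_nz[of "B t"] invertible_left_inverse[of "B t"] matrix_left_invertible_injective[of "B t"] by simp
  then obtain v where v: "v \<noteq> 0" "B t *v v = 0"
    using matrix_left_invertible_ker[of "B t"] matrix_left_invertible_injective[of "B t"] by blast
  have "B t *v v = (1 - t) *\<^sub>R v + t *\<^sub>R (A *v v)"
    by (simp add: B_def matrix_vector_mult_add_rdistrib scaleR_matrix_vector_assoc[symmetric])
  hence "(1 - t) * (v \<bullet> v) + t * (v \<bullet> (A *v v)) = 0"
    using v(2) inner_add_right[of v "(1 - t) *\<^sub>R v" "t *\<^sub>R (A *v v)"] by simp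
  moreover have "v \<bullet> v > 0" "v \<bullet> (A *v v) > 0" using v(1) pos by auto
  ultimately show False using t
    by (smt (verit) mult_nonneg_nonneg mult_pos_pos)
qed

lemma smooth_on_det:
  fixes A :: "real^'m \<Rightarrow> real^'n^'n"
  assumes "open W" "\<And>i j. smooth_on W (\<lambda>x. A x $ i $ j)"
  shows "smooth_on W (\<lambda>x. det (A x))"
  using assms unfolding det_def smooth_on_def
  by (intro allI C_k_on_sum C_k_on_mult C_k_on_const C_k_on_prod) auto

lemma smooth_on_inverse:
  "open W \<Longrightarrow> smooth_on W f \<Longrightarrow> (\<And>x. x \<in> W \<Longrightarrow> f x > (0::real)) \<Longrightarrow> smooth_on W (\<lambda>x. inverse (f x))"
  by (simp add: smooth_on_def C_k_on_inverse)

lemma smooth_on_sqrt: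
  "open W \<Longrightarrow> smooth_on W f \<Longrightarrow> (\<And>x. x \<in> W \<Longrightarrow> f x > (0::real)) \<Longrightarrow> smooth_on W (\<lambda>x. sqrt (f x))"
  by (simp add: smooth_on_def C_k_on_sqrt)

text \<open>The components of the differential in coordinates; the gradient proper arises after
  multiplication by the inverse metric.\<close>

definition grad_vec :: "('m \<Rightarrow> real) \<Rightarrow> (real^'n \<Rightarrow> 'm) \<Rightarrow> real^'n \<Rightarrow> real^'n" where
  "grad_vec u \<psi> x = (\<chi> i. partial (u \<circ> \<psi>) i x)"

lemma loc_grad_inner_eq:
  "loc_grad_inner S \<psi> u v x = grad_vec u \<psi> x \<bullet> (metric_inv S \<psi> x *v grad_vec v \<psi> x)"
  by (simp add: loc_grad_inner_def grad_vec_def inner_vec_def matrix_vector_mult_def sum_distrib_left mult_ac)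

section \<open>Metric and coefficients in a chart\<close>

locale immersion =
  fixes S :: "('m::{t2_space, second_countable_topology}, 'n::finite, 'k::finite) hypersurface"
  assumes immersed: "immersed_hypersurface S"
begin

lemma atlas: "smooth_atlas (charts S)" and immersion_smooth: "smooth_fun S (pos S)"
  and immersion_inj: "\<forall>(W, \<psi>)\<in>charts S. \<forall>x\<in>W. inj (frechet_derivative (pos S \<circ> \<psi>) (at x))"
  using immersed by (simp_all add: immersed_hypersurface_def)

lemma atlas_cover: "(\<Union>(W, \<psi>)\<in>charts S. \<psi> ` W) = UNIV"
  and atlas_charts: "\<forall>(W, \<psi>)\<in>charts S. open W \<and> open (\<psi> ` W) \<and> (\<exists>\<kappa>. homeomorphism W (\<psi> ` W) \<psi> \<kappa>)"
  and atlas_transition: "\<forall>(W, \<psi>)\<in>charts S. \<forall>(V, \<theta>)\<in>charts S. smooth_on {x\<in>W. \<psi> x \<in> \<theta> ` V} (the_inv_into V \<theta> \<circ> \<psi>)"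
  using atlas by (simp_all add: smooth_atlas_def)

lemma charts_cover: "\<exists>W \<psi> x. (W, \<psi>) \<in> charts S \<and> x \<in> W \<and> \<psi> x = p"
proof -
  have "p \<in> (\<Union>(W, \<psi>)\<in>charts S. \<psi> ` W)"
    unfolding atlas_cover by simp
  thus ?thesis by blast
qed

context
  fixes W \<psi> assumes chart: "(W, \<psi>) \<in> charts S"
begin

lemma chart_open: "open W" and chart_open_image: "open (\<psi> ` W)"
  and chart_homeo: "\<exists>\<kappa>. homeomorphism W (\<psi> ` W) \<psi> \<kappa>"
  using atlas_charts chart by auto

lemma chart_continuous: "continuous_on W \<psi>"
  using chart_homeo homeomorphism_cont1 by blast

lemma chart_inj: "inj_on \<psi> W"
  using chart_homeo unfolding homeomorphism_def by (metis inj_on_inverseI)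

lemma chart_inv [simp]: "x \<in> W \<Longrightarrow> the_inv_into W \<psi> (\<psi> x) = x"
  by (rule the_inv_into_f_f[OF chart_inj])

lemma chart_inv_in: "p \<in> \<psi> ` W \<Longrightarrow> the_inv_into W \<psi> p \<in> W" "p \<in> \<psi> ` W \<Longrightarrow> \<psi> (the_inv_into W \<psi> p) = p"
  by auto

lemma chart_inv_continuous: "continuous_on (\<psi> ` W) (the_inv_into W \<psi>)"
proof -
  obtain \<kappa> where \<kappa>: "homeomorphism W (\<psi> ` W) \<psi> \<kappa>" using chart_homeo by blast
  have "continuous_on (\<psi> ` W) \<kappa>" using \<kappa> homeomorphism_cont2 by blast
  moreover have "\<kappa> p = the_inv_into W \<psi> p" if "p \<in> \<psi> ` W" for p
    using \<kappa> that unfolding homeomorphism_def by auto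
  ultimately show ?thesis by (simp cong: continuous_on_cong)
qed

lemma chart_open_map: 
  assumes "open V" "V \<subseteq> W" shows "open (\<psi> ` V)"
proof -
  have "\<psi> ` V = the_inv_into W \<psi> -` V \<inter> \<psi> ` W" using assms by auto
  thus ?thesis using continuous_open_preimage[OF chart_inv_continuous chart_open_image assms(1)] by (simp add: Int_commute vimage_def Int_def)
qed

lemma smooth_fun_chart: "smooth_fun S f \<Longrightarrow> smooth_on W (f \<circ> \<psi>)"
  using chart unfolding smooth_fun_def C_k_fun_def smooth_on_def by blast

lemma smooth_pos: "smooth_on W (pos S \<circ> \<psi>)"
  by (rule smooth_fun_chart[OF immersion_smooth])

abbreviation "DX x \<equiv> frechet_derivative (pos S \<circ> \<psi>) (at x)"

lemma DX_inj: "x \<in> W \<Longrightarrow> inj (DX x)"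
  using immersion_inj chart by auto

lemma DX_linear: "x \<in> W \<Longrightarrow> linear (DX x)"
  using smooth_on_has_derivative[OF smooth_pos] has_derivative_linear by blast

lemma linear_axis_expansion:
  assumes "linear L" shows "L v = (\<Sum>i\<in>UNIV. v $ i *\<^sub>R L (axis i (1::real)))"
proof -
  have "L v = L (\<Sum>i\<in>UNIV. v $ i *s axis i 1)" by (simp add: basis_expansion)
  also have "\<dots> = (\<Sum>i\<in>UNIV. v $ i *\<^sub>R L (axis i 1))"
    using assms by (simp add: linear_sum scalar_mult_eq_scaleR linear_scale)
  finally show ?thesis .
qed

text \<open>The metric is the pullback of the Euclidean inner product; its symmetry, positivity and
  transformation law are all derived from this form.\<close>

lemma metric_bilinear:
  assumes "x \<in> W" shows "w \<bullet> (metric_mat S \<psi> x *v v) = DX x w \<bullet> DX x v"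
proof -
  have "DX x w \<bullet> DX x v = (\<Sum>i\<in>UNIV. w $ i *\<^sub>R DX x (axis i 1)) \<bullet> (\<Sum>j\<in>UNIV. v $ j *\<^sub>R DX x (axis j 1))"
    using linear_axis_expansion[OF DX_linear[OF assms], of w] linear_axis_expansion[OF DX_linear[OF assms], of v] by simp
  also have "\<dots> = (\<Sum>i\<in>UNIV. w $ i * (\<Sum>j\<in>UNIV. (DX x (axis i 1) \<bullet> DX x (axis j 1)) * v $ j))"
    by (subst inner_sum_left, intro sum.cong refl, subst inner_sum_right) (simp add: sum_distrib_left mult_ac)
  finally show ?thesis
    by (simp add: metric_mat_def partial_def inner_vec_def matrix_vector_mult_def)
qed

lemma metric_pos: 
  assumes "x \<in> W" "v \<noteq> 0" shows "v \<bullet> (metric_mat S \<psi> x *v v) > 0"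
proof -
  have "DX x v \<noteq> 0" using DX_inj[OF assms(1)] DX_linear[OF assms(1)] assms(2) linear_injective_0 by blast
  thus ?thesis by (simp add: metric_bilinear[OF assms(1)])
qed

lemma det_metric_pos: "x \<in> W \<Longrightarrow> det (metric_mat S \<psi> x) > 0"
  using metric_pos by (intro positive_definite_det) auto

lemma vol_density_pos: "x \<in> W \<Longrightarrow> vol_density S \<psi> x > 0"
  using det_metric_pos by (simp add: vol_density_def)

lemma metric_inv_eq:
  assumes "x \<in> W"
  shows "metric_mat S \<psi> x ** metric_inv S \<psi> x = mat 1" "metric_inv S \<psi> x ** metric_mat S \<psi> x = mat 1"
  using matrix_inv_invertible[of "metric_mat S \<psi> x"] det_metric_pos[OF assms] by (auto simp: metric_inv_def)

lemma metric_inv_vec: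
  assumes "x \<in> W"
  shows "metric_mat S \<psi> x *v (metric_inv S \<psi> x *v v) = v" "metric_inv S \<psi> x *v (metric_mat S \<psi> x *v v) = v"
  using metric_inv_eq[OF assms] by (simp_all add: matrix_vector_mul_assoc)

lemma metric_self_adjoint: "x \<in> W \<Longrightarrow> w \<bullet> (metric_mat S \<psi> x *v v) = v \<bullet> (metric_mat S \<psi> x *v w)"
  by (simp add: metric_bilinear inner_commute)

lemma metric_inv_self_adjoint: 
  assumes x: "x \<in> W" shows "w \<bullet> (metric_inv S \<psi> x *v v) = v \<bullet> (metric_inv S \<psi> x *v w)"
  using metric_self_adjoint[OF x, of "metric_inv S \<psi> x *v v" "metric_inv S \<psi> x *v w"]
  by (simp add: metric_inv_vec[OF x] inner_commute)

lemma metric_inv_pos: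
  assumes x: "x \<in> W" and "v \<noteq> 0" shows "v \<bullet> (metric_inv S \<psi> x *v v) > 0"
proof -
  let ?w = "metric_inv S \<psi> x *v v"
  have "?w \<noteq> 0" using metric_inv_vec(1)[OF x, of v] assms(2) by (metis matrix_vector_mult_0_right)
  from metric_pos[OF x this] show ?thesis by (simp add: metric_inv_vec[OF x] inner_commute)
qed

lemma metric_inv_nonneg: "x \<in> W \<Longrightarrow> v \<bullet> (metric_inv S \<psi> x *v v) \<ge> 0"
  using metric_inv_pos[of x v] by (cases "v = 0") (auto simp: less_imp_le)

lemma metric_inv_sym: "x \<in> W \<Longrightarrow> metric_inv S \<psi> x $ i $ j = metric_inv S \<psi> x $ j $ i"
  using metric_inv_self_adjoint[of x "axis i 1" "axis j 1"] by (simp add: axis_inner_matrix)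

lemma smooth_metric: "smooth_on W (\<lambda>x. metric_mat S \<psi> x $ i $ j)"
  unfolding metric_mat_def by (simp, intro smooth_on_inner chart_open smooth_on_partial smooth_pos)

lemma smooth_vol_density: "smooth_on W (vol_density S \<psi>)"
  unfolding vol_density_def[abs_def] by (intro smooth_on_sqrt smooth_on_det smooth_metric chart_open det_metric_pos)

lemma smooth_metric_inv: "smooth_on W (\<lambda>x. metric_inv S \<psi> x $ i $ j)"
proof -
  have "smooth_on W (\<lambda>x. (\<chi> k l. if l = i then axis j 1 $ k else metric_mat S \<psi> x $ k $ l) $ k $ l)" for k l
    using smooth_metric[of k l] smooth_on_const[OF chart_open, of "axis j (1::real) $ k"] by (cases "l = i") auto
  hence "smooth_on W (\<lambda>x. det (\<chi> k l. if l = i then axis j 1 $ k else metric_mat S \<psi> x $ k $ l) * inverse (det (metric_mat S \<psi> x)))"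
    by (intro smooth_on_mult chart_open smooth_on_inverse det_metric_pos smooth_on_det smooth_metric)
  thus ?thesis
  proof (rule smooth_on_cong[OF chart_open])
    fix x assume "x \<in> W"
    hence "det (metric_mat S \<psi> x) \<noteq> 0" using det_metric_pos by force
    from matrix_inv_cramer[OF this]
    show "det (\<chi> k l. if l = i then axis j 1 $ k else metric_mat S \<psi> x $ k $ l) * inverse (det (metric_mat S \<psi> x)) = metric_inv S \<psi> x $ i $ j"
      by (simp add: metric_inv_def divide_inverse)
  qed
qed

text \<open>The Lebesgue density of the weighted area in the chart.\<close>

definition rho :: "real^'n \<Rightarrow> real" where "rho x = vol_density S \<psi> x * exp (weight S (\<psi> x))"

lemma rho_pos: "x \<in> W \<Longrightarrow> rho x > 0"
  by (simp add: rho_def vol_density_pos)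

lemma smooth_weight_chart: "smooth_on W (\<lambda>x. weight S (\<psi> x))"
proof -
  have "smooth_on W (\<lambda>x. (- 1 / 4) * ((pos S \<circ> \<psi>) x \<bullet> (pos S \<circ> \<psi>) x))"
    by (intro smooth_on_mult smooth_on_inner smooth_on_const chart_open smooth_pos)
  thus ?thesis by (simp add: weight_def power2_norm_eq_inner)
qed

lemma smooth_rho: "smooth_on W rho"
proof -
  have "smooth_on W (\<lambda>x. exp (weight S (\<psi> x)))"
    by (rule smooth_on_compose[OF chart_open smooth_weight_chart, of UNIV exp]) (auto simp: smooth_on_def C_k_on_exp)
  thus ?thesis unfolding rho_def[abs_def] by (intro smooth_on_mult chart_open smooth_vol_density)
qed

text \<open>The coefficients of the weighted Laplacian multiplied by its density, which puts it in
  divergence form with respect to Lebesgue measure.\<close>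

definition coeff :: "'n \<Rightarrow> 'n \<Rightarrow> real^'n \<Rightarrow> real" where "coeff i j x = rho x * metric_inv S \<psi> x $ i $ j"

lemma smooth_coeff: "smooth_on W (coeff i j)"
  unfolding coeff_def[abs_def] by (intro smooth_on_mult chart_open smooth_rho smooth_metric_inv)

lemma coeff_sym: "x \<in> W \<Longrightarrow> coeff i j x = coeff j i x"
  by (simp add: coeff_def metric_inv_sym)

lemma coeff_quadratic: "(\<Sum>i\<in>UNIV. \<Sum>j\<in>UNIV. coeff i j x * \<xi> $ i * \<eta> $ j) = rho x * (\<xi> \<bullet> (metric_inv S \<psi> x *v \<eta>))"
  by (simp add: coeff_def inner_vec_def matrix_vector_mult_def sum_distrib_left mult_ac)

lemma coeff_pos: "x \<in> W \<Longrightarrow> \<xi> \<noteq> 0 \<Longrightarrow> (\<Sum>i\<in>UNIV. \<Sum>j\<in>UNIV. coeff i j x * \<xi> $ i * \<xi> $ j) > 0"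
  by (simp add: coeff_quadratic rho_pos metric_inv_pos)

end

section \<open>Change of chart\<close>

context
  fixes W \<psi> V \<theta> assumes chart1: "(W, \<psi>) \<in> charts S" and chart2: "(V, \<theta>) \<in> charts S"
begin

definition overlap :: "(real^'n) set" where "overlap = {x\<in>W. \<psi> x \<in> \<theta> ` V}"
definition trans :: "real^'n \<Rightarrow> real^'n" where "trans = the_inv_into V \<theta> \<circ> \<psi>"

lemma open_overlap: "open overlap"
  unfolding overlap_def
  using continuous_open_preimage[OF chart_continuous[OF chart1] chart_open[OF chart1] chart_open_image[OF chart2]]
  by (simp add: vimage_def Int_def)

lemma smooth_trans: "smooth_on overlap trans"
  using atlas_transition chart1 chart2 unfolding overlap_def trans_def by auto

lemma trans_in: "x \<in> overlap \<Longrightarrow> trans x \<in> V" and trans_eq: "x \<in> overlap \<Longrightarrow> \<theta> (trans x) = \<psi> x"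
  using chart_inv_in[OF chart2] by (auto simp: overlap_def trans_def)

lemma trans_inj: "inj_on trans overlap"
  by (rule inj_onI) (metis (no_types, lifting) trans_eq chart_inv[OF chart1] overlap_def mem_Collect_eq)

abbreviation "DT x \<equiv> frechet_derivative trans (at x)"

lemma chain_rule:
  fixes F :: "'m \<Rightarrow> 'b::real_normed_vector"
  assumes x: "x \<in> overlap" and F: "(F \<circ> \<theta>) differentiable (at (trans x))"
  shows "((F \<circ> \<psi>) has_derivative (\<lambda>v. frechet_derivative (F \<circ> \<theta>) (at (trans x)) (DT x v))) (at x)"
proof -
  have "((\<lambda>y. (F \<circ> \<theta>) (trans y)) has_derivative (\<lambda>v. frechet_derivative (F \<circ> \<theta>) (at (trans x)) (DT x v))) (at x)"
    by (rule has_derivative_compose[OF smooth_on_has_derivative[OF smooth_trans x]]) (use F frechet_derivative_works in blast)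
  thus ?thesis by (rule has_derivative_transform_within_open[OF _ open_overlap x]) (simp add: trans_eq)
qed

lemma DX_trans: 
  assumes "x \<in> overlap" shows "DX \<psi> x v = DX \<theta> (trans x) (DT x v)"
proof -
  have "(pos S \<circ> \<theta>) differentiable (at (trans x))"
    using smooth_on_has_derivative[OF smooth_pos[OF chart2] trans_in[OF assms]] by (rule differentiableI)
  from fun_cong[OF frechet_derivative_at[OF chain_rule[OF assms this]], of v] show ?thesis by simp
qed

lemma DT_linear: "x \<in> overlap \<Longrightarrow> linear (DT x)"
  using smooth_on_has_derivative[OF smooth_trans] has_derivative_linear by blast

lemma DT_inj: 
  assumes "x \<in> overlap" shows "inj (DT x)"
proof -
  have "inj (DX \<psi> x)" using DX_inj[OF chart1] assms by (simp add: overlap_def)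
  thus ?thesis using DX_trans[OF assms] by (metis injI injD)
qed

text \<open>The metric matrices are related by the congruence with the Jacobian J, so their
  determinants differ by (det J)^2.\<close>

lemma vol_density_trans:
  assumes x: "x \<in> overlap"
  shows "vol_density S \<psi> x = \<bar>det (matrix (DT x))\<bar> * vol_density S \<theta> (trans x)"
proof -
  let ?J = "matrix (DT x)"
  have J: "?J *v v = DT x v" for v by (rule fun_cong[OF matrix_vector_mul(2)[OF DT_linear[OF x]]])
  have adj: "(?J *v v) \<bullet> z = v \<bullet> (transpose ?J *v z)" for v z
    using dot_lmul_matrix[of z ?J v] by (simp add: inner_commute)
  have xW: "x \<in> W" using x by (simp add: overlap_def)
  have "metric_mat S \<psi> x $ i $ j = (transpose ?J ** metric_mat S \<theta> (trans x) ** ?J) $ i $ j" for i j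
  proof -
    have "axis i 1 \<bullet> (metric_mat S \<psi> x *v axis j 1) = DX \<theta> (trans x) (DT x (axis i 1)) \<bullet> DX \<theta> (trans x) (DT x (axis j 1))"
      by (simp add: metric_bilinear[OF chart1 xW] DX_trans[OF x])
    also have "\<dots> = (?J *v axis i 1) \<bullet> (metric_mat S \<theta> (trans x) *v (?J *v axis j 1))"
      by (simp add: metric_bilinear[OF chart2 trans_in[OF x]] J)
    also have "\<dots> = axis i 1 \<bullet> ((transpose ?J ** metric_mat S \<theta> (trans x) ** ?J) *v axis j 1)"
      unfolding adj by (simp only: matrix_vector_mul_assoc matrix_mul_assoc)
    finally show ?thesis by (simp only: axis_inner_matrix)
  qed
  hence "metric_mat S \<psi> x = transpose ?J ** metric_mat S \<theta> (trans x) ** ?J" by (simp add: vec_eq_iff)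
  hence "det (metric_mat S \<psi> x) = (det ?J)\<^sup>2 * det (metric_mat S \<theta> (trans x))"
    by (simp add: det_mul det_transpose power2_eq_square)
  thus ?thesis by (simp add: vol_density_def real_sqrt_mult)
qed

lemma grad_vec_trans:
  assumes x: "x \<in> overlap" and u: "(u \<circ> \<theta>) differentiable (at (trans x))"
  shows "grad_vec u \<psi> x \<bullet> w = grad_vec u \<theta> (trans x) \<bullet> DT x w"
proof -
  have g: "grad_vec u \<phi> y \<bullet> w = frechet_derivative (u \<circ> \<phi>) (at y) w" if "(u \<circ> \<phi>) differentiable (at y)" for \<phi> :: "real^'n \<Rightarrow> 'm" and y w
  proof -
    have "linear (frechet_derivative (u \<circ> \<phi>) (at y))" using that linear_frechet_derivative by blast
    from linear_axis_expansion[OF chart1 this, of w] show ?thesis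
      by (simp add: grad_vec_def partial_def inner_vec_def mult.commute)
  qed
  have "(u \<circ> \<psi>) differentiable (at x)" using chain_rule[OF x u] by (auto simp: differentiable_def)
  thus ?thesis using fun_cong[OF frechet_derivative_at[OF chain_rule[OF x u]], of w] by (simp add: g u)
qed

text \<open>The derivative of the transition map carries the coordinate gradient of v to its
  coordinate gradient in the other chart. This is checked by pairing with an arbitrary vector, which
  is in the range of that derivative because it is injective between spaces of equal
  dimension.\<close>

lemma loc_grad_inner_trans:
  assumes x: "x \<in> overlap" and u: "(u \<circ> \<theta>) differentiable (at (trans x))" and v: "(v \<circ> \<theta>) differentiable (at (trans x))"
  shows "loc_grad_inner S \<psi> u v x = loc_grad_inner S \<theta> u v (trans x)"
proof -
  have xW: "x \<in> W" using x by (simp add: overlap_def)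
  let ?w = "metric_inv S \<psi> x *v grad_vec v \<psi> x"
  let ?y = "trans x"
  have "z \<bullet> (metric_mat S \<theta> ?y *v DT x ?w) = z \<bullet> grad_vec v \<theta> ?y" for z
  proof -
    obtain z' where z': "z = DT x z'"
      using linear_injective_imp_surjective[OF DT_linear[OF x] DT_inj[OF x]] by (metis surjD)
    have "z \<bullet> (metric_mat S \<theta> ?y *v DT x ?w) = DX \<psi> x z' \<bullet> DX \<psi> x ?w"
      by (simp add: metric_bilinear[OF chart2 trans_in[OF x]] DX_trans[OF x] z')
    also have "\<dots> = z' \<bullet> (metric_mat S \<psi> x *v ?w)" by (simp add: metric_bilinear[OF chart1 xW])
    also have "\<dots> = z' \<bullet> grad_vec v \<psi> x" by (simp add: metric_inv_vec[OF chart1 xW])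
    also have "\<dots> = z \<bullet> grad_vec v \<theta> ?y" using grad_vec_trans[OF x v, of z'] z' by (simp add: inner_commute)
    finally show ?thesis .
  qed
  hence "metric_mat S \<theta> ?y *v DT x ?w = grad_vec v \<theta> ?y" by (subst vector_eq_ldot[symmetric]) blast
  hence "DT x ?w = metric_inv S \<theta> ?y *v grad_vec v \<theta> ?y"
    using metric_inv_vec(2)[OF chart2 trans_in[OF x], of "DT x ?w"] by simp
  thus ?thesis using grad_vec_trans[OF x u, of ?w] by (simp add: loc_grad_inner_eq)
qed

end

section \<open>Independence of the chosen chart\<close>

lemma chart_at: "chart_at S p \<in> charts S" "p \<in> snd (chart_at S p) ` fst (chart_at S p)"
proof -
  have "\<exists>c. c \<in> charts S \<and> p \<in> snd c ` fst c" using charts_cover[of p] by force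
  from someI_ex[OF this] show "chart_at S p \<in> charts S" "p \<in> snd (chart_at S p) ` fst (chart_at S p)"
    unfolding chart_at_def by auto
qed

text \<open>Removes the arbitrary choice behind \<open>grad_inner\<close>: any chart around the
  point may be used.\<close>

lemma grad_inner_chart:
  assumes c: "(W, \<psi>) \<in> charts S" and x: "x \<in> W" and u: "C_k_fun 1 S u" and v: "C_k_fun 1 S v"
  shows "grad_inner S u v (\<psi> x) = loc_grad_inner S \<psi> u v x"
proof -
  let ?p = "\<psi> x"
  obtain V \<theta> where V: "chart_at S ?p = (V, \<theta>)" by fastforce
  have c2: "(V, \<theta>) \<in> charts S" "?p \<in> \<theta> ` V" using chart_at[of ?p] by (auto simp: V)
  have xo: "x \<in> overlap W \<psi> V \<theta>" using x c2(2) by (simp add: overlap_def[OF c c2(1)])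
  have t: "trans \<psi> V \<theta> x = coord_at S ?p" by (simp add: trans_def[OF c c2(1)] coord_at_def V)
  have d: "(w \<circ> \<theta>) differentiable (at (trans \<psi> V \<theta> x))" if "C_k_fun 1 S w" for w :: "'m \<Rightarrow> real"
    using that c2(1) trans_in[OF c c2(1) xo] unfolding C_k_fun_def by force
  show ?thesis
    using loc_grad_inner_trans[OF c c2(1) xo d[OF u] d[OF v]] by (simp add: grad_inner_def V t)
qed

text \<open>The i-th row of the second form is dual to a tangent vector e_i in the ambient space.
  Then |A|^2 is the contraction of g^{-1} with the Gram matrix of the e_i, which splits over ambient
  components into values of a nonnegative quadratic form. Symmetry of the second form is not
  invoked.\<close>

lemma norm_A_sq_nonneg: "norm_A_sq S p \<ge> 0"
proof -
  obtain V \<theta> where V: "chart_at S p = (V, \<theta>)" by fastforce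
  have c: "(V, \<theta>) \<in> charts S" "p \<in> \<theta> ` V" using chart_at[of p] by (auto simp: V)
  let ?x = "coord_at S p"
  have x: "?x \<in> V" using chart_inv_in[OF c] by (simp add: coord_at_def V)
  let ?g = "metric_inv S \<theta> ?x" and ?h = "second_form S \<theta> ?x"
  define e where "e i = DX \<theta> ?x (?g *v (?h $ i))" for i
  have ee: "e i \<bullet> e k = (\<Sum>j\<in>UNIV. \<Sum>l\<in>UNIV. ?g $ j $ l * ?h $ i $ j * ?h $ k $ l)" for i k
  proof -
    have "e i \<bullet> e k = ?h $ k \<bullet> (?g *v (?h $ i))"
      by (simp add: e_def metric_bilinear[OF c(1) x, symmetric] metric_inv_vec[OF c(1) x] inner_commute)
    also have "\<dots> = ?h $ i \<bullet> (?g *v (?h $ k))" by (rule metric_inv_self_adjoint[OF c(1) x])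
    finally show ?thesis by (simp add: inner_vec_def matrix_vector_mult_def sum_distrib_left mult_ac)
  qed
  have "loc_norm_A_sq S \<theta> ?x = (\<Sum>i\<in>UNIV. \<Sum>k\<in>UNIV. ?g $ i $ k * (e i \<bullet> e k))"
    unfolding loc_norm_A_sq_def ee sum_distrib_left by (rule sum.cong[OF refl], subst sum.swap, simp only: mult.assoc)
  also have "\<dots> = (\<Sum>b\<in>UNIV. (\<chi> i. e i $ b) \<bullet> (?g *v (\<chi> i. e i $ b)))"
  proof -
    have "(\<Sum>i\<in>UNIV. \<Sum>k\<in>UNIV. ?g $ i $ k * (e i \<bullet> e k)) = (\<Sum>i\<in>UNIV. \<Sum>k\<in>UNIV. \<Sum>b\<in>UNIV. ?g $ i $ k * (e i $ b * e k $ b))"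
      by (simp add: inner_vec_def sum_distrib_left)
    also have "\<dots> = (\<Sum>i\<in>UNIV. \<Sum>b\<in>UNIV. \<Sum>k\<in>UNIV. ?g $ i $ k * (e i $ b * e k $ b))"
      by (intro sum.cong refl sum.swap)
    also have "\<dots> = (\<Sum>b\<in>UNIV. \<Sum>i\<in>UNIV. \<Sum>k\<in>UNIV. ?g $ i $ k * (e i $ b * e k $ b))" by (rule sum.swap)
    finally show ?thesis by (simp add: inner_vec_def matrix_vector_mult_def sum_distrib_left mult_ac)
  qed
  also have "\<dots> \<ge> 0" by (intro sum_nonneg metric_inv_nonneg[OF c(1) x])
  finally have "loc_norm_A_sq S \<theta> ?x \<ge> 0" .
  thus ?thesis by (simp add: norm_A_sq_def V)
qed

end

section \<open>The Riemannian measure\<close>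

text \<open>The push-forward needs a total map; outside \<open>W\<close> it is constant, and the
  density vanishes there, so that constant has no effect.\<close>

definition chart_measure :: "(real^'n) set \<Rightarrow> (real^'n \<Rightarrow> 'm::topological_space) \<Rightarrow> (real^'n \<Rightarrow> real) \<Rightarrow> 'm measure" where
  "chart_measure W \<psi> k = distr (density lborel (\<lambda>x. ennreal (indicator W x * k x))) borel (\<lambda>x. if x \<in> W then \<psi> x else undefined)"

lemma chart_measurable:
  assumes "open W" "continuous_on W \<psi>"
  shows "(\<lambda>x. if x \<in> W then \<psi> x else c) \<in> borel_measurable borel"
  by (rule borel_measurable_continuous_on_if) (use assms in auto)

lemma chart_preimage_borel:
  assumes "open W" "continuous_on W \<psi>" "B \<in> sets borel"
  shows "{x\<in>W. \<psi> x \<in> B} \<in> sets borel"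
proof -
  have "(\<lambda>x. if x \<in> W then \<psi> x else undefined) -` B \<inter> space borel \<inter> W \<in> sets borel"
    using measurable_sets[OF chart_measurable[OF assms(1,2)] assms(3)] assms(1) by (intro sets.Int) auto
  also have "(\<lambda>x. if x \<in> W then \<psi> x else undefined) -` B \<inter> space borel \<inter> W = {x\<in>W. \<psi> x \<in> B}" by auto
  finally show ?thesis .
qed

lemma indicator_times_measurable:
  fixes k :: "'a::topological_space \<Rightarrow> real"
  assumes "open W" "continuous_on W k"
  shows "(\<lambda>x. indicator W x * k x) \<in> borel_measurable borel"
  using borel_measurable_continuous_on_indicator[of W k] assms by simp

lemma emeasure_chart_measure:
  assumes W: "open W" "continuous_on W \<psi>" and k: "continuous_on W k" and B: "B \<in> sets borel"
  shows "emeasure (chart_measure W \<psi> k) B = (\<integral>\<^sup>+x\<in>{x\<in>W. \<psi> x \<in> B}. ennreal (k x) \<partial>lborel)"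
proof -
  let ?\<psi> = "\<lambda>x. if x \<in> W then \<psi> x else undefined"
  have m: "?\<psi> \<in> borel_measurable borel" by (rule chart_measurable[OF W])
  have d: "(\<lambda>x. ennreal (indicator W x * k x)) \<in> borel_measurable borel"
    using indicator_times_measurable[OF W(1) k] by simp
  have "emeasure (chart_measure W \<psi> k) B = emeasure (density lborel (\<lambda>x. ennreal (indicator W x * k x))) (?\<psi> -` B)"
    unfolding chart_measure_def using m B by (subst emeasure_distr) auto
  also have "\<dots> = (\<integral>\<^sup>+x. ennreal (indicator W x * k x) * indicator (?\<psi> -` B) x \<partial>lborel)"
    using d measurable_sets[OF m B] by (subst emeasure_density) auto
  also have "\<dots> = (\<integral>\<^sup>+x\<in>{x\<in>W. \<psi> x \<in> B}. ennreal (k x) \<partial>lborel)"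
    by (rule nn_integral_cong) (auto simp: indicator_def)
  finally show ?thesis .
qed

lemma sets_chart_measure [simp]: "sets (chart_measure W \<psi> k) = sets borel"
  by (simp add: chart_measure_def)

lemma integral_chart_measure:
  fixes f :: "'m::topological_space \<Rightarrow> real"
  assumes W: "open W" "continuous_on W \<psi>" and k: "continuous_on W k" "\<And>x. x \<in> W \<Longrightarrow> k x \<ge> 0" and f: "f \<in> borel_measurable borel"
  shows "integrable (chart_measure W \<psi> k) f \<longleftrightarrow> integrable lborel (\<lambda>x. indicator W x * (k x * f (\<psi> x)))"
    "(\<integral>p. f p \<partial>chart_measure W \<psi> k) = (\<integral>x. indicator W x * (k x * f (\<psi> x)) \<partial>lborel)"
    "(\<integral>\<^sup>+p. ennreal (f p) \<partial>chart_measure W \<psi> k) = (\<integral>\<^sup>+x. ennreal (indicator W x * (k x * f (\<psi> x))) \<partial>lborel)"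
proof -
  let ?\<psi> = "\<lambda>x. if x \<in> W then \<psi> x else undefined"
  have m: "?\<psi> \<in> borel_measurable borel" by (rule chart_measurable[OF W])
  have d: "(\<lambda>x. indicator W x * k x) \<in> borel_measurable borel" by (rule indicator_times_measurable[OF W(1) k(1)])
  have nn: "0 \<le> indicator W x * k x" for x using k(2) by (auto simp: indicator_def)
  have fm: "(\<lambda>x. f (?\<psi> x)) \<in> borel_measurable borel" by (rule measurable_compose[OF m f])
  have e: "(\<lambda>x. (indicator W x * k x) *\<^sub>R f (?\<psi> x)) = (\<lambda>x. indicator W x * (k x * f (\<psi> x)))"
    by (auto simp: indicator_def fun_eq_iff)
  show "integrable (chart_measure W \<psi> k) f \<longleftrightarrow> integrable lborel (\<lambda>x. indicator W x * (k x * f (\<psi> x)))"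
    unfolding chart_measure_def using m f fm d nn e by (simp add: integrable_distr_eq integrable_density)
  show "(\<integral>p. f p \<partial>chart_measure W \<psi> k) = (\<integral>x. indicator W x * (k x * f (\<psi> x)) \<partial>lborel)"
    unfolding chart_measure_def using m f fm d nn e by (simp add: integral_distr integral_density)
  have "(\<integral>\<^sup>+p. ennreal (f p) \<partial>chart_measure W \<psi> k) = (\<integral>\<^sup>+x. ennreal (indicator W x * k x) * ennreal (f (?\<psi> x)) \<partial>lborel)"
    unfolding chart_measure_def using m f fm d by (subst nn_integral_distr, simp, simp, subst nn_integral_density) auto
  also have "\<dots> = (\<integral>\<^sup>+x. ennreal (indicator W x * (k x * f (\<psi> x))) \<partial>lborel)"
    by (rule nn_integral_cong) (use k(2) in \<open>auto simp: indicator_def ennreal_mult'\<close>)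
  finally show "(\<integral>\<^sup>+p. ennreal (f p) \<partial>chart_measure W \<psi> k) = (\<integral>\<^sup>+x. ennreal (indicator W x * (k x * f (\<psi> x))) \<partial>lborel)" .
qed

section \<open>Existence and uniqueness of the Riemannian measure\<close>

context immersion
begin

text \<open>The condition inside the definite description that defines
  \<open>volume_measure\<close>.\<close>

definition is_volume :: "'m measure \<Rightarrow> bool" where
  "is_volume \<mu> \<longleftrightarrow> sets \<mu> = sets borel \<and>
     (\<forall>(W, \<psi>)\<in>charts S. \<forall>B\<in>sets borel. B \<subseteq> \<psi> ` W \<longrightarrow>
        emeasure \<mu> B = (\<integral>\<^sup>+x\<in>{x\<in>W. \<psi> x \<in> B}. ennreal (vol_density S \<psi> x) \<partial>lborel))"

lemma is_volumeD: "is_volume \<mu> \<Longrightarrow> (W, \<psi>) \<in> charts S \<Longrightarrow> B \<in> sets borel \<Longrightarrow> B \<subseteq> \<psi> ` W \<Longrightarrow>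
   emeasure \<mu> B = (\<integral>\<^sup>+x\<in>{x\<in>W. \<psi> x \<in> B}. ennreal (vol_density S \<psi> x) \<partial>lborel)"
  unfolding is_volume_def by blast

lemma continuous_vol_density: "(W, \<psi>) \<in> charts S \<Longrightarrow> continuous_on W (vol_density S \<psi>)"
  by (rule smooth_on_continuous[OF smooth_vol_density])

text \<open>Change of variables along the transition map, whose Jacobian is exactly the ratio of the
  two densities.\<close>

lemma volume_overlap:
  assumes c1: "(W, \<psi>) \<in> charts S" and c2: "(V, \<theta>) \<in> charts S"
    and B: "B \<in> sets borel" "B \<subseteq> \<psi> ` W" "B \<subseteq> \<theta> ` V"
  shows "(\<integral>\<^sup>+x\<in>{x\<in>W. \<psi> x \<in> B}. ennreal (vol_density S \<psi> x) \<partial>lborel) = 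
     (\<integral>\<^sup>+y\<in>{y\<in>V. \<theta> y \<in> B}. ennreal (vol_density S \<theta> y) \<partial>lborel)"
proof -
  let ?t = "trans \<psi> V \<theta>"
  let ?T = "{x\<in>W. \<psi> x \<in> B}" and ?R = "{y\<in>V. \<theta> y \<in> B}"
  note tdef = trans_def[OF c1 c2]
  have To: "?T \<subseteq> overlap W \<psi> V \<theta>" using B by (auto simp: overlap_def[OF c1 c2])
  have im: "?t ` ?T = ?R"
  proof
    show "?t ` ?T \<subseteq> ?R" using To trans_in[OF c1 c2] trans_eq[OF c1 c2] by fastforce
    show "?R \<subseteq> ?t ` ?T"
    proof
      fix y assume y: "y \<in> ?R"
      then obtain x where x: "x \<in> W" "\<psi> x = \<theta> y" using B(2) by (metis (no_types, lifting) imageE mem_Collect_eq subsetD)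
      hence "?t x = y" using y by (simp add: tdef chart_inv[OF c2])
      thus "y \<in> ?t ` ?T" using x y by (intro image_eqI[of _ _ x]) auto
    qed
  qed
  \<comment> \<open>Extended by 0 off V, because the change of variables asks for an integrand that
    is nonnegative everywhere.\<close>
  define f where "f y = (if y \<in> V then vol_density S \<theta> y else 0)" for y
  have f0: "f y \<ge> 0" for y using vol_density_pos[OF c2] by (auto simp: f_def less_imp_le)
  have mT: "?T \<in> sets borel" by (rule chart_preimage_borel[OF chart_open[OF c1] chart_continuous[OF c1] B(1)])
  have mR: "?R \<in> sets borel" by (rule chart_preimage_borel[OF chart_open[OF c2] chart_continuous[OF c2] B(1)])
  have e1: "indicator ?T x * (\<bar>det (matrix (frechet_derivative ?t (at x)))\<bar> * f (?t x)) = indicator ?T x * (indicator W x * vol_density S \<psi> x)" for x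
  proof (cases "x \<in> ?T")
    case True
    hence o: "x \<in> overlap W \<psi> V \<theta>" using To by blast
    show ?thesis using vol_density_trans[OF c1 c2 o] trans_in[OF c1 c2 o] True by (simp add: f_def)
  qed simp
  have e2: "indicator ?R y * f y = indicator ?R y * (indicator V y * vol_density S \<theta> y)" for y
    by (auto simp: f_def indicator_def)
  have "(\<integral>\<^sup>+x. ennreal (indicator ?T x * (\<bar>det (matrix (frechet_derivative ?t (at x)))\<bar> * f (?t x))) \<partial>lborel) =
     (\<integral>\<^sup>+y. ennreal (indicator (?t ` ?T) y * f y) \<partial>lborel)"
  proof (rule nn_change_of_variables[OF mT _ _ f0])
    show "(?t has_derivative frechet_derivative ?t (at x)) (at x)" if "x \<in> ?T" for x
      using smooth_on_has_derivative[OF smooth_trans[OF c1 c2]] To that by blast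
    show "inj_on ?t ?T" by (rule inj_on_subset[OF trans_inj[OF c1 c2] To])
    show "(\<lambda>y. indicator (?t ` ?T) y * f y) \<in> borel_measurable borel"
      unfolding im e2
      by (rule borel_measurable_times[OF borel_measurable_indicator[OF mR] indicator_times_measurable[OF chart_open[OF c2] continuous_vol_density[OF c2]]])
    show "(\<lambda>x. indicator ?T x * (\<bar>det (matrix (frechet_derivative ?t (at x)))\<bar> * f (?t x))) \<in> borel_measurable borel"
      unfolding e1
      by (rule borel_measurable_times[OF borel_measurable_indicator[OF mT] indicator_times_measurable[OF chart_open[OF c1] continuous_vol_density[OF c1]]])
  qed
  moreover have "(\<integral>\<^sup>+x. ennreal (indicator ?T x * (\<bar>det (matrix (frechet_derivative ?t (at x)))\<bar> * f (?t x))) \<partial>lborel)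
     = (\<integral>\<^sup>+x\<in>?T. ennreal (vol_density S \<psi> x) \<partial>lborel)"
    unfolding e1 by (rule nn_integral_cong) (auto simp: indicator_def)
  moreover have "(\<integral>\<^sup>+y. ennreal (indicator (?t ` ?T) y * f y) \<partial>lborel) = (\<integral>\<^sup>+y\<in>?R. ennreal (vol_density S \<theta> y) \<partial>lborel)"
    unfolding im e2 by (rule nn_integral_cong) (auto simp: indicator_def)
  ultimately show ?thesis by simp
qed

text \<open>Second countability gives a countable subcover by the Lindelof property; the enumeration
  may repeat charts.\<close>

lemma countable_atlas:
  obtains c :: "nat \<Rightarrow> ('m, 'n) chart" where "range c \<subseteq> charts S" "(\<Union>n. snd (c n) ` fst (c n)) = UNIV"
proof -
  let ?F = "(\<lambda>c. snd c ` fst c) ` charts S"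
  have "open U" if "U \<in> ?F" for U using that chart_open_image by auto
  then obtain F' where F': "F' \<subseteq> ?F" "countable F'" "\<Union>F' = \<Union>?F" using Lindelof[of ?F] by blast
  obtain C where C: "C \<subseteq> charts S" "countable C" "F' = (\<lambda>c. snd c ` fst c) ` C"
    using countable_subset_image[of F' "\<lambda>c. snd c ` fst c" "charts S"] F'(1,2) by blast
  have "\<Union>?F = UNIV" using atlas_cover by (auto simp: case_prod_beta)
  hence U: "(\<Union>c\<in>C. snd c ` fst c) = UNIV" using F'(3) C(3) by simp
  hence "C \<noteq> {}" by auto
  hence r: "range (from_nat_into C) = C" by (rule range_from_nat_into) (rule C(2))
  show ?thesis
  proof (rule that[of "from_nat_into C"])
    show "range (from_nat_into C) \<subseteq> charts S" using r C(1) by simp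
    have "(\<Union>n. snd (from_nat_into C n) ` fst (from_nat_into C n)) = (\<Union>c\<in>range (from_nat_into C). snd c ` fst c)" by simp
    thus "(\<Union>n. snd (from_nat_into C n) ` fst (from_nat_into C n)) = UNIV" unfolding r U .
  qed
qed

text \<open>The countable cover by charts is made disjoint, and each piece is measured in its own
  chart. A set inside any other chart gets the right measure because the two densities agree on
  overlaps.\<close>

lemma is_volume_exists: "\<exists>\<mu>. is_volume \<mu>"
proof -
  obtain c :: "nat \<Rightarrow> ('m, 'n) chart" where c: "range c \<subseteq> charts S" "(\<Union>n. snd (c n) ` fst (c n)) = UNIV"
    by (rule countable_atlas)
  define W where "W n = fst (c n)" for n
  define \<psi> where "\<psi> n = snd (c n)" for n
  have cn: "(W n, \<psi> n) \<in> charts S" for n using c(1) by (auto simp: W_def \<psi>_def)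
  define D where "D = disjointed (\<lambda>n. \<psi> n ` W n)"
  have D: "D n \<in> sets borel" for n
  proof -
    have "range D \<subseteq> sets borel" unfolding D_def
      by (rule sets.range_disjointed_sets) (use chart_open_image[OF cn] in auto)
    thus ?thesis by blast
  qed
  have Dsub: "D n \<subseteq> \<psi> n ` W n" for n unfolding D_def by (rule disjointed_subset)
  have DU: "(\<Union>n. D n) = UNIV" unfolding D_def UN_disjointed_eq using c(2) by (simp add: W_def \<psi>_def)
  have Ddis: "disjoint_family D" unfolding D_def by (rule disjoint_family_disjointed)
  define \<nu> where "\<nu> n = chart_measure (W n) (\<psi> n) (vol_density S (\<psi> n))" for n
  have \<nu>: "emeasure (\<nu> n) B = (\<integral>\<^sup>+x\<in>{x\<in>W n. \<psi> n x \<in> B}. ennreal (vol_density S (\<psi> n) x) \<partial>lborel)" if "B \<in> sets borel" for n B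
    unfolding \<nu>_def by (rule emeasure_chart_measure[OF chart_open[OF cn] chart_continuous[OF cn] continuous_vol_density[OF cn] that])
  have s\<nu>: "sets (\<nu> n) = sets borel" for n by (simp add: \<nu>_def)
  define e where "e B = (\<Sum>n. emeasure (\<nu> n) (B \<inter> D n))" for B
  define \<mu> where "\<mu> = measure_of UNIV (sets borel) e"
  have em: "emeasure \<mu> B = e B" if "B \<in> sets borel" for B
    unfolding \<mu>_def
  proof (rule emeasure_measure_of_sigma)
    show "sigma_algebra UNIV (sets (borel :: 'm measure))" using sets.sigma_algebra_axioms[of borel] by simp
    show "positive (sets borel) e" by (simp add: positive_def e_def)
    show "countably_additive (sets borel) e"
    proof (rule countably_additiveI)
      fix A :: "nat \<Rightarrow> 'm set" assume A: "range A \<subseteq> sets borel" "disjoint_family A" "(\<Union>i. A i) \<in> sets borel"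
      \<comment> \<open>The sum over pieces is written as an integral over a counting measure, so
        that the two infinite sums can be interchanged.\<close>
      have "(\<Sum>i. e (A i)) = (\<Sum>i. \<integral>\<^sup>+n. emeasure (\<nu> n) (A i \<inter> D n) \<partial>count_space UNIV)"
        by (simp add: e_def nn_integral_count_space_nat)
      also have "\<dots> = (\<integral>\<^sup>+n. (\<Sum>i. emeasure (\<nu> n) (A i \<inter> D n)) \<partial>count_space UNIV)"
        by (rule nn_integral_suminf[symmetric]) simp
      also have "\<dots> = (\<integral>\<^sup>+n. emeasure (\<nu> n) ((\<Union>i. A i) \<inter> D n) \<partial>count_space UNIV)"
      proof (rule nn_integral_cong)
        fix n
        have "(\<Sum>i. emeasure (\<nu> n) (A i \<inter> D n)) = emeasure (\<nu> n) (\<Union>i. A i \<inter> D n)"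
          by (rule suminf_emeasure) (use A D in \<open>auto simp: s\<nu> disjoint_family_on_def\<close>)
        thus "(\<Sum>i. emeasure (\<nu> n) (A i \<inter> D n)) = emeasure (\<nu> n) ((\<Union>i. A i) \<inter> D n)" by simp
      qed
      also have "\<dots> = e (\<Union>i. A i)" by (simp add: e_def nn_integral_count_space_nat)
      finally show "(\<Sum>i. e (A i)) = e (\<Union>i. A i)" .
    qed
    show "B \<in> sets borel" by (rule that)
  qed
  have vol: "emeasure \<mu> B = (\<integral>\<^sup>+x\<in>{x\<in>V. \<theta> x \<in> B}. ennreal (vol_density S \<theta> x) \<partial>lborel)"
    if c2: "(V, \<theta>) \<in> charts S" and B: "B \<in> sets borel" "B \<subseteq> \<theta> ` V" for V \<theta> B
  proof -
    let ?L = "chart_measure V \<theta> (vol_density S \<theta>)"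
    have L: "emeasure ?L C = (\<integral>\<^sup>+x\<in>{x\<in>V. \<theta> x \<in> C}. ennreal (vol_density S \<theta> x) \<partial>lborel)" if "C \<in> sets borel" for C
      by (rule emeasure_chart_measure[OF chart_open[OF c2] chart_continuous[OF c2] continuous_vol_density[OF c2] that])
    have "emeasure (\<nu> n) (B \<inter> D n) = emeasure ?L (B \<inter> D n)" for n
      using volume_overlap[OF cn c2, of "B \<inter> D n" n] B D[of n] Dsub[of n] by (subst \<nu>, simp, subst L, simp) auto
    hence "emeasure \<mu> B = (\<Sum>n. emeasure ?L (B \<inter> D n))" by (simp add: em[OF B(1)] e_def)
    also have "\<dots> = emeasure ?L (\<Union>n. B \<inter> D n)"
      by (rule suminf_emeasure[OF _ disjoint_family_subset[OF Ddis]]) (use B D in auto)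
    also have "(\<Union>n. B \<inter> D n) = B" using DU by blast
    finally show ?thesis by (simp add: L[OF B(1)])
  qed
  have "sets \<mu> = sets borel" unfolding \<mu>_def using sets.sets_measure_of_eq[of borel e] by simp
  hence "is_volume \<mu>" unfolding is_volume_def using vol by auto
  thus ?thesis by blast
qed

text \<open>A Borel set is cut along the disjointed chart cover, and on each piece the value is
  prescribed.\<close>

lemma is_volume_unique:
  assumes \<mu>: "is_volume \<mu>" and \<nu>: "is_volume \<nu>"
  shows "\<mu> = \<nu>"
proof -
  obtain c :: "nat \<Rightarrow> ('m, 'n) chart" where c: "range c \<subseteq> charts S" "(\<Union>n. snd (c n) ` fst (c n)) = UNIV"
    by (rule countable_atlas)
  have cn: "(fst (c n), snd (c n)) \<in> charts S" for n using c(1) by auto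
  define D where "D = disjointed (\<lambda>n. snd (c n) ` fst (c n))"
  have "range D \<subseteq> sets borel" unfolding D_def
    by (rule sets.range_disjointed_sets) (use chart_open_image[OF cn] in auto)
  hence D: "D n \<in> sets borel" for n by blast
  have Dsub: "D n \<subseteq> snd (c n) ` fst (c n)" for n unfolding D_def by (rule disjointed_subset)
  have DU: "(\<Union>n. D n) = UNIV" unfolding D_def UN_disjointed_eq using c(2) by simp
  have Ddis: "disjoint_family D" unfolding D_def by (rule disjoint_family_disjointed)
  have sets: "sets \<mu> = sets borel" "sets \<nu> = sets borel" using \<mu> \<nu> by (auto simp: is_volume_def)
  show ?thesis
  proof (rule measure_eqI)
    show "sets \<mu> = sets \<nu>" using sets by simp
    fix B assume "B \<in> sets \<mu>"
    hence B: "B \<in> sets borel" using sets by simp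
    have BU: "(\<Union>n. B \<inter> D n) = B" using DU by blast
    have "emeasure N B = (\<Sum>n. emeasure N (B \<inter> D n))" if "sets N = sets borel" for N
    proof -
      have "(\<Sum>n. emeasure N (B \<inter> D n)) = emeasure N (\<Union>n. B \<inter> D n)"
        by (rule suminf_emeasure[OF _ disjoint_family_subset[OF Ddis]]) (use B D that in auto)
      thus ?thesis by (simp only: BU)
    qed
    moreover have "emeasure \<mu> (B \<inter> D n) = emeasure \<nu> (B \<inter> D n)" for n
    proof -
      have "B \<inter> D n \<in> sets borel" "B \<inter> D n \<subseteq> snd (c n) ` fst (c n)" using B D Dsub by auto
      from is_volumeD[OF \<mu> cn this] is_volumeD[OF \<nu> cn this] show ?thesis by simp
    qed
    ultimately show "emeasure \<mu> B = emeasure \<nu> B" using sets by simp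
  qed
qed

lemma is_volume_volume_measure: "is_volume (volume_measure S)"
proof -
  have "is_volume (THE \<mu>. is_volume \<mu>)"
    by (rule theI') (use is_volume_exists is_volume_unique in blast)
  moreover have "volume_measure S = (THE \<mu>. is_volume \<mu>)" unfolding volume_measure_def is_volume_def ..
  ultimately show ?thesis by simp
qed

lemma sets_volume_measure [simp]: "sets (volume_measure S) = sets borel"
  using is_volume_volume_measure by (simp add: is_volume_def)

lemma continuous_on_charts:
  fixes f :: "'m \<Rightarrow> 'b::topological_space"
  assumes "\<And>W \<psi>. (W, \<psi>) \<in> charts S \<Longrightarrow> continuous_on W (f \<circ> \<psi>)"
  shows "continuous_on UNIV f"
proof -
  have "isCont f p" for p
  proof -
    obtain W \<psi> x where c: "(W, \<psi>) \<in> charts S" and x: "x \<in> W" "\<psi> x = p" using charts_cover by blast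
    have "continuous_on (\<psi> ` W) ((f \<circ> \<psi>) \<circ> the_inv_into W \<psi>)"
      by (rule continuous_on_compose[OF chart_inv_continuous[OF c]])
        (rule continuous_on_subset[OF assms[OF c]], use chart_inv_in[OF c] in auto)
    hence "continuous_on (\<psi> ` W) f"
      by (rule continuous_on_eq) (use chart_inv_in[OF c] in auto)
    moreover have "p \<in> \<psi> ` W" using x by blast
    ultimately show ?thesis using continuous_on_eq_continuous_at[OF chart_open_image[OF c]] by blast
  qed
  thus ?thesis by (simp add: continuous_at_imp_continuous_on)
qed

lemma C_k_fun_continuous: "C_k_fun k S f \<Longrightarrow> continuous_on UNIV f"
  by (rule continuous_on_charts) (rule C_k_on_continuous[of k], auto simp: C_k_fun_def simp del: o_apply)

lemma continuous_weight: "continuous_on UNIV (weight S)"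
  by (rule continuous_on_charts) (use smooth_on_continuous[OF smooth_weight_chart] in \<open>simp add: o_def\<close>)

section \<open>The weighted measure\<close>

definition wmeas :: "'m measure" where "wmeas = density (volume_measure S) (\<lambda>p. ennreal (exp (weight S p)))"

lemma sets_wmeas [simp]: "sets wmeas = sets borel" by (simp add: wmeas_def)

lemma space_wmeas [simp]: "space wmeas = UNIV" using sets_eq_imp_space_eq[OF sets_wmeas] by simp

lemma exp_weight_measurable: "(\<lambda>p. ennreal (exp (weight S p))) \<in> borel_measurable (volume_measure S)"
proof -
  have "(\<lambda>p. exp (weight S p)) \<in> borel_measurable borel"
    by (intro borel_measurable_continuous_onI continuous_intros continuous_weight)
  hence "(\<lambda>p. ennreal (exp (weight S p))) \<in> borel_measurable borel" by simp
  thus ?thesis using measurable_cong_sets[OF sets_volume_measure refl] by blast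
qed

text \<open>Restricted to one chart, the weighted area is a push-forward from coordinates; through
  this every integral of a function supported in a chart becomes a Lebesgue integral with density
  \<open>rho\<close>.\<close>

lemma wmeas_chart:
  assumes c: "(W, \<psi>) \<in> charts S"
  shows "density wmeas (\<lambda>p. ennreal (indicator (\<psi> ` W) p)) = chart_measure W \<psi> (rho \<psi>)"
proof (rule measure_eqI)
  show "sets (density wmeas (\<lambda>p. ennreal (indicator (\<psi> ` W) p))) = sets (chart_measure W \<psi> (rho \<psi>))" by simp
  fix B assume "B \<in> sets (density wmeas (\<lambda>p. ennreal (indicator (\<psi> ` W) p)))"
  hence B: "B \<in> sets borel" by simp
  have BW: "B \<inter> \<psi> ` W \<in> sets borel" using B chart_open_image[OF c] by auto
  have vol: "density (volume_measure S) (indicator (\<psi> ` W)) = chart_measure W \<psi> (vol_density S \<psi>)"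
  proof (rule measure_eqI)
    fix C assume "C \<in> sets (density (volume_measure S) (indicator (\<psi> ` W)))"
    hence C: "C \<in> sets borel" by simp
    have "(indicator (\<psi> ` W) :: 'm \<Rightarrow> ennreal) \<in> borel_measurable (volume_measure S)"
      by (rule borel_measurable_indicator) (use chart_open_image[OF c] in simp)
    hence "emeasure (density (volume_measure S) (indicator (\<psi> ` W))) C = emeasure (volume_measure S) (C \<inter> \<psi> ` W)"
      using C chart_open_image[OF c] by (subst emeasure_density) (auto simp: indicator_inter_arith[symmetric] mult.commute nn_integral_indicator)
    also have "\<dots> = emeasure (chart_measure W \<psi> (vol_density S \<psi>)) (C \<inter> \<psi> ` W)"
      using is_volumeD[OF is_volume_volume_measure c] C chart_open_image[OF c]
        emeasure_chart_measure[OF chart_open[OF c] chart_continuous[OF c] continuous_vol_density[OF c], of "C \<inter> \<psi> ` W"] by simp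
    also have "\<dots> = emeasure (chart_measure W \<psi> (vol_density S \<psi>)) C"
    proof -
      have "{x\<in>W. \<psi> x \<in> C \<inter> \<psi> ` W} = {x\<in>W. \<psi> x \<in> C}" by auto
      thus ?thesis using C chart_open_image[OF c]
        by (simp add: emeasure_chart_measure[OF chart_open[OF c] chart_continuous[OF c] continuous_vol_density[OF c]])
    qed
    finally show "emeasure (density (volume_measure S) (indicator (\<psi> ` W))) C = emeasure (chart_measure W \<psi> (vol_density S \<psi>)) C" .
  qed simp
  let ?f = "\<lambda>p. exp (weight S p) * indicator B p"
  have fm: "?f \<in> borel_measurable borel"
    using B by (intro borel_measurable_times borel_measurable_continuous_onI[of "\<lambda>p. exp (weight S p)"] continuous_intros continuous_weight) auto
  have iv: "(indicator (\<psi> ` W) :: 'm \<Rightarrow> ennreal) \<in> borel_measurable (volume_measure S)"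
    by (rule borel_measurable_indicator) (use chart_open_image[OF c] in simp)
  have "(\<lambda>p. ennreal (?f p)) \<in> borel_measurable borel" using fm by simp
  hence fv: "(\<lambda>p. ennreal (?f p)) \<in> borel_measurable (volume_measure S)"
    using measurable_cong_sets[OF sets_volume_measure refl] by blast
  have "emeasure (density wmeas (\<lambda>p. ennreal (indicator (\<psi> ` W) p))) B = 
    (\<integral>\<^sup>+p. ennreal (exp (weight S p)) * (ennreal (indicator (\<psi> ` W) p) * indicator B p) \<partial>volume_measure S)"
  proof -
    let ?g = "\<lambda>p. ennreal (indicator (\<psi> ` W) p)"
    have g: "?g \<in> borel_measurable M" if "sets M = sets borel" for M
      by (rule measurable_compose[OF borel_measurable_indicator measurable_ennreal])
        (use that chart_open_image[OF c] in simp)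
    have "emeasure (density wmeas ?g) B = (\<integral>\<^sup>+p. ?g p * indicator B p \<partial>wmeas)"
      by (rule emeasure_density[OF g]) (use B in simp_all)
    also have "\<dots> = (\<integral>\<^sup>+p. ennreal (exp (weight S p)) * (?g p * indicator B p) \<partial>volume_measure S)"
      unfolding wmeas_def
      by (rule nn_integral_density[OF exp_weight_measurable borel_measurable_times_ennreal[OF g borel_measurable_indicator]])
        (use B in simp_all)
    finally show ?thesis .
  qed
  also have "\<dots> = (\<integral>\<^sup>+p. indicator (\<psi> ` W) p * ennreal (?f p) \<partial>volume_measure S)"
    by (rule nn_integral_cong) (auto simp: indicator_def)
  also have "\<dots> = (\<integral>\<^sup>+p. ennreal (?f p) \<partial>chart_measure W \<psi> (vol_density S \<psi>))"
    unfolding vol[symmetric] by (rule nn_integral_density[OF iv fv, symmetric])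
  also have "\<dots> = (\<integral>\<^sup>+x. ennreal (indicator W x * (vol_density S \<psi> x * ?f (\<psi> x))) \<partial>lborel)"
    by (rule integral_chart_measure(3)[OF chart_open[OF c] chart_continuous[OF c] continuous_vol_density[OF c] _ fm])
      (use vol_density_pos[OF c] in \<open>auto simp: less_imp_le\<close>)
  also have "\<dots> = (\<integral>\<^sup>+x\<in>{x\<in>W. \<psi> x \<in> B}. ennreal (rho \<psi> x) \<partial>lborel)"
    by (rule nn_integral_cong) (auto simp: indicator_def rho_def[OF c])
  also have "\<dots> = emeasure (chart_measure W \<psi> (rho \<psi>)) B"
    by (rule emeasure_chart_measure[OF chart_open[OF c] chart_continuous[OF c] smooth_on_continuous[OF smooth_rho[OF c]] B, symmetric])
  finally show "emeasure (density wmeas (\<lambda>p. ennreal (indicator (\<psi> ` W) p))) B = emeasure (chart_measure W \<psi> (rho \<psi>)) B" .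
qed

lemma integral_wmeas_chart:
  fixes f :: "'m \<Rightarrow> real"
  assumes c: "(W, \<psi>) \<in> charts S" and f: "f \<in> borel_measurable borel" "\<And>p. p \<notin> \<psi> ` W \<Longrightarrow> f p = 0"
  shows "integrable wmeas f \<longleftrightarrow> integrable lborel (\<lambda>x. indicator W x * (rho \<psi> x * f (\<psi> x)))"
    "(\<integral>p. f p \<partial>wmeas) = (\<integral>x. indicator W x * (rho \<psi> x * f (\<psi> x)) \<partial>lborel)"
proof -
  have fi: "indicator (\<psi> ` W) p * f p = f p" for p using f(2)[of p] by (auto simp: indicator_def)
  have m: "f \<in> borel_measurable wmeas" "indicat_real (\<psi> ` W) \<in> borel_measurable wmeas"
    using f(1) chart_open_image[OF c] by (auto simp: measurable_cong_sets[OF sets_wmeas refl])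
  note r = chart_open[OF c] chart_continuous[OF c] smooth_on_continuous[OF smooth_rho[OF c]] less_imp_le[OF rho_pos[OF c]]
  show "integrable wmeas f \<longleftrightarrow> integrable lborel (\<lambda>x. indicator W x * (rho \<psi> x * f (\<psi> x)))"
    using integrable_density[OF m] integral_chart_measure(1)[OF r f(1)] unfolding wmeas_chart[OF c] by (simp add: fi)
  show "(\<integral>p. f p \<partial>wmeas) = (\<integral>x. indicator W x * (rho \<psi> x * f (\<psi> x)) \<partial>lborel)"
    using integral_density[OF m] integral_chart_measure(2)[OF r f(1)] unfolding wmeas_chart[OF c] by (simp add: fi)
qed

text \<open>The measure is locally finite, since the density is bounded on closed balls inside a
  chart; finitely many such neighbourhoods cover K.\<close>

lemma compact_wmeas_finite:
  assumes K: "compact K" shows "emeasure wmeas K < \<infinity>"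
proof -
  have "\<exists>G. open G \<and> p \<in> G \<and> emeasure wmeas G < \<infinity>" for p
  proof -
    obtain W \<psi> x where c: "(W, \<psi>) \<in> charts S" and x: "x \<in> W" "\<psi> x = p" using charts_cover by blast
    obtain r where r: "r > 0" "cball x r \<subseteq> W" using chart_open[OF c] x(1) open_contains_cball by blast
    let ?O = "\<psi> ` ball x r"
    have bW: "ball x r \<subseteq> W" using r(2) ball_subset_cball by blast
    have o: "open ?O" by (rule chart_open_map[OF c open_ball bW])
    have Om: "?O \<in> sets borel" using o by simp
    have ie: "indicator W y * (rho \<psi> y * indicator ?O (\<psi> y)) = indicator (ball x r) y * rho \<psi> y" for y
    proof (cases "y \<in> W")
      case True
      have "\<psi> y \<in> ?O \<longleftrightarrow> y \<in> ball x r" by (rule inj_on_image_mem_iff[OF chart_inj[OF c] True bW])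
      hence "indicator ?O (\<psi> y) = (indicator (ball x r) y :: real)" by (simp only: indicator_def)
      thus ?thesis using True by simp
    next
      case False
      hence "y \<notin> ball x r" using bW by blast
      thus ?thesis using False by simp
    qed
    have "integrable lborel (\<lambda>y. indicator (cball x r) y *\<^sub>R rho \<psi> y)"
      by (rule borel_integrable_compact[OF compact_cball continuous_on_subset[OF smooth_on_continuous[OF smooth_rho[OF c]] r(2)]])
    hence "integrable lborel (\<lambda>y. indicator W y * (rho \<psi> y * indicator ?O (\<psi> y)))"
    proof (rule Bochner_Integration.integrable_bound)
      show "(\<lambda>y. indicator W y * (rho \<psi> y * indicator ?O (\<psi> y))) \<in> borel_measurable lborel"
        unfolding ie using indicator_times_measurable[OF open_ball continuous_on_subset[OF smooth_on_continuous[OF smooth_rho[OF c]] bW]] by simp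
      show "AE y in lborel. norm (indicator W y * (rho \<psi> y * indicator ?O (\<psi> y))) \<le> norm (indicator (cball x r) y *\<^sub>R rho \<psi> y)"
        unfolding ie by (intro AE_I2) (simp add: indicator_def)
    qed
    hence "integrable wmeas (indicat_real ?O)"
      using bW by (subst integral_wmeas_chart(1)[OF c]) (use Om in \<open>auto simp: indicator_def\<close>)
    hence "emeasure wmeas ?O < \<infinity>" using Om by (simp add: integrable_indicator_iff)
    thus ?thesis using o r(1) x(2) by (intro exI[of _ ?O]) auto
  qed
  then obtain G where G: "\<And>p. open (G p)" "\<And>p. p \<in> G p" "\<And>p. emeasure wmeas (G p) < \<infinity>" by metis
  have cov: "K \<subseteq> (\<Union>p\<in>K. G p)" using G(2) by blast
  obtain F where "F \<subseteq> K" and F: "finite F" "K \<subseteq> (\<Union>p\<in>F. G p)"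
    by (rule compactE_image[OF K G(1) cov])
  have "emeasure wmeas K \<le> emeasure wmeas (\<Union>p\<in>F. G p)" using F G(1) by (intro emeasure_mono) auto
  also have "\<dots> \<le> (\<Sum>p\<in>F. emeasure wmeas (G p))" using F G(1) by (intro emeasure_subadditive_finite) auto
  also have "\<dots> < \<infinity>" using F(1) G(3) by (simp add: ennreal_sum_less_top less_top)
  finally show ?thesis .
qed

lemma integrable_wmeas:
  fixes f :: "'m \<Rightarrow> real"
  assumes "continuous_on UNIV f" "supported_in UNIV f"
  shows "integrable wmeas f"
proof -
  obtain K where K: "compact K" "\<And>x. x \<notin> K \<Longrightarrow> f x = 0" using assms(2) by (auto simp: supported_in_def)
  obtain B where B: "\<And>x. norm (f x) \<le> B" using bounded_supported[OF assms] by blast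
  have "integrable wmeas (\<lambda>x. B * indicator K x)"
    using compact_wmeas_finite[OF K(1)] compact_imp_closed[OF K(1)] by (simp add: integrable_indicator_iff)
  thus ?thesis
  proof (rule Bochner_Integration.integrable_bound)
    show "f \<in> borel_measurable wmeas"
      using borel_measurable_continuous_onI[OF assms(1)] by (simp add: measurable_cong_sets[OF sets_wmeas refl])
    show "AE x in wmeas. norm (f x) \<le> norm (B * indicator K x)"
      using B K(2) by (intro AE_I2) (smt (verit) indicator_simps mult_cancel_left2 mult_zero_right norm_ge_zero norm_zero real_norm_def)
  qed
qed

end

section \<open>Minimisation\<close>

context immersion
begin

section \<open>Smooth functions of compact support\<close>

lemma smooth_funI: "(\<And>W \<psi>. (W, \<psi>) \<in> charts S \<Longrightarrow> smooth_on W (u \<circ> \<psi>)) \<Longrightarrow> smooth_fun S u"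
  unfolding smooth_fun_def C_k_fun_def smooth_on_def by blast

lemma smooth_fun_add: "smooth_fun S u \<Longrightarrow> smooth_fun S v \<Longrightarrow> smooth_fun S (\<lambda>p. u p + v p :: real)"
  by (rule smooth_funI, unfold o_def, rule smooth_on_add[OF chart_open])
    (use smooth_fun_chart in \<open>auto simp: o_def\<close>)

lemma smooth_fun_cmult: "smooth_fun S u \<Longrightarrow> smooth_fun S (\<lambda>p. c * u p :: real)"
  by (rule smooth_funI, unfold o_def, rule smooth_on_compose_linear[OF chart_open _ bounded_linear_mult_right])
    (use smooth_fun_chart in \<open>auto simp: o_def\<close>)

definition CC :: "('m \<Rightarrow> real) \<Rightarrow> bool" where "CC u \<longleftrightarrow> smooth_fun S u \<and> supported_in UNIV u"

lemma CC_smooth: "CC u \<Longrightarrow> smooth_fun S u" by (simp add: CC_def)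
lemma CC_C1: "CC u \<Longrightarrow> C_k_fun 1 S u" by (simp add: CC_def smooth_fun_def)

lemma CC_continuous: "CC u \<Longrightarrow> continuous_on UNIV u"
  by (rule C_k_fun_continuous[OF CC_C1])

lemma CC_add: "CC u \<Longrightarrow> CC v \<Longrightarrow> CC (\<lambda>p. u p + v p)"
  by (simp add: CC_def smooth_fun_add supported_in_add)

lemma supported_in_cmult: "supported_in W u \<Longrightarrow> supported_in W (\<lambda>p. c * u p :: real)"
  unfolding supported_in_def by (metis mult_zero_right)

lemma CC_cmult: "CC u \<Longrightarrow> CC (\<lambda>p. c * u p)"
  by (simp add: CC_def smooth_fun_cmult supported_in_cmult)

lemma CC_zero: "CC (\<lambda>p. 0)"
  unfolding CC_def by (rule conjI, rule smooth_funI, unfold o_def, rule smooth_on_const[OF chart_open]) (auto simp: supported_in_def)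

lemma chart_has_derivative:
  assumes c: "(W, \<psi>) \<in> charts S" and x: "x \<in> W" and u: "C_k_fun 1 S u"
  shows "((u \<circ> \<psi>) has_derivative frechet_derivative (u \<circ> \<psi>) (at x)) (at x)"
proof -
  have "C_k_on (Suc 0) W (u \<circ> \<psi>)" using c u by (auto simp: C_k_fun_def simp del: C_k_on.simps)
  thus ?thesis using C_k_on_has_derivative x by blast
qed

lemma grad_vec_lincomb:
  fixes u v :: "'m \<Rightarrow> real"
  assumes c: "(W, \<psi>) \<in> charts S" and x: "x \<in> W" and u: "C_k_fun 1 S u" and v: "C_k_fun 1 S v"
  shows "grad_vec (\<lambda>p. a * u p + b * v p) \<psi> x = a *\<^sub>R grad_vec u \<psi> x + b *\<^sub>R grad_vec v \<psi> x"
proof -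
  have "(((\<lambda>p. a * u p + b * v p) \<circ> \<psi>) has_derivative (\<lambda>h. a * frechet_derivative (u \<circ> \<psi>) (at x) h + b * frechet_derivative (v \<circ> \<psi>) (at x) h)) (at x)"
    using has_derivative_add[OF has_derivative_mult_right[OF chart_has_derivative[OF c x u], of a] has_derivative_mult_right[OF chart_has_derivative[OF c x v], of b]]
    by (simp add: o_def)
  from frechet_derivative_at[OF this, symmetric] show ?thesis by (simp add: grad_vec_def partial_def vec_eq_iff)
qed

lemma chart_point: obtains W \<psi> x where "(W, \<psi>) \<in> charts S" "x \<in> W" "p = \<psi> x"
  using charts_cover[of p] by blast

lemma C_k_fun_lincomb:
  fixes u v :: "'m \<Rightarrow> real"
  assumes "C_k_fun 1 S u" "C_k_fun 1 S v" shows "C_k_fun 1 S (\<lambda>p. a * u p + b * v p)"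
  unfolding C_k_fun_def
proof (intro ballI, clarify)
  fix W \<psi> assume c: "(W, \<psi>) \<in> charts S"
  have "C_k_on 1 W (u \<circ> \<psi>)" "C_k_on 1 W (v \<circ> \<psi>)" using assms c unfolding C_k_fun_def by blast+
  hence "C_k_on 1 W (\<lambda>x. a * (u \<circ> \<psi>) x + b * (v \<circ> \<psi>) x)"
    by (intro C_k_on_add C_k_on_mult C_k_on_const chart_open[OF c])
  thus "C_k_on 1 W ((\<lambda>p. a * u p + b * v p) \<circ> \<psi>)" by (simp only: o_def)
qed

lemma grad_inner_lincomb:
  fixes u v w :: "'m \<Rightarrow> real"
  assumes u: "C_k_fun 1 S u" and v: "C_k_fun 1 S v" and w: "C_k_fun 1 S w"
  shows "grad_inner S (\<lambda>p. a * u p + b * v p) w p = a * grad_inner S u w p + b * grad_inner S v w p"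
proof -
  obtain W \<psi> x where c: "(W, \<psi>) \<in> charts S" and x: "x \<in> W" and p: "p = \<psi> x" by (rule chart_point)
  show ?thesis unfolding p
    by (simp only: grad_inner_chart[OF c x] C_k_fun_lincomb u v w loc_grad_inner_eq grad_vec_lincomb[OF c x u v] inner_add_left inner_scaleR_left)
qed

lemma grad_inner_commute:
  fixes u v :: "'m \<Rightarrow> real"
  assumes u: "C_k_fun 1 S u" and v: "C_k_fun 1 S v"
  shows "grad_inner S u v p = grad_inner S v u p"
proof -
  obtain W \<psi> x where c: "(W, \<psi>) \<in> charts S" and x: "x \<in> W" and p: "p = \<psi> x" by (rule chart_point)
  show ?thesis unfolding p grad_inner_chart[OF c x u v] grad_inner_chart[OF c x v u] loc_grad_inner_eq
    by (rule metric_inv_self_adjoint[OF c x])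
qed

lemma grad_inner_nonneg:
  fixes u :: "'m \<Rightarrow> real"
  assumes u: "C_k_fun 1 S u"
  shows "grad_inner S u u p \<ge> 0"
proof -
  obtain W \<psi> x where c: "(W, \<psi>) \<in> charts S" and x: "x \<in> W" and p: "p = \<psi> x" by (rule chart_point)
  show ?thesis unfolding p grad_inner_chart[OF c x u u] loc_grad_inner_eq by (rule metric_inv_nonneg[OF c x])
qed

lemma continuous_grad_inner:
  fixes u v :: "'m \<Rightarrow> real"
  assumes u: "C_k_fun 1 S u" and v: "C_k_fun 1 S v"
  shows "continuous_on UNIV (grad_inner S u v)"
proof (rule continuous_on_charts)
  fix W \<psi> assume c: "(W, \<psi>) \<in> charts S"
  have "continuous_on W (\<lambda>x. partial (w \<circ> \<psi>) i x)" if "C_k_fun 1 S w" for w :: "'m \<Rightarrow> real" and i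
    using that c unfolding C_k_fun_def by (auto simp: partial_def)
  hence "continuous_on W (loc_grad_inner S \<psi> u v)"
    unfolding loc_grad_inner_def[abs_def]
    by (intro continuous_intros smooth_on_continuous[OF smooth_metric_inv[OF c]]) (use u v in auto)
  thus "continuous_on W (grad_inner S u v \<circ> \<psi>)"
    by (rule continuous_on_eq) (simp add: grad_inner_chart[OF c _ u v])
qed

lemma grad_vec_zero:
  assumes c: "(W, \<psi>) \<in> charts S" and x: "x \<in> W" and K: "closed K" "\<And>p. p \<notin> K \<Longrightarrow> u p = 0" "\<psi> x \<notin> K"
  shows "grad_vec u \<psi> x = 0"
proof -
  let ?V = "{y\<in>W. \<psi> y \<in> - K}"
  have V: "open ?V" using continuous_open_preimage[OF chart_continuous[OF c] chart_open[OF c], of "- K"] K(1)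
    by (simp add: vimage_def Int_def open_Compl)
  have "frechet_derivative (u \<circ> \<psi>) (at x) = frechet_derivative (\<lambda>_. 0) (at x)"
    by (rule frechet_derivative_cong_open[OF V]) (use x K in auto)
  thus ?thesis by (simp add: grad_vec_def partial_def frechet_derivative_const vec_eq_iff)
qed

lemma supported_grad_inner:
  fixes u v :: "'m \<Rightarrow> real"
  assumes u: "C_k_fun 1 S u" and v: "C_k_fun 1 S v" and K: "compact K" "\<And>p. p \<notin> K \<Longrightarrow> u p = 0"
  shows "p \<notin> K \<Longrightarrow> grad_inner S u v p = 0"
proof -
  assume pK: "p \<notin> K"
  obtain W \<psi> x where c: "(W, \<psi>) \<in> charts S" and x: "x \<in> W" and p: "p = \<psi> x" by (rule chart_point)
  have "grad_vec u \<psi> x = 0" using pK p by (intro grad_vec_zero[OF c x compact_imp_closed[OF K(1)] K(2)]) auto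
  thus ?thesis unfolding p grad_inner_chart[OF c x u v] loc_grad_inner_eq by simp
qed

section \<open>The Dirichlet form and the weighted L^2 product\<close>

definition energy :: "('m \<Rightarrow> real) \<Rightarrow> ('m \<Rightarrow> real) \<Rightarrow> real" where "energy u v = (\<integral>p. grad_inner S u v p \<partial>wmeas)"
definition pairing :: "('m \<Rightarrow> real) \<Rightarrow> ('m \<Rightarrow> real) \<Rightarrow> real" where "pairing u v = (\<integral>p. u p * v p \<partial>wmeas)"

lemma integrable_grad_inner:
  assumes u: "CC u" and v: "CC v" shows "integrable wmeas (grad_inner S u v)"
proof (rule integrable_wmeas[OF continuous_grad_inner[OF CC_C1[OF u] CC_C1[OF v]]])
  show "supported_in UNIV (grad_inner S u v)"
    using u supported_grad_inner[OF CC_C1[OF u] CC_C1[OF v]] unfolding CC_def supported_in_def by blast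
qed

lemma integrable_mult:
  assumes u: "CC u" and v: "CC v" shows "integrable wmeas (\<lambda>p. u p * v p)"
  by (rule integrable_wmeas)
    (use u v CC_continuous supported_in_bilinear[OF bounded_bilinear_mult] in \<open>auto simp: CC_def intro!: continuous_intros\<close>)

lemma energy_commute: "CC u \<Longrightarrow> CC v \<Longrightarrow> energy u v = energy v u"
  unfolding energy_def by (rule Bochner_Integration.integral_cong) (auto intro: grad_inner_commute CC_C1)

lemma pairing_commute: "pairing u v = pairing v u"
  by (simp add: pairing_def mult.commute)

lemma energy_lincomb:
  assumes "CC u" "CC v" "CC w"
  shows "energy (\<lambda>p. a * u p + b * v p) w = a * energy u w + b * energy v w"
proof -
  have "grad_inner S (\<lambda>p. a * u p + b * v p) w = (\<lambda>p. a * grad_inner S u w p + b * grad_inner S v w p)"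
    by (rule ext) (intro grad_inner_lincomb CC_C1 assms)
  thus ?thesis unfolding energy_def by (simp add: assms integrable_grad_inner)
qed

lemma pairing_lincomb:
  assumes "CC u" "CC v" "CC w"
  shows "pairing (\<lambda>p. a * u p + b * v p) w = a * pairing u w + b * pairing v w"
proof -
  have "(\<lambda>p. (a * u p + b * v p) * w p) = (\<lambda>p. a * (u p * w p) + b * (v p * w p))" by (simp add: algebra_simps)
  thus ?thesis unfolding pairing_def by (simp add: integrable_mult assms)
qed

lemma CC_lincomb: "CC u \<Longrightarrow> CC v \<Longrightarrow> CC (\<lambda>p. a * u p + b * v p)"
  by (intro CC_add CC_cmult)

lemma energy_quadratic:
  assumes "CC u" "CC v"
  shows "energy (\<lambda>p. a * u p + b * v p) (\<lambda>p. a * u p + b * v p) = a\<^sup>2 * energy u u + 2 * a * b * energy u v + b\<^sup>2 * energy v v"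
  using assms energy_commute[of u "\<lambda>p. a * u p + b * v p"] energy_commute[of v "\<lambda>p. a * u p + b * v p"] energy_commute[of u v]
  by (simp add: energy_lincomb CC_lincomb power2_eq_square algebra_simps)

lemma energy_nonneg: "CC u \<Longrightarrow> energy u u \<ge> 0"
  unfolding energy_def by (rule Bochner_Integration.integral_nonneg) (auto intro: grad_inner_nonneg CC_C1)

lemma pairing_nonneg: "pairing u u \<ge> 0"
  unfolding pairing_def by (rule Bochner_Integration.integral_nonneg) auto

lemma nn_integral_wmeas:
  fixes f :: "'m \<Rightarrow> real"
  assumes "continuous_on UNIV f"
  shows "(\<integral>\<^sup>+p. ennreal (f p * exp (weight S p)) \<partial>volume_measure S) = (\<integral>\<^sup>+p. ennreal (f p) \<partial>wmeas)"
proof -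
  have "(\<lambda>p. ennreal (f p)) \<in> borel_measurable borel"
    using borel_measurable_continuous_onI[OF assms] by simp
  hence "(\<lambda>p. ennreal (f p)) \<in> borel_measurable (volume_measure S)"
    using measurable_cong_sets[OF sets_volume_measure refl] by blast
  from nn_integral_density[OF exp_weight_measurable this] show ?thesis
    unfolding wmeas_def by (simp add: ennreal_mult'' mult.commute)
qed

text \<open>A smooth function is piecewise smooth with a single piece. Dropping the nonnegative term
  |A|^2 leaves half the squared norm on the left, whence the factor 2.\<close>

lemma stability:
  assumes st: "L_stable S" and u: "CC u"
  shows "pairing u u \<le> 2 * energy u u"
proof -
  obtain K where K: "compact K" "\<And>p. p \<notin> K \<Longrightarrow> u p = 0" using u by (auto simp: CC_def supported_in_def)
  have "closure {p. u p \<noteq> 0} \<subseteq> K"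
    by (rule closure_minimal) (use K compact_imp_closed in auto)
  hence "compact (closure {p. u p \<noteq> 0})" using compact_Int_closed[OF K(1) closed_closure] by (metis Int_absorb1)
  moreover have "piecewise_smooth S u" unfolding piecewise_smooth_def
    using CC_continuous[OF u] CC_smooth[OF u] by (intro conjI exI[of _ "{(UNIV, u)}"]) auto
  ultimately have le: "(\<integral>\<^sup>+p. ennreal ((norm_A_sq S p + 1/2) * (u p)\<^sup>2 * exp (weight S p)) \<partial>volume_measure S)
        \<le> (\<integral>\<^sup>+p. ennreal (grad_inner S u u p * exp (weight S p)) \<partial>volume_measure S)"
    using st unfolding L_stable_def by blast
  have "ennreal (pairing u u / 2) = (\<integral>\<^sup>+p. ennreal (1/2 * (u p)\<^sup>2) \<partial>wmeas)"
    using integrable_mult[OF u u] by (subst nn_integral_eq_integral) (auto simp: pairing_def power2_eq_square)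
  also have "\<dots> = (\<integral>\<^sup>+p. ennreal (1/2 * (u p)\<^sup>2 * exp (weight S p)) \<partial>volume_measure S)"
    by (rule nn_integral_wmeas[symmetric]) (intro continuous_intros CC_continuous[OF u])
  also have "\<dots> \<le> (\<integral>\<^sup>+p. ennreal ((norm_A_sq S p + 1/2) * (u p)\<^sup>2 * exp (weight S p)) \<partial>volume_measure S)"
    using norm_A_sq_nonneg by (intro nn_integral_mono ennreal_leI mult_right_mono) auto
  also note le
  also have "(\<integral>\<^sup>+p. ennreal (grad_inner S u u p * exp (weight S p)) \<partial>volume_measure S) = (\<integral>\<^sup>+p. ennreal (grad_inner S u u p) \<partial>wmeas)"
    by (rule nn_integral_wmeas[OF continuous_grad_inner[OF CC_C1[OF u] CC_C1[OF u]]])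
  also have "\<dots> = ennreal (energy u u)" unfolding energy_def
    by (rule nn_integral_eq_integral[OF integrable_grad_inner[OF u u]]) (auto intro: grad_inner_nonneg CC_C1[OF u])
  finally show ?thesis using energy_nonneg[OF u] by (simp add: ennreal_le_iff)
qed

text \<open>Vanishing at 0 keeps supports compact, and the Lipschitz constant 1 keeps the energy from increasing.\<close>

definition soft_abs :: "real \<Rightarrow> real \<Rightarrow> real" where "soft_abs e t = sqrt (t\<^sup>2 + e\<^sup>2) - e"

lemma soft_abs_ge: "e > 0 \<Longrightarrow> soft_abs e t \<ge> t - e" and soft_abs_nonneg: "e > 0 \<Longrightarrow> soft_abs e t \<ge> 0"
proof -
  assume e: "e > 0"
  have "t \<le> sqrt (t\<^sup>2 + e\<^sup>2)" by (rule real_le_rsqrt) simp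
  thus "soft_abs e t \<ge> t - e" by (simp add: soft_abs_def)
  have "e \<le> sqrt (t\<^sup>2 + e\<^sup>2)" by (rule real_le_rsqrt) simp
  thus "soft_abs e t \<ge> 0" by (simp add: soft_abs_def)
qed

lemma soft_abs_deriv:
  assumes e: "e > 0"
  shows "(soft_abs e has_real_derivative t / sqrt (t\<^sup>2 + e\<^sup>2)) (at t)" "\<bar>t / sqrt (t\<^sup>2 + e\<^sup>2)\<bar> \<le> 1"
proof -
  have pos: "t\<^sup>2 + e\<^sup>2 > 0" using e by (simp add: add_nonneg_pos)
  show "(soft_abs e has_real_derivative t / sqrt (t\<^sup>2 + e\<^sup>2)) (at t)"
    unfolding soft_abs_def[abs_def] using pos by (auto intro!: derivative_eq_intros simp: field_simps)
  have "\<bar>t\<bar> \<le> sqrt (t\<^sup>2 + e\<^sup>2)" by (rule real_le_rsqrt) simp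
  thus "\<bar>t / sqrt (t\<^sup>2 + e\<^sup>2)\<bar> \<le> 1" using pos by (simp add: divide_le_eq)
qed

lemma CC_soft_abs:
  assumes u: "CC u" and e: "e > 0"
  shows "CC (\<lambda>p. soft_abs e (u p))"
proof -
  have "smooth_fun S (\<lambda>p. soft_abs e (u p))"
  proof (rule smooth_funI)
    fix W \<psi> assume c: "(W, \<psi>) \<in> charts S"
    have s: "smooth_on W (u \<circ> \<psi>)" by (rule smooth_fun_chart[OF c CC_smooth[OF u]])
    have "smooth_on W (\<lambda>x. sqrt ((u \<circ> \<psi>) x * (u \<circ> \<psi>) x + e * e) - e)"
      by (intro smooth_on_diff smooth_on_sqrt smooth_on_add smooth_on_mult smooth_on_const s chart_open[OF c])
        (use e in \<open>simp add: add_nonneg_pos\<close>)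
    thus "smooth_on W ((\<lambda>p. soft_abs e (u p)) \<circ> \<psi>)" by (simp add: soft_abs_def o_def power2_eq_square)
  qed
  moreover have "supported_in UNIV (\<lambda>p. soft_abs e (u p))"
    using u e unfolding CC_def supported_in_def by (fastforce simp: soft_abs_def)
  ultimately show ?thesis by (simp add: CC_def)
qed

text \<open>By the chain rule the gradient is multiplied pointwise by the derivative of
  \<open>soft_abs\<close>, which has absolute value at most 1.\<close>

lemma energy_soft_abs:
  assumes u: "CC u" and e: "e > 0"
  shows "energy (\<lambda>p. soft_abs e (u p)) (\<lambda>p. soft_abs e (u p)) \<le> energy u u"
  unfolding energy_def
proof (rule integral_mono[OF integrable_grad_inner integrable_grad_inner])
  show "CC (\<lambda>p. soft_abs e (u p))" "CC (\<lambda>p. soft_abs e (u p))" "CC u" "CC u"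
    using CC_soft_abs u e by auto
  fix p
  obtain W \<psi> x where c: "(W, \<psi>) \<in> charts S" and x: "x \<in> W" and p: "p = \<psi> x" by (rule chart_point)
  let ?s = "u p / sqrt ((u p)\<^sup>2 + e\<^sup>2)"
  have "((\<lambda>y. soft_abs e ((u \<circ> \<psi>) y)) has_derivative (\<lambda>h. ?s * frechet_derivative (u \<circ> \<psi>) (at x) h)) (at x)"
  proof (rule has_derivative_compose[OF chart_has_derivative[OF c x CC_C1[OF u]]])
    show "(soft_abs e has_derivative (*) ?s) (at ((u \<circ> \<psi>) x))"
      using soft_abs_deriv(1)[OF e, of "u p"] p by (simp add: has_field_derivative_def)
  qed
  from frechet_derivative_at[OF this, symmetric] have g: "grad_vec (\<lambda>p. soft_abs e (u p)) \<psi> x = ?s *\<^sub>R grad_vec u \<psi> x"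
    by (simp add: grad_vec_def partial_def vec_eq_iff o_def)
  have "?s\<^sup>2 \<le> 1" using soft_abs_deriv(2)[OF e, of "u p"] by (simp add: abs_square_le_1)
  hence "?s\<^sup>2 * (grad_vec u \<psi> x \<bullet> (metric_inv S \<psi> x *v grad_vec u \<psi> x)) \<le> 1 * (grad_vec u \<psi> x \<bullet> (metric_inv S \<psi> x *v grad_vec u \<psi> x))"
    by (rule mult_right_mono) (rule metric_inv_nonneg[OF c x])
  thus "grad_inner S (\<lambda>p. soft_abs e (u p)) (\<lambda>p. soft_abs e (u p)) p \<le> grad_inner S u u p"
    unfolding p grad_inner_chart[OF c x CC_C1[OF CC_soft_abs[OF u e]] CC_C1[OF CC_soft_abs[OF u e]]] grad_inner_chart[OF c x CC_C1[OF u] CC_C1[OF u]] loc_grad_inner_eq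
    using g p by (simp add: matrix_vector_mult_scaleR power2_eq_square mult.assoc)
qed

section \<open>The functional and its minimising sequence\<close>

context
  fixes f assumes st: "L_stable S" and f: "CC f" "\<And>p. f p \<ge> 0"
begin

definition J :: "('m \<Rightarrow> real) \<Rightarrow> real" where "J v = energy v v / 2 - pairing f v"

text \<open>The linear term is split by f v <= f^2 + v^2/4. The constant 1/4 is the one for which
  the Poincare inequality absorbs the last term exactly into half the energy.\<close>

lemma J_bounded_below:
  assumes v: "CC v" shows "J v \<ge> - pairing f f"
proof -
  have "pairing f v \<le> (\<integral>p. f p * f p + 1/4 * (v p * v p) \<partial>wmeas)" unfolding pairing_def
  proof (rule integral_mono)
    show "f p * v p \<le> f p * f p + 1/4 * (v p * v p)" for p
      using zero_le_power2[of "f p - v p / 2"] by (simp add: power2_eq_square algebra_simps)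
  qed (use integrable_mult f v in auto)
  also have "\<dots> = pairing f f + 1/4 * pairing v v"
    unfolding pairing_def by (simp add: integrable_mult f v)
  finally show ?thesis using stability[OF st v] by (simp add: J_def)
qed

definition Jmin :: real where "Jmin = (INF v\<in>Collect CC. J v)"

lemma Jmin_le: "CC v \<Longrightarrow> Jmin \<le> J v"
  unfolding Jmin_def using J_bounded_below by (intro cINF_lower bdd_belowI2[of _ "- pairing f f"]) auto

text \<open>An approximate minimiser w is replaced by a smoothed absolute value. This does not raise
  the energy, and since f is nonnegative the linear term loses at most e times the integral of
  f.\<close>

lemma almost_minimiser:
  assumes d: "d > 0"
  shows "\<exists>v. CC v \<and> (\<forall>p. v p \<ge> 0) \<and> J v \<le> Jmin + d"
proof -
  have "\<exists>w\<in>Collect CC. J w < Jmin + d / 2" unfolding Jmin_def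
    using cINF_less_iff[of "Collect CC" J "Jmin + d / 2"] J_bounded_below d CC_zero
    by (metis (no_types, lifting) Jmin_def bdd_belowI2 empty_iff less_add_same_cancel1 half_gt_zero mem_Collect_eq)
  then obtain w where w: "CC w" "J w < Jmin + d / 2" by blast
  define F where "F = (\<integral>p. f p \<partial>wmeas)"
  have fi: "integrable wmeas f" using f(1) CC_continuous unfolding CC_def by (intro integrable_wmeas) auto
  have F: "F \<ge> 0" unfolding F_def by (rule Bochner_Integration.integral_nonneg) (use f in auto)
  \<comment> \<open>Makes the loss in the linear term at most d/2; \<open>F + 1\<close> avoids
    division by zero.\<close>
  define e where "e = d / (2 * (F + 1))"
  have e: "e > 0" using d F by (simp add: e_def)
  let ?v = "\<lambda>p. soft_abs e (w p)"
  have v: "CC ?v" by (rule CC_soft_abs[OF w(1) e])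
  have "pairing f w - e * F = (\<integral>p. f p * w p - e * f p \<partial>wmeas)"
    unfolding pairing_def F_def using integrable_mult[OF f(1) w(1)] fi by simp
  also have "\<dots> \<le> pairing f ?v" unfolding pairing_def
  proof (rule integral_mono)
    show "f p * w p - e * f p \<le> f p * ?v p" for p
      using mult_left_mono[OF soft_abs_ge[OF e, of "w p"] f(2)[of p]] by (simp add: algebra_simps)
  qed (use integrable_mult[OF f(1) w(1)] integrable_mult[OF f(1) v] fi in auto)
  finally have "J ?v \<le> J w + e * F" using energy_soft_abs[OF w(1) e] by (simp add: J_def)
  also have "e * F \<le> d / 2" using F d by (simp add: e_def field_simps)
  finally have "J ?v \<le> Jmin + d" using w(2) by simp
  thus ?thesis using v soft_abs_nonneg[OF e] by blast
qed

lemma J_perturb: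
  assumes v: "CC v" and g: "CC g"
  shows "J (\<lambda>p. 1 * v p + t * g p) = J v + t * (energy v g - pairing f g) + t\<^sup>2 * energy g g / 2"
  using energy_quadratic[OF v g, of 1 t] pairing_lincomb[OF v g f(1), of 1 t]
  by (simp add: J_def pairing_commute[of f] algebra_simps add_divide_distrib)

text \<open>First-order condition at an almost minimiser, from the increments \<open>\<plusminus> d\<close>.\<close>

lemma euler_lagrange:
  assumes v: "CC v" and g: "CC g" and d: "J v \<le> Jmin + d\<^sup>2" "d > 0"
  shows "\<bar>energy v g - pairing f g\<bar> \<le> d * (1 + energy g g / 2)"
proof -
  let ?D = "energy v g - pairing f g"
  have "0 \<le> d\<^sup>2 + t * ?D + t\<^sup>2 * energy g g / 2" for t
    using Jmin_le[OF CC_lincomb[OF v g, of 1 t]] J_perturb[OF v g, of t] d(1) by simp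
  from this[of d] this[of "- d"] have "d * \<bar>?D\<bar> \<le> d * (d * (1 + energy g g / 2))"
    by (cases "?D \<ge> 0") (auto simp: power2_eq_square algebra_simps)
  thus ?thesis using d(2) by simp
qed

text \<open>Parallelogram identity for the energy, followed by the Poincare inequality.\<close>

lemma almost_minimisers_close:
  assumes v: "CC v" and w: "CC w" and "J v \<le> Jmin + d" "J w \<le> Jmin + d"
  shows "pairing (\<lambda>p. v p - w p) (\<lambda>p. v p - w p) \<le> 16 * d"
proof -
  have m: "J (\<lambda>p. 1/2 * v p + 1/2 * w p) \<ge> Jmin" by (rule Jmin_le[OF CC_lincomb[OF v w]])
  have e: "energy (\<lambda>p. 1 * v p + (-1) * w p) (\<lambda>p. 1 * v p + (-1) * w p) = energy v v - 2 * energy v w + energy w w"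
    using energy_quadratic[OF v w, of 1 "-1"] by simp
  \<comment> \<open>At the midpoint the energy of v - w is subtracted with the factor 1/8.
    Minimality then bounds it by 8 d, and the Poincare inequality doubles this to 16 d.\<close>
  have "J (\<lambda>p. 1/2 * v p + 1/2 * w p) = J v / 2 + J w / 2 - (energy v v - 2 * energy v w + energy w w) / 8"
    using energy_quadratic[OF v w, of "1/2" "1/2"] pairing_lincomb[OF v w f(1), of "1/2" "1/2"]
    by (simp add: J_def pairing_commute[of f] power2_eq_square field_simps)
  hence "Jmin \<le> J v / 2 + J w / 2 - (energy v v - 2 * energy v w + energy w w) / 8" using m by (simp only:)
  moreover have "x \<le> 8 * d" if "l \<le> a / 2 + b / 2 - x / 8" "a \<le> l + d" "b \<le> l + d" for a b l x :: real
    using that by (simp add: field_simps)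
  ultimately have "energy v v - 2 * energy v w + energy w w \<le> 8 * d" using assms(3,4) by blast
  thus ?thesis using stability[OF st CC_lincomb[OF v w, of 1 "-1"]] e by simp
qed

text \<open>Collects what the construction of the solution uses: the sign, the weak Euler-Lagrange
  equation in the limit, and the Cauchy property in the weighted L^2 norm.\<close>

lemma minimising_sequence:
  "\<exists>v. (\<forall>n. CC (v n) \<and> (\<forall>p. v n p \<ge> 0)) \<and>
    (\<forall>g. CC g \<longrightarrow> (\<lambda>n. energy (v n) g) \<longlonglongrightarrow> pairing f g) \<and>
    (\<forall>e>0. \<exists>N. \<forall>m\<ge>N. \<forall>n\<ge>N. pairing (\<lambda>p. v m p - v n p) (\<lambda>p. v m p - v n p) < e)"
proof -
  define d where "d n = inverse (real (Suc n))" for n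
  have d: "d n > 0" for n by (simp add: d_def)
  have d0: "d \<longlonglongrightarrow> 0" unfolding d_def by (rule LIMSEQ_inverse_real_of_nat)
  \<comment> \<open>The tolerance is the square of d because an increment of size d in the
    first-order condition divides it by d.\<close>
  have "\<forall>n. \<exists>v. CC v \<and> (\<forall>p. v p \<ge> 0) \<and> J v \<le> Jmin + (d n)\<^sup>2"
    by (intro allI almost_minimiser zero_less_power d)
  then obtain v where v: "\<And>n. CC (v n)" "\<And>n p. v n p \<ge> 0" "\<And>n. J (v n) \<le> Jmin + (d n)\<^sup>2" by metis
  have "(\<lambda>n. energy (v n) g) \<longlonglongrightarrow> pairing f g" if g: "CC g" for g
  proof -
    have "(\<lambda>n. d n * (1 + energy g g / 2)) \<longlonglongrightarrow> 0 * (1 + energy g g / 2)" by (intro tendsto_intros d0)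
    hence "(\<lambda>n. d n * (1 + energy g g / 2)) \<longlonglongrightarrow> 0" by simp
    moreover have "norm (energy (v n) g - pairing f g) \<le> d n * (1 + energy g g / 2)" for n
      unfolding real_norm_def by (rule euler_lagrange[OF v(1) g v(3) d])
    ultimately have "(\<lambda>n. energy (v n) g - pairing f g) \<longlonglongrightarrow> 0"
      using Lim_null_comparison[of "\<lambda>n. energy (v n) g - pairing f g" "\<lambda>n. d n * (1 + energy g g / 2)" sequentially]
      by simp
    thus ?thesis by (simp add: Lim_null[of _ "pairing f g"])
  qed
  moreover have "\<exists>N. \<forall>m\<ge>N. \<forall>n\<ge>N. pairing (\<lambda>p. v m p - v n p) (\<lambda>p. v m p - v n p) < e" if e: "e > 0" for e
  proof -
    have "(\<lambda>n. 16 * (d n)\<^sup>2) \<longlonglongrightarrow> 16 * 0\<^sup>2" by (intro tendsto_intros d0)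
    hence "\<forall>\<^sub>F n in sequentially. 16 * (d n)\<^sup>2 < e" using e by (intro order_tendstoD) auto
    then obtain N where N: "\<And>n. n \<ge> N \<Longrightarrow> 16 * (d n)\<^sup>2 < e" by (auto simp: eventually_sequentially)
    have "pairing (\<lambda>p. v m p - v n p) (\<lambda>p. v m p - v n p) < e" if "m \<ge> N" "n \<ge> N" for m n
    proof -
      have mono: "(d k)\<^sup>2 \<le> (d N)\<^sup>2" if "k \<ge> N" for k
        using that d[of k] by (intro power_mono) (auto simp: d_def field_simps)
      have "pairing (\<lambda>p. v m p - v n p) (\<lambda>p. v m p - v n p) \<le> 16 * (d N)\<^sup>2"
        by (rule almost_minimisers_close[OF v(1) v(1)]) (use v(3) mono that in \<open>meson add_left_mono order_trans\<close>)+
      thus ?thesis using N[of N] by simp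
    qed
    thus ?thesis by blast
  qed
  ultimately show ?thesis using v(1,2) by blast
qed

end

end

section \<open>The limit functional in a chart\<close>

lemma continuous_zero_ext:
  fixes f :: "'a::topological_space \<Rightarrow> 'b::{topological_space,zero}"
  assumes "open W" "continuous_on W f" "closed K" "K \<subseteq> W" "\<And>x. x \<notin> K \<Longrightarrow> f x = 0"
  shows "continuous_on UNIV f"
proof -
  have "continuous_on (- K) (\<lambda>x. 0 :: 'b)" by simp
  hence "continuous_on (- K) f" by (rule continuous_on_eq) (use assms(5) in auto)
  hence "continuous_on (W \<union> - K) f" using assms by (intro continuous_on_open_Un) auto
  moreover have "W \<union> - K = UNIV" using assms(4) by blast
  ultimately show ?thesis by simp
qed

lemma test_fun_supported: "test_fun W f \<Longrightarrow> supported_in W f"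
  by (simp add: test_fun_def)

lemma partial_linear:
  assumes "test_fun W f" "bounded_linear L"
  shows "partial (\<lambda>x. L (f x)) i x = L (partial f i x)"
  unfolding partial_def
  by (rule fun_cong[OF frechet_derivative_at[OF bounded_linear.has_derivative[OF assms(2) test_fun_has_derivative[OF assms(1)]]], symmetric])

lemma test_fun_linear:
  assumes "test_fun W f" "bounded_linear L"
  shows "test_fun W (\<lambda>x. L (f x))"
  unfolding test_fun_def
proof
  show "smooth_on UNIV (\<lambda>x. L (f x))" by (rule smooth_on_compose_linear[OF open_UNIV test_fun_smooth_on[OF assms(1)] assms(2)])
  show "supported_in W (\<lambda>x. L (f x))"
    using test_fun_supported[OF assms(1)] linear_0[OF bounded_linear.linear[OF assms(2)]] unfolding supported_in_def by metis
qed

text \<open>Used with the real and imaginary parts, to reduce the equation for complex test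
  functions to real ones.\<close>

lemma div_op_linear:
  assumes W: "open W" and a: "\<And>i j. smooth_on W (a i j)" and f: "test_fun W f" and L: "bounded_linear L"
  shows "div_op a (\<lambda>x. L (f x)) x = L (div_op a f x)"
proof -
  interpret L: bounded_linear L by (rule L)
  have e: "(\<lambda>y. \<Sum>j\<in>UNIV. a i j y *\<^sub>R partial (\<lambda>x. L (f x)) j y) = (\<lambda>y. L (\<Sum>j\<in>UNIV. a i j y *\<^sub>R partial f j y))" for i
    by (simp add: partial_linear[OF f L] L.sum L.scaleR)
  have p: "partial (\<lambda>y. L (\<Sum>j\<in>UNIV. a i j y *\<^sub>R partial f j y)) i x = L (partial (\<lambda>y. \<Sum>j\<in>UNIV. a i j y *\<^sub>R partial f j y) i x)" for i
    by (rule partial_linear[OF test_fun_flux[OF W a f] L])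
  show ?thesis unfolding div_op_def e p by (rule L.sum[symmetric])
qed

context immersion
begin

section \<open>Lifting test functions to the hypersurface\<close>

definition lift :: "(real^'n) set \<Rightarrow> (real^'n \<Rightarrow> 'm) \<Rightarrow> (real^'n \<Rightarrow> real) \<Rightarrow> 'm \<Rightarrow> real" where
  "lift W \<psi> h p = (if p \<in> \<psi> ` W then h (the_inv_into W \<psi> p) else 0)"

lemma lift_chart: "(W, \<psi>) \<in> charts S \<Longrightarrow> x \<in> W \<Longrightarrow> lift W \<psi> h (\<psi> x) = h x"
  by (simp add: lift_def)

lemma lift_nonneg: "(\<And>x. h x \<ge> 0) \<Longrightarrow> lift W \<psi> h p \<ge> 0"
  by (simp add: lift_def)

lemma lift_zero:
  assumes c: "(W, \<psi>) \<in> charts S" and K: "K \<subseteq> W" "\<And>x. x \<notin> K \<Longrightarrow> h x = 0" and p: "p \<notin> \<psi> ` K"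
  shows "lift W \<psi> h p = 0"
proof (cases "p \<in> \<psi> ` W")
  case True
  have "the_inv_into W \<psi> p \<notin> K" using p chart_inv_in(2)[OF c True] by (metis imageI)
  thus ?thesis using K(2) by (simp add: lift_def)
qed (simp add: lift_def)

text \<open>Seen from another chart, the lift is h composed with the smooth transition map on the
  overlap, and vanishes off the image of the support of h. That image is compact, hence closed, so
  the two cases cover the chart by open sets.\<close>

lemma CC_lift:
  assumes c: "(W, \<psi>) \<in> charts S" and h: "test_fun W h"
  shows "CC (lift W \<psi> h)"
proof -
  obtain K where K: "compact K" "K \<subseteq> W" "\<And>x. x \<notin> K \<Longrightarrow> h x = 0" using h by (auto simp: test_fun_def supported_in_def)
  have cK: "compact (\<psi> ` K)" using compact_continuous_image[OF continuous_on_subset[OF chart_continuous[OF c] K(2)] K(1)] .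
  note z = lift_zero[OF c K(2,3)]
  have "smooth_fun S (lift W \<psi> h)"
  proof (rule smooth_funI)
    fix V \<theta> assume c2: "(V, \<theta>) \<in> charts S"
    show "smooth_on V (lift W \<psi> h \<circ> \<theta>)" unfolding smooth_on_def
    proof (intro allI C_k_on_local)
      fix k y assume y: "y \<in> V"
      show "\<exists>U. open U \<and> y \<in> U \<and> C_k_on k U (lift W \<psi> h \<circ> \<theta>)"
      proof (cases "\<theta> y \<in> \<psi> ` W")
        case True
        let ?U = "overlap V \<theta> W \<psi>"
        have "smooth_on ?U (\<lambda>y. h (trans \<theta> W \<psi> y))"
          by (rule smooth_on_compose[OF open_overlap[OF c2 c] smooth_trans[OF c2 c] test_fun_smooth_on[OF h]]) auto
        hence "smooth_on ?U (lift W \<psi> h \<circ> \<theta>)"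
          by (rule smooth_on_cong[OF open_overlap[OF c2 c]]) (auto simp: overlap_def[OF c2 c] trans_def[OF c2 c] lift_def)
        moreover have "y \<in> ?U" using y True by (simp add: overlap_def[OF c2 c])
        ultimately show ?thesis using open_overlap[OF c2 c] by (auto simp: smooth_on_def)
      next
        case False
        let ?U = "{y\<in>V. \<theta> y \<in> - \<psi> ` K}"
        have U: "open ?U" using continuous_open_preimage[OF chart_continuous[OF c2] chart_open[OF c2], of "- \<psi> ` K"] compact_imp_closed[OF cK]
          by (simp add: vimage_def Int_def open_Compl)
        have "C_k_on k ?U (\<lambda>y. 0 :: real)" using U by auto
        hence "C_k_on k ?U (lift W \<psi> h \<circ> \<theta>)" by (rule C_k_on_cong[OF U]) (simp add: z)
        moreover have "y \<in> ?U" using y False K(2) by auto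
        ultimately show ?thesis using U by blast
      qed
    qed
  qed
  moreover have "supported_in UNIV (lift W \<psi> h)" unfolding supported_in_def
    by (intro exI[of _ "\<psi> ` K"] conjI cK subset_UNIV allI impI z)
  ultimately show ?thesis by (simp add: CC_def)
qed

lemma partial_lift:
  assumes c: "(W, \<psi>) \<in> charts S" and x: "x \<in> W"
  shows "partial (lift W \<psi> h \<circ> \<psi>) i x = partial h i x"
  unfolding partial_def
  by (rule fun_cong[OF frechet_derivative_cong_open[OF chart_open[OF c] x]]) (simp add: lift_chart[OF c])

lemma integral_lift:
  assumes c: "(W, \<psi>) \<in> charts S" and h: "test_fun W h" and m: "(\<lambda>p. w p * lift W \<psi> h p) \<in> borel_measurable borel"
  shows "(\<integral>p. w p * lift W \<psi> h p \<partial>wmeas) = (\<integral>x. w (\<psi> x) * (rho \<psi> x * h x) \<partial>lborel)"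
proof -
  have h0: "x \<notin> W \<Longrightarrow> h x = 0" for x using h unfolding test_fun_def supported_in_def by blast
  have "(\<integral>p. w p * lift W \<psi> h p \<partial>wmeas) = (\<integral>x. indicator W x * (rho \<psi> x * (w (\<psi> x) * lift W \<psi> h (\<psi> x))) \<partial>lborel)"
    by (rule integral_wmeas_chart(2)[OF c m]) (simp add: lift_def)
  also have "\<dots> = (\<integral>x. w (\<psi> x) * (rho \<psi> x * h x) \<partial>lborel)"
  proof (rule Bochner_Integration.integral_cong[OF refl])
    fix x show "indicator W x * (rho \<psi> x * (w (\<psi> x) * lift W \<psi> h (\<psi> x))) = w (\<psi> x) * (rho \<psi> x * h x)"
      using h0[of x] by (cases "x \<in> W") (simp_all add: lift_chart[OF c])
  qed
  finally show ?thesis .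
qed

text \<open>All derivatives are moved onto the test function. This is essential since the sequence
  to be inserted for w is controlled in the limit without derivatives.\<close>

lemma energy_lift:
  assumes c: "(W, \<psi>) \<in> charts S" and h: "test_fun W h" and w: "CC w"
  shows "energy w (lift W \<psi> h) = - (\<integral>x. w (\<psi> x) * div_op (coeff \<psi>) h x \<partial>lborel)"
proof -
  let ?l = "lift W \<psi> h"
  note W = chart_open[OF c]
  have cl: "CC ?l" by (rule CC_lift[OF c h])
  have h0: "x \<notin> W \<Longrightarrow> h x = 0" for x using h unfolding test_fun_def supported_in_def by blast
  let ?F = "\<lambda>i x. \<Sum>j\<in>UNIV. coeff \<psi> i j x *\<^sub>R partial h j x"
  have tF: "test_fun W (?F i)" for i by (rule test_fun_flux[OF W smooth_coeff[OF c] h])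
  have F0: "?F i x = 0" if "x \<notin> W" for i x
    using tF[of i] that unfolding test_fun_def supported_in_def by blast
  have sw: "smooth_on W (w \<circ> \<psi>)" by (rule smooth_fun_chart[OF c CC_smooth[OF w]])
  have C1w: "C_k_on 1 W (w \<circ> \<psi>)" using sw unfolding smooth_on_def by blast
  have i1: "integrable lborel (\<lambda>x. partial (w \<circ> \<psi>) i x * ?F i x)" for i
    using continuous_on_mult[OF smooth_on_continuous[OF smooth_on_partial[OF sw]] continuous_on_subset[OF test_fun_continuous[OF tF] subset_UNIV]]
      supported_in_bilinear[OF bounded_bilinear_mult test_fun_supported[OF tF]] by (rule integrable_supported)
  have i2: "integrable lborel (\<lambda>x. w (\<psi> x) * partial (?F i) i x)" for i
    using continuous_on_mult[OF smooth_on_continuous[OF sw, unfolded o_def] continuous_on_subset[OF test_fun_continuous[OF test_fun_partial[OF tF]] subset_UNIV]]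
      supported_in_bilinear[OF bounded_bilinear_mult test_fun_supported[OF test_fun_partial[OF tF]]] by (rule integrable_supported)
  have "energy w ?l = (\<integral>x. indicator W x * (rho \<psi> x * grad_inner S w ?l (\<psi> x)) \<partial>lborel)"
    unfolding energy_def
  proof (rule integral_wmeas_chart(2)[OF c])
    show "grad_inner S w ?l \<in> borel_measurable borel"
      by (rule borel_measurable_continuous_onI[OF continuous_grad_inner[OF CC_C1[OF w] CC_C1[OF cl]]])
    obtain K where K: "compact K" "K \<subseteq> W" "\<And>x. x \<notin> K \<Longrightarrow> h x = 0" using h by (auto simp: test_fun_def supported_in_def)
    have cK: "compact (\<psi> ` K)" using compact_continuous_image[OF continuous_on_subset[OF chart_continuous[OF c] K(2)] K(1)] .
    fix p assume "p \<notin> \<psi> ` W"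
    hence "p \<notin> \<psi> ` K" using K(2) by blast
    from supported_grad_inner[OF CC_C1[OF cl] CC_C1[OF w] cK lift_zero[OF c K(2,3)] this]
    show "grad_inner S w ?l p = 0" by (simp add: grad_inner_commute[OF CC_C1[OF w] CC_C1[OF cl]])
  qed
  also have "\<dots> = (\<integral>x. (\<Sum>i\<in>UNIV. partial (w \<circ> \<psi>) i x * ?F i x) \<partial>lborel)"
  proof (rule Bochner_Integration.integral_cong[OF refl])
    fix x
    show "indicator W x * (rho \<psi> x * grad_inner S w ?l (\<psi> x)) = (\<Sum>i\<in>UNIV. partial (w \<circ> \<psi>) i x * ?F i x)"
    proof (cases "x \<in> W")
      case True
      show ?thesis using True
        by (simp add: grad_inner_chart[OF c True CC_C1[OF w] CC_C1[OF cl]] loc_grad_inner_def partial_lift[OF c True] coeff_def[OF c] sum_distrib_left mult_ac)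
    next
      case False
      thus ?thesis by (simp add: F0 del: real_scaleR_def)
    qed
  qed
  also have "\<dots> = (\<Sum>i\<in>UNIV. \<integral>x. partial (w \<circ> \<psi>) i x * ?F i x \<partial>lborel)"
    by (rule Bochner_Integration.integral_sum) (rule i1)
  also have "\<dots> = (\<Sum>i\<in>UNIV. - (\<integral>x. w (\<psi> x) * partial (?F i) i x \<partial>lborel))"
  proof (rule sum.cong[OF refl])
    fix i
    have "C_k_on 1 W (?F i)" using test_fun_smooth_on[OF tF] unfolding smooth_on_def by blast
    moreover have "supported_in W (?F i)" using tF unfolding test_fun_def by blast
    ultimately show "(\<integral>x. partial (w \<circ> \<psi>) i x * ?F i x \<partial>lborel) = - (\<integral>x. w (\<psi> x) * partial (?F i) i x \<partial>lborel)"
      using integral_by_parts[OF bounded_bilinear_mult W C1w, of "?F i" "axis i 1"] by (simp add: partial_def)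
  qed
  also have "\<dots> = - (\<integral>x. (\<Sum>i\<in>UNIV. w (\<psi> x) * partial (?F i) i x) \<partial>lborel)"
    by (subst Bochner_Integration.integral_sum[OF i2]) (simp add: sum_negf)
  finally show ?thesis by (simp add: div_op_def sum_distrib_left)
qed

section \<open>Estimates on compact sets of a chart\<close>

text \<open>The density \<open>rho\<close> is continuous and positive, hence bounded below on the
  compact set K.\<close>

lemma chart_L2_bound:
  assumes c: "(W, \<psi>) \<in> charts S" and K: "compact K" "K \<subseteq> W"
  shows "\<exists>C\<ge>0. \<forall>w. CC w \<longrightarrow> (\<integral>x. indicator K x * (w (\<psi> x))\<^sup>2 \<partial>lborel) \<le> C * pairing w w"
proof -
  obtain m where m: "m > 0" "\<And>x. x \<in> K \<Longrightarrow> m \<le> rho \<psi> x"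
  proof (cases "K = {}")
    case False
    obtain x0 where "x0 \<in> K" "\<And>x. x \<in> K \<Longrightarrow> rho \<psi> x0 \<le> rho \<psi> x"
      using continuous_attains_inf[OF K(1) False continuous_on_subset[OF smooth_on_continuous[OF smooth_rho[OF c]] K(2)]] by blast
    thus ?thesis using that[of "rho \<psi> x0"] rho_pos[OF c] K(2) by blast
  qed (use that[of 1] in auto)
  have "(\<integral>x. indicator K x * (w (\<psi> x))\<^sup>2 \<partial>lborel) \<le> (1 / m) * pairing w w" if w: "CC w" for w
  proof -
    let ?f = "\<lambda>p. indicator (\<psi> ` W) p * (w p * w p)"
    have cw: "continuous_on UNIV w" by (rule CC_continuous[OF w])
    have fm: "?f \<in> borel_measurable borel"
      using chart_open_image[OF c] by (intro borel_measurable_times borel_measurable_indicator borel_measurable_continuous_onI[OF cw]) auto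
    have iw: "integrable wmeas (\<lambda>p. w p * w p)" by (rule integrable_mult[OF w w])
    have fi: "integrable wmeas ?f"
      by (rule Bochner_Integration.integrable_bound[OF iw])
        (use fm in \<open>auto simp: indicator_def measurable_cong_sets[OF sets_wmeas refl]\<close>)
    let ?g = "\<lambda>x. indicator W x * (rho \<psi> x * ?f (\<psi> x))"
    have gi: "integrable lborel ?g"
      using integral_wmeas_chart(1)[OF c fm] fi by (simp add: indicator_def)
    have ge: "(\<integral>p. ?f p \<partial>wmeas) = (\<integral>x. ?g x \<partial>lborel)"
      by (rule integral_wmeas_chart(2)[OF c fm]) (simp add: indicator_def)
    have ki: "integrable lborel (\<lambda>x. indicator K x *\<^sub>R (w (\<psi> x))\<^sup>2)"
      by (rule borel_integrable_compact[OF K(1)])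
        (intro continuous_intros continuous_on_compose2[OF cw] continuous_on_subset[OF chart_continuous[OF c] K(2)], auto)
    have "(\<integral>x. indicator K x * (w (\<psi> x))\<^sup>2 \<partial>lborel) \<le> (\<integral>x. 1 / m * ?g x \<partial>lborel)"
    proof (rule integral_mono)
      fix x
      show "indicator K x * (w (\<psi> x))\<^sup>2 \<le> 1 / m * ?g x"
      proof (cases "x \<in> K")
        case True
        have "m * (w (\<psi> x))\<^sup>2 \<le> rho \<psi> x * (w (\<psi> x))\<^sup>2" by (intro mult_right_mono m(2)[OF True]) auto
        thus ?thesis using True K(2) m(1) by (auto simp: field_simps power2_eq_square)
      next
        case False
        have "0 \<le> ?g x" using rho_pos[OF c, of x] by (auto simp: indicator_def less_imp_le)
        thus ?thesis using False m(1) by simp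
      qed
    qed (use ki gi in auto)
    also have "\<dots> = 1 / m * (\<integral>p. ?f p \<partial>wmeas)" using ge by simp
    also have "\<dots> \<le> 1 / m * pairing w w"
      unfolding pairing_def using m(1) by (intro mult_left_mono integral_mono fi iw) (auto simp: indicator_def)
    finally show ?thesis .
  qed
  thus ?thesis using m(1) by (intro exI[of _ "1 / m"]) auto
qed

text \<open>In place of the Cauchy-Schwarz inequality, |t| <= \<eta> + t^2/\<eta> is integrated over
  K. The parameter \<eta> is taken small to show that the integrals converge and equal to 1 to bound
  their limit.\<close>

lemma chart_L1_bound:
  assumes c: "(W, \<psi>) \<in> charts S" and K: "compact K" "K \<subseteq> W"
  shows "\<exists>C\<ge>0. \<forall>w \<eta> B (h :: real^'n \<Rightarrow> complex). CC w \<longrightarrow> \<eta> > 0 \<longrightarrow> test_fun W h \<longrightarrow> (\<forall>x. x \<notin> K \<longrightarrow> h x = 0) \<longrightarrow> (\<forall>x. norm (h x) \<le> B) \<longrightarrow>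
     norm (\<integral>x. w (\<psi> x) *\<^sub>R h x \<partial>lborel) \<le> (\<eta> * measure lborel K + C / \<eta> * pairing w w) * B"
proof -
  obtain C where C: "C \<ge> 0" "\<And>w. CC w \<Longrightarrow> (\<integral>x. indicator K x * (w (\<psi> x))\<^sup>2 \<partial>lborel) \<le> C * pairing w w"
    using chart_L2_bound[OF c K] by blast
  have "norm (\<integral>x. w (\<psi> x) *\<^sub>R h x \<partial>lborel) \<le> (\<eta> * measure lborel K + C / \<eta> * pairing w w) * B"
    if w: "CC w" and \<eta>: "\<eta> > 0" and h: "test_fun W h" "\<And>x. x \<notin> K \<Longrightarrow> h x = 0" "\<And>x. norm (h x) \<le> B"
    for w \<eta> B and h :: "real^'n \<Rightarrow> complex"
  proof -
    have cw: "continuous_on UNIV w" by (rule CC_continuous[OF w])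
    have B: "B \<ge> 0" using h(3)[of 0] norm_ge_zero order_trans by blast
    have wc: "continuous_on W (\<lambda>x. w (\<psi> x))"
      by (rule continuous_on_compose2[OF cw chart_continuous[OF c]]) auto
    have i: "integrable lborel (\<lambda>x. w (\<psi> x) *\<^sub>R h x)"
      by (rule integrable_supported[of W])
        (use h(1) wc test_fun_continuous[OF h(1)] supported_in_bilinear[OF bounded_bilinear_scaleR] in \<open>auto intro!: continuous_on_scaleR simp: test_fun_def\<close>)
    have k1: "integrable lborel (\<lambda>x. indicator K x *\<^sub>R (w (\<psi> x))\<^sup>2)"
      by (rule borel_integrable_compact[OF K(1)]) (intro continuous_intros continuous_on_subset[OF wc K(2)])
    have k0: "integrable lborel (\<lambda>x. indicator K x *\<^sub>R (1::real))" by (rule borel_integrable_compact[OF K(1)]) auto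
    have "norm (\<integral>x. w (\<psi> x) *\<^sub>R h x \<partial>lborel) \<le> (\<integral>x. norm (w (\<psi> x) *\<^sub>R h x) \<partial>lborel)" by (rule integral_norm_bound)
    also have "\<dots> \<le> (\<integral>x. (\<eta> * indicator K x + 1 / \<eta> * (indicator K x * (w (\<psi> x))\<^sup>2)) * B \<partial>lborel)"
    proof (rule integral_mono)
      fix x
      have "\<bar>t\<bar> \<le> \<eta> + 1 / \<eta> * t\<^sup>2" for t :: real
      proof (cases "\<bar>t\<bar> \<le> \<eta>")
        case True
        have "0 \<le> 1 / \<eta> * t\<^sup>2" using \<eta> by simp
        thus ?thesis using True by linarith
      next
        case False
        have "\<eta> * \<bar>t\<bar> \<le> \<bar>t\<bar> * \<bar>t\<bar>" using False by (intro mult_right_mono) auto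
        hence "\<bar>t\<bar> \<le> 1 / \<eta> * t\<^sup>2" using \<eta> by (simp add: field_simps power2_eq_square)
        thus ?thesis using \<eta> by linarith
      qed
      hence "\<bar>w (\<psi> x)\<bar> * norm (h x) \<le> (\<eta> + 1 / \<eta> * (w (\<psi> x))\<^sup>2) * B"
        using h(3) B \<eta> by (intro mult_mono) auto
      thus "norm (w (\<psi> x) *\<^sub>R h x) \<le> (\<eta> * indicator K x + 1 / \<eta> * (indicator K x * (w (\<psi> x))\<^sup>2)) * B"
        using h(2)[of x] by (cases "x \<in> K") auto
    qed (use integrable_norm[OF i] k0 k1 in auto)
    also have "\<dots> = (\<eta> * measure lborel K + 1 / \<eta> * (\<integral>x. indicator K x * (w (\<psi> x))\<^sup>2 \<partial>lborel)) * B"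
      using k0 k1 compact_imp_closed[OF K(1)] by simp
    also have "\<dots> \<le> (\<eta> * measure lborel K + 1 / \<eta> * (C * pairing w w)) * B"
      using C(2)[OF w] \<eta> B by (intro mult_right_mono add_left_mono mult_left_mono) auto
    finally show ?thesis by simp
  qed
  thus ?thesis using C(1) by blast
qed

end

section \<open>The divergence-form operator on C^2 functions\<close>

lemma div_op_cong_open:
  assumes "open V" "\<And>y. y \<in> V \<Longrightarrow> f y = g y" "x \<in> V"
  shows "div_op a f x = div_op a g x"
proof -
  have p: "partial f j y = partial g j y" if "y \<in> V" for j y
    unfolding partial_def by (simp add: frechet_derivative_cong_open[OF assms(1) that assms(2)])
  show ?thesis unfolding div_op_def partial_def[of "\<lambda>y. \<Sum>j\<in>UNIV. a _ j y *\<^sub>R _ j y"]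
    by (rule sum.cong[OF refl], rule fun_cong[OF frechet_derivative_cong_open[OF assms(1,3)]]) (simp add: p)
qed

lemma C_k_on_flux:
  fixes a :: "'n::finite \<Rightarrow> 'n \<Rightarrow> real^'n \<Rightarrow> real" and u :: "real^'n \<Rightarrow> real"
  assumes W: "open W" and a: "\<And>i j. smooth_on W (a i j)" and u: "C_k_on 2 W u"
  shows "C_k_on 1 W (\<lambda>x. \<Sum>j\<in>UNIV. a i j x * partial u j x :: real)"
proof -
  have "C_k_on 1 W (\<lambda>x. partial u j x)" for j
    using u unfolding partial_def by (simp add: numeral_2_eq_2)
  moreover have "C_k_on 1 W (a i j)" for j using a unfolding smooth_on_def by blast
  ultimately show ?thesis by (intro C_k_on_sum W C_k_on_mult)
qed

lemma continuous_div_op: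
  fixes a :: "'n::finite \<Rightarrow> 'n \<Rightarrow> real^'n \<Rightarrow> real" and u :: "real^'n \<Rightarrow> real"
  assumes W: "open W" and a: "\<And>i j. smooth_on W (a i j)" and u: "C_k_on 2 W u"
  shows "continuous_on W (div_op a u :: real^'n \<Rightarrow> real)"
proof -
  have "C_k_on 1 W (\<lambda>x. \<Sum>j\<in>UNIV. a i j x * partial u j x)" for i by (rule C_k_on_flux[OF W a u])
  hence "continuous_on W (\<lambda>x. partial (\<lambda>y. \<Sum>j\<in>UNIV. a i j y * partial u j y) i x)" for i
    by (simp add: partial_def[of "\<lambda>y. \<Sum>j\<in>UNIV. a i j y * partial u j y"])
  thus ?thesis unfolding div_op_def[abs_def] by (simp add: continuous_on_sum)
qed

text \<open>Two integrations by parts, with the symmetry of the coefficients used in between. It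
  moves the operator from the test function to the C^2 density, where the equation becomes
  pointwise.\<close>

lemma div_op_self_adjoint:
  fixes u h :: "real^'n \<Rightarrow> real"
  assumes W: "open W" and a: "\<And>i j. smooth_on W (a i j)" and sym: "\<And>i j x. x \<in> W \<Longrightarrow> a i j x = a j i x"
    and u: "C_k_on 2 W u" and h: "test_fun W h"
  shows "(\<integral>x. u x * div_op a h x \<partial>lborel) = (\<integral>x. div_op a u x * h x \<partial>lborel)"
proof -
  let ?F = "\<lambda>i x. \<Sum>j\<in>UNIV. a i j x *\<^sub>R partial h j x"
  let ?G = "\<lambda>i x. \<Sum>j\<in>UNIV. a i j x * partial u j x"
  have tF: "test_fun W (?F i)" for i by (rule test_fun_flux[OF W a h])
  have G: "C_k_on 1 W (?G i)" for i by (rule C_k_on_flux[OF W a u])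
  have u1: "C_k_on 1 W u" using C_k_on_le[OF u, of 1] by simp
  have pu: "continuous_on W (partial u i)" for i
    using u by (simp add: numeral_2_eq_2 partial_def[abs_def] differentiable_imp_continuous_on differentiable_on_def differentiable_at_withinI)
  have pG: "continuous_on W (partial (?G i) i)" for i
    using G[of i] by (simp add: partial_def[of "\<lambda>y. \<Sum>j\<in>UNIV. a i j y * partial u j y"])
  have int: "integrable lborel (\<lambda>x. p x * q x)" if "continuous_on W p" "test_fun W q" for p q :: "real^'n \<Rightarrow> real"
    using continuous_on_mult[OF that(1) test_fun_continuous[OF that(2)]]
      supported_in_bilinear[OF bounded_bilinear_mult test_fun_supported[OF that(2)]] by (rule integrable_supported)
  have cu: "continuous_on W u" by (rule C_k_on_continuous[OF u])
  have h1: "C_k_on 1 W h" using test_fun_smooth_on[OF h] unfolding smooth_on_def by blast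
  have F1: "C_k_on 1 W (?F i)" for i using test_fun_smooth_on[OF tF] unfolding smooth_on_def by blast
  have "(\<integral>x. u x * div_op a h x \<partial>lborel) = (\<integral>x. (\<Sum>i\<in>UNIV. u x * partial (?F i) i x) \<partial>lborel)"
    by (simp add: div_op_def sum_distrib_left)
  also have "\<dots> = (\<Sum>i\<in>UNIV. \<integral>x. u x * partial (?F i) i x \<partial>lborel)"
    by (rule Bochner_Integration.integral_sum) (rule int[OF cu test_fun_partial[OF tF]])
  also have "\<dots> = (\<Sum>i\<in>UNIV. - (\<integral>x. partial u i x * ?F i x \<partial>lborel))"
  proof (rule sum.cong[OF refl])
    fix i
    show "(\<integral>x. u x * partial (?F i) i x \<partial>lborel) = - (\<integral>x. partial u i x * ?F i x \<partial>lborel)"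
      using integral_by_parts[OF bounded_bilinear_mult W u1 F1[of i] test_fun_supported[OF tF[of i]], where v="axis i 1"]
      by (simp add: partial_def[of u] partial_def[of "?F i"] del: real_scaleR_def)
  qed
  also have "\<dots> = - (\<integral>x. (\<Sum>i\<in>UNIV. partial u i x * ?F i x) \<partial>lborel)"
    by (subst Bochner_Integration.integral_sum[OF int[OF pu tF]]) (simp add: sum_negf)
  also have "(\<lambda>x. \<Sum>i\<in>UNIV. partial u i x * ?F i x) = (\<lambda>x. \<Sum>j\<in>UNIV. ?G j x * partial h j x)"
  proof (rule ext)
    fix x
    show "(\<Sum>i\<in>UNIV. partial u i x * ?F i x) = (\<Sum>j\<in>UNIV. ?G j x * partial h j x)"
    proof (cases "x \<in> W")
      case True
      have "(\<Sum>i\<in>UNIV. partial u i x * ?F i x) = (\<Sum>i\<in>UNIV. \<Sum>j\<in>UNIV. a j i x * partial u i x * partial h j x)"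
        by (simp add: sum_distrib_left, intro sum.cong refl, simp add: sym[OF True] mult_ac)
      also have "\<dots> = (\<Sum>j\<in>UNIV. ?G j x * partial h j x)" by (subst sum.swap) (simp add: sum_distrib_right)
      finally show ?thesis .
    next
      case False
      have "partial h j x = 0" for j using test_fun_supported[OF test_fun_partial[OF h]] False unfolding supported_in_def by blast
      thus ?thesis by simp
    qed
  qed
  also have "- (\<integral>x. (\<Sum>j\<in>UNIV. ?G j x * partial h j x) \<partial>lborel) = (\<Sum>j\<in>UNIV. - (\<integral>x. ?G j x * partial h j x \<partial>lborel))"
    by (subst Bochner_Integration.integral_sum[OF int[OF C_k_on_continuous[OF G] test_fun_partial[OF h]]]) (simp add: sum_negf)
  also have "\<dots> = (\<Sum>j\<in>UNIV. \<integral>x. partial (?G j) j x * h x \<partial>lborel)"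
  proof (rule sum.cong[OF refl])
    fix j
    show "- (\<integral>x. ?G j x * partial h j x \<partial>lborel) = (\<integral>x. partial (?G j) j x * h x \<partial>lborel)"
      using integral_by_parts[OF bounded_bilinear_mult W G[of j] h1 test_fun_supported[OF h], where v="axis j 1"]
      by (simp add: partial_def[of h] partial_def[of "?G j"])
  qed
  also have "\<dots> = (\<integral>x. div_op a u x * h x \<partial>lborel)"
    by (subst Bochner_Integration.integral_sum[OF int[OF pG h], symmetric]) (simp add: div_op_def sum_distrib_right)
  finally show ?thesis .
qed

lemma fundamental_lemma_eq:
  fixes g :: "'a::euclidean_space \<Rightarrow> real"
  assumes W: "open W" and g: "continuous_on W g"
    and z: "\<And>h::'a \<Rightarrow> real. test_fun W h \<Longrightarrow> (\<integral>x. g x * h x \<partial>lborel) = 0" and x: "x \<in> W"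
  shows "g x = 0"
proof -
  have "g x \<ge> 0" by (rule fundamental_lemma[OF W g _ x]) (simp add: z)
  moreover have "- g x \<ge> 0" by (rule fundamental_lemma[OF W continuous_on_minus[OF g] _ x]) (simp add: z)
  ultimately show ?thesis by simp
qed

context immersion
begin

lemma chart_integrable:
  fixes h :: "real^'n \<Rightarrow> 'b::{banach, second_countable_topology}"
  assumes c: "(W, \<psi>) \<in> charts S" and w: "continuous_on UNIV w" and h: "test_fun W h"
  shows "integrable lborel (\<lambda>x. w (\<psi> x) *\<^sub>R h x)"
  using continuous_on_scaleR[OF continuous_on_compose2[OF w chart_continuous[OF c] subset_UNIV] test_fun_continuous[OF h]]
    supported_in_bilinear[OF bounded_bilinear_scaleR test_fun_supported[OF h]] by (rule integrable_supported)

end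

section \<open>Passage to the limit\<close>

locale minimising = immersion S
  for S :: "('m::{t2_space, second_countable_topology}, 'n::finite, 'k::finite) hypersurface" +
  fixes f :: "'m \<Rightarrow> real" and v :: "nat \<Rightarrow> 'm \<Rightarrow> real"
  assumes f: "CC f" and v: "\<And>n. CC (v n)" and v_nonneg: "\<And>n p. v n p \<ge> 0"
    and euler: "\<And>g. CC g \<Longrightarrow> (\<lambda>n. energy (v n) g) \<longlonglongrightarrow> pairing f g"
    and cauchy: "\<And>e. e > 0 \<Longrightarrow> \<exists>N. \<forall>m\<ge>N. \<forall>n\<ge>N. pairing (\<lambda>p. v m p - v n p) (\<lambda>p. v m p - v n p) < e"
begin

lemma CC_diff_v: "CC (\<lambda>p. v m p - v n p)"
  using CC_lincomb[OF v v, of 1 m "-1" n] by simp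

lemma eventually_bounded: "\<exists>M N. \<forall>n\<ge>N. pairing (v n) (v n) \<le> M"
proof -
  obtain N where N: "\<And>m n. m \<ge> N \<Longrightarrow> n \<ge> N \<Longrightarrow> pairing (\<lambda>p. v m p - v n p) (\<lambda>p. v m p - v n p) < 1"
    using cauchy[of 1] by auto
  have "pairing (v n) (v n) \<le> 2 + 2 * pairing (v N) (v N)" if n: "n \<ge> N" for n
  proof -
    have "pairing (v n) (v n) \<le> (\<integral>p. 2 * ((v n p - v N p) * (v n p - v N p)) + 2 * (v N p * v N p) \<partial>wmeas)"
      unfolding pairing_def
    proof (rule integral_mono)
      fix p
      \<comment> \<open>The difference of the two sides of the desired inequality is exactly this
        square.\<close>
      have "0 \<le> (v n p - 2 * v N p)\<^sup>2" by simp
      thus "v n p * v n p \<le> 2 * ((v n p - v N p) * (v n p - v N p)) + 2 * (v N p * v N p)"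
        by (simp add: power2_eq_square algebra_simps)
    qed (use integrable_mult v CC_diff_v in auto)
    also have "\<dots> = 2 * pairing (\<lambda>p. v n p - v N p) (\<lambda>p. v n p - v N p) + 2 * pairing (v N) (v N)"
      unfolding pairing_def using integrable_mult[OF CC_diff_v CC_diff_v, of n N n N] integrable_mult[OF v v] by simp
    finally show ?thesis using N[OF n order_refl] by simp
  qed
  thus ?thesis by blast
qed

text \<open>The limit of the sequence is recorded only through its Lebesgue integrals against test
  functions in one chart; no limit function is constructed at this stage.\<close>

definition chart_lim :: "(real^'n \<Rightarrow> 'm) \<Rightarrow> (real^'n \<Rightarrow> complex) \<Rightarrow> complex" where
  "chart_lim \<psi> h = lim (\<lambda>n. \<integral>x. v n (\<psi> x) *\<^sub>R h x \<partial>lborel)"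

lemma chart_lim:
  assumes c: "(W, \<psi>) \<in> charts S" and h: "test_fun W h"
  shows "(\<lambda>n. \<integral>x. v n (\<psi> x) *\<^sub>R h x \<partial>lborel) \<longlonglongrightarrow> chart_lim \<psi> h"
proof -
  obtain K where K: "compact K" "K \<subseteq> W" "\<And>x. x \<notin> K \<Longrightarrow> h x = 0" using test_fun_supported[OF h] unfolding supported_in_def by blast
  obtain B where B: "B > 0" "\<And>x. norm (h x) \<le> B"
    using bounded_supported[OF test_fun_continuous[OF h] test_fun_supported[OF h]] by blast
  obtain C where C: "C \<ge> 0" and bound: "\<forall>w \<eta> B (h :: real^'n \<Rightarrow> complex). CC w \<longrightarrow> \<eta> > 0 \<longrightarrow> test_fun W h \<longrightarrow> (\<forall>x. x \<notin> K \<longrightarrow> h x = 0) \<longrightarrow> (\<forall>x. norm (h x) \<le> B) \<longrightarrow>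
     norm (\<integral>x. w (\<psi> x) *\<^sub>R h x \<partial>lborel) \<le> (\<eta> * measure lborel K + C / \<eta> * pairing w w) * B"
    using chart_L1_bound[OF c K(1,2)] by (elim exE conjE)
  note bound = bound[rule_format]
  let ?I = "\<lambda>n. \<integral>x. v n (\<psi> x) *\<^sub>R h x \<partial>lborel"
  have "Cauchy ?I"
  proof (rule CauchyI)
    fix e :: real assume e: "e > 0"
    have cancel: "t / (2 * k * B) * k * B = t / 2" if "k > 0" for t k using that B(1) by simp
    \<comment> \<open>Makes the contribution of the measure of K less than e/2; the next choice of d
      then makes the L^2 term at most e/2 for this fixed value.\<close>
    define \<eta> where "\<eta> = e / (2 * (measure lborel K + 1) * B)"
    have \<eta>: "\<eta> > 0" using e B by (simp add: \<eta>_def add_nonneg_pos)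
    define d where "d = e * \<eta> / (2 * (C + 1) * B)"
    have "d > 0" using e \<eta> B C by (simp add: d_def add_nonneg_pos)
    then obtain N where N: "\<And>m n. m \<ge> N \<Longrightarrow> n \<ge> N \<Longrightarrow> pairing (\<lambda>p. v m p - v n p) (\<lambda>p. v m p - v n p) < d" using cauchy by blast
    have "norm (?I m - ?I n) < e" if mn: "m \<ge> N" "n \<ge> N" for m n
    proof -
      let ?P = "pairing (\<lambda>p. v m p - v n p) (\<lambda>p. v m p - v n p)"
      have "?I m - ?I n = (\<integral>x. (v m (\<psi> x) - v n (\<psi> x)) *\<^sub>R h x \<partial>lborel)"
        using chart_integrable[OF c CC_continuous[OF v] h] by (simp add: scaleR_diff_left)
      hence "norm (?I m - ?I n) \<le> (\<eta> * measure lborel K + C / \<eta> * ?P) * B"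
        using bound[OF CC_diff_v[of m n] \<eta> h K(3) B(2)] by simp
      also have "\<dots> = \<eta> * measure lborel K * B + C * ?P * B / \<eta>" by (simp add: algebra_simps)
      also have "\<eta> * measure lborel K * B < e / 2"
      proof -
        have "\<eta> * measure lborel K * B < \<eta> * (measure lborel K + 1) * B" using \<eta> B by simp
        also have "\<dots> = e / 2" using B(1) measure_nonneg[of lborel K] by (simp only: \<eta>_def) (rule cancel, simp add: add_nonneg_pos)
        finally show ?thesis .
      qed
      also have "C * ?P * B / \<eta> \<le> e / 2"
      proof -
        have "C * ?P \<le> (C + 1) * d" using N[OF mn] C pairing_nonneg \<open>d > 0\<close> by (intro mult_mono) auto
        hence "C * ?P * B / \<eta> \<le> (C + 1) * d * B / \<eta>" using B \<eta> by (intro divide_right_mono mult_right_mono) auto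
        also have "(C + 1) * d * B = e * \<eta> / 2" using cancel[of "C + 1" "e * \<eta>"] C unfolding d_def by (simp only: mult_ac)
        also have "e * \<eta> / 2 / \<eta> = e / 2" using \<eta> by simp
        finally show ?thesis .
      qed
      finally show ?thesis by simp
    qed
    thus "\<exists>N. \<forall>m\<ge>N. \<forall>n\<ge>N. norm (?I m - ?I n) < e" by blast
  qed
  thus ?thesis unfolding chart_lim_def by (simp add: Cauchy_convergent_iff convergent_LIMSEQ_iff)
qed

text \<open>Additivity and homogeneity pass to the limit. The order-0 bound is the L^1 estimate with
  parameter 1, the L^2 norms being eventually bounded.\<close>

lemma distribution_chart_lim:
  assumes c: "(W, \<psi>) \<in> charts S"
  shows "distribution W (chart_lim \<psi>)"
proof
  show "open W" by (rule chart_open[OF c])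
  show "chart_lim \<psi> (\<lambda>x. g x + h x) = chart_lim \<psi> g + chart_lim \<psi> h" if g: "test_fun W g" and h: "test_fun W h" for g h
  proof (rule LIMSEQ_unique[OF chart_lim[OF c test_fun_add[OF g h]]])
    show "(\<lambda>n. \<integral>x. v n (\<psi> x) *\<^sub>R (g x + h x) \<partial>lborel) \<longlonglongrightarrow> chart_lim \<psi> g + chart_lim \<psi> h"
      using tendsto_add[OF chart_lim[OF c g] chart_lim[OF c h]] chart_integrable[OF c CC_continuous[OF v] g] chart_integrable[OF c CC_continuous[OF v] h]
      by (simp add: scaleR_add_right)
  qed
  show "chart_lim \<psi> (\<lambda>x. k * h x) = k * chart_lim \<psi> h" if h: "test_fun W h" for h k
  proof (rule LIMSEQ_unique[OF chart_lim[OF c test_fun_linear[OF h bounded_linear_mult_right]]])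
    show "(\<lambda>n. \<integral>x. v n (\<psi> x) *\<^sub>R (k * h x) \<partial>lborel) \<longlonglongrightarrow> k * chart_lim \<psi> h"
      using tendsto_mult_left[OF chart_lim[OF c h], of k] by (simp only: mult_scaleR_right[symmetric] integral_mult_right_zero)
  qed
  fix K :: "(real^'n) set" assume K: "compact K" "K \<subseteq> W"
  obtain C where C: "C \<ge> 0" and bound: "\<forall>w \<eta> B (h :: real^'n \<Rightarrow> complex). CC w \<longrightarrow> \<eta> > 0 \<longrightarrow> test_fun W h \<longrightarrow> (\<forall>x. x \<notin> K \<longrightarrow> h x = 0) \<longrightarrow> (\<forall>x. norm (h x) \<le> B) \<longrightarrow>
     norm (\<integral>x. w (\<psi> x) *\<^sub>R h x \<partial>lborel) \<le> (\<eta> * measure lborel K + C / \<eta> * pairing w w) * B"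
    using chart_L1_bound[OF c K] by (elim exE conjE)
  note bound = bound[rule_format]
  obtain M N where M: "\<And>n. n \<ge> N \<Longrightarrow> pairing (v n) (v n) \<le> M" using eventually_bounded by blast
  have "norm (chart_lim \<psi> h) \<le> (measure lborel K + C * M) * B"
    if h: "test_fun W h" "\<forall>x. x \<notin> K \<longrightarrow> h x = 0" "\<forall>x. norm (h x) \<le> B" for h B
  proof (rule Lim_bounded[OF tendsto_norm[OF chart_lim[OF c h(1)]]], intro allI impI)
    fix n assume n: "n \<ge> N"
    have B: "B \<ge> 0" using h(3) norm_ge_zero order_trans by blast
    have "norm (\<integral>x. v n (\<psi> x) *\<^sub>R h x \<partial>lborel) \<le> (measure lborel K + C * pairing (v n) (v n)) * B"
      using bound[OF v zero_less_one h(1) h(2)[rule_format] h(3)[rule_format], of n] by simp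
    also have "\<dots> \<le> (measure lborel K + C * M) * B" using M[OF n] C B by (intro mult_right_mono add_left_mono mult_left_mono) auto
    finally show "norm (\<integral>x. v n (\<psi> x) *\<^sub>R h x \<partial>lborel) \<le> (measure lborel K + C * M) * B" .
  qed
  thus "\<exists>C. \<forall>h B. test_fun W h \<longrightarrow> (\<forall>x. x \<notin> K \<longrightarrow> h x = 0) \<longrightarrow> (\<forall>x. norm (h x) \<le> B) \<longrightarrow> norm (chart_lim \<psi> h) \<le> C * B" by blast
qed

text \<open>The limiting Euler-Lagrange equation tested with the lift of h and rewritten in
  coordinates.\<close>

lemma weak_equation:
  assumes c: "(W, \<psi>) \<in> charts S" and h: "test_fun W h"
  shows "(\<lambda>n. \<integral>x. v n (\<psi> x) * div_op (coeff \<psi>) h x \<partial>lborel) \<longlonglongrightarrow> - (\<integral>x. (rho \<psi> x * f (\<psi> x)) * h x \<partial>lborel)"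
proof -
  have "(\<integral>x. v n (\<psi> x) * div_op (coeff \<psi>) h x \<partial>lborel) = - energy (v n) (lift W \<psi> h)" for n
    using energy_lift[OF c h v] by simp
  moreover have "pairing f (lift W \<psi> h) = (\<integral>x. (rho \<psi> x * f (\<psi> x)) * h x \<partial>lborel)"
    unfolding pairing_def integral_lift[OF c h borel_measurable_continuous_onI[OF continuous_on_mult[OF CC_continuous[OF f] CC_continuous[OF CC_lift[OF c h]]]]]
    by (simp add: mult_ac)
  ultimately show ?thesis using tendsto_minus[OF euler[OF CC_lift[OF c h]]] by simp
qed

lemma smooth_source:
  assumes c: "(W, \<psi>) \<in> charts S"
  shows "smooth_on W (\<lambda>x. rho \<psi> x * f (\<psi> x))"
  using smooth_on_mult[OF chart_open[OF c] smooth_rho[OF c] smooth_fun_chart[OF c CC_smooth[OF f]]] by simp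

text \<open>The regularity theorem works with complex test functions because of the exponentials;
  the equation is checked after applying the real and imaginary parts.\<close>

lemma weak_equation_complex:
  assumes c: "(W, \<psi>) \<in> charts S" and h: "test_fun W h"
  shows "chart_lim \<psi> (div_op (coeff \<psi>) h) = - (\<integral>x. (rho \<psi> x * f (\<psi> x)) *\<^sub>R h x \<partial>lborel)"
proof -
  note W = chart_open[OF c]
  have td: "test_fun W (div_op (coeff \<psi>) h)" by (rule test_fun_div_op[OF W smooth_coeff[OF c] h])
  have i: "integrable lborel (\<lambda>x. (rho \<psi> x * f (\<psi> x)) *\<^sub>R h x)"
    using continuous_on_scaleR[OF smooth_on_continuous[OF smooth_source[OF c]] test_fun_continuous[OF h]]
      supported_in_bilinear[OF bounded_bilinear_scaleR test_fun_supported[OF h]] by (rule integrable_supported)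
  have L: "L (chart_lim \<psi> (div_op (coeff \<psi>) h)) = L (- (\<integral>x. (rho \<psi> x * f (\<psi> x)) *\<^sub>R h x \<partial>lborel))"
    if L: "bounded_linear L" for L :: "complex \<Rightarrow> real"
  proof -
    interpret L: bounded_linear L by (rule L)
    have e: "L (\<integral>x. v n (\<psi> x) *\<^sub>R div_op (coeff \<psi>) h x \<partial>lborel) = (\<integral>x. v n (\<psi> x) * div_op (coeff \<psi>) (\<lambda>x. L (h x)) x \<partial>lborel)" for n
      by (simp add: integral_bounded_linear[OF L chart_integrable[OF c CC_continuous[OF v] td], symmetric] L.scaleR div_op_linear[OF W smooth_coeff[OF c] h L])
    have "L (- (\<integral>x. (rho \<psi> x * f (\<psi> x)) *\<^sub>R h x \<partial>lborel)) = - (\<integral>x. (rho \<psi> x * f (\<psi> x)) * L (h x) \<partial>lborel)"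
      by (simp add: L.neg integral_bounded_linear[OF L i, symmetric] L.scaleR)
    thus ?thesis
      using LIMSEQ_unique[OF L.tendsto[OF chart_lim[OF c td], unfolded e] weak_equation[OF c test_fun_linear[OF h L]]] by simp
  qed
  show ?thesis using L[OF bounded_linear_Re] L[OF bounded_linear_Im] by (simp add: complex_eq_iff)
qed

lemma local_density:
  assumes c: "(W, \<psi>) \<in> charts S" and p: "p \<in> W"
  shows "\<exists>r>0. ball p r \<subseteq> W \<and> (\<exists>u::real^'n \<Rightarrow> real. C_k_on 2 UNIV u \<and>
    (\<forall>h. test_fun (ball p r) h \<longrightarrow> (\<lambda>n. \<integral>x. v n (\<psi> x) * h x \<partial>lborel) \<longlonglongrightarrow> (\<integral>x. u x * h x \<partial>lborel)))"
proof -
  obtain r u where r: "r > 0" "ball p r \<subseteq> W" and u: "C_k_on 2 UNIV u"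
    and d: "\<And>h. test_fun (ball p r) h \<Longrightarrow> chart_lim \<psi> h = (\<integral>x. u x * h x \<partial>lborel)"
    using elliptic_regularity[OF distribution_chart_lim[OF c] smooth_coeff[OF c] smooth_source[OF c] coeff_pos[OF c] weak_equation_complex[OF c] p] by blast
  have "(\<lambda>n. \<integral>x. v n (\<psi> x) * h x \<partial>lborel) \<longlonglongrightarrow> (\<integral>x. Re (u x) * h x \<partial>lborel)" if h: "test_fun (ball p r) h" for h
  proof -
    let ?h = "\<lambda>x. complex_of_real (h x)"
    have h': "test_fun (ball p r) ?h" by (rule test_fun_linear[OF h bounded_linear_of_real])
    have hW: "test_fun W ?h" by (rule test_fun_mono[OF h' r(2)])
    have i: "integrable lborel (\<lambda>x. u x * ?h x)"
      using continuous_on_mult[OF C_k_on_continuous[OF u] test_fun_continuous[OF h']]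
        supported_in_bilinear[OF bounded_bilinear_mult test_fun_supported[OF test_fun_mono[OF h' subset_UNIV]]] by (rule integrable_supported)
    have "(\<lambda>n. Re (\<integral>x. v n (\<psi> x) *\<^sub>R ?h x \<partial>lborel)) \<longlonglongrightarrow> Re (\<integral>x. u x * ?h x \<partial>lborel)"
      using tendsto_Re[OF chart_lim[OF c hW]] by (simp add: d[OF h'])
    thus ?thesis
      by (simp add: integral_bounded_linear[OF bounded_linear_Re chart_integrable[OF c CC_continuous[OF v] hW], symmetric]
        integral_bounded_linear[OF bounded_linear_Re i, symmetric])
  qed
  moreover have "C_k_on 2 UNIV (\<lambda>x. Re (u x))" by (rule C_k_on_compose_linear[OF open_UNIV u bounded_linear_Re])
  ultimately show ?thesis using r by blast
qed

text \<open>Both claims are tested: nonnegativity of the sequence survives in the integrals against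
  nonnegative test functions, and the weak equation becomes pointwise after the operator is moved
  onto the C^2 function u.\<close>

lemma local_solution:
  fixes u :: "real^'n \<Rightarrow> real"
  assumes c: "(W, \<psi>) \<in> charts S" and B: "open B" "B \<subseteq> W" and u: "C_k_on 2 B u"
    and lim: "\<And>h. test_fun B h \<Longrightarrow> (\<lambda>n. \<integral>x. v n (\<psi> x) * h x \<partial>lborel) \<longlonglongrightarrow> (\<integral>x. u x * h x \<partial>lborel)" and x: "x \<in> B"
  shows "u x \<ge> 0" "div_op (coeff \<psi>) u x = - (rho \<psi> x * f (\<psi> x))"
proof -
  show "u x \<ge> 0"
  proof (rule fundamental_lemma[OF B(1) C_k_on_continuous[OF u] _ x])
    fix h :: "real^'n \<Rightarrow> real" assume h: "test_fun B h" "\<And>x. h x \<ge> 0"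
    show "(\<integral>x. u x * h x \<partial>lborel) \<ge> 0"
      by (rule LIMSEQ_le_const[OF lim[OF h(1)]]) (simp add: v_nonneg h(2))
  qed
  note a = smooth_on_subset[OF smooth_coeff[OF c] B(2)]
  have cd: "continuous_on B (div_op (coeff \<psi>) u)" by (rule continuous_div_op[OF B(1) a u])
  have cs: "continuous_on B (\<lambda>x. rho \<psi> x * f (\<psi> x))"
    by (rule continuous_on_subset[OF smooth_on_continuous[OF smooth_source[OF c]] B(2)])
  have "div_op (coeff \<psi>) u x + rho \<psi> x * f (\<psi> x) = 0"
  proof (rule fundamental_lemma_eq[OF B(1) continuous_on_add[OF cd cs] _ x])
    fix h :: "real^'n \<Rightarrow> real" assume h: "test_fun B h"
    have int: "integrable lborel (\<lambda>x. q x * h x)" if "continuous_on B q" for q :: "real^'n \<Rightarrow> real"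
      using continuous_on_mult[OF that(1) test_fun_continuous[OF h]]
        supported_in_bilinear[OF bounded_bilinear_mult test_fun_supported[OF h]] by (rule integrable_supported)
    have "(\<integral>x. div_op (coeff \<psi>) u x * h x \<partial>lborel) = (\<integral>x. u x * div_op (coeff \<psi>) h x \<partial>lborel)"
      by (rule div_op_self_adjoint[symmetric, OF B(1) a _ u h]) (rule coeff_sym[OF c], use B(2) in blast)
    also have "\<dots> = - (\<integral>x. (rho \<psi> x * f (\<psi> x)) * h x \<partial>lborel)"
      by (rule LIMSEQ_unique[OF lim[OF test_fun_div_op[OF B(1) a h]] weak_equation[OF c test_fun_mono[OF h B(2)]]])
    finally show "(\<integral>x. (div_op (coeff \<psi>) u x + rho \<psi> x * f (\<psi> x)) * h x \<partial>lborel) = 0"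
      using int[OF cd] int[OF cs] by (simp add: distrib_right)
  qed
  thus "div_op (coeff \<psi>) u x = - (rho \<psi> x * f (\<psi> x))" by simp
qed

end

section \<open>The global solution\<close>

context minimising
begin

section \<open>Gluing the local densities\<close>

text \<open>The density is taken with respect to the weighted measure on the hypersurface, so the
  notion makes no reference to a chart and densities found in different charts can be
  compared.\<close>

definition represents :: "'m set \<Rightarrow> ('m \<Rightarrow> real) \<Rightarrow> bool" where
  "represents G u \<longleftrightarrow> open G \<and> continuous_on G u \<and>
     (\<forall>g. CC g \<longrightarrow> supported_in G g \<longrightarrow> (\<lambda>n. pairing (v n) g) \<longlonglongrightarrow> (\<integral>p. u p * g p \<partial>wmeas))"

lemma product_measurable:
  fixes u :: "'m \<Rightarrow> real"
  assumes "open G" "continuous_on G u" "CC g" "supported_in G g"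
  shows "(\<lambda>p. u p * g p) \<in> borel_measurable borel"
proof -
  obtain K where K: "compact K" "K \<subseteq> G" "\<And>p. p \<notin> K \<Longrightarrow> g p = 0" using assms(4) unfolding supported_in_def by blast
  show ?thesis
    by (rule borel_measurable_continuous_onI, rule continuous_zero_ext[OF assms(1) _ compact_imp_closed[OF K(1)] K(2)])
      (rule continuous_on_mult[OF assms(2) continuous_on_subset[OF CC_continuous[OF assms(3)] subset_UNIV]], simp add: K(3))
qed

text \<open>Near p both densities give the same integrals against lifts of test functions supported
  in the common domain; being continuous, they agree there.\<close>

lemma represents_unique:
  assumes u: "represents G u" and u': "represents G' u'" and p: "p \<in> G" "p \<in> G'"
  shows "u p = u' p"
proof -
  obtain W \<psi> x where c: "(W, \<psi>) \<in> charts S" and x: "x \<in> W" "p = \<psi> x" by (rule chart_point)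
  note o = u[unfolded represents_def, THEN conjunct1] u'[unfolded represents_def, THEN conjunct1]
  note cont = u[unfolded represents_def, THEN conjunct2, THEN conjunct1] u'[unfolded represents_def, THEN conjunct2, THEN conjunct1]
  note lim = u[unfolded represents_def, THEN conjunct2, THEN conjunct2, rule_format] u'[unfolded represents_def, THEN conjunct2, THEN conjunct2, rule_format]
  define D where "D = {y\<in>W. \<psi> y \<in> G \<inter> G'}"
  have D: "open D" "D \<subseteq> W" "x \<in> D" "\<psi> ` D \<subseteq> G" "\<psi> ` D \<subseteq> G'"
    using continuous_open_preimage[OF chart_continuous[OF c] chart_open[OF c] open_Int[OF o]] x p by (auto simp: D_def vimage_def Int_def)
  have cD: "continuous_on D \<psi>" by (rule continuous_on_subset[OF chart_continuous[OF c] D(2)])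
  have cu: "continuous_on D (\<lambda>y. u (\<psi> y))" "continuous_on D (\<lambda>y. u' (\<psi> y))"
    by (rule continuous_on_compose2[OF cont(1) cD D(4)], rule continuous_on_compose2[OF cont(2) cD D(5)])
  have cr: "continuous_on D (rho \<psi>)" by (rule continuous_on_subset[OF smooth_on_continuous[OF smooth_rho[OF c]] D(2)])
  have "rho \<psi> x * (u (\<psi> x) - u' (\<psi> x)) = 0"
  proof (rule fundamental_lemma_eq[OF D(1) _ _ D(3)])
    show "continuous_on D (\<lambda>y. rho \<psi> y * (u (\<psi> y) - u' (\<psi> y)))" by (intro continuous_on_mult continuous_on_diff cr cu)
    fix h :: "real^'n \<Rightarrow> real" assume h: "test_fun D h"
    have hW: "test_fun W h" by (rule test_fun_mono[OF h D(2)])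
    let ?g = "lift W \<psi> h"
    have g: "CC ?g" by (rule CC_lift[OF c hW])
    obtain K where K: "compact K" "K \<subseteq> D" "\<And>y. y \<notin> K \<Longrightarrow> h y = 0" using test_fun_supported[OF h] unfolding supported_in_def by blast
    have gs: "supported_in A ?g" if "\<psi> ` D \<subseteq> A" for A unfolding supported_in_def
    proof (intro exI conjI allI impI)
      show "compact (\<psi> ` K)" by (rule compact_continuous_image[OF continuous_on_subset[OF cD K(2)] K(1)])
      show "\<psi> ` K \<subseteq> A" using K(2) that by blast
      show "?g q = 0" if "q \<notin> \<psi> ` K" for q by (rule lift_zero[OF c order_trans[OF K(2) D(2)] K(3) that])
    qed
    have e: "(\<integral>q. u q * ?g q \<partial>wmeas) = (\<integral>q. u' q * ?g q \<partial>wmeas)"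
      by (rule LIMSEQ_unique[OF lim(1)[OF g gs[OF D(4)]] lim(2)[OF g gs[OF D(5)]]])
    have int: "integrable lborel (\<lambda>y. q y * (rho \<psi> y * h y))" if "continuous_on D q" for q :: "real^'n \<Rightarrow> real"
      using continuous_on_mult[OF that(1) continuous_on_mult[OF cr test_fun_continuous[OF h]]]
        supported_in_bilinear[OF bounded_bilinear_mult supported_in_bilinear[OF bounded_bilinear_mult test_fun_supported[OF h]]] by (rule integrable_supported)
    have "(\<integral>y. u (\<psi> y) * (rho \<psi> y * h y) \<partial>lborel) = (\<integral>y. u' (\<psi> y) * (rho \<psi> y * h y) \<partial>lborel)"
      using e unfolding integral_lift[OF c hW product_measurable[OF o(1) cont(1) g gs[OF D(4)]]]
        integral_lift[OF c hW product_measurable[OF o(2) cont(2) g gs[OF D(5)]]] .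
    moreover have "(\<lambda>y. rho \<psi> y * (u (\<psi> y) - u' (\<psi> y)) * h y) = (\<lambda>y. u (\<psi> y) * (rho \<psi> y * h y) - u' (\<psi> y) * (rho \<psi> y * h y))"
      by (simp add: algebra_simps)
    ultimately show "(\<integral>y. rho \<psi> y * (u (\<psi> y) - u' (\<psi> y)) * h y \<partial>lborel) = 0"
      using int[OF cu(1)] int[OF cu(2)] by simp
  qed
  thus ?thesis using rho_pos[OF c x(1)] x(2) by simp
qed

text \<open>A function supported in the image of B is the lift of a test function h, and the factor
  \<open>rho\<close> relating the two measures is smooth, so \<open>rho\<close> times h is again an
  admissible test function.\<close>

lemma represents_density:
  assumes c: "(W, \<psi>) \<in> charts S" and B: "open B" "B \<subseteq> W" and u: "continuous_on B u"
    and lim: "\<And>h. test_fun B h \<Longrightarrow> (\<lambda>n. \<integral>x. v n (\<psi> x) * h x \<partial>lborel) \<longlonglongrightarrow> (\<integral>x. u x * h x \<partial>lborel)"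
  shows "represents (\<psi> ` B) (\<lambda>p. u (the_inv_into W \<psi> p))"
  unfolding represents_def
proof (intro conjI allI impI)
  let ?i = "the_inv_into W \<psi>"
  have inv: "?i (\<psi> x) = x" if "x \<in> W" for x using chart_inv[OF c that] .
  have ci: "continuous_on (\<psi> ` B) ?i" by (rule continuous_on_subset[OF chart_inv_continuous[OF c]]) (use B(2) in auto)
  show oB: "open (\<psi> ` B)" by (rule chart_open_map[OF c B])
  show cU: "continuous_on (\<psi> ` B) (\<lambda>p. u (?i p))"
    by (rule continuous_on_compose2[OF u ci]) (use inv B(2) in auto)
  fix g assume g: "CC g" and s: "supported_in (\<psi> ` B) g"
  obtain K where K: "compact K" "K \<subseteq> \<psi> ` B" "\<And>p. p \<notin> K \<Longrightarrow> g p = 0" using s unfolding supported_in_def by blast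
  let ?K = "?i ` K"
  define h where "h x = (if x \<in> B then g (\<psi> x) else 0)" for x
  have cK: "compact ?K" by (rule compact_continuous_image[OF continuous_on_subset[OF ci K(2)] K(1)])
  have iB: "?i ` \<psi> ` B \<subseteq> B" using inv B(2) by auto
  have KB: "?K \<subseteq> B" by (rule order_trans[OF image_mono[OF K(2)] iB])
  have h0: "h x = 0" if "x \<notin> ?K" for x
  proof (cases "x \<in> B")
    case True
    have "\<psi> x \<notin> K" using that inv[of x] True B(2) by (metis imageI subsetD)
    thus ?thesis by (simp add: h_def K(3))
  qed (simp add: h_def)
  have "smooth_on B h"
    by (rule smooth_on_cong[OF B(1) smooth_on_subset[OF smooth_fun_chart[OF c CC_smooth[OF g]] B(2)]]) (simp add: h_def)
  hence "C_k_on k B h" for k unfolding smooth_on_def by blast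
  hence "C_k_on k UNIV h" for k by (rule C_k_on_zero_ext[OF B(1) _ compact_imp_closed[OF cK] KB]) (rule h0)
  moreover have "supported_in B h" unfolding supported_in_def using cK KB h0 by (intro exI[of _ ?K]) auto
  ultimately have h: "test_fun B h" by (simp add: test_fun_def smooth_on_def)
  have hW: "test_fun W h" by (rule test_fun_mono[OF h B(2)])
  have gl: "g = lift W \<psi> h"
  proof
    fix p show "g p = lift W \<psi> h p"
    proof (cases "p \<in> \<psi> ` B")
      case True
      then obtain x where "x \<in> B" "p = \<psi> x" by blast
      thus ?thesis using B(2) lift_chart[OF c] by (auto simp: h_def)
    next
      case False
      have "?i p \<notin> B" if "p \<in> \<psi> ` W" using chart_inv_in(2)[OF c that] False by (metis imageI)
      hence "lift W \<psi> h p = 0" by (simp add: lift_def h_def)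
      thus ?thesis using False K(2,3) by auto
    qed
  qed
  have e: "pairing (v n) g = (\<integral>x. v n (\<psi> x) * (rho \<psi> x * h x) \<partial>lborel)" for n
    unfolding pairing_def gl
    by (rule integral_lift[OF c hW]) (intro borel_measurable_continuous_onI continuous_on_mult CC_continuous v CC_lift[OF c hW])
  have "(\<integral>p. u (?i p) * g p \<partial>wmeas) = (\<integral>x. u (?i (\<psi> x)) * (rho \<psi> x * h x) \<partial>lborel)"
    unfolding gl by (rule integral_lift[OF c hW]) (use product_measurable[OF oB cU g s] in \<open>simp add: gl\<close>)
  also have "\<dots> = (\<integral>x. u x * (rho \<psi> x * h x) \<partial>lborel)"
  proof (rule Bochner_Integration.integral_cong[OF refl])
    fix x show "u (?i (\<psi> x)) * (rho \<psi> x * h x) = u x * (rho \<psi> x * h x)"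
      using inv[of x] B(2) by (cases "x \<in> B") (auto simp: h_def)
  qed
  finally show "(\<lambda>n. pairing (v n) g) \<longlonglongrightarrow> (\<integral>p. u (?i p) * g p \<partial>wmeas)"
    using lim[OF test_fun_mult[OF B(1) smooth_on_subset[OF smooth_rho[OF c] B(2)] h]] by (simp add: e)
qed

text \<open>The value given by any local representation around p; by uniqueness the choice does not
  matter.\<close>

definition solution :: "'m \<Rightarrow> real" where
  "solution p = (SOME t. \<exists>G u. represents G u \<and> p \<in> G \<and> t = u p)"

lemma solution_eq:
  assumes "represents G u" "p \<in> G"
  shows "solution p = u p"
proof -
  have "\<exists>t G u. represents G u \<and> p \<in> G \<and> t = u p" using assms by blast
  from someI_ex[OF this] obtain G' u' where "represents G' u'" "p \<in> G'" "solution p = u' p" unfolding solution_def by blast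
  thus ?thesis using represents_unique[OF assms(1) _ assms(2)] by simp
qed

lemma solution_chart:
  assumes c: "(W, \<psi>) \<in> charts S" and x: "x \<in> W"
  obtains B where "open B" "x \<in> B" "B \<subseteq> W" "C_k_on 2 B (solution \<circ> \<psi>)" "solution (\<psi> x) \<ge> 0"
    "div_op (coeff \<psi>) (solution \<circ> \<psi>) x = - (rho \<psi> x * f (\<psi> x))"
proof -
  obtain r u where r: "r > 0" "ball x r \<subseteq> W" and u: "C_k_on 2 UNIV (u :: real^'n \<Rightarrow> real)"
    and lim: "\<And>h. test_fun (ball x r) h \<Longrightarrow> (\<lambda>n. \<integral>x. v n (\<psi> x) * h x \<partial>lborel) \<longlonglongrightarrow> (\<integral>x. u x * h x \<partial>lborel)"
    using local_density[OF c x] by blast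
  let ?B = "ball x r"
  have uB: "C_k_on 2 ?B u" by (rule C_k_on_subset[OF u]) simp
  have xB: "x \<in> ?B" using r(1) by simp
  have rep: "represents (\<psi> ` ?B) (\<lambda>p. u (the_inv_into W \<psi> p))"
    by (rule represents_density[OF c open_ball r(2) C_k_on_continuous[OF uB] lim])
  have eq: "solution (\<psi> y) = u y" if "y \<in> ?B" for y
    using solution_eq[OF rep imageI[OF that]] chart_inv[OF c subsetD[OF r(2) that]] by simp
  show ?thesis
  proof (rule that[of ?B])
    show "C_k_on 2 ?B (solution \<circ> \<psi>)" by (rule C_k_on_cong[OF open_ball uB]) (simp add: eq)
    show "solution (\<psi> x) \<ge> 0" using local_solution(1)[OF c open_ball r(2) uB lim xB] eq[OF xB] by simp
    have "div_op (coeff \<psi>) (solution \<circ> \<psi>) x = div_op (coeff \<psi>) u x"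
      by (rule div_op_cong_open[OF open_ball _ xB]) (simp add: eq)
    thus "div_op (coeff \<psi>) (solution \<circ> \<psi>) x = - (rho \<psi> x * f (\<psi> x))"
      using local_solution(2)[OF c open_ball r(2) uB lim xB] by simp
  qed (use xB r in auto)
qed

lemma C2_solution: "C_k_fun 2 S solution"
  unfolding C_k_fun_def
proof clarify
  fix W \<psi> assume c: "(W, \<psi>) \<in> charts S"
  show "C_k_on 2 W (solution \<circ> \<psi>)"
  proof (rule C_k_on_local)
    fix x assume x: "x \<in> W"
    show "\<exists>U. open U \<and> x \<in> U \<and> C_k_on 2 U (solution \<circ> \<psi>)" by (rule solution_chart[OF c x]) blast
  qed
qed

lemma solution_nonneg: "solution p \<ge> 0"
proof -
  obtain W \<psi> x where c: "(W, \<psi>) \<in> charts S" "x \<in> W" "p = \<psi> x" by (rule chart_point)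
  show ?thesis unfolding c(3) by (rule solution_chart[OF c(1,2)])
qed

lemma solution_equation:
  assumes c: "(W, \<psi>) \<in> charts S" and x: "x \<in> W"
  shows "div_op (coeff \<psi>) (solution \<circ> \<psi>) x = - (rho \<psi> x * f (\<psi> x))"
  by (rule solution_chart[OF c x])

end

section \<open>The weighted Laplacian and the contradiction\<close>

context immersion
begin

text \<open>Differentiating the factor \<open>exp (weight S)\<close> of the density produces the
  first-order term, the remaining divergence is the Laplacian times the volume density.\<close>

lemma div_op_coeff:
  assumes c: "(W, \<psi>) \<in> charts S" and x: "x \<in> W" and u: "C_k_fun 2 S u"
  shows "div_op (coeff \<psi>) (u \<circ> \<psi>) x = rho \<psi> x * (loc_laplacian S \<psi> u x + loc_grad_inner S \<psi> (weight S) u x)"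
proof -
  note W = chart_open[OF c]
  have uW: "C_k_on 2 W (u \<circ> \<psi>)" using u c unfolding C_k_fun_def by blast
  let ?e = "\<lambda>y. exp (weight S (\<psi> y))"
  let ?w = "\<lambda>i. partial (weight S \<circ> \<psi>) i x"
  define q where "q i y = vol_density S \<psi> y * (\<Sum>j\<in>UNIV. metric_inv S \<psi> y $ i $ j * partial (u \<circ> \<psi>) j y)" for i y
  have "C_k_on 1 W (\<lambda>y. \<Sum>j\<in>UNIV. metric_inv S \<psi> y $ i $ j * partial (u \<circ> \<psi>) j y)" for i
    by (rule C_k_on_flux[OF W smooth_metric_inv[OF c] uW])
  moreover have "C_k_on 1 W (vol_density S \<psi>)" using smooth_vol_density[OF c] unfolding smooth_on_def by blast
  ultimately have q1: "C_k_on 1 W (q i)" for i unfolding q_def[abs_def] by (intro C_k_on_mult W)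
  have dq: "(q i has_derivative frechet_derivative (q i) (at x)) (at x)" for i
    using C_k_on_has_derivative[of 0 W "q i" x] q1[of i] x by simp
  have dw: "((\<lambda>y. weight S (\<psi> y)) has_derivative frechet_derivative (\<lambda>y. weight S (\<psi> y)) (at x)) (at x)"
    by (rule smooth_on_has_derivative[OF smooth_weight_chart[OF c] x])
  have de: "(?e has_derivative (\<lambda>z. ?e x * frechet_derivative (\<lambda>y. weight S (\<psi> y)) (at x) z)) (at x)"
    by (rule has_derivative_eq_rhs[OF has_derivative_exp[OF dw]]) (simp add: mult_ac)
  have "partial (\<lambda>y. ?e y * q i y) i x = ?e x * partial (q i) i x + ?e x * ?w i * q i x" for i
    unfolding partial_def o_def
    by (rule fun_cong[OF frechet_derivative_at[OF has_derivative_mult[OF de dq], symmetric]])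
  moreover have "(\<lambda>y. \<Sum>j\<in>UNIV. coeff \<psi> i j y *\<^sub>R partial (u \<circ> \<psi>) j y) = (\<lambda>y. ?e y * q i y)" for i
    by (simp add: coeff_def[OF c] rho_def[OF c] q_def sum_distrib_left mult_ac)
  ultimately have "div_op (coeff \<psi>) (u \<circ> \<psi>) x = ?e x * ((\<Sum>i\<in>UNIV. partial (q i) i x) + (\<Sum>i\<in>UNIV. ?w i * q i x))"
    unfolding div_op_def by (simp add: sum.distrib sum_distrib_left distrib_left mult_ac)
  moreover have "(\<Sum>i\<in>UNIV. partial (q i) i x) = vol_density S \<psi> x * loc_laplacian S \<psi> u x"
    using vol_density_pos[OF c x] by (simp add: loc_laplacian_def q_def[abs_def])
  moreover have "(\<Sum>i\<in>UNIV. ?w i * q i x) = vol_density S \<psi> x * loc_grad_inner S \<psi> (weight S) u x"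
    by (simp add: loc_grad_inner_def q_def sum_distrib_left mult_ac)
  ultimately show ?thesis by (simp add: rho_def[OF c] algebra_simps)
qed

lemma div_op_const: "div_op a (\<lambda>x. k :: real) x = 0"
  by (simp add: div_op_def partial_def)

lemma not_stable_parabolic:
  assumes st: "L_stable S" and par: "weighted_parabolic S"
  shows False
proof -
  obtain W \<psi> x where c: "(W, \<psi>) \<in> charts S" and x: "x \<in> W" by (rule chart_point)
  obtain h :: "real^'n \<Rightarrow> real" where h: "test_fun W h" "\<And>y. h y \<ge> 0" "h x > 0" using bump_exists[OF chart_open[OF c] x] by metis
  define f where "f = lift W \<psi> h"
  have fp: "CC f" "\<And>p. f p \<ge> 0" "f (\<psi> x) > 0"
    using CC_lift[OF c h(1)] lift_nonneg[of h, OF h(2)] lift_chart[OF c x] h(3) by (simp_all add: f_def)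
  obtain v where v: "\<forall>n. CC (v n) \<and> (\<forall>p. v n p \<ge> 0)" "\<forall>g. CC g \<longrightarrow> (\<lambda>n. energy (v n) g) \<longlonglongrightarrow> pairing f g"
    "\<forall>e>0. \<exists>N. \<forall>m\<ge>N. \<forall>n\<ge>N. pairing (\<lambda>p. v m p - v n p) (\<lambda>p. v m p - v n p) < e"
    using minimising_sequence[OF st fp(1,2)] by (elim exE conjE)
  interpret minimising S f v
    by unfold_locales (use fp(1) v in blast)+
  have "laplacian S solution p + grad_inner S (weight S) solution p \<le> 0" for p
  proof -
    obtain V \<theta> where V: "chart_at S p = (V, \<theta>)" by fastforce
    have c2: "(V, \<theta>) \<in> charts S" "p \<in> \<theta> ` V" using chart_at[of p] by (auto simp: V)
    let ?y = "coord_at S p"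
    have y: "?y \<in> V" "\<theta> ?y = p" using chart_inv_in[OF c2(1) c2(2)] by (simp_all add: coord_at_def V)
    have "rho \<theta> ?y * (laplacian S solution p + grad_inner S (weight S) solution p) = - (rho \<theta> ?y * f p)"
      using div_op_coeff[OF c2(1) y(1) C2_solution] solution_equation[OF c2(1) y(1)] y(2)
      by (simp add: laplacian_def grad_inner_def V)
    hence "rho \<theta> ?y * (laplacian S solution p + grad_inner S (weight S) solution p) \<le> 0"
      using rho_pos[OF c2(1) y(1)] fp(2)[of p] by simp
    thus ?thesis using rho_pos[OF c2(1) y(1)] by (simp add: mult_le_0_iff)
  qed
  hence "solution constant_on UNIV" using par C2_solution solution_nonneg unfolding weighted_parabolic_def by blast
  then obtain k where "\<And>p. solution p = k" unfolding constant_on_def by blast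
  hence "solution \<circ> \<psi> = (\<lambda>y. k)" by (simp add: fun_eq_iff)
  \<comment> \<open>Evaluated at the point where the bump is positive; for a constant solution the
    left side of the equation vanishes.\<close>
  hence "rho \<psi> x * f (\<psi> x) = 0" using solution_equation[OF c x] by (simp add: div_op_const)
  thus False using rho_pos[OF c x] fp(3) by simp
qed

end

theorem theorem5p1:
  shows "\<not> (\<exists>S :: ('m::{t2_space, second_countable_topology}, 'n::finite, 'k::finite) hypersurface.
    immersed_hypersurface S \<and> complete_hypersurface S \<and> self_shrinker S \<and>
    weighted_parabolic S \<and> L_stable S)"
  using immersion.not_stable_parabolic[OF immersion.intro] by blast

end
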